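(* Let $\gamma\in(0,1)$ be a constant. In the MPC model with $O(n^{1-\gamma}\operatorname{polylog} n)$ machines, each having space $O(n^{\gamma})$, every algorithm that can sample $\Theta(\log n)$ independent random walks of length $\Theta(\log^4 n)$ starting at each vertex of an $n$-vertex graph requires $\Omega(\log\log n)$ rounds, unless the 1-vs-2-cycle conjecture does not hold.
   Context: MPC model: the input graph is distributed over machines with a bounded amount of space each; computation proceeds in synchronous rounds, in each of which every machine performs local computation and then exchanges messages, with total message size sent and received per machine bounded by its space. A random walk of length $k$ in an undirected graph repeatedly moves along a uniformly random incident edge. The 1-vs-2-cycle conjecture: any MPC algorithm that distinguishes an input graph which is a single cycle on $n$ vertices from one which is a disjoint union of two cycles on $n/2$ vertices each, using $O(n^{\gamma})$ space per machine and $O(n^{1-\gamma})$ machines, requires $\Omega(\log n)$ rounds. *)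

theory Defs
  imports "HOL-Probability.Probability" "HOL-Probability.SPMF" "HOL-Probability.Product_PMF"
    "HOL-Library.Landau_Symbols"
begin

text \<open>
  An MPC algorithm is a family indexed by the number \<open>n\<close> of vertices. Space and messages are
  counted in words of \<open>word_bits A n\<close> bits. \<open>local_step A n r i m b\<close> is the (arbitrary, randomized)
  local computation of machine \<open>i\<close> in round \<open>r\<close>, holding the memory \<open>m\<close> and the words \<open>b\<close> received
  in the previous round: it yields the memory to keep and the one-word messages \<open>(destination, word)\<close>
  to send. Machines use independent private randomness.
\<close>

record mpc =
  machines :: "nat \<Rightarrow> nat"
  mem_words :: "nat \<Rightarrow> nat"
  word_bits :: "nat \<Rightarrow> nat"
  num_rounds :: "nat \<Rightarrow> nat"
  local_step :: "nat \<Rightarrow> nat \<Rightarrow> nat \<Rightarrow> nat list \<Rightarrow> nat list \<Rightarrow> (nat list \<times> (nat \<times> nat) list) pmf"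

text \<open>A configuration gives the memory and the inbox of each machine.\<close>

type_synonym config = "nat \<Rightarrow> nat list \<times> nat list"

definition config_ok :: "mpc \<Rightarrow> nat \<Rightarrow> config \<Rightarrow> bool" where
  "config_ok A n c \<longleftrightarrow>
     (\<forall>i<machines A n.
        length (fst (c i)) + length (snd (c i)) \<le> mem_words A n \<and>
        set (fst (c i)) \<union> set (snd (c i)) \<subseteq> {..<2 ^ word_bits A n})"

definition sends_ok :: "mpc \<Rightarrow> nat \<Rightarrow> (nat \<Rightarrow> nat list \<times> (nat \<times> nat) list) \<Rightarrow> bool" where
  "sends_ok A n L \<longleftrightarrow>
     (\<forall>i<machines A n.
        length (snd (L i)) \<le> mem_words A n \<and> fst ` set (snd (L i)) \<subseteq> {..<machines A n})"

definition exchange :: "nat \<Rightarrow> (nat \<Rightarrow> nat list \<times> (nat \<times> nat) list) \<Rightarrow> config" where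
  "exchange M L = (\<lambda>i. if i < M
     then (fst (L i), concat (map (\<lambda>j. map snd (filter (\<lambda>p. fst p = i) (snd (L j)))) [0..<M]))
     else ([], []))"

text \<open>
  An execution in which some machine exceeds its space or message budget is aborted; the missing mass
  of the subprobability distribution is the probability of this event.
\<close>

definition check_config :: "mpc \<Rightarrow> nat \<Rightarrow> config \<Rightarrow> config spmf" where
  "check_config A n c = (if config_ok A n c then return_spmf c else return_pmf None)"

definition mpc_round :: "mpc \<Rightarrow> nat \<Rightarrow> nat \<Rightarrow> config \<Rightarrow> config spmf" where
  "mpc_round A n r c =
     bind_pmf (Pi_pmf {..<machines A n} ([], []) (\<lambda>i. local_step A n r i (fst (c i)) (snd (c i))))
       (\<lambda>L. if sends_ok A n L then check_config A n (exchange (machines A n) L) else return_pmf None)"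

primrec mpc_steps :: "mpc \<Rightarrow> nat \<Rightarrow> config \<Rightarrow> nat \<Rightarrow> config spmf" where
  "mpc_steps A n c 0 = check_config A n c"
| "mpc_steps A n c (Suc r) = bind_spmf (mpc_steps A n c r) (mpc_round A n r)"

text \<open>Undirected simple graphs on the vertex set \<open>{..<n}\<close>; edges are two-element sets.\<close>

definition simple_graph :: "nat \<Rightarrow> nat set set \<Rightarrow> bool" where
  "simple_graph n E \<longleftrightarrow> (\<forall>e\<in>E. \<exists>u v. u < n \<and> v < n \<and> u \<noteq> v \<and> e = {u, v})"

definition no_isolated :: "nat \<Rightarrow> nat set set \<Rightarrow> bool" where
  "no_isolated n E \<longleftrightarrow> (\<forall>v<n. \<exists>u. {v, u} \<in> E)"

text \<open>
  \<open>I i\<close> is the list of edges initially held by machine \<open>i\<close>. Each edge is held once, in either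
  orientation, and the edges are distributed arbitrarily subject to at most \<open>cap\<close> edges per machine.
\<close>

definition edge_input :: "nat \<Rightarrow> nat \<Rightarrow> nat set set \<Rightarrow> (nat \<Rightarrow> (nat \<times> nat) list) \<Rightarrow> bool" where
  "edge_input M cap E I \<longleftrightarrow>
     (\<forall>i<M. length (I i) \<le> cap) \<and>
     (let es = map (\<lambda>(u, v). {u, v}) (concat (map I [0..<M])) in distinct es \<and> set es = E)"

definition init_config :: "nat \<Rightarrow> (nat \<Rightarrow> (nat \<times> nat) list) \<Rightarrow> config" where
  "init_config M I =
     (\<lambda>i. if i < M then (concat (map (\<lambda>(u, v). [u, v]) (I i)), []) else ([], []))"

definition mpc_run :: "mpc \<Rightarrow> nat \<Rightarrow> (nat \<Rightarrow> (nat \<times> nat) list) \<Rightarrow> config spmf" where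
  "mpc_run A n I = mpc_steps A n (init_config (machines A n) I) (num_rounds A n)"

definition cycle_graph :: "nat set \<Rightarrow> nat set set \<Rightarrow> bool" where
  "cycle_graph V E \<longleftrightarrow>
     (\<exists>xs. distinct xs \<and> set xs = V \<and> 3 \<le> length xs \<and>
        E = (\<lambda>i. {xs ! i, xs ! (Suc i mod length xs)}) ` {..<length xs})"

definition one_cycle :: "nat \<Rightarrow> nat set set \<Rightarrow> bool" where
  "one_cycle n E \<longleftrightarrow> cycle_graph {..<n} E"

definition two_cycles :: "nat \<Rightarrow> nat set set \<Rightarrow> bool" where
  "two_cycles n E \<longleftrightarrow>
     (\<exists>V1 V2 E1 E2. V1 \<union> V2 = {..<n} \<and> V1 \<inter> V2 = {} \<and> card V1 = card V2 \<and>
        cycle_graph V1 E1 \<and> cycle_graph V2 E2 \<and> E = E1 \<union> E2)"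

abbreviation even_sizes :: "nat filter" where
  "even_sizes \<equiv> inf sequentially (principal {n. even n})"

text \<open>
  With high probability means with probability at least \<open>1 - n powr - c\<close> for some constant \<open>c > 0\<close>.
  The verdict is the final memory of machine 0. The condition \<open>n \<le> machines A n * cap n\<close> says that
  the \<open>n\<close> input edges fit.
\<close>

definition distinguishes_cycles :: "mpc \<Rightarrow> bool" where
  "distinguishes_cycles A \<longleftrightarrow>
     (\<exists>cap c. 0 < c \<and>
        (\<forall>\<^sub>F n in even_sizes. n \<le> machines A n * cap n \<and>
           (\<forall>E I. edge_input (machines A n) (cap n) E I \<longrightarrow>
              (one_cycle n E \<longrightarrow>
                 measure (measure_spmf (mpc_run A n I)) {s. fst (s 0) = [1]} \<ge> 1 - real n powr (- c)) \<and>
              (two_cycles n E \<longrightarrow>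
                 measure (measure_spmf (mpc_run A n I)) {s. fst (s 0) = [0]} \<ge> 1 - real n powr (- c)))))"

definition one_vs_two_cycle_conjecture :: "real \<Rightarrow> bool" where
  "one_vs_two_cycle_conjecture \<gamma> \<longleftrightarrow>
     (\<forall>A. (\<lambda>n. real (machines A n)) \<in> O(\<lambda>n. real n powr (1 - \<gamma>)) \<longrightarrow>
          (\<lambda>n. real (mem_words A n)) \<in> O(\<lambda>n. real n powr \<gamma>) \<longrightarrow>
          (\<lambda>n. real (word_bits A n)) \<in> O(\<lambda>n. ln (real n)) \<longrightarrow>
          distinguishes_cycles A \<longrightarrow>
          (\<lambda>n. real (num_rounds A n)) \<in> \<Omega>[even_sizes](\<lambda>n. ln (real n)))"

text \<open>The walk of length \<open>l\<close> from \<open>v\<close> as the list of its \<open>l + 1\<close> vertices; only meaningful if no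
  vertex is isolated.\<close>

primrec random_walk :: "nat set set \<Rightarrow> nat \<Rightarrow> nat \<Rightarrow> nat list pmf" where
  "random_walk E 0 v = return_pmf [v]"
| "random_walk E (Suc l) v =
     bind_pmf (pmf_of_set {u. {v, u} \<in> E}) (\<lambda>u. map_pmf (\<lambda>xs. v # xs) (random_walk E l u))"

definition independent_walks :: "nat \<Rightarrow> nat set set \<Rightarrow> nat \<Rightarrow> nat \<Rightarrow> (nat \<times> nat \<Rightarrow> nat list) pmf" where
  "independent_walks n E k l = Pi_pmf ({..<n} \<times> {..<k}) [] (\<lambda>(v, j). random_walk E l v)"

text \<open>
  A family of walks is output as the set of all \<open>(v, j, t, x)\<close> such that \<open>x\<close> is the vertex at time
  \<open>t\<close> of the \<open>j\<close>-th walk from \<open>v\<close>. Each such record takes four consecutive words in the final memory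
  of some machine.
\<close>

definition walk_records ::
  "nat \<Rightarrow> nat \<Rightarrow> nat \<Rightarrow> (nat \<times> nat \<Rightarrow> nat list) \<Rightarrow> (nat \<times> nat \<times> nat \<times> nat) set" where
  "walk_records n k l W = {(v, j, t, W (v, j) ! t) | v j t. v < n \<and> j < k \<and> t \<le> l}"

fun records :: "nat list \<Rightarrow> (nat \<times> nat \<times> nat \<times> nat) set" where
  "records (v # j # t # x # ws) = insert (v, j, t, x) (records ws)"
| "records _ = {}"

definition output_records :: "nat \<Rightarrow> config \<Rightarrow> (nat \<times> nat \<times> nat \<times> nat) set" where
  "output_records M s = (\<Union>i<M. records (fst (s i)))"

text \<open>
  The output law is within total variation distance \<open>n powr - c\<close> of the law of \<open>k n\<close> independent
  walks of length \<open>l n\<close> from every vertex (in particular, exact samplers qualify). Graphs that must be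
  handled are those that fit, given a capacity \<open>cap\<close> that suffices for \<open>n\<close> edges.
\<close>

definition samples_walks :: "mpc \<Rightarrow> (nat \<Rightarrow> nat) \<Rightarrow> (nat \<Rightarrow> nat) \<Rightarrow> bool" where
  "samples_walks A k l \<longleftrightarrow>
     (\<exists>cap c. 0 < c \<and>
        (\<forall>\<^sub>F n in sequentially. n \<le> machines A n * cap n \<and>
           (\<forall>E I. simple_graph n E \<and> no_isolated n E \<and> edge_input (machines A n) (cap n) E I \<longrightarrow>
              (\<forall>X. \<bar>measure (measure_spmf (map_spmf (output_records (machines A n)) (mpc_run A n I))) X
                   - measure_pmf.prob (map_pmf (walk_records n (k n) (l n))
                       (independent_walks n E (k n) (l n))) X\<bar> \<le> real n powr (- c)))))"

end

theory Submission
  imports Defs "HOL-Library.Nat_Bijection" "HOL-Real_Asymp.Real_Asymp"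
begin

text \<open>
  A fast sampler would solve the cycle problem by repeated contraction. Symmetry breaking of constant
  radius first shrinks the cycles by a polylogarithmic factor in \<open>O((log log n) ^ 3)\<close> rounds; the
  remaining vertices, each with a pendant vertex attached, form an input for the sampler. A walk of
  length \<open>\<Theta>(log ^ 4 n)\<close> misses a vertex at distance about \<open>log n * (log n) powr (1 / 4)\<close> on the cycle with
  probability less than a small constant, so the \<open>\<Theta>(log n)\<close> walks from a vertex cover its neighbourhood
  of this radius with high probability. Their records are routed to the machine responsible for the
  vertex in \<open>O(1)\<close> rounds, where a short random seed selects a hash function that balances the load.
  A ruling set that depends only on this neighbourhood then contracts every cycle by a factor
  \<open>D\<close> of order \<open>(log n) powr (1 / 4)\<close>. After \<open>O(log n / log log n)\<close> contractions everything fits into one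
  machine. Hence \<open>o(log log n)\<close> rounds for the sampler would give \<open>o(log n)\<close> rounds for the cycle problem.
\<close>

section \<open>Programs as lists of rounds\<close>

text \<open>The sampler may use polylogarithmically more machines than the conjecture allows. It can
  therefore be run only on \<open>N\<close> vertices, with \<open>N\<close> smaller than
  \<open>n\<close> by a polylogarithmic factor, and the shrinking without walks bridges this gap.
  Each vertex decides alone, from its own window, who survives. These decisions must agree, so the
  rules use labels only, no randomness, and are symmetric under reversal of the cycle. Deterministic
  merging over the \<open>b\<close> label bits forces a radius of order \<open>b * D\<close>. With
  \<open>D\<close> near \<open>b powr (1/4)\<close> and escape distance \<open>b^2\<close>, the
  escape ratio \<open>b powr (5/4) / b^2\<close> and the time ratio
  \<open>b powr (13/4) / b^4\<close> both vanish, while \<open>ln D\<close> is still of order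
  \<open>ln ln n\<close>, and the number of contractions depends on \<open>D\<close> only through
  \<open>ln D\<close>. The hash functions come from counting: local computation may depend on
  \<open>n\<close> in any way, so existence suffices. Machine numbers are read as a constant number
  \<open>p\<close> of digits in base \<open>f\<close>, which bounds the depth of broadcast and
  routing.\<close>

type_synonym round_fun = "nat \<Rightarrow> nat list \<Rightarrow> nat list \<Rightarrow> (nat list \<times> (nat \<times> nat) list) pmf"

text \<open>The test on sent messages and the test on the resulting configuration are merged, so
  that a round is one draw followed by one check.\<close>

definition round_ok :: "nat \<Rightarrow> nat \<Rightarrow> nat \<Rightarrow> (nat \<Rightarrow> nat list \<times> (nat \<times> nat) list) \<Rightarrow> bool" where
  "round_ok M W wb L \<longleftrightarrow>
     (\<forall>i<M. length (snd (L i)) \<le> W \<and> fst ` set (snd (L i)) \<subseteq> {..<M}) \<and>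
     (\<forall>i<M. length (fst (exchange M L i)) + length (snd (exchange M L i)) \<le> W \<and>
        set (fst (exchange M L i)) \<union> set (snd (exchange M L i)) \<subseteq> {..<2 ^ wb})"

definition round_outcome :: "nat \<Rightarrow> round_fun \<Rightarrow> config \<Rightarrow> (nat \<Rightarrow> nat list \<times> (nat \<times> nat) list) pmf" where
  "round_outcome M g c = Pi_pmf {..<M} ([], []) (\<lambda>i. g i (fst (c i)) (snd (c i)))"

definition exec_round :: "nat \<Rightarrow> nat \<Rightarrow> nat \<Rightarrow> round_fun \<Rightarrow> config \<Rightarrow> config spmf" where
  "exec_round M W wb g c = bind_pmf (round_outcome M g c)
     (\<lambda>L. if round_ok M W wb L then return_spmf (exchange M L) else return_pmf None)"

primrec exec :: "nat \<Rightarrow> nat \<Rightarrow> nat \<Rightarrow> round_fun list \<Rightarrow> config \<Rightarrow> config spmf" where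
  "exec M W wb [] c = return_spmf c"
| "exec M W wb (g # gs) c = bind_spmf (exec_round M W wb g c) (exec M W wb gs)"

lemma exec_append:
  "exec M W wb (fs @ gs) c = bind_spmf (exec M W wb fs c) (exec M W wb gs)"
proof (induction fs arbitrary: c)
  case (Cons g fs)
  have "exec M W wb (fs @ gs) = (\<lambda>c. bind_spmf (exec M W wb fs c) (exec M W wb gs))"
    using Cons.IH by blast
  then show ?case by simp
qed simp

lemma exec_single: "exec M W wb [g] = exec_round M W wb g"
proof
  fix c
  have "exec M W wb [] = return_spmf" by (rule ext) simp
  then show "exec M W wb [g] c = exec_round M W wb g c" by simp
qed

lemma mpc_round_eq_exec_round:
  "mpc_round A n r = exec_round (machines A n) (mem_words A n) (word_bits A n) (local_step A n r)"
  unfolding mpc_round_def exec_round_def round_outcome_def check_config_def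
  by (intro ext bind_pmf_cong refl) (auto simp: round_ok_def sends_ok_def config_ok_def)

lemma mpc_steps_eq_exec:
  assumes "config_ok A n c"
  shows "mpc_steps A n c r =
    exec (machines A n) (mem_words A n) (word_bits A n) (map (local_step A n) [0..<r]) c"
  using assms
  by (induction r) (simp_all add: check_config_def exec_append exec_single mpc_round_eq_exec_round del: exec.simps(2))

text \<open>Aborted runs carry no mass, so a lower bound on this quantity certifies correctness and
  compliance with all budgets at once.\<close>

definition prob_reach :: "nat \<Rightarrow> nat \<Rightarrow> nat \<Rightarrow> round_fun list \<Rightarrow> config \<Rightarrow> config set \<Rightarrow> real" where
  "prob_reach M W wb gs c Q = measure (measure_spmf (exec M W wb gs c)) Q"

lemma measure_bind_pmf_eq_expectation:
  "measure_pmf.prob (bind_pmf p f) X = measure_pmf.expectation p (\<lambda>x. measure_pmf.prob (f x) X)"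
  unfolding measure_pmf_bind
  by (subst measure_pmf.measure_bind[where N="count_space UNIV"])
    (auto simp: space_subprob_algebra intro: measure_pmf.subprob_space_axioms)

lemma prob_reach_Nil: "prob_reach M W wb [] c Q = indicator Q c"
  by (simp add: prob_reach_def measure_measure_spmf_conv_measure_pmf indicator_def image_iff)

lemma prob_reach_Cons:
  "prob_reach M W wb (g # gs) c Q = measure_pmf.expectation (round_outcome M g c)
     (\<lambda>L. if round_ok M W wb L then prob_reach M W wb gs (exchange M L) Q else 0)"
  unfolding prob_reach_def measure_measure_spmf_conv_measure_pmf exec.simps exec_round_def
  by (auto simp: bind_spmf_def bind_assoc_pmf measure_bind_pmf_eq_expectation bind_return_pmf
      intro!: arg_cong[where f="measure_pmf.expectation _"] simp: fun_eq_iff image_iff)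

lemma prob_reach_le_1: "prob_reach M W wb gs c Q \<le> 1"
  unfolding prob_reach_def by (rule measure_spmf.subprob_measure_le_1)

lemma prob_reach_nonneg: "0 \<le> prob_reach M W wb gs c Q"
  unfolding prob_reach_def by simp

lemma prob_reach_mono:
  assumes "Q \<subseteq> Q'"
  shows "prob_reach M W wb gs c Q \<le> prob_reach M W wb gs c Q'"
  unfolding prob_reach_def using assms by (intro measure_spmf.finite_measure_mono) auto

lemma integrable_bounded_pmf [simp, intro]:
  fixes f :: "'a \<Rightarrow> real"
  assumes "\<And>x. 0 \<le> f x" "\<And>x. f x \<le> 1"
  shows "integrable (measure_pmf p) f"
  using assms by (intro measure_pmf.integrable_const_bound[where B=1]) auto

text \<open>Failure probabilities of consecutive phases add. Most phases below avoid this lemma by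
  speaking about an arbitrary rest \<open>gs\<close> of the program; it is needed after the sampler,
  whose rounds are opaque.\<close>

lemma prob_reach_append:
  assumes "prob_reach M W wb fs c Q1 \<ge> 1 - e1"
    and "\<And>c'. c' \<in> Q1 \<Longrightarrow> prob_reach M W wb gs c' Q2 \<ge> 1 - e2"
    and "0 \<le> e2"
  shows "prob_reach M W wb (fs @ gs) c Q2 \<ge> 1 - (e1 + e2)"
proof -
  \<comment> \<open>The product form passes through the expectation over the first round; the
    additive form is derived from it at the end.\<close>
  have *: "prob_reach M W wb (fs @ gs) c Q2 \<ge> (1 - e2) * prob_reach M W wb fs c Q1"
    using assms(2)
  proof (induction fs arbitrary: c)
    case Nil
    then show ?case
      by (cases "c \<in> Q1") (auto simp: prob_reach_Nil prob_reach_nonneg)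
  next
    case (Cons g fs)
    have "(1 - e2) * prob_reach M W wb (g # fs) c Q1 =
      measure_pmf.expectation (round_outcome M g c)
       (\<lambda>L. (1 - e2) * (if round_ok M W wb L then prob_reach M W wb fs (exchange M L) Q1 else 0))"
      by (simp add: prob_reach_Cons)
    also have "\<dots> \<le> measure_pmf.expectation (round_outcome M g c)
       (\<lambda>L. if round_ok M W wb L then prob_reach M W wb (fs @ gs) (exchange M L) Q2 else 0)"
      using Cons.IH[OF Cons.prems]
      by (intro integral_mono integrable_mult_right integrable_bounded_pmf)
        (auto simp: prob_reach_nonneg prob_reach_le_1)
    finally show ?case by (simp add: prob_reach_Cons)
  qed
  show ?thesis
  proof (cases "e2 \<le> 1")
    case True
    have "(1 - e2) * prob_reach M W wb fs c Q1 \<ge> (1 - e2) * (1 - e1)"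
      using True assms(1) by (intro mult_left_mono) auto
    moreover have "(1 - e2) * (1 - e1) \<ge> 1 - (e1 + e2) \<or> e1 < 0"
      using assms(3) by (auto simp: algebra_simps)
    moreover have "e1 < 0 \<Longrightarrow> (1 - e2) * prob_reach M W wb fs c Q1 \<ge> 1 - (e1 + e2)"
      using assms(1) prob_reach_le_1[of M W wb fs c Q1] by linarith
    ultimately show ?thesis using * by linarith
  next
    \<comment> \<open>For \<open>e2 > 1\<close> the factor \<open>1 - e2\<close> is negative, but
      then the claimed lower bound is negative as well.\<close>
    case False
    have "e1 \<ge> 0"
      using assms(1) prob_reach_le_1[of M W wb fs c Q1] by linarith
    then show ?thesis
      using False prob_reach_nonneg[of M W wb "fs @ gs" c Q2] by linarith
  qed
qed

subsection \<open>Simulating a smaller network\<close>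

definition lift_round :: "nat \<Rightarrow> round_fun \<Rightarrow> round_fun" where
  "lift_round m g i = (if i < m then g i else (\<lambda>_ _. return_pmf ([], [])))"

lemma exchange_larger:
  assumes "m \<le> M" "\<And>i. i < m \<Longrightarrow> fst ` set (snd (L i)) \<subseteq> {..<m}"
    and "\<And>i. i \<ge> m \<Longrightarrow> L i = ([], [])"
  shows "exchange M L = exchange m L"
proof
  fix i
  have split: "[0..<M] = [0..<m] @ [m..<M]"
    using assms(1) upt_add_eq_append[of 0 m "M - m"] by simp
  have nil: "concat (map (\<lambda>j. map snd (filter (\<lambda>p. fst p = i) (snd (L j)))) [m..<M]) = []"
    using assms(3) by simp
  have nil2: "concat (map (\<lambda>j. map snd (filter (\<lambda>p. fst p = i) (snd (L j)))) [0..<m]) = []"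
    if "i \<ge> m"
    using assms(2) that by (force simp: filter_empty_conv)
  show "exchange M L i = exchange m L i"
    using assms nil nil2 by (auto simp: exchange_def split)
qed

text \<open>Larger budgets can only turn aborts into continuations, hence an inequality. This embeds
  the sampler, written for its own network, into the network of the reduction.\<close>

lemma prob_reach_simulation:
  assumes "m \<le> M" "w \<le> W" "wb \<le> wb'"
    and "\<And>i. i \<ge> m \<Longrightarrow> c i = ([], [])"
  shows "prob_reach m w wb gs c Q \<le> prob_reach M W wb' (map (lift_round m) gs) c Q"
  using assms(4)
proof (induction gs arbitrary: c)
  case Nil
  then show ?case by (simp add: prob_reach_Nil)
next
  case (Cons g gs)
  \<comment> \<open>Idle machines contribute the point mass at \<open>([], [])\<close>, which is
    also the default value of the product over the first \<open>m\<close> machines.\<close>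
  have outcome: "round_outcome M (lift_round m g) c = round_outcome m g c"
    unfolding round_outcome_def using assms(1)
    by (subst Pi_pmf_subset'[of "{..<M}" "{..<m}"])
      (auto simp: lift_round_def intro!: Pi_pmf_cong)
  have L0: "L i = ([], [])" if "L \<in> set_pmf (round_outcome m g c)" "i \<ge> m" for L i
    using that set_Pi_pmf_subset[of "{..<m}" "([], [])"] unfolding round_outcome_def by force
  have ok: "round_ok M W wb' L \<and> exchange M L = exchange m L"
    if "round_ok m w wb L" "\<And>i. i \<ge> m \<Longrightarrow> L i = ([], [])" for L
  proof -
    have eq: "exchange M L = exchange m L"
      using that assms(1) by (intro exchange_larger) (auto simp: round_ok_def)
    have pow: "(2::nat) ^ wb \<le> 2 ^ wb'" using assms(3) by (simp add: power_increasing)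
    have a: "length (snd (L i)) \<le> W \<and> fst ` set (snd (L i)) \<subseteq> {..<M}" for i
    proof (cases "i < m")
      case True
      then have "length (snd (L i)) \<le> w" "fst ` set (snd (L i)) \<subseteq> {..<m}"
        using that(1) by (auto simp: round_ok_def)
      then show ?thesis using assms(1,2) by (auto intro: order_trans)
    qed (use that(2) in auto)
    have b: "length (fst (exchange m L i)) + length (snd (exchange m L i)) \<le> W \<and>
        set (fst (exchange m L i)) \<union> set (snd (exchange m L i)) \<subseteq> {..<2 ^ wb'}" for i
    proof (cases "i < m")
      case True
      then have "length (fst (exchange m L i)) + length (snd (exchange m L i)) \<le> w"
        "set (fst (exchange m L i)) \<union> set (snd (exchange m L i)) \<subseteq> {..<2 ^ wb}"
        using that(1) by (auto simp: round_ok_def)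
      then show ?thesis using assms(2) pow by (auto intro: order_trans less_le_trans)
    qed (auto simp: exchange_def)
    show ?thesis using a b eq by (auto simp: round_ok_def)
  qed
  have "prob_reach m w wb (g # gs) c Q \<le> measure_pmf.expectation (round_outcome m g c)
     (\<lambda>L. if round_ok M W wb' L then prob_reach M W wb' (map (lift_round m) gs) (exchange M L) Q else 0)"
    unfolding prob_reach_Cons
  proof (intro integral_mono_AE integrable_bounded_pmf AE_pmfI)
    fix L assume L: "L \<in> set_pmf (round_outcome m g c)"
    show "(if round_ok m w wb L then prob_reach m w wb gs (exchange m L) Q else 0)
      \<le> (if round_ok M W wb' L then prob_reach M W wb' (map (lift_round m) gs) (exchange M L) Q else 0)"
      using ok[of L] L0[OF L] Cons.IH[of "exchange m L"]
      by (auto simp: prob_reach_nonneg exchange_def)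
  qed (auto simp: prob_reach_nonneg prob_reach_le_1)
  then show ?case by (simp add: prob_reach_Cons outcome)
qed

subsection \<open>Deterministic rounds on sets of facts\<close>

text \<open>\<open>Edge v x y\<close> tells the machine in charge of \<open>v\<close> that
  \<open>x\<close> and \<open>y\<close> are adjacent, with \<open>x = v\<close> for the edges at
  \<open>v\<close> itself. \<open>Rec\<close> is a walk record, \<open>Seed\<close> the shared
  choice of a hash function, and \<open>Name v a\<close> the new label \<open>a\<close> of
  \<open>v\<close>.\<close>

datatype fact = Edge nat nat nat | Rec nat nat nat nat | Seed nat | Name nat nat

primrec enc :: "fact \<Rightarrow> nat" where
  "enc (Edge v x y) = prod_encode (0, prod_encode (v, prod_encode (x, y)))"
| "enc (Rec v j t x) = prod_encode (1, prod_encode (v, prod_encode (j, prod_encode (t, x))))"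
| "enc (Seed s) = prod_encode (2, s)"
| "enc (Name v a) = prod_encode (3, prod_encode (v, a))"

lemma inj_enc: "inj enc"
proof (rule injI)
  fix s t assume "enc s = enc t"
  then show "s = t" by (cases s; cases t) (simp_all add: prod_encode_eq)
qed

lemma enc_eq_iff [simp]: "enc s = enc t \<longleftrightarrow> s = t"
  using inj_enc by (auto dest: injD)

primrec fact_lt :: "nat \<Rightarrow> fact \<Rightarrow> bool" where
  "fact_lt K (Edge v x y) \<longleftrightarrow> v < K \<and> x < K \<and> y < K"
| "fact_lt K (Rec v j t x) \<longleftrightarrow> v < K \<and> j < K \<and> t < K \<and> x < K"
| "fact_lt K (Seed s) \<longleftrightarrow> s < K"
| "fact_lt K (Name v a) \<longleftrightarrow> v < K \<and> a < K"

lemma prod_encode_le: "prod_encode (a, b) \<le> (a + b) ^ 2 + a"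
proof -
  have "triangle m \<le> m ^ 2" for m
    by (induction m) (auto simp: power2_eq_square)
  then show ?thesis by (simp add: prod_encode_def)
qed

lemma prod_encode_lt:
  assumes "a < K" "b < K" shows "prod_encode (a, b) < 4 * K ^ 2"
proof -
  have "(a + b) ^ 2 + a \<le> (2 * K - 2) ^ 2 + (K - 1)"
    using assms by (intro add_mono power_mono) auto
  also have "\<dots> < 4 * K ^ 2"
    using assms by (cases K) (auto simp: power2_eq_square algebra_simps)
  finally show ?thesis using prod_encode_le[of a b] by simp
qed

text \<open>At most four pairings are nested, and each turns a bound \<open>B\<close> into
  \<open>4 * B ^ 2\<close>. So a fact fits into one word of logarithmic length. The assumption
  \<open>4 \<le> K\<close> covers the tags 0 to 3.\<close>

lemma enc_lt:
  assumes "fact_lt K t" "4 \<le> K"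
  shows "enc t < 2 ^ 30 * K ^ 16"
proof -
  have K: "K ^ a \<le> K ^ b" if "a \<le> b" for a b
    using assms(2) that by (intro power_increasing) auto
  have up: "x < 4 * K ^ 2 \<Longrightarrow> x < 2 ^ 6 * K ^ 4" "y < 2 ^ 6 * K ^ 4 \<Longrightarrow> y < 2 ^ 14 * K ^ 8"
    "z < 2 ^ 14 * K ^ 8 \<Longrightarrow> z < 2 ^ 30 * K ^ 16" "u < K \<Longrightarrow> u < 4 * K ^ 2" for x y z u
    using K[of 2 4] K[of 4 8] K[of 8 16] K[of 1 2] assms(2) by (simp_all, linarith+)
  have l1: "a < K \<Longrightarrow> b < K \<Longrightarrow> prod_encode (a, b) < 4 * K ^ 2" for a b
    by (rule prod_encode_lt)
  have l2: "a < 4 * K ^ 2 \<Longrightarrow> b < 4 * K ^ 2 \<Longrightarrow> prod_encode (a, b) < 2 ^ 6 * K ^ 4" for a b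
    using prod_encode_lt[of a "4 * K ^ 2" b] by (simp add: power_mult_distrib flip: power_mult)
  have l3: "a < 2 ^ 6 * K ^ 4 \<Longrightarrow> b < 2 ^ 6 * K ^ 4 \<Longrightarrow> prod_encode (a, b) < 2 ^ 14 * K ^ 8" for a b
    using prod_encode_lt[of a "2 ^ 6 * K ^ 4" b] by (simp add: power_mult_distrib flip: power_mult)
  have l4: "a < 2 ^ 14 * K ^ 8 \<Longrightarrow> b < 2 ^ 14 * K ^ 8 \<Longrightarrow> prod_encode (a, b) < 2 ^ 30 * K ^ 16" for a b
    using prod_encode_lt[of a "2 ^ 14 * K ^ 8" b] by (simp add: power_mult_distrib flip: power_mult)
  have c: "0 < K" "1 < K" "2 < K" "3 < K" using assms(2) by auto
  note up14 = up(2)[OF up(1)[OF up(4)]]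
  note up6 = up(1)[OF up(4)]
  show ?thesis
  proof (cases t)
    case (Edge v x y)
    then have *: "v < K" "x < K" "y < K" using assms by auto
    show ?thesis unfolding Edge enc.simps
      by (intro l4 up14 c l3 up6 l2 up(4) l1 *  up(2)[OF l2])
  next
    case (Rec v j u x)
    then have *: "v < K" "j < K" "u < K" "x < K" using assms by auto
    show ?thesis unfolding Rec enc.simps
      by (intro l4 up14 c l3 up6 l2 up(4) l1 *)
  next
    case (Seed s)
    then have "s < K" using assms by auto
    then show ?thesis unfolding Seed enc.simps
      using c by (intro l4 up14)
  next
    case (Name v a)
    then have *: "v < K" "a < K" using assms by auto
    show ?thesis unfolding Name enc.simps
      by (intro l4 up14 c up(2)[OF up(1)[OF l1]] *)
  qed
qed

definition list_of :: "'a set \<Rightarrow> 'a list" where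
  "list_of X = (SOME xs. set xs = X \<and> distinct xs)"

lemma list_of:
  assumes "finite X"
  shows set_list_of: "set (list_of X) = X" and distinct_list_of: "distinct (list_of X)"
    and length_list_of: "length (list_of X) = card X"
proof -
  have *: "set (list_of X) = X \<and> distinct (list_of X)"
    unfolding list_of_def using finite_distinct_list[OF assms] by (rule someI_ex)
  then show "set (list_of X) = X" "distinct (list_of X)" by auto
  then show "length (list_of X) = card X" using distinct_card by force
qed

text \<open>Memory and inbox are read alike, and words that are not codes are ignored.\<close>

definition facts_in :: "nat list \<Rightarrow> nat list \<Rightarrow> fact set" where
  "facts_in m b = enc -` (set m \<union> set b)"

abbreviation known :: "config \<Rightarrow> nat \<Rightarrow> fact set" where
  "known c i \<equiv> facts_in (fst (c i)) (snd (c i))"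

definition fact_msgs :: "(nat \<times> fact) set \<Rightarrow> (nat \<times> nat) list" where
  "fact_msgs Z = list_of (map_prod id enc ` Z)"

text \<open>The memory is always cleared; a machine keeps a fact by sending it to itself, so only
  messages have to be counted. The reader \<open>rd\<close> is a parameter because some rounds start
  from raw words instead of encoded facts.\<close>

definition fact_round ::
    "(nat list \<Rightarrow> nat list \<Rightarrow> 'a) \<Rightarrow> (nat \<Rightarrow> 'a \<Rightarrow> (nat \<times> fact) set) \<Rightarrow> round_fun" where
  "fact_round rd S i m b = return_pmf ([], fact_msgs (S i (rd m b)))"

text \<open>The received facts are counted once per sender, since equal facts from several senders
  occupy several inbox words.\<close>

definition fits :: "nat \<Rightarrow> nat \<Rightarrow> nat \<Rightarrow> (nat \<Rightarrow> (nat \<times> fact) set) \<Rightarrow> bool" where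
  "fits M W wb Z \<longleftrightarrow>
     (\<forall>i<M. finite (Z i) \<and> card (Z i) \<le> W \<and> (\<forall>(j, t)\<in>Z i. j < M \<and> enc t < 2 ^ wb)) \<and>
     (\<forall>j<M. (\<Sum>i<M. card {t. (j, t) \<in> Z i}) \<le> W)"

definition delivered :: "nat \<Rightarrow> (nat \<Rightarrow> (nat \<times> fact) set) \<Rightarrow> nat \<Rightarrow> fact set" where
  "delivered M Z j = {t. \<exists>i<M. (j, t) \<in> Z i}"

lemma fact_msgs:
  assumes "finite Z"
  shows set_fact_msgs: "set (fact_msgs Z) = map_prod id enc ` Z"
    and length_fact_msgs: "length (fact_msgs Z) = card Z"
    and length_filter_fact_msgs:
      "length (filter (\<lambda>p. fst p = j) (fact_msgs Z)) = card {t. (j, t) \<in> Z}"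
proof -
  have fin: "finite (map_prod id enc ` Z)" using assms by simp
  have inj: "inj_on (map_prod id enc) Z"
    by (intro inj_onI) auto
  show s: "set (fact_msgs Z) = map_prod id enc ` Z"
    unfolding fact_msgs_def by (rule set_list_of[OF fin])
  show "length (fact_msgs Z) = card Z"
    unfolding fact_msgs_def length_list_of[OF fin] using inj by (rule card_image)
  have "length (filter (\<lambda>p. fst p = j) (fact_msgs Z)) = card (set (filter (\<lambda>p. fst p = j) (fact_msgs Z)))"
    unfolding fact_msgs_def by (rule distinct_card[symmetric]) (simp add: distinct_list_of[OF fin])
  also have "set (filter (\<lambda>p. fst p = j) (fact_msgs Z)) = (\<lambda>t. (j, enc t)) ` {t. (j, t) \<in> Z}"
    by (auto simp: s image_iff Bex_def)
  also have "card \<dots> = card {t. (j, t) \<in> Z}"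
    by (intro card_image inj_onI) auto
  finally show "length (filter (\<lambda>p. fst p = j) (fact_msgs Z)) = card {t. (j, t) \<in> Z}" .
qed

lemma exchange_fact_msgs:
  assumes fits: "fits M W wb Z" and L: "\<And>i. i < M \<Longrightarrow> L i = ([], fact_msgs (Z i))"
  shows "round_ok M W wb L" and "\<And>j. j < M \<Longrightarrow> known (exchange M L) j = delivered M Z j"
proof -
  have fin: "finite (Z i)" if "i < M" for i using fits that by (auto simp: fits_def)
  have snd: "snd (exchange M L j) =
      concat (map (\<lambda>i. map snd (filter (\<lambda>p. fst p = j) (fact_msgs (Z i)))) [0..<M])" if "j < M" for j
    using that L by (auto simp: exchange_def intro!: arg_cong[where f=concat] map_cong)
  have fst: "fst (exchange M L j) = []" if "j < M" for j
    using that L by (auto simp: exchange_def)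
  have set: "set (snd (exchange M L j)) = enc ` delivered M Z j" if "j < M" for j
  proof -
    have "set (snd (exchange M L j)) = (\<Union>i<M. snd ` {p \<in> set (fact_msgs (Z i)). fst p = j})"
      by (auto simp: snd[OF that])
    also have "\<dots> = (\<Union>i<M. snd ` {p \<in> map_prod id enc ` Z i. fst p = j})"
      using fin by (simp add: set_fact_msgs)
    also have "\<dots> = enc ` delivered M Z j"
      by (force simp: delivered_def)
    finally show ?thesis .
  qed
  show "known (exchange M L) j = delivered M Z j" if "j < M" for j
    using fst[OF that] set[OF that] by (auto simp: facts_in_def)
  have len: "length (snd (exchange M L j)) = (\<Sum>i<M. card {t. (j, t) \<in> Z i})" if "j < M" for j
  proof -
    have "length (snd (exchange M L j)) = (\<Sum>i\<leftarrow>[0..<M]. card {t. (j, t) \<in> Z i})"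
      unfolding snd[OF that] length_concat map_map
      by (intro arg_cong[where f=sum_list] map_cong) (auto simp: length_filter_fact_msgs fin)
    then show ?thesis by (simp add: sum_list_distinct_conv_sum_set atLeast0LessThan)
  qed
  show "round_ok M W wb L"
    unfolding round_ok_def
  proof (intro conjI allI impI)
    fix i assume i: "i < M"
    show "length (snd (L i)) \<le> W"
      using fits i L fin by (auto simp: fits_def length_fact_msgs)
    show "fst ` set (snd (L i)) \<subseteq> {..<M}"
      using fits i L fin by (force simp: fits_def set_fact_msgs)
    show "length (fst (exchange M L i)) + length (snd (exchange M L i)) \<le> W"
      using fits i by (simp add: fst len fits_def)
    show "set (fst (exchange M L i)) \<union> set (snd (exchange M L i)) \<subseteq> {..<2 ^ wb}"
      using fits i by (auto simp: fst set fits_def delivered_def)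
  qed
qed

definition holds :: "nat \<Rightarrow> (nat \<Rightarrow> fact set) \<Rightarrow> config \<Rightarrow> bool" where
  "holds M X c \<longleftrightarrow> (\<forall>j<M. known c j = X j)"

lemma prob_reach_fact_round_rd:
  assumes X: "\<And>i. i < M \<Longrightarrow> rd (fst (c i)) (snd (c i)) = X i"
    and fits: "fits M W wb (\<lambda>i. S i (X i))"
    and cont: "\<And>c'. holds M (delivered M (\<lambda>i. S i (X i))) c' \<Longrightarrow> 1 - e \<le> prob_reach M W wb gs c' Q"
  shows "1 - e \<le> prob_reach M W wb (fact_round rd S # gs) c Q"
proof -
  define L where "L = (\<lambda>i. if i \<in> {..<M} then ([] :: nat list, fact_msgs (S i (rd (fst (c i)) (snd (c i))))) else ([], []))"
  have out: "round_outcome M (fact_round rd S) c = return_pmf L"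
    unfolding round_outcome_def fact_round_def L_def
    by (subst Pi_pmf_return_pmf) (rule finite_lessThan, rule refl)
  have L: "L i = ([], fact_msgs (S i (X i)))" if "i < M" for i
    using that X by (auto simp: L_def)
  have "round_ok M W wb L" "holds M (delivered M (\<lambda>i. S i (X i))) (exchange M L)"
    using exchange_fact_msgs[OF fits L] by (auto simp: holds_def)
  then show ?thesis
    using cont by (simp add: prob_reach_Cons out)
qed

lemma prob_reach_fact_round:
  assumes "holds M X c" "fits M W wb (\<lambda>i. S i (X i))"
    and "\<And>c'. holds M (delivered M (\<lambda>i. S i (X i))) c' \<Longrightarrow> 1 - e \<le> prob_reach M W wb gs c' Q"
  shows "1 - e \<le> prob_reach M W wb (fact_round facts_in S # gs) c Q"
  using assms by (intro prob_reach_fact_round_rd) (auto simp: holds_def)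

text \<open>Apart from the sampler this is the only randomized round. Machine 0 draws the seed, and
  every machine keeps its facts by sending them to itself.\<close>

definition seed_round :: "nat \<Rightarrow> (nat list \<Rightarrow> nat list \<Rightarrow> fact set) \<Rightarrow> round_fun" where
  "seed_round S rd i m b =
     (let Z = (\<lambda>t. (i, t)) ` rd m b in
      if i = 0 then map_pmf (\<lambda>s. ([], fact_msgs (insert (0, Seed s) Z))) (pmf_of_set {..<S})
      else return_pmf ([], fact_msgs Z))"

definition with_seed :: "(nat \<Rightarrow> fact set) \<Rightarrow> nat \<Rightarrow> nat \<Rightarrow> nat \<Rightarrow> fact set" where
  "with_seed X s m i = (if i < m then insert (Seed s) (X i) else X i)"

lemma prob_reach_seed_round:
  assumes "0 < M" "0 < S"
    and X: "\<And>i. i < M \<Longrightarrow> rd (fst (c i)) (snd (c i)) = X i"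
    and fin: "\<And>i. i < M \<Longrightarrow> finite (X i) \<and> card (X i) + 1 \<le> W"
    and bits: "\<And>i t. i < M \<Longrightarrow> t \<in> X i \<Longrightarrow> enc t < 2 ^ wb" "\<And>s. s < S \<Longrightarrow> enc (Seed s) < 2 ^ wb"
    and bad: "real (card {s. s < S \<and> \<not> G s}) \<le> d * real S"
    and cont: "\<And>s c'. s < S \<Longrightarrow> G s \<Longrightarrow> holds M (with_seed X s 1) c' \<Longrightarrow> 1 - e \<le> prob_reach M W wb gs c' Q"
    and "0 \<le> e"
  shows "1 - (d + e) \<le> prob_reach M W wb (seed_round S rd # gs) c Q"
proof -
  define Z where "Z = (\<lambda>s i. (if i = 0 then insert (0, Seed s) (Pair i ` X i) else Pair i ` X i))"
  define L where "L = (\<lambda>s i. if i \<in> {..<M} then ([] :: nat list, fact_msgs (Z s i)) else ([], []))"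
  have out: "round_outcome M (seed_round S rd) c = map_pmf L (pmf_of_set {..<S})"
  proof -
    \<comment> \<open>Machine 0 is split off the product, because all other factors are point
      masses.\<close>
    have "{..<M} = insert 0 {1..<M}" using assms(1) by auto
    then have "round_outcome M (seed_round S rd) c =
      Pi_pmf (insert 0 {1..<M}) ([], []) (\<lambda>i. seed_round S rd i (fst (c i)) (snd (c i)))"
      by (simp add: round_outcome_def)
    also have "\<dots> = bind_pmf (seed_round S rd 0 (fst (c 0)) (snd (c 0))) (\<lambda>y.
        bind_pmf (Pi_pmf {1..<M} ([], []) (\<lambda>i. seed_round S rd i (fst (c i)) (snd (c i))))
         (\<lambda>f. return_pmf (f(0 := y))))"
      by (rule Pi_pmf_insert') auto
    also have "Pi_pmf {1..<M} ([], []) (\<lambda>i. seed_round S rd i (fst (c i)) (snd (c i))) =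
        Pi_pmf {1..<M} ([], []) (\<lambda>i. return_pmf ([], fact_msgs (Pair i ` X i)))"
      by (rule Pi_pmf_cong) (auto simp: seed_round_def X Let_def)
    also have "bind_pmf (seed_round S rd 0 (fst (c 0)) (snd (c 0))) (\<lambda>y.
        bind_pmf \<dots> (\<lambda>f. return_pmf (f(0 := y)))) = map_pmf L (pmf_of_set {..<S})"
      using assms(1)
      by (simp add: seed_round_def X map_pmf_def bind_assoc_pmf bind_return_pmf)
        (intro bind_pmf_cong refl arg_cong[where f=return_pmf], auto simp: L_def Z_def fun_eq_iff)
    finally show ?thesis .
  qed
  have fits: "fits M W wb (Z s)" if "s < S" for s
  proof -
    have c: "card (Z s i) \<le> W" if "i < M" for i
    proof -
      have "card (Pair i ` X i) = card (X i)" by (intro card_image inj_onI) auto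
      then show ?thesis using fin[OF that] card_insert_le_m1
        by (auto simp: Z_def card_insert_if)
    qed
    have s: "(\<Sum>i<M. card {t. (j, t) \<in> Z s i}) \<le> W" if "j < M" for j
    proof -
      have e: "{t. (j, t) \<in> Z s i} = {}" if "i \<noteq> j" for i using that by (auto simp: Z_def)
      have "(\<Sum>i<M. card {t. (j, t) \<in> Z s i}) = (\<Sum>i<M. if i = j then card {t. (j, t) \<in> Z s j} else 0)"
        using e by (intro sum.cong) auto
      also have "\<dots> = card {t. (j, t) \<in> Z s j}"
        using that by simp
      also have "\<dots> \<le> card (snd ` Z s j)"
        using fin[OF that] by (intro card_mono) (force simp: Z_def)+
      also have "\<dots> \<le> card (Z s j)" using fin[OF that] by (intro card_image_le) (auto simp: Z_def)
      also have "\<dots> \<le> W" using c that by blast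
      finally show ?thesis .
    qed
    show ?thesis
      using fin c s bits that assms(1) by (auto simp: fits_def Z_def split: if_splits)
  qed
  have good: "1 - e \<le> prob_reach M W wb gs (exchange M (L s)) Q \<and> round_ok M W wb (L s)"
    if "s < S" "G s" for s
  proof -
    have L: "L s i = ([], fact_msgs (Z s i))" if "i < M" for i using that by (simp add: L_def)
    note * = exchange_fact_msgs[OF fits[OF that(1)] L]
    have "delivered M (Z s) j = with_seed X s 1 j" if "j < M" for j
      using that by (auto simp: delivered_def Z_def with_seed_def split: if_splits)
    then have "holds M (with_seed X s 1) (exchange M (L s))"
      using *(2) by (auto simp: holds_def)
    then show ?thesis using cont that *(1) by blast
  qed
  have "{..<S} \<noteq> {}" using assms(2) by auto
  then have "prob_reach M W wb (seed_round S rd # gs) c Q =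
    (\<Sum>s<S. if round_ok M W wb (L s) then prob_reach M W wb gs (exchange M (L s)) Q else 0) / real S"
    by (simp add: prob_reach_Cons out integral_pmf_of_set)
  \<comment> \<open>A bad seed is charged a full unit; by \<open>0 \<le> e\<close> its summand is
    then at most 0, so nothing has to be known about the run.\<close>
  also have "\<dots> \<ge> (\<Sum>s<S. (1 - e) - of_bool (\<not> G s)) / real S"
    using good prob_reach_nonneg \<open>0 \<le> e\<close>
    by (intro divide_right_mono sum_mono) (auto intro: order_trans[of _ 0])
  also have "(\<Sum>s<S. (1 - e) - of_bool (\<not> G s)) = real S * (1 - e) - real (card {s. s < S \<and> \<not> G s})"
    by (simp add: sum_subtractf sum.If_cases of_bool_def Int_def conj_commute lessThan_def)
  also have "\<dots> / real S \<ge> (real S * (1 - e) - d * real S) / real S"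
    using bad by (intro divide_right_mono) auto
  also have "(real S * (1 - e) - d * real S) / real S = 1 - (d + e)"
    using assms(2) by (simp add: field_simps)
  finally show ?thesis .
qed

subsection \<open>Rounds that write the memory\<close>

text \<open>The sampler expects its input, and the verdict is read, as plain words in memory,
  whereas fact rounds leave the memory empty.\<close>

definition write_round :: "(nat \<Rightarrow> fact set \<Rightarrow> nat list) \<Rightarrow> round_fun" where
  "write_round K i m b = return_pmf (K i (facts_in m b), [])"

lemma prob_reach_write_round:
  assumes "holds M X c"
    and "\<And>i. i < M \<Longrightarrow> length (K i (X i)) \<le> W \<and> set (K i (X i)) \<subseteq> {..<2 ^ wb}"
  shows "prob_reach M W wb (write_round K # gs) c Q =
    prob_reach M W wb gs (\<lambda>i. if i < M then (K i (X i), []) else ([], [])) Q"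
proof -
  define L where "L = (\<lambda>i. if i \<in> {..<M} then (K i (known c i), [] :: (nat \<times> nat) list) else ([], []))"
  have out: "round_outcome M (write_round K) c = return_pmf L"
    unfolding round_outcome_def write_round_def L_def
    by (subst Pi_pmf_return_pmf) (rule finite_lessThan, rule refl)
  have ex: "exchange M L = (\<lambda>i. if i < M then (K i (X i), []) else ([], []))"
    using assms(1) by (auto simp: exchange_def L_def holds_def fun_eq_iff)
  have "round_ok M W wb L"
    unfolding round_ok_def ex using assms(2) by (auto simp: L_def)
  then show ?thesis by (simp add: prob_reach_Cons out ex)
qed

section \<open>Unions of cycles and their contractions\<close>

text \<open>Integer indices turn a cycle into a periodic two-sided sequence, so both directions are
  treated alike and no wrap-around cases arise.\<close>

definition cyc_nth :: "nat list \<Rightarrow> int \<Rightarrow> nat" where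
  "cyc_nth xs i = xs ! nat (i mod int (length xs))"

definition cyc_edges :: "nat list \<Rightarrow> nat set set" where
  "cyc_edges xs = range (\<lambda>i. {cyc_nth xs i, cyc_nth xs (i + 1)})"

definition nbs :: "nat set set \<Rightarrow> nat \<Rightarrow> nat set" where
  "nbs E v = {u. {v, u} \<in> E}"

lemma cyc_nth_in_set: "xs \<noteq> [] \<Longrightarrow> cyc_nth xs i \<in> set xs"
  unfolding cyc_nth_def by (intro nth_mem) (simp add: nat_less_iff)

lemma cyc_nth_of_nat: "i < length xs \<Longrightarrow> cyc_nth xs (int i) = xs ! i"
  by (simp add: cyc_nth_def)

lemma in_set_cyc_nth: "v \<in> set xs \<Longrightarrow> \<exists>i. 0 \<le> i \<and> i < int (length xs) \<and> v = cyc_nth xs i"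
proof -
  assume "v \<in> set xs"
  then obtain i where "i < length xs" "v = xs ! i" by (auto simp: in_set_conv_nth)
  then show ?thesis by (intro exI[of _ "int i"]) (simp add: cyc_nth_of_nat)
qed

lemma cyc_nth_mod [simp]: "cyc_nth xs (i mod int (length xs)) = cyc_nth xs i"
  by (simp add: cyc_nth_def)

lemma cyc_nth_eq_iff:
  assumes "distinct xs" "xs \<noteq> []"
  shows "cyc_nth xs i = cyc_nth xs j \<longleftrightarrow> i mod int (length xs) = j mod int (length xs)"
proof -
  have "nat (i mod int (length xs)) < length xs" for i
    using assms(2) by (simp add: nat_less_iff)
  moreover have "nat (i mod int (length xs)) = nat (j mod int (length xs)) \<longleftrightarrow>
      i mod int (length xs) = j mod int (length xs)"
    using assms(2) by (intro eq_nat_nat_iff) auto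
  ultimately show ?thesis
    using assms(1) by (simp add: cyc_nth_def nth_eq_iff_index_eq)
qed

lemma cyc_nth_cong_add:
  assumes "distinct xs" "xs \<noteq> []" "cyc_nth xs i = cyc_nth xs j"
  shows "cyc_nth xs (i + d) = cyc_nth xs (j + d)"
  using assms cyc_nth_eq_iff[OF assms(1,2)] by (metis mod_add_left_eq)

lemma nbs_cyc_edges:
  assumes "distinct xs" "xs \<noteq> []"
  shows "nbs (cyc_edges xs) (cyc_nth xs i) = {cyc_nth xs (i - 1), cyc_nth xs (i + 1)}"
proof (intro equalityI subsetI)
  fix u assume "u \<in> nbs (cyc_edges xs) (cyc_nth xs i)"
  then obtain m where "{cyc_nth xs i, u} = {cyc_nth xs m, cyc_nth xs (m + 1)}"
    by (auto simp: nbs_def cyc_edges_def)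
  then consider "cyc_nth xs i = cyc_nth xs m" "u = cyc_nth xs (m + 1)"
    | "cyc_nth xs i = cyc_nth xs (m + 1)" "u = cyc_nth xs m"
    by (auto simp: doubleton_eq_iff)
  then show "u \<in> {cyc_nth xs (i - 1), cyc_nth xs (i + 1)}"
  proof cases
    case 1
    then show ?thesis using cyc_nth_cong_add[OF assms, of i m 1] by simp
  next
    case 2
    then show ?thesis using cyc_nth_cong_add[OF assms, of i "m + 1" "-1"] by simp
  qed
next
  fix u assume "u \<in> {cyc_nth xs (i - 1), cyc_nth xs (i + 1)}"
  then show "u \<in> nbs (cyc_edges xs) (cyc_nth xs i)"
  proof
    assume "u = cyc_nth xs (i - 1)"
    then show ?thesis unfolding nbs_def cyc_edges_def
      by (auto intro!: image_eqI[of _ _ "i - 1"])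
  qed (auto simp: nbs_def cyc_edges_def)
qed

section \<open>Rotations of a cycle and the new neighbours of a surviving vertex\<close>

lemma cyc_nth_rotate:
  assumes "xs \<noteq> []"
  shows "cyc_nth (rotate k xs) i = cyc_nth xs (i + int k)"
proof -
  have l: "nat (i mod int (length xs)) < length xs" using assms by (simp add: nat_less_iff)
  have "(k + nat (i mod int (length xs))) mod length xs = nat ((i + int k) mod int (length xs))"
  proof -
    have "int ((k + nat (i mod int (length xs))) mod length xs) = (int k + i mod int (length xs)) mod int (length xs)"
      using assms by (simp add: zmod_int)
    also have "\<dots> = (i + int k) mod int (length xs)" by (simp add: mod_simps add.commute)
    finally show ?thesis by linarith
  qed
  then show ?thesis using l by (simp add: cyc_nth_def nth_rotate)
qed

lemma cyc_edges_rotate: "xs \<noteq> [] \<Longrightarrow> cyc_edges (rotate k xs) = cyc_edges xs"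
proof -
  assume xs: "xs \<noteq> []"
  have "cyc_edges (rotate k xs) = (\<lambda>i. {cyc_nth xs i, cyc_nth xs (i + 1)}) ` range (\<lambda>i. i + int k)"
    unfolding cyc_edges_def image_image
    by (intro image_cong) (auto simp: cyc_nth_rotate[OF xs] algebra_simps)
  also have "range (\<lambda>i. i + int k) = UNIV"
    by (auto intro!: image_eqI[of _ _ "_ - int k"])
  finally show ?thesis by (simp add: cyc_edges_def)
qed

lemma rotate_to_hd:
  assumes "xs \<noteq> []"
  obtains k where "k < length xs" "cyc_nth xs i = hd (rotate k xs)"
    "\<And>j. cyc_nth (rotate k xs) j = cyc_nth xs (i + j)"
proof
  define k where "k = nat (i mod int (length xs))"
  show "k < length xs" using assms by (simp add: k_def nat_less_iff)
  have k: "int k = i mod int (length xs)" using assms by (simp add: k_def)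
  show *: "cyc_nth (rotate k xs) j = cyc_nth xs (i + j)" for j
  proof -
    have "cyc_nth (rotate k xs) j = cyc_nth xs (j + i mod int (length xs))"
      using assms by (simp add: cyc_nth_rotate k)
    also have "\<dots> = cyc_nth xs ((j + i mod int (length xs)) mod int (length xs))" by simp
    also have "(j + i mod int (length xs)) mod int (length xs) = (i + j) mod int (length xs)"
      by (simp add: mod_simps add.commute)
    finally show ?thesis by simp
  qed
  show "cyc_nth xs i = hd (rotate k xs)"
    using *[of 0] assms by (simp add: cyc_nth_def hd_conv_nth)
qed

lemma filter_rotate:
  assumes "k \<le> length xs"
  obtains k' where "filter P (rotate k xs) = rotate k' (filter P xs)"
proof
  have "rotate k xs = drop k xs @ take k xs"
    using assms by (cases "k = length xs") (auto simp: rotate_drop_take)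
  moreover have "rotate (length (filter P (take k xs))) (filter P (take k xs) @ filter P (drop k xs))
      = filter P (drop k xs) @ filter P (take k xs)"
    by (rule rotate_append)
  moreover have "filter P (take k xs) @ filter P (drop k xs) = filter P xs"
    by (metis append_take_drop_id filter_append)
  ultimately show "filter P (rotate k xs) = rotate (length (filter P (take k xs))) (filter P xs)"
    by simp
qed

lemma cyc_nth_minus:
  assumes "1 \<le> k" "k \<le> length xs"
  shows "cyc_nth xs (- int k) = xs ! (length xs - k)"
proof -
  have "(- int k) mod int (length xs) = (int (length xs) - int k) mod int (length xs)"
    by (metis diff_0 mod_diff_left_eq mod_self)
  also have "\<dots> = int (length xs) - int k" using assms by (intro mod_pos_pos_trivial) auto
  also have "\<dots> = int (length xs - k)" using assms by simp
  finally show ?thesis by (simp add: cyc_nth_def)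
qed

text \<open>With \<open>v\<close> at the head, its new successor is the first survivor of the tail
  and its new predecessor the last one. If nothing else survives, both are \<open>v\<close>
  itself.\<close>

lemma nbs_filter_hd:
  assumes dist: "distinct xs" and xs: "xs = v # zs" and v: "P v"
    and j: "0 < j" "P (cyc_nth xs j)" "\<And>m. 0 < m \<Longrightarrow> m < j \<Longrightarrow> \<not> P (cyc_nth xs m)"
    and j': "0 < j'" "P (cyc_nth xs (- j'))" "\<And>m. 0 < m \<Longrightarrow> m < j' \<Longrightarrow> \<not> P (cyc_nth xs (- m))"
  shows "nbs (cyc_edges (filter P xs)) v = {cyc_nth xs (- j'), cyc_nth xs j}"
proof -
  let ?ys = "filter P xs"
  have ys: "?ys = v # filter P zs" using xs v by simp
  have "cyc_nth ?ys 0 = v" by (simp add: cyc_nth_def ys)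
  then have "nbs (cyc_edges ?ys) v = {cyc_nth ?ys (- 1), cyc_nth ?ys 1}"
    using nbs_cyc_edges[of ?ys 0] dist ys distinct_filter[OF dist, of P] by simp
  moreover have "cyc_nth xs j = cyc_nth ?ys 1"
  proof (cases "filter P zs = []")
    case True
    then have n: "\<not> P (xs ! i)" if "0 < i" "i < length xs" for i
      using that xs by (auto simp: filter_empty_conv nth_Cons')
    have "cyc_nth xs j = v"
    proof (rule ccontr)
      assume "cyc_nth xs j \<noteq> v"
      then have "cyc_nth xs j \<in> set zs" using cyc_nth_in_set[of xs j] xs by auto
      then show False using j(2) True by (auto simp: filter_empty_conv)
    qed
    then show ?thesis using ys True by (simp add: cyc_nth_def)
  next
    case False
    then obtain w C where wC: "filter P zs = w # C" by (cases "filter P zs") auto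
    then obtain B C' where B: "zs = B @ w # C'" "\<forall>x\<in>set B. \<not> P x" "P w"
      by (auto simp: filter_eq_Cons_iff)
    have w: "cyc_nth xs (int (Suc (length B))) = w"
      by (subst cyc_nth_of_nat) (auto simp: xs B)
    have no: "\<not> P (cyc_nth xs m)" if "0 < m" "m < int (Suc (length B))" for m
    proof -
      define m' where "m' = nat m - 1"
      have m': "m = int (Suc m')" using that(1) by (simp add: m'_def)
      then have "cyc_nth xs m = B ! m'" using that
        by (subst m', subst cyc_nth_of_nat) (auto simp: xs B nth_append)
      then show ?thesis using B(2) m' that by auto
    qed
    have "j = int (Suc (length B))"
    proof (rule ccontr)
      assume "j \<noteq> int (Suc (length B))"
      then show False using no[of j] j w B(3) j(3)[of "int (Suc (length B))"] by fastforce
    qed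
    moreover have "cyc_nth ?ys 1 = w"
      using cyc_nth_of_nat[of 1 ?ys] ys wC by simp
    ultimately show ?thesis using w by simp
  qed
  moreover have "cyc_nth xs (- j') = cyc_nth ?ys (- 1)"
  proof (cases "filter P zs = []")
    case True
    have "cyc_nth xs (- j') = v"
    proof (rule ccontr)
      assume "cyc_nth xs (- j') \<noteq> v"
      then have "cyc_nth xs (- j') \<in> set zs" using cyc_nth_in_set[of xs "- j'"] xs by auto
      then show False using j'(2) True by (auto simp: filter_empty_conv)
    qed
    then show ?thesis using ys True by (simp add: cyc_nth_def)
  next
    case False
    then have "filter P (rev zs) \<noteq> []" by (simp add: filter_empty_conv)
    then obtain w C where wC: "filter P (rev zs) = w # C" by (cases "filter P (rev zs)") auto
    then obtain B C' where B: "rev zs = B @ w # C'" "\<forall>x\<in>set B. \<not> P x" "P w"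
      by (auto simp: filter_eq_Cons_iff)
    have zs: "zs = rev C' @ w # rev B"
      using arg_cong[OF B(1), of rev] by simp
    have w: "cyc_nth xs (- int (Suc (length B))) = w"
      by (subst cyc_nth_minus) (auto simp: xs zs nth_append)
    have no: "\<not> P (cyc_nth xs (- m))" if "0 < m" "m < int (Suc (length B))" for m
    proof -
      define m' where "m' = nat m - 1"
      have m': "m = int (Suc m')" using that(1) by (simp add: m'_def)
      then have "cyc_nth xs (- m) = xs ! (length xs - Suc m')" using that
        by (subst m', subst cyc_nth_minus) (auto simp: xs zs)
      also have "\<dots> = rev xs ! m'" using m' that by (subst rev_nth) (auto simp: xs zs)
      also have "\<dots> = B ! m'" using m' that by (simp add: xs B nth_append)
      finally show ?thesis using B(2) m' that by auto
    qed
    have "j' = int (Suc (length B))"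
    proof (rule ccontr)
      assume "j' \<noteq> int (Suc (length B))"
      then show False using no[of j'] j' w B(3) j'(3)[of "int (Suc (length B))"] by fastforce
    qed
    moreover have "cyc_nth ?ys (- 1) = w"
    proof -
      have "?ys = v # filter P (rev C') @ [w]" using ys zs B(2,3) by simp
      then show ?thesis using cyc_nth_minus[of 1 ?ys] by simp
    qed
    ultimately show ?thesis using w by simp
  qed
  ultimately show ?thesis by auto
qed

text \<open>A rotation brings any vertex to the head, and filtering a rotated list rotates the
  filtered list.\<close>

lemma nbs_filter:
  assumes dist: "distinct xs" "xs \<noteq> []" and v: "P (cyc_nth xs i)"
    and j: "0 < j" "P (cyc_nth xs (i + j))" "\<And>m. 0 < m \<Longrightarrow> m < j \<Longrightarrow> \<not> P (cyc_nth xs (i + m))"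
    and j': "0 < j'" "P (cyc_nth xs (i - j'))" "\<And>m. 0 < m \<Longrightarrow> m < j' \<Longrightarrow> \<not> P (cyc_nth xs (i - m))"
  shows "nbs (cyc_edges (filter P xs)) (cyc_nth xs i) = {cyc_nth xs (i - j'), cyc_nth xs (i + j)}"
proof -
  obtain k where k: "k < length xs" "cyc_nth xs i = hd (rotate k xs)"
    "\<And>j. cyc_nth (rotate k xs) j = cyc_nth xs (i + j)"
    using rotate_to_hd[OF dist(2)] by metis
  obtain k' where k': "filter P (rotate k xs) = rotate k' (filter P xs)"
    using filter_rotate[of k xs P] k(1) by auto
  obtain zs where zs: "rotate k xs = cyc_nth xs i # zs"
    using k(2) dist(2) by (metis list.exhaust_sel rotate_is_Nil_conv)
  have ne: "filter P xs \<noteq> []"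
    using v cyc_nth_in_set[OF dist(2), of i] by (auto simp: filter_empty_conv)
  have "nbs (cyc_edges (filter P (rotate k xs))) (cyc_nth xs i) =
      {cyc_nth (rotate k xs) (- j'), cyc_nth (rotate k xs) j}"
    by (rule nbs_filter_hd[OF _ zs]) (use assms k(3) in auto)
  then show ?thesis using k' k(3) ne by (simp add: cyc_edges_rotate)
qed

subsection \<open>Systems of disjoint cycles\<close>

text \<open>Length at least 3 excludes loops and double edges, so the two neighbours of a vertex are
  distinct.\<close>

definition good_cycles :: "nat list list \<Rightarrow> bool" where
  "good_cycles css \<longleftrightarrow> distinct (concat css) \<and> (\<forall>xs\<in>set css. 3 \<le> length xs)"

definition cycles_edges :: "nat list list \<Rightarrow> nat set set" where
  "cycles_edges css = (\<Union>xs\<in>set css. cyc_edges xs)"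

abbreviation cycles_verts :: "nat list list \<Rightarrow> nat set" where
  "cycles_verts css \<equiv> set (concat css)"

lemma good_cyclesD:
  assumes "good_cycles css" "xs \<in> set css"
  shows "distinct xs" "xs \<noteq> []" "3 \<le> length xs"
  using assms by (auto simp: good_cycles_def distinct_concat_iff)

lemma good_cycles_unique:
  assumes "good_cycles css" "xs \<in> set css" "ys \<in> set css" "cyc_nth xs i = cyc_nth ys j"
  shows "xs = ys"
proof -
  have "cyc_nth xs i \<in> set xs \<inter> set ys"
    using assms cyc_nth_in_set[of xs i] cyc_nth_in_set[of ys j] good_cyclesD(2)[OF assms(1)] by auto
  then show ?thesis
    using assms(1-3) unfolding good_cycles_def distinct_concat_iff by blast
qed

lemma nbs_cycles_edges_cyc:
  assumes "good_cycles css" "xs \<in> set css"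
  shows "nbs (cycles_edges css) (cyc_nth xs i) = nbs (cyc_edges xs) (cyc_nth xs i)"
proof -
  have "u \<in> nbs (cyc_edges xs) (cyc_nth xs i)"
    if "ys \<in> set css" "u \<in> nbs (cyc_edges ys) (cyc_nth xs i)" for u ys
  proof -
    from that(2) obtain m where "{cyc_nth xs i, u} = {cyc_nth ys m, cyc_nth ys (m + 1)}"
      by (auto simp: nbs_def cyc_edges_def)
    then have "cyc_nth xs i = cyc_nth ys m \<or> cyc_nth xs i = cyc_nth ys (m + 1)"
      by (auto simp: doubleton_eq_iff)
    then have "xs = ys" using good_cycles_unique[OF assms that(1)] by blast
    then show ?thesis using that by simp
  qed
  then show ?thesis
    using assms(2) by (auto simp: nbs_def cycles_edges_def)
qed

lemma nbs_cycles_edges: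
  assumes "good_cycles css" "xs \<in> set css"
  shows "nbs (cycles_edges css) (cyc_nth xs i) = {cyc_nth xs (i - 1), cyc_nth xs (i + 1)}"
  using nbs_cycles_edges_cyc[OF assms] nbs_cyc_edges good_cyclesD[OF assms] by simp

lemma cycles_vertsE:
  assumes "v \<in> cycles_verts css"
  obtains xs i where "xs \<in> set css" "v = cyc_nth xs i"
  using assms in_set_cyc_nth by fastforce

lemma cyc_nth_in_verts:
  assumes "good_cycles css" "xs \<in> set css"
  shows "cyc_nth xs i \<in> cycles_verts css"
  using cyc_nth_in_set[OF good_cyclesD(2)[OF assms]] assms(2) by auto

lemma nbs_subset_verts:
  assumes "good_cycles css"
  shows "nbs (cycles_edges css) v \<subseteq> cycles_verts css"
    and "v \<notin> cycles_verts css \<Longrightarrow> nbs (cycles_edges css) v = {}"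
proof -
  have "v \<in> cycles_verts css \<and> u \<in> cycles_verts css" if "u \<in> nbs (cycles_edges css) v" for u
  proof -
    from that obtain xs m where "xs \<in> set css" "{v, u} = {cyc_nth xs m, cyc_nth xs (m + 1)}"
      by (auto simp: nbs_def cycles_edges_def cyc_edges_def)
    then show ?thesis using cyc_nth_in_verts[OF assms] by (metis doubleton_eq_iff)
  qed
  then show "nbs (cycles_edges css) v \<subseteq> cycles_verts css"
    "v \<notin> cycles_verts css \<Longrightarrow> nbs (cycles_edges css) v = {}" by auto
qed

lemma cyc_nth_neq:
  assumes "distinct xs" "3 \<le> length xs"
  shows "cyc_nth xs i \<noteq> cyc_nth xs (i + 1)" "cyc_nth xs (i - 1) \<noteq> cyc_nth xs (i + 1)"
proof -
  have ne: "xs \<noteq> []" using assms(2) by auto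
  have dvd: "\<not> int (length xs) dvd 1" "\<not> int (length xs) dvd 2"
    using assms(2) zdvd_imp_le[of "int (length xs)" 1] zdvd_imp_le[of "int (length xs)" 2] by auto
  show "cyc_nth xs i \<noteq> cyc_nth xs (i + 1)"
    using dvd(1) mod_eq_dvd_iff[of "i + 1" "int (length xs)" i]
    by (auto simp: cyc_nth_eq_iff[OF assms(1) ne])
  show "cyc_nth xs (i - 1) \<noteq> cyc_nth xs (i + 1)"
    using dvd(2) mod_eq_dvd_iff[of "i + 1" "int (length xs)" "i - 1"]
    by (auto simp: cyc_nth_eq_iff[OF assms(1) ne])
qed

lemma card_nbs_le: 
  assumes "good_cycles css"
  shows "card (nbs (cycles_edges css) v) \<le> 2" "finite (nbs (cycles_edges css) v)"
proof -
  have "card (nbs (cycles_edges css) v) \<le> 2 \<and> finite (nbs (cycles_edges css) v)"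
  proof (cases "v \<in> cycles_verts css")
    case True
    then obtain xs i where "xs \<in> set css" "v = cyc_nth xs i" by (rule cycles_vertsE)
    then show ?thesis using nbs_cycles_edges[OF assms, of xs i] by (simp add: card_insert_if)
  next
    case False
    then show ?thesis using nbs_subset_verts[OF assms, of v] by simp
  qed
  then show "card (nbs (cycles_edges css) v) \<le> 2" "finite (nbs (cycles_edges css) v)" by auto
qed

subsection \<open>Contraction by a local predicate\<close>

text \<open>A two-sided sequence is the view from its position 0. \<open>sh\<close> moves the
  viewpoint, and \<open>rv\<close> swaps the directions, because a vertex knows no orientation of
  its cycle.\<close>

definition sh :: "int \<Rightarrow> (int \<Rightarrow> nat) \<Rightarrow> int \<Rightarrow> nat" where
  "sh j c = (\<lambda>i. c (i + j))"

definition rv :: "(int \<Rightarrow> nat) \<Rightarrow> int \<Rightarrow> nat" where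
  "rv c = (\<lambda>i. c (- i))"

lemma sh_apply: "sh j c i = c (i + j)" by (simp add: sh_def)
lemma rv_apply: "rv c i = c (- i)" by (simp add: rv_def)
lemma rv_rv [simp]: "rv (rv c) = c" by (simp add: rv_def)
lemma sh_sh [simp]: "sh i (sh j c) = sh (i + j) c" by (simp add: sh_def fun_eq_iff algebra_simps)
lemma sh_0 [simp]: "sh 0 c = c" by (simp add: sh_def)
lemma sh_rv: "sh j (rv c) = rv (sh (- j) c)" by (simp add: sh_def rv_def fun_eq_iff algebra_simps)

text \<open>These are the predicates that a vertex can evaluate on a window of radius
  \<open>r\<close> whose orientation is unknown.\<close>

definition local_sym :: "int \<Rightarrow> ((int \<Rightarrow> nat) \<Rightarrow> bool) \<Rightarrow> bool" where
  "local_sym r P \<longleftrightarrow> (\<forall>c c'. (\<forall>i. \<bar>i\<bar> \<le> r \<longrightarrow> c i = c' i) \<longrightarrow> P c = P c') \<and> (\<forall>c. P (rv c) = P c)"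

definition keep :: "((int \<Rightarrow> nat) \<Rightarrow> bool) \<Rightarrow> nat list list \<Rightarrow> nat \<Rightarrow> bool" where
  "keep P css v \<longleftrightarrow> (\<exists>xs\<in>set css. \<exists>i. v = cyc_nth xs i \<and> P (sh i (cyc_nth xs)))"

definition contract :: "((int \<Rightarrow> nat) \<Rightarrow> bool) \<Rightarrow> nat list list \<Rightarrow> nat list list" where
  "contract P css = map (filter (keep P css)) css"

definition gap_le :: "int \<Rightarrow> ((int \<Rightarrow> nat) \<Rightarrow> bool) \<Rightarrow> (int \<Rightarrow> nat) \<Rightarrow> bool" where
  "gap_le g P c \<longleftrightarrow> (\<forall>i. \<exists>j. 0 < j \<and> j \<le> g \<and> P (sh (i + j) c))"

lemma sh_cyc_nth_cong:
  assumes "distinct xs" "xs \<noteq> []" "cyc_nth xs i = cyc_nth xs j"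
  shows "sh i (cyc_nth xs) = sh j (cyc_nth xs)"
  using cyc_nth_cong_add[OF assms] by (simp add: sh_def add.commute)

lemma keep_cyc_nth:
  assumes "good_cycles css" "xs \<in> set css"
  shows "keep P css (cyc_nth xs i) \<longleftrightarrow> P (sh i (cyc_nth xs))"
proof
  assume "keep P css (cyc_nth xs i)"
  then obtain ys j where ys: "ys \<in> set css" "cyc_nth xs i = cyc_nth ys j" "P (sh j (cyc_nth ys))"
    by (auto simp: keep_def)
  then have "ys = xs" using good_cycles_unique[OF assms] by blast
  then show "P (sh i (cyc_nth xs))"
    using ys sh_cyc_nth_cong[OF good_cyclesD(1,2)[OF assms]] by metis
qed (use assms(2) in \<open>auto simp: keep_def\<close>)

definition next_at :: "((int \<Rightarrow> nat) \<Rightarrow> bool) \<Rightarrow> (int \<Rightarrow> nat) \<Rightarrow> int \<Rightarrow> bool" where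
  "next_at P c j \<longleftrightarrow> 0 < j \<and> P (sh j c) \<and> (\<forall>m. 0 < m \<and> m < j \<longrightarrow> \<not> P (sh m c))"

text \<open>A path with \<open>2 * R\<close> steps, centred at \<open>v\<close>, that never turns
  back. It may run around a short cycle several times, so injectivity is not asked for.\<close>

definition window :: "int \<Rightarrow> nat set set \<Rightarrow> nat \<Rightarrow> (int \<Rightarrow> nat) \<Rightarrow> bool" where
  "window R F v c \<longleftrightarrow> c 0 = v \<and> (\<forall>i. - R \<le> i \<and> i < R \<longrightarrow> {c i, c (i + 1)} \<in> F) \<and>
     (\<forall>i. - R < i \<and> i < R \<longrightarrow> c (i - 1) \<noteq> c (i + 1))"

definition nexts :: "((int \<Rightarrow> nat) \<Rightarrow> bool) \<Rightarrow> int \<Rightarrow> (int \<Rightarrow> nat) \<Rightarrow> nat set" where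
  "nexts P g c = {c j | j. j \<le> g \<and> next_at P c j}"

text \<open>A window around \<open>v\<close> is unique up to reversal, so the choice is harmless for the symmetric \<open>P\<close> used below.\<close>

definition new_nbs :: "((int \<Rightarrow> nat) \<Rightarrow> bool) \<Rightarrow> int \<Rightarrow> int \<Rightarrow> nat \<Rightarrow> nat set set \<Rightarrow> nat set" where
  "new_nbs P R g v F = (if \<exists>c. window R F v c
     then let c = (SOME c. window R F v c) in if P c then nexts P g c \<union> nexts P g (rv c) else {}
     else {})"

lemma next_at_unique: "next_at P c j \<Longrightarrow> next_at P c j' \<Longrightarrow> j = j'"
  unfolding next_at_def by (meson linorder_neqE)

lemma next_at_exists:
  assumes "0 < j" "P (sh j c)"
  obtains j' where "next_at P c j'" "j' \<le> j"
proof -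
  define n where "n = (LEAST n. 0 < n \<and> P (sh (int n) c))"
  have *: "0 < nat j \<and> P (sh (int (nat j)) c)" using assms by simp
  have 1: "0 < n \<and> P (sh (int n) c)"
    unfolding n_def using * by (rule LeastI[where P="\<lambda>n. 0 < n \<and> P (sh (int n) c)"])
  have 2: "n \<le> nat j"
    unfolding n_def using * by (rule Least_le[where P="\<lambda>n. 0 < n \<and> P (sh (int n) c)"])
  have 3: "\<not> P (sh m c)" if "0 < m" "m < int n" for m
    using not_less_Least[of "nat m" "\<lambda>n. 0 < n \<and> P (sh (int n) c)"] that unfolding n_def by auto
  show ?thesis using that[of "int n"] 1 2 3 assms(1) by (auto simp: next_at_def)
qed

text \<open>Each vertex has two neighbours and the path never turns back, so the first step
  \<open>c 1\<close> fixes the direction and with it the whole window.\<close>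

lemma window_unique:
  assumes "good_cycles css" "xs \<in> set css" "F \<subseteq> cycles_edges css" "1 \<le> R"
    and w: "window R F (cyc_nth xs a) c"
  shows "(\<forall>i. \<bar>i\<bar> \<le> R \<longrightarrow> c i = sh a (cyc_nth xs) i) \<or> (\<forall>i. \<bar>i\<bar> \<le> R \<longrightarrow> c i = rv (sh a (cyc_nth xs)) i)"
proof -
  note nb = nbs_cycles_edges[OF assms(1,2)]
  \<comment> \<open>\<open>f\<close> is later instantiated by the cycle read in either direction, so
    the induction is done once for both.\<close>
  have main: "\<forall>i. \<bar>i\<bar> \<le> R \<longrightarrow> c i = f (i)"
    if f0: "f 0 = cyc_nth xs a" and c1: "c 1 = f 1" and w: "window R F (cyc_nth xs a) c"
      and fn: "\<And>i. nbs (cycles_edges css) (f i) = {f (i - 1), f (i + 1)}" for f c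
  proof -
    have c0: "c 0 = f 0" using w f0 by (simp add: window_def)
    have nbc: "c (i + 1) \<in> nbs (cycles_edges css) (c i)" "c i \<in> nbs (cycles_edges css) (c (i + 1))"
      if "- R \<le> i" "i < R" for i
      using w that assms(3) by (auto simp: window_def nbs_def insert_commute)
    have wne: "c (i - 1) \<noteq> c (i + 1)" if "- R < i" "i < R" for i
      using w that by (simp add: window_def)
    have "\<forall>i. \<bar>i\<bar> \<le> int n \<longrightarrow> c i = f i" if "int n \<le> R" for n
      using that
    proof (induction n)
      case 0 then show ?case using c0 by simp
    next
      case (Suc n)
      then have IH: "\<bar>i\<bar> \<le> int n \<Longrightarrow> c i = f i" for i by simp
      \<comment> \<open>Only \<open>c 1\<close> is matched by assumption; the condition against
        turning back at 0 leaves one choice for \<open>c (-1)\<close>.\<close>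
      have cm1: "c (-1) = f (-1)"
      proof -
        have "c (-1) \<in> {f (-1), f 1}" using nbc(2)[of "-1"] assms(4) c0 fn[of 0] by auto
        moreover have "c (0 - 1) \<noteq> c (0 + 1)"
          using wne[of 0] assms(4) by simp
        ultimately show ?thesis using c1 by auto
      qed
      have "c (int n + 1) = f (int n + 1)"
      proof (cases "n = 0")
        case False
        then have "c (int n + 1) \<in> {f (int n - 1), f (int n + 1)}"
          using nbc(1)[of "int n"] Suc.prems IH[of "int n"] fn by auto
        moreover have "c (int n - 1) \<noteq> c (int n + 1)" using wne[of "int n"] Suc.prems by simp
        ultimately show ?thesis using IH[of "int n - 1"] False by auto
      qed (use c1 in simp)
      moreover have "c (- int n - 1) = f (- int n - 1)"
      proof (cases "n = 0")
        case False
        then have "c (- int n - 1) \<in> {f (- int n - 1), f (- int n + 1)}"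
          using nbc(2)[of "- int n - 1"] Suc.prems IH[of "- int n"] fn by auto
        moreover have "c (- int n - 1) \<noteq> c (- int n + 1)" using wne[of "- int n"] Suc.prems by simp
        ultimately show ?thesis using IH[of "- int n + 1"] False by auto
      qed (use cm1 in simp)
      moreover have "\<bar>i\<bar> \<le> int n \<or> i = int n + 1 \<or> i = - int n - 1" if "\<bar>i\<bar> \<le> int (Suc n)" for i
        using that by auto
      ultimately show ?case using IH by metis
    qed
    from this[of "nat R"] show ?thesis using assms(4) by simp
  qed
  have "c 1 \<in> nbs (cycles_edges css) (c 0)"
  proof -
    have "\<forall>i. - R \<le> i \<and> i < R \<longrightarrow> {c i, c (i + 1)} \<in> F" using w by (simp add: window_def)
    from this[rule_format, of 0] show ?thesis using assms(3,4) by (auto simp: nbs_def)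
  qed
  then have "c 1 \<in> {cyc_nth xs (a - 1), cyc_nth xs (a + 1)}"
    using w nb by (auto simp: window_def)
  then consider "c 1 = sh a (cyc_nth xs) 1" | "c 1 = rv (sh a (cyc_nth xs)) 1"
    by (auto simp: sh_def rv_def algebra_simps)
  then show ?thesis
  proof cases
    case 1
    have "\<forall>i. \<bar>i\<bar> \<le> R \<longrightarrow> c i = sh a (cyc_nth xs) i"
    proof (rule main[where f="sh a (cyc_nth xs)" and c=c])
      show "nbs (cycles_edges css) (sh a (cyc_nth xs) i) =
          {sh a (cyc_nth xs) (i - 1), sh a (cyc_nth xs) (i + 1)}" for i
        using nb[of "i + a"] by (simp add: sh_def algebra_simps)
    qed (use 1 w in \<open>auto simp: sh_def\<close>)
    then show ?thesis ..
  next
    case 2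
    have "\<forall>i. \<bar>i\<bar> \<le> R \<longrightarrow> c i = rv (sh a (cyc_nth xs)) i"
    proof (rule main[where f="rv (sh a (cyc_nth xs))" and c=c])
      show "nbs (cycles_edges css) (rv (sh a (cyc_nth xs)) i) =
          {rv (sh a (cyc_nth xs)) (i - 1), rv (sh a (cyc_nth xs)) (i + 1)}" for i
        using nb[of "a - i"] by (auto simp: sh_def rv_def algebra_simps)
    qed (use 2 w in \<open>auto simp: sh_def rv_def\<close>)
    then show ?thesis ..
  qed
qed

text \<open>Survival of a position up to \<open>g\<close> depends on \<open>r\<close> further
  positions beyond it, whence the radius \<open>r + g\<close>.\<close>

lemma nexts_cong:
  assumes "local_sym r P" "r + g \<le> R" "0 \<le> r" "\<And>i. \<bar>i\<bar> \<le> R \<Longrightarrow> c i = c' i"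
  shows "nexts P g c = nexts P g c'"
proof -
  have P: "P (sh m c) = P (sh m c')" if "0 < m" "m \<le> g" for m
  proof -
    have "\<forall>i. \<bar>i\<bar> \<le> r \<longrightarrow> sh m c i = sh m c' i" using assms(2,4) that by (auto simp: sh_def)
    then show ?thesis using assms(1) unfolding local_sym_def by blast
  qed
  have "next_at P c j = next_at P c' j" if "j \<le> g" for j
    using P that unfolding next_at_def by auto
  moreover have "c j = c' j" if "j \<le> g" "next_at P c j" for j
    using that assms(2-4) by (auto simp: next_at_def)
  ultimately show ?thesis unfolding nexts_def by (metis (no_types, lifting))
qed

text \<open>A vertex that knows the edges in its ball of radius \<open>R\<close> finds its
  neighbours in the contracted cycle without communication. Further cycle edges in \<open>F\<close>
  do no harm, since windows remain unique.\<close>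

theorem new_nbs_correct:
  assumes good: "good_cycles css" and xs: "xs \<in> set css" and good': "good_cycles (contract P css)"
    and loc: "local_sym r P" and R: "r + g \<le> R" "0 \<le> r" "1 \<le> g"
    and gap: "gap_le g P (cyc_nth xs)"
    and F: "F \<subseteq> cycles_edges css"
    and ball: "\<And>m. - R \<le> m \<Longrightarrow> m < R \<Longrightarrow> {cyc_nth xs (a + m), cyc_nth xs (a + m + 1)} \<in> F"
  shows "new_nbs P R g (cyc_nth xs a) F = nbs (cycles_edges (contract P css)) (cyc_nth xs a)"
proof -
  note D = good_cyclesD[OF good xs]
  define C where "C = sh a (cyc_nth xs)"
  let ?v = "cyc_nth xs a"
  have "window R F ?v C"
    unfolding window_def C_def
  proof (intro conjI allI impI)
    fix i assume "- R \<le> i \<and> i < R"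
    then show "{sh a (cyc_nth xs) i, sh a (cyc_nth xs) (i + 1)} \<in> F"
      using ball[of i] by (simp add: sh_def algebra_simps)
  next
    fix i show "sh a (cyc_nth xs) (i - 1) \<noteq> sh a (cyc_nth xs) (i + 1)"
      using cyc_nth_neq(2)[OF D(1,3), of "i + a"] by (simp add: sh_def algebra_simps)
  qed (simp add: sh_def)
  then have ex: "\<exists>c. window R F ?v c" by blast
  define c where "c = (SOME c. window R F ?v c)"
  have w: "window R F ?v c" unfolding c_def using ex by (rule someI_ex)
  have cases: "(\<forall>i. \<bar>i\<bar> \<le> R \<longrightarrow> c i = C i) \<or> (\<forall>i. \<bar>i\<bar> \<le> R \<longrightarrow> c i = rv C i)"
    unfolding C_def using R by (intro window_unique[OF good xs F _ w]) auto
  have PC: "P c = P C"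
  proof -
    have loc': "P c = P c'" if "\<forall>i. \<bar>i\<bar> \<le> R \<longrightarrow> c i = c' i" for c'
    proof -
      have "\<forall>i. \<bar>i\<bar> \<le> r \<longrightarrow> c i = c' i" using that R by auto
      then show ?thesis using loc unfolding local_sym_def by blast
    qed
    have "P c = P C \<or> P c = P (rv C)"
      using cases loc' by blast
    then show ?thesis using loc by (auto simp: local_sym_def)
  qed
  have nx: "nexts P g c \<union> nexts P g (rv c) = nexts P g C \<union> nexts P g (rv C)"
    using cases
  proof
    assume *: "\<forall>i. \<bar>i\<bar> \<le> R \<longrightarrow> c i = C i"
    then have "nexts P g c = nexts P g C" "nexts P g (rv c) = nexts P g (rv C)"
      by (intro nexts_cong[OF loc R(1,2)]; simp add: rv_def)+
    then show ?thesis by simp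
  next
    assume *: "\<forall>i. \<bar>i\<bar> \<le> R \<longrightarrow> c i = rv C i"
    then have "nexts P g c = nexts P g (rv C)" "nexts P g (rv c) = nexts P g (rv (rv C))"
      by (intro nexts_cong[OF loc R(1,2)]; simp add: rv_def)+
    then show ?thesis by auto
  qed
  have k: "P (sh m C) = keep P css (cyc_nth xs (a + m))" for m
    using keep_cyc_nth[OF good xs] by (simp add: C_def add.commute)
  have kr: "P (sh m (rv C)) = keep P css (cyc_nth xs (a - m))" for m
    using k[of "- m"] loc by (simp add: sh_rv local_sym_def)
  have lhs: "new_nbs P R g ?v F = (if P C then nexts P g C \<union> nexts P g (rv C) else {})"
    unfolding new_nbs_def using ex PC nx by (simp add: c_def[symmetric] Let_def)
  show ?thesis
  proof (cases "P C")
    case True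
    obtain j0 where "0 < j0" "j0 \<le> g" "P (sh (a + j0) (cyc_nth xs))"
      using gap by (auto simp: gap_le_def)
    then have "P (sh j0 C)" by (simp add: C_def add.commute)
    then obtain j where j: "next_at P C j" "j \<le> g"
      using next_at_exists[of j0 P C] \<open>0 < j0\<close> \<open>j0 \<le> g\<close> by (metis order_trans)
    \<comment> \<open>The gap property looks forward only. Applied at \<open>a - g - 1\<close>, it
      finds a survivor at distance \<open>g + 1 - j1\<close> behind \<open>a\<close>, which lies
      between 1 and \<open>g\<close>.\<close>
    obtain j1 where j1: "0 < j1" "j1 \<le> g" "P (sh (a - g - 1 + j1) (cyc_nth xs))"
      using gap by (auto simp: gap_le_def)
    have "P (sh (g + 1 - j1) (rv C))"
      using j1(3) loc by (simp add: sh_rv local_sym_def C_def algebra_simps)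
    from next_at_exists[of "g + 1 - j1" P "rv C", OF _ this]
    obtain j' where j': "next_at P (rv C) j'" "j' \<le> g + 1 - j1" using j1(2) by auto
    have j'g: "j' \<le> g" using j' j1(1) by simp
    have nexts: "nexts P g c = {c j}" if "next_at P c j" "j \<le> g" for c j
      using that next_at_unique[OF that(1)] unfolding nexts_def by blast
    note nexts[OF j] nexts[OF j'(1) j'g]
    then have "new_nbs P R g ?v F = {cyc_nth xs (a - j'), cyc_nth xs (a + j)}"
      using True by (auto simp: lhs C_def sh_def rv_def algebra_simps)
    moreover have "nbs (cyc_edges (filter (keep P css) xs)) ?v = {cyc_nth xs (a - j'), cyc_nth xs (a + j)}"
      by (rule nbs_filter[OF D(1,2)])
        (use True j j' k kr k[of 0] in \<open>auto simp: next_at_def\<close>)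
    moreover have "nbs (cycles_edges (contract P css)) ?v = nbs (cyc_edges (filter (keep P css) xs)) ?v"
    proof -
      let ?ys = "filter (keep P css) xs"
      have "?v \<in> set ?ys"
        using True k[of 0] cyc_nth_in_set[OF D(2), of a] by simp
      then obtain m where "?v = cyc_nth ?ys m" using in_set_cyc_nth by blast
      moreover have "?ys \<in> set (contract P css)" using xs by (simp add: contract_def)
      ultimately show ?thesis using nbs_cycles_edges_cyc[OF good'] by metis
    qed
    ultimately show ?thesis by simp
  next
    case False
    then have "?v \<notin> cycles_verts (contract P css)"
      using k[of 0] by (auto simp: contract_def)
    then show ?thesis using nbs_subset_verts(2)[OF good'] False lhs by simp
  qed
qed

lemma new_nbs_empty:
  assumes "\<And>u. {v, u} \<notin> F" "1 \<le> R"
  shows "new_nbs P R g v F = {}"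
proof -
  have "\<not> window R F v c" for c
  proof
    assume "window R F v c"
    then have "c 0 = v" and "\<forall>i. - R \<le> i \<and> i < R \<longrightarrow> {c i, c (i + 1)} \<in> F"
      by (auto simp: window_def)
    from this(2)[rule_format, of 0] this(1) show False using assms by simp
  qed
  then show ?thesis by (simp add: new_nbs_def)
qed

section \<open>Counting survivors on a cycle by covering and packing\<close>

lemma length_filter_cyc:
  assumes "xs \<noteq> []"
  shows "length (filter Q xs) = card {i. 0 \<le> i \<and> i < int (length xs) \<and> Q (cyc_nth xs i)}"
proof -
  have "length (filter Q xs) = card {i. i < length xs \<and> Q (xs ! i)}"
    by (rule length_filter_conv_card)
  also have "\<dots> = card (int ` {i. i < length xs \<and> Q (xs ! i)})"
    by (simp add: card_image)
  also have "int ` {i. i < length xs \<and> Q (xs ! i)} =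
      {i. 0 \<le> i \<and> i < int (length xs) \<and> Q (cyc_nth xs i)}"
    by (auto simp: cyc_nth_of_nat image_iff intro!: exI[of _ "nat _"])
      (auto simp: cyc_nth_def)
  finally show ?thesis .
qed

text \<open>Every position is a survivor shifted back by an element of \<open>D\<close>, so the
  pairs of a displacement and a survivor map onto all positions.\<close>

lemma length_le_cover:
  assumes "distinct xs" "xs \<noteq> []" "finite D"
    and "\<And>i. \<exists>d\<in>D. Q (cyc_nth xs (i + d))"
  shows "length xs \<le> card D * length (filter Q xs)"
proof -
  let ?s = "int (length xs)"
  define A where "A = {i. 0 \<le> i \<and> i < ?s \<and> Q (cyc_nth xs i)}"
  have finA: "finite A" by (rule finite_subset[of _ "{0..<?s}"]) (auto simp: A_def)
  have "{0..<?s} \<subseteq> (\<lambda>(d, a). (a - d) mod ?s) ` (D \<times> A)"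
  proof
    fix i assume i: "i \<in> {0..<?s}"
    obtain d where d: "d \<in> D" "Q (cyc_nth xs (i + d))" using assms(4) by blast
    then have "(i + d) mod ?s \<in> A" using assms(2) by (simp add: A_def)
    moreover have "((i + d) mod ?s - d) mod ?s = i" using i by (simp add: mod_simps)
    ultimately show "i \<in> (\<lambda>(d, a). (a - d) mod ?s) ` (D \<times> A)"
      using d(1) by force
  qed
  then have "card {0..<?s} \<le> card (D \<times> A)"
    using assms(3) finA by (meson card_image_le card_mono finite_SigmaI finite_imageI order_trans)
  then show ?thesis
    using length_filter_cyc[OF assms(2), of Q] by (simp add: A_def card_cartesian_product)
qed

text \<open>The arcs of \<open>d\<close> positions that start at the survivors are disjoint modulo
  the length.\<close>

lemma length_ge_packing:
  assumes "distinct xs" "xs \<noteq> []" "d \<le> length xs"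
    and sep: "\<And>i m. 0 < m \<Longrightarrow> m < int d \<Longrightarrow> Q (cyc_nth xs i) \<Longrightarrow> \<not> Q (cyc_nth xs (i + m))"
  shows "d * length (filter Q xs) \<le> length xs"
proof -
  let ?s = "int (length xs)"
  define A where "A = {i. 0 \<le> i \<and> i < ?s \<and> Q (cyc_nth xs i)}"
  have finA: "finite A" by (rule finite_subset[of _ "{0..<?s}"]) (auto simp: A_def)
  \<comment> \<open>If two arcs met, one survivor would follow another at distance
    \<open>m' - m < d\<close>. The order \<open>m \<le> m'\<close> is no loss by symmetry.\<close>
  have key: "m = m' \<and> a = a'"
    if "a \<in> A" "a' \<in> A" "0 \<le> m" "m \<le> m'" "m' < int d" "(a + m) mod ?s = (a' + m') mod ?s" for a a' m m'
  proof -
    have "a mod ?s = (a' + (m' - m)) mod ?s"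
      using that(6) by (metis add_diff_cancel_right' add_diff_eq mod_diff_left_eq)
    then have "Q (cyc_nth xs (a' + (m' - m)))"
      using that(1) cyc_nth_eq_iff[OF assms(1,2)] by (simp add: A_def)
    moreover have "Q (cyc_nth xs a')" using that(2) by (simp add: A_def)
    ultimately have "\<not> 0 < m' - m" using sep[of "m' - m" a'] that(3,5) by linarith
    then have "m' - m = 0" using that(4) by simp
    then have "m = m'" "a mod ?s = a' mod ?s" using \<open>a mod ?s = _\<close> by auto
    then show ?thesis using that(1,2) by (simp add: A_def)
  qed
  have "inj_on (\<lambda>(m, a). (a + m) mod ?s) ({0..<int d} \<times> A)"
  proof (rule inj_onI, clarify)
    fix m a m' a' assume *: "m \<in> {0..<int d}" "a \<in> A" "m' \<in> {0..<int d}" "a' \<in> A"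
      "(a + m) mod ?s = (a' + m') mod ?s"
    show "m = m' \<and> a = a'"
      using key[of a a' m m'] key[of a' a m' m] * by (cases "m \<le> m'") auto
  qed
  moreover have "(\<lambda>(m, a). (a + m) mod ?s) ` ({0..<int d} \<times> A) \<subseteq> {0..<?s}"
    using assms(2) by auto
  ultimately have "card ({0..<int d} \<times> A) \<le> card {0..<?s}"
    by (intro card_inj_on_le) auto
  then show ?thesis
    using length_filter_cyc[OF assms(2), of Q] by (simp add: A_def card_cartesian_product)
qed

section \<open>Inputs of the cycle problem as lists of cycles\<close>

lemma cycle_graph_eq:
  "cycle_graph V E \<longleftrightarrow> (\<exists>xs. distinct xs \<and> set xs = V \<and> 3 \<le> length xs \<and> E = cyc_edges xs)"
proof -
  have eq0: "(\<lambda>i. {xs ! i, xs ! (Suc i mod length xs)}) ` {..<length xs} = cyc_edges xs"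
    if "xs \<noteq> []" for xs :: "nat list"
  proof -
    have *: "xs ! i = cyc_nth xs (int i)" "xs ! (Suc i mod length xs) = cyc_nth xs (int i + 1)"
      if "i < length xs" for i
    proof -
      show "xs ! i = cyc_nth xs (int i)" using that by (simp add: cyc_nth_of_nat)
      have "int (Suc i mod length xs) = (int i + 1) mod int (length xs)" by (simp add: zmod_int add.commute)
      then have "nat ((int i + 1) mod int (length xs)) = Suc i mod length xs" by linarith
      then show "xs ! (Suc i mod length xs) = cyc_nth xs (int i + 1)" by (simp add: cyc_nth_def)
    qed
    show ?thesis
    proof (intro equalityI subsetI)
      fix e assume "e \<in> cyc_edges xs"
      then obtain i where i: "e = {cyc_nth xs i, cyc_nth xs (i + 1)}" by (auto simp: cyc_edges_def)
      define k where "k = nat (i mod int (length xs))"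
      have k: "k < length xs" "int k = i mod int (length xs)"
        using that by (auto simp: k_def nat_less_iff)
      have "cyc_nth xs (int k + 1) = cyc_nth xs ((int k + 1) mod int (length xs))" by simp
      also have "(int k + 1) mod int (length xs) = (i + 1) mod int (length xs)"
        unfolding k(2) by (simp add: mod_simps)
      finally have "e = {cyc_nth xs (int k), cyc_nth xs (int k + 1)}"
        by (simp add: i k(2))
      then show "e \<in> (\<lambda>i. {xs ! i, xs ! (Suc i mod length xs)}) ` {..<length xs}"
        using *[OF k(1)] k(1) by (intro image_eqI[of _ _ k]) auto
    qed (auto simp: * cyc_edges_def)
  qed
  have eq: "(\<lambda>i. {xs ! i, xs ! (Suc i mod length xs)}) ` {..<length xs} = cyc_edges xs"
    if "3 \<le> length xs" for xs :: "nat list"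
    by (rule eq0) (use that in auto)
  show ?thesis unfolding cycle_graph_def
    by (rule arg_cong[where f=Ex]) (use eq in \<open>auto simp: fun_eq_iff\<close>)
qed

lemma one_cycle_cycles:
  assumes "one_cycle n E"
  obtains css where "good_cycles css" "length css = 1" "cycles_verts css = {..<n}" "E = cycles_edges css"
    "\<And>xs. xs \<in> set css \<Longrightarrow> length xs = n"
proof -
  obtain xs where xs: "distinct xs" "set xs = {..<n}" "3 \<le> length xs" "E = cyc_edges xs"
    using assms by (auto simp: one_cycle_def cycle_graph_eq)
  have "length xs = n" using distinct_card[OF xs(1)] xs(2) by simp
  then show ?thesis using that[of "[xs]"] xs by (auto simp: good_cycles_def cycles_edges_def)
qed

lemma two_cycles_cycles:
  assumes "two_cycles n E"
  obtains css where "good_cycles css" "length css = 2" "cycles_verts css = {..<n}" "E = cycles_edges css"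
    "\<And>xs. xs \<in> set css \<Longrightarrow> 2 * length xs = n"
proof -
  obtain V1 V2 E1 E2 where V: "V1 \<union> V2 = {..<n}" "V1 \<inter> V2 = {}" "card V1 = card V2"
    "cycle_graph V1 E1" "cycle_graph V2 E2" "E = E1 \<union> E2"
    using assms by (auto simp: two_cycles_def)
  obtain xs where xs: "distinct xs" "set xs = V1" "3 \<le> length xs" "E1 = cyc_edges xs"
    using V by (auto simp: cycle_graph_eq)
  obtain ys where ys: "distinct ys" "set ys = V2" "3 \<le> length ys" "E2 = cyc_edges ys"
    using V by (auto simp: cycle_graph_eq)
  have "length xs = length ys" using distinct_card[OF xs(1)] distinct_card[OF ys(1)] xs ys V by simp
  moreover have "length xs + length ys = n"
    using distinct_card[OF xs(1)] distinct_card[OF ys(1)] xs(2) ys(2) V(1,2)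
      card_Un_disjoint[of V1 V2] by (metis List.finite_set card_lessThan)
  ultimately have "2 * length xs = n" "2 * length ys = n" by auto
  then show ?thesis using that[of "[xs, ys]"] xs ys V by (auto simp: good_cycles_def cycles_edges_def)
qed

text \<open>The vertex set is left open, since labels change and vertices disappear during the
  contractions.\<close>

definition single_cycle :: "nat set set \<Rightarrow> bool" where
  "single_cycle E \<longleftrightarrow> (\<exists>xs. distinct xs \<and> 3 \<le> length xs \<and> E = cyc_edges xs)"

text \<open>If there were two cycles, following the alleged single one from a vertex of
  \<open>xs\<close> would never leave \<open>set xs\<close>, as the neighbourhoods agree; yet it
  would have to reach the disjoint \<open>ys\<close>.\<close>

lemma single_cycle_iff:
  assumes "good_cycles css" "css \<noteq> []"
  shows "single_cycle (cycles_edges css) \<longleftrightarrow> length css = 1"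
proof
  assume "length css = 1"
  then obtain xs where "css = [xs]" by (cases css) auto
  then show "single_cycle (cycles_edges css)"
    using assms by (auto simp: single_cycle_def good_cycles_def cycles_edges_def)
next
  assume "single_cycle (cycles_edges css)"
  then obtain zs where zs: "distinct zs" "3 \<le> length zs" "cycles_edges css = cyc_edges zs"
    by (auto simp: single_cycle_def)
  have ne: "zs \<noteq> []" using zs(2) by auto
  show "length css = 1"
  proof (rule ccontr)
    assume "length css \<noteq> 1"
    then obtain xs ys css' where css: "css = xs # ys # css'" using assms(2) by (cases css; cases "tl css") auto
    have xs: "xs \<in> set css" and ys: "ys \<in> set css" using css by auto
    have disj: "set xs \<inter> set ys = {}" using assms(1) css by (auto simp: good_cycles_def)
    have vz: "v \<in> set zs" if "v \<in> cycles_verts css" for v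
    proof -
      obtain us i where us: "us \<in> set css" "v = cyc_nth us i" using \<open>v \<in> cycles_verts css\<close> by (rule cycles_vertsE)
      then have "cyc_nth us (i + 1) \<in> nbs (cyc_edges zs) v"
        using nbs_cycles_edges[OF assms(1) us(1)] zs(3) by auto
      then obtain m where "{v, cyc_nth us (i + 1)} = {cyc_nth zs m, cyc_nth zs (m + 1)}"
        by (auto simp: nbs_def cyc_edges_def)
      then show ?thesis using cyc_nth_in_set[OF ne] by (metis doubleton_eq_iff)
    qed
    have step: "cyc_nth zs (i + 1) \<in> set xs" if "cyc_nth zs i \<in> set xs" for i
    proof -
      from in_set_cyc_nth[OF that] obtain m where m: "cyc_nth zs i = cyc_nth xs m" by blast
      have "cyc_nth zs (i + 1) \<in> nbs (cyc_edges zs) (cyc_nth zs i)"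
        using nbs_cyc_edges[OF zs(1) ne] by auto
      then have "cyc_nth zs (i + 1) \<in> {cyc_nth xs (m - 1), cyc_nth xs (m + 1)}"
        using nbs_cycles_edges[OF assms(1) xs, of m] zs(3) m by auto
      then show ?thesis using cyc_nth_in_set good_cyclesD(2)[OF assms(1) xs] by auto
    qed
    obtain a where a: "cyc_nth xs 0 = cyc_nth zs a"
      using vz[OF cyc_nth_in_verts[OF assms(1) xs]] in_set_cyc_nth by blast
    have all: "cyc_nth zs (a + int k) \<in> set xs" for k
    proof (induction k)
      case 0
      then show ?case using a cyc_nth_in_set[OF good_cyclesD(2)[OF assms(1) xs], of 0] by simp
    next
      case (Suc k)
      then show ?case using step[of "a + int k"] by (simp add: algebra_simps)
    qed
    obtain b where b: "cyc_nth ys 0 = cyc_nth zs b"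
      using vz[OF cyc_nth_in_verts[OF assms(1) ys]] in_set_cyc_nth by blast
    define k where "k = nat ((b - a) mod int (length zs))"
    have "cyc_nth zs (a + int k) = cyc_nth zs b"
      using ne by (simp add: cyc_nth_eq_iff[OF zs(1) ne] k_def mod_simps)
    then have "cyc_nth ys 0 \<in> set xs" using all[of k] b by simp
    then show False using disj cyc_nth_in_set[OF good_cyclesD(2)[OF assms(1) ys], of 0] by auto
  qed
qed

section \<open>Local selection rules\<close>

subsection \<open>Local minima of a colouring\<close>

definition diff_bit :: "nat \<Rightarrow> nat \<Rightarrow> nat" where
  "diff_bit x y = (LEAST i. bit x i \<noteq> bit y i)"

text \<open>The colour reduction of Cole and Vishkin: the lowest position where the labels differ,
  together with the own bit there. It compresses labels of \<open>L\<close> bits to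
  \<open>2 * L\<close> values.\<close>

definition bit_code :: "nat \<Rightarrow> nat \<Rightarrow> nat" where
  "bit_code x y = 2 * diff_bit x y + of_bool (bit x (diff_bit x y))"

text \<open>The classical scheme compares with the successor only. Without an orientation, the codes
  towards both neighbours are combined, sorted by the label of the neighbour to make the result
  symmetric.\<close>

definition color :: "nat \<Rightarrow> nat \<Rightarrow> nat \<Rightarrow> nat" where
  "color x y z = prod_encode (bit_code x (min y z), bit_code x (max y z))"

lemma bit_lt_exp: "x < 2 ^ L \<Longrightarrow> bit (x :: nat) i \<Longrightarrow> i < L"
  by (metis bit_take_bit_iff take_bit_nat_eq_self)

lemma diff_bit:
  assumes "x \<noteq> y"
  shows "bit x (diff_bit x y) \<noteq> bit y (diff_bit x y)"
proof -
  have "\<exists>i. bit x i \<noteq> bit y i" using assms by (auto simp: bit_eq_iff)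
  then show ?thesis unfolding diff_bit_def by (rule LeastI_ex)
qed

lemma bit_code_lt:
  assumes "x \<noteq> y" "x < 2 ^ L" "y < 2 ^ L"
  shows "bit_code x y < 2 * L"
proof -
  have "diff_bit x y < L" using diff_bit[OF assms(1)] bit_lt_exp assms(2,3) by blast
  then show ?thesis by (simp add: bit_code_def of_bool_def)
qed

text \<open>Equal codes would name the same position and the same bit there, but \<open>x\<close>
  and \<open>y\<close> differ at the position named by the first code.\<close>

lemma bit_code_neq:
  assumes "x \<noteq> y"
  shows "bit_code x y \<noteq> bit_code y w"
proof
  assume *: "bit_code x y = bit_code y w"
  have "(bit_code x y) div 2 = diff_bit x y" "(bit_code y w) div 2 = diff_bit y w"
    "odd (bit_code x y) = bit x (diff_bit x y)" "odd (bit_code y w) = bit y (diff_bit y w)"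
    by (auto simp: bit_code_def)
  then show False using * diff_bit[OF assms] by simp
qed

text \<open>The component in which \<open>x\<close> is compared with \<open>y\<close> already
  differs from the same component of the other colour, whatever \<open>y\<close> is compared with
  there.\<close>

lemma color_neq:
  assumes "x \<noteq> y" "y = a \<or> y = b"
  shows "color x a b \<noteq> color y c d"
  using assms bit_code_neq[OF assms(1)]
  by (auto simp: color_def prod_encode_eq min_def max_def split: if_splits)

lemma color_lt:
  assumes "x \<noteq> a" "x \<noteq> b" "x < 2 ^ L" "a < 2 ^ L" "b < 2 ^ L"
  shows "color x a b < 16 * L\<^sup>2"
proof -
  have "bit_code x (min a b) < 2 * L" "bit_code x (max a b) < 2 * L"
    using assms by (auto intro!: bit_code_lt simp: min_def max_def)
  from prod_encode_lt[OF this] show ?thesis by (simp add: color_def power_mult_distrib)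
qed

lemma color_commute: "color x a b = color x b a"
  by (simp add: color_def min.commute max.commute)

definition color1 :: "(int \<Rightarrow> nat) \<Rightarrow> nat" where
  "color1 c = color (c 0) (c 1) (c (-1))"

definition color2 :: "(int \<Rightarrow> nat) \<Rightarrow> nat" where
  "color2 c = color (color1 c) (color1 (sh 1 c)) (color1 (sh (-1) c))"

text \<open>Strict local minima are removed. Being strict they are never adjacent, and they are
  frequent because two reductions leave fewer than \<open>16 * L1^2\<close> colours, with
  \<open>L1\<close> of order \<open>ln ln n\<close>.\<close>

definition pre_keep :: "(int \<Rightarrow> nat) \<Rightarrow> bool" where
  "pre_keep c \<longleftrightarrow> \<not> (color2 c < color2 (sh 1 c) \<and> color2 c < color2 (sh (-1) c))"

lemma color1_rv: "color1 (rv c) = color1 c"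
  by (simp add: color1_def rv_def color_commute)

lemma color2_rv: "color2 (rv c) = color2 c"
  by (simp add: color2_def sh_rv color1_rv color_commute)

lemma local_sym_pre_keep: "local_sym 3 pre_keep"
  unfolding local_sym_def
proof (intro conjI allI impI)
  fix c c' :: "int \<Rightarrow> nat" assume *: "\<forall>i. \<bar>i\<bar> \<le> 3 \<longrightarrow> c i = c' i"
  then have **: "c (-3) = c' (-3)" "c (-2) = c' (-2)" "c (-1) = c' (-1)" "c 0 = c' 0"
    "c 1 = c' 1" "c 2 = c' 2" "c 3 = c' 3" by auto
  show "pre_keep c = pre_keep c'"
    by (simp add: pre_keep_def color2_def color1_def sh_apply **)
next
  fix c show "pre_keep (rv c) = pre_keep c"
    by (auto simp: pre_keep_def sh_rv color2_rv)
qed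

context
  fixes xs :: "nat list" and L L1 :: nat
  assumes dist: "distinct xs" and len: "3 \<le> length xs" and lt: "\<And>v. v \<in> set xs \<Longrightarrow> v < 2 ^ L"
    and L1: "16 * L\<^sup>2 \<le> 2 ^ L1"
begin

private lemma ne: "xs \<noteq> []" using len by auto

private lemma color1_neq: "color1 (sh i (cyc_nth xs)) \<noteq> color1 (sh (i + 1) (cyc_nth xs))"
  unfolding color1_def sh_apply
  using cyc_nth_neq(1)[OF dist len, of i] by (intro color_neq) (auto simp: algebra_simps)

private lemma color1_lt: "color1 (sh i (cyc_nth xs)) < 2 ^ L1"
proof -
  have "color1 (sh i (cyc_nth xs)) < 16 * L\<^sup>2"
    unfolding color1_def sh_apply
    using cyc_nth_neq(1)[OF dist len, of i] cyc_nth_neq(1)[OF dist len, of "i - 1"]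
    by (intro color_lt lt cyc_nth_in_set ne) (auto simp: algebra_simps)
  then show ?thesis using L1 by simp
qed

private lemma color2_neq: "color2 (sh i (cyc_nth xs)) \<noteq> color2 (sh (i + 1) (cyc_nth xs))"
  unfolding color2_def sh_sh
  using color1_neq[of i] by (intro color_neq) (auto simp: algebra_simps)

private lemma color2_lt: "color2 (sh i (cyc_nth xs)) < 16 * L1\<^sup>2"
  unfolding color2_def sh_sh
  using color1_neq[of i] color1_neq[of "i - 1"]
  by (intro color_lt color1_lt) (auto simp: algebra_simps)

text \<open>Of two consecutive vertices at most one is a strict local minimum.\<close>

lemma gap_pre_keep: "gap_le 2 pre_keep (cyc_nth xs)"
  unfolding gap_le_def
proof
  fix i :: int
  show "\<exists>j. 0 < j \<and> j \<le> 2 \<and> pre_keep (sh (i + j) (cyc_nth xs))"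
  proof (cases "pre_keep (sh (i + 1) (cyc_nth xs))")
    case False
    then have "pre_keep (sh (i + 2) (cyc_nth xs))"
      by (auto simp: pre_keep_def algebra_simps)
    then show ?thesis by (intro exI[of _ 2]) auto
  qed (intro exI[of _ 1], auto)
qed

text \<open>Adjacent colours differ, so a kept vertex has a neighbour of smaller colour; the descent
  takes at most as many steps as the value of the colour.\<close>

private lemma local_min_near:
  "\<exists>d. \<bar>d\<bar> \<le> int (color2 (sh i (cyc_nth xs))) \<and> \<not> pre_keep (sh (i + d) (cyc_nth xs))"
proof (induction "color2 (sh i (cyc_nth xs))" arbitrary: i rule: less_induct)
  case less
  show ?case
  proof (cases "pre_keep (sh i (cyc_nth xs))")
    case False
    then show ?thesis by (intro exI[of _ 0]) auto
  next
    case True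
    have "color2 (sh (i + 1) (cyc_nth xs)) < color2 (sh i (cyc_nth xs)) \<or>
      color2 (sh (i - 1) (cyc_nth xs)) < color2 (sh i (cyc_nth xs))"
      using True color2_neq[of i] color2_neq[of "i - 1"]
      by (auto simp: pre_keep_def algebra_simps)
    then obtain e where e: "\<bar>e\<bar> \<le> 1" "color2 (sh (i + e) (cyc_nth xs)) < color2 (sh i (cyc_nth xs))"
      by (metis abs_minus_cancel abs_one diff_conv_add_uminus order_refl)
    from less[OF e(2)] obtain d where
      d: "\<bar>d\<bar> \<le> int (color2 (sh (i + e) (cyc_nth xs)))" "\<not> pre_keep (sh (i + e + d) (cyc_nth xs))"
      by blast
    show ?thesis using d e by (intro exI[of _ "e + d"]) (auto simp: algebra_simps)
  qed
qed

text \<open>For the first bound, removed vertices at distance below \<open>16 * L1^2\<close> on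
  either side cover the cycle. The second bound, from the gap 2, ensures that cycles do not become
  too short during several stages.\<close>

lemma length_pre_keep:
  assumes Q: "\<And>i. Q (cyc_nth xs i) \<longleftrightarrow> pre_keep (sh i (cyc_nth xs))"
  shows "32 * L1\<^sup>2 * length (filter Q xs) \<le> (32 * L1\<^sup>2 - 1) * length xs"
    and "length xs \<le> 2 * length (filter Q xs)"
proof -
  let ?K = "16 * L1\<^sup>2"
  have "length xs \<le> card {- int ?K<..<int ?K} * length (filter (\<lambda>v. \<not> Q v) xs)"
  proof (intro length_le_cover dist ne)
    fix i
    obtain d where "\<bar>d\<bar> \<le> int (color2 (sh i (cyc_nth xs)))" "\<not> pre_keep (sh (i + d) (cyc_nth xs))"
      using local_min_near by blast
    moreover have "int (color2 (sh i (cyc_nth xs))) < int ?K"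
      using color2_lt[of i] by (simp only: of_nat_less_iff)
    ultimately have "d \<in> {- int ?K<..<int ?K}" "\<not> Q (cyc_nth xs (i + d))"
      unfolding greaterThanLessThan_iff Q by linarith+
    then show "\<exists>d\<in>{- int ?K<..<int ?K}. \<not> Q (cyc_nth xs (i + d))" by blast
  qed auto
  also have "\<dots> \<le> 32 * L1\<^sup>2 * length (filter (\<lambda>v. \<not> Q v) xs)"
  proof (rule mult_right_mono)
    have "card {- int k<..<int k} \<le> 2 * k" for k by simp
    from this[of ?K] show "card {- int ?K<..<int ?K} \<le> 32 * L1\<^sup>2" by linarith
  qed simp
  finally have "length xs \<le> 32 * L1\<^sup>2 * length (filter (\<lambda>v. \<not> Q v) xs)" .
  moreover have "length (filter Q xs) + length (filter (\<lambda>v. \<not> Q v) xs) = length xs"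
    by (rule sum_length_filter_compl)
  ultimately have "32 * L1\<^sup>2 * length (filter Q xs) + length xs \<le> 32 * L1\<^sup>2 * length xs"
    by (metis add.commute add_le_cancel_left distrib_left)
  then show "32 * L1\<^sup>2 * length (filter Q xs) \<le> (32 * L1\<^sup>2 - 1) * length xs"
    by (simp add: diff_mult_distrib)
  have "length xs \<le> card {1..2::int} * length (filter Q xs)"
  proof (intro length_le_cover dist ne)
    fix i
    obtain j where "0 < j" "j \<le> 2" "pre_keep (sh (i + j) (cyc_nth xs))"
      using gap_pre_keep unfolding gap_le_def by blast
    then show "\<exists>d\<in>{1..2}. Q (cyc_nth xs (i + d))" by (intro bexI[of _ j]) (auto simp: Q)
  qed auto
  then show "length xs \<le> 2 * length (filter Q xs)" by simp
qed

end

subsection \<open>Ruling sets by bitwise merging\<close>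

text \<open>A ruling set by merging over label bits. After \<open>b\<close> levels the labels are
  grouped by their bits from \<open>b\<close> on, and distinct leaders of one group are at least
  \<open>D\<close> apart. When two groups merge, a leader with bit 1 yields to leaders with bit 0
  nearby.\<close>

primrec lead :: "int \<Rightarrow> nat \<Rightarrow> (int \<Rightarrow> nat) \<Rightarrow> bool" where
  "lead D 0 c \<longleftrightarrow> True"
| "lead D (Suc b) c \<longleftrightarrow> lead D b c \<and> (bit (c 0) b \<longrightarrow>
     \<not> (\<exists>d. \<bar>d\<bar> < D \<and> lead D b (sh d c) \<and> \<not> bit (c d) b \<and> drop_bit (Suc b) (c d) = drop_bit (Suc b) (c 0)))"

text \<open>Each level consults leaders at distance below \<open>D\<close>, so the radius of
  dependence grows by \<open>D\<close> per level.\<close>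

lemma lead_local:
  assumes "0 \<le> D" "\<And>i. \<bar>i\<bar> \<le> int b * D \<Longrightarrow> c i = c' i"
  shows "lead D b c = lead D b c'"
  using assms(2)
proof (induction b arbitrary: c c')
  case (Suc b)
  have eq: "lead D b (sh d c) = lead D b (sh d c')" "c d = c' d" if "\<bar>d\<bar> < D" for d
  proof -
    show "lead D b (sh d c) = lead D b (sh d c')"
      using that by (intro Suc.IH) (auto simp: sh_apply algebra_simps intro!: Suc.prems)
    have "\<bar>d\<bar> \<le> int (Suc b) * D" using that assms(1) by (simp add: algebra_simps add_increasing2)
    then show "c d = c' d" by (rule Suc.prems)
  qed
  have "c 0 = c' 0" using assms(1) by (intro Suc.prems) auto
  moreover have "lead D b c = lead D b c'"
    using assms(1) by (intro Suc.IH Suc.prems) (auto simp: algebra_simps)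
  ultimately show ?case using eq by (simp, metis)
qed simp

lemma lead_rv: "lead D b (rv c) = lead D b c"
proof (induction b arbitrary: c)
  case (Suc b)
  have *: "(\<exists>d. \<bar>d\<bar> < D \<and> lead D b (sh d (rv c)) \<and> \<not> bit (rv c d) b \<and> drop_bit (Suc b) (rv c d) = x) \<longleftrightarrow>
     (\<exists>d. \<bar>d\<bar> < D \<and> lead D b (sh d c) \<and> \<not> bit (c d) b \<and> drop_bit (Suc b) (c d) = x)" for x
    unfolding sh_rv Suc.IH rv_apply by (metis abs_minus_cancel minus_minus)
  show ?case unfolding lead.simps(2) Suc.IH * by (simp add: rv_apply)
qed simp

lemma drop_bit_eq_SucI:
  assumes "drop_bit (Suc b) (x :: nat) = drop_bit (Suc b) y" "bit x b = bit y b"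
  shows "drop_bit b x = drop_bit b y"
proof (rule bit_eqI)
  fix i
  have "bit (drop_bit (Suc b) x) (i - 1) = bit (drop_bit (Suc b) y) (i - 1)" using assms(1) by simp
  then show "bit (drop_bit b x) i = bit (drop_bit b y) i"
    using assms(2) by (cases i) (auto simp: bit_drop_bit_eq)
qed

lemma drop_bit_SucD: "drop_bit b (x :: nat) = drop_bit b y \<Longrightarrow> drop_bit (Suc b) x = drop_bit (Suc b) y"
  by (metis drop_bit_drop_bit plus_1_eq_Suc)

text \<open>The conclusion is equality of labels instead of \<open>d = 0\<close>, since the same
  vertex reappears on a periodic sequence. Two close leaders of one group with different bit
  \<open>b\<close> would contradict the yielding rule at the one with bit 1.\<close>

lemma lead_separated:
  assumes "lead D b c" "lead D b (sh d c)" "\<bar>d\<bar> < D" "drop_bit b (c d) = drop_bit b (c 0)"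
  shows "c d = c 0"
  using assms
proof (induction b)
  case (Suc b)
  have *: "lead D b c" "lead D b (sh d c)" using Suc.prems by auto
  have "bit (c d) b = bit (c 0) b"
  proof (rule ccontr)
    assume ne: "bit (c d) b \<noteq> bit (c 0) b"
    show False
    proof (cases "bit (c 0) b")
      case True
      then show False using Suc.prems(1,3,4) * ne by auto
    next
      \<comment> \<open>Now the leader with bit 1 sits at \<open>d\<close>, so the rule is applied
        with the viewpoint moved there.\<close>
      case False
      have "\<bar>- d\<bar> < D \<and> lead D b (sh (- d) (sh d c)) \<and> \<not> bit (sh d c (- d)) b \<and>
          drop_bit (Suc b) (sh d c (- d)) = drop_bit (Suc b) (sh d c 0)"
        using Suc.prems(3,4) * False by (simp add: sh_apply)
      moreover have "bit (sh d c 0) b" using ne False by (simp add: sh_apply)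
      ultimately show False using Suc.prems(2) by (meson lead.simps(2))
    qed
  qed
  then show ?case using Suc.IH * Suc.prems(3,4) drop_bit_eq_SucI by blast
qed (simp add: sh_apply)

text \<open>A leader that yields at level \<open>b\<close> yields to one with bit 0, which survives
  this level; so every level adds at most \<open>D\<close> to the distance.\<close>

lemma lead_dominates:
  assumes "0 < D"
  shows "\<exists>d. \<bar>d\<bar> \<le> int b * D \<and> lead D b (sh d c) \<and> drop_bit b (c d) = drop_bit b (c 0)"
proof (induction b)
  case (Suc b)
  then obtain d where d: "\<bar>d\<bar> \<le> int b * D" "lead D b (sh d c)" "drop_bit b (c d) = drop_bit b (c 0)"
    by blast
  show ?case
  proof (cases "lead D (Suc b) (sh d c)")
    case True
    then show ?thesis using d assms drop_bit_SucD[OF d(3)]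
      by (intro exI[of _ d]) (auto simp: algebra_simps simp del: lead.simps)
  next
    case False
    then obtain e where e: "\<bar>e\<bar> < D" "lead D b (sh (e + d) c)" "\<not> bit (c (e + d)) b"
      "drop_bit (Suc b) (c (e + d)) = drop_bit (Suc b) (c d)"
      using d(2) by (auto simp: sh_apply)
    have "lead D (Suc b) (sh (e + d) c)" using e by (simp add: sh_apply)
    moreover have "\<bar>e + d\<bar> \<le> int (Suc b) * D" using e(1) d(1) by (auto simp: algebra_simps)
    ultimately show ?thesis using e(4) drop_bit_SucD[OF d(3)] by (metis)
  qed
qed (auto intro: exI[of _ 0])

text \<open>A label repeated within \<open>Rs\<close> reveals a cycle of length at most
  \<open>Rs\<close>. Such cycles are kept whole, because thinning them could leave fewer than 3
  vertices.\<close>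

definition main_keep :: "int \<Rightarrow> nat \<Rightarrow> int \<Rightarrow> (int \<Rightarrow> nat) \<Rightarrow> bool" where
  "main_keep D L Rs c \<longleftrightarrow> (\<exists>d. d \<noteq> 0 \<and> \<bar>d\<bar> \<le> Rs \<and> c d = c 0) \<or> lead D L c"

lemma local_sym_main_keep:
  assumes "0 \<le> D" "int L * D \<le> Rs"
  shows "local_sym Rs (main_keep D L Rs)"
  unfolding local_sym_def
proof (intro conjI allI impI)
  fix c c' :: "int \<Rightarrow> nat" assume *: "\<forall>i. \<bar>i\<bar> \<le> Rs \<longrightarrow> c i = c' i"
  have "0 \<le> Rs" using assms by (metis of_nat_0_le_iff order_trans zero_le_mult_iff)
  moreover have "lead D L c = lead D L c'" using * assms by (intro lead_local) auto
  ultimately show "main_keep D L Rs c = main_keep D L Rs c'"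
    using * unfolding main_keep_def by auto
next
  fix c
  have "(\<exists>d. d \<noteq> 0 \<and> \<bar>d\<bar> \<le> Rs \<and> rv c d = rv c 0) \<longleftrightarrow> (\<exists>d. d \<noteq> 0 \<and> \<bar>d\<bar> \<le> Rs \<and> c d = c 0)"
    unfolding rv_apply by (metis abs_minus_cancel minus_minus neg_equal_0_iff_equal minus_zero)
  then show "main_keep D L Rs (rv c) = main_keep D L Rs c"
    by (simp add: main_keep_def lead_rv)
qed

context
  fixes xs :: "nat list" and L D :: nat and Rs g :: int
  assumes dist: "distinct xs" and len: "3 \<le> length xs" and lt: "\<And>v. v \<in> set xs \<Longrightarrow> v < 2 ^ L"
    and D: "0 < D" "int D \<le> Rs" and g: "g = 2 * int L * int D + 1" and Rs: "3 * g \<le> Rs"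
begin

private lemma ne': "xs \<noteq> []" using len by auto

private lemma small_iff:
  "(\<exists>d. d \<noteq> 0 \<and> \<bar>d\<bar> \<le> Rs \<and> sh i (cyc_nth xs) d = sh i (cyc_nth xs) 0) \<longleftrightarrow> int (length xs) \<le> Rs"
proof
  assume "\<exists>d. d \<noteq> 0 \<and> \<bar>d\<bar> \<le> Rs \<and> sh i (cyc_nth xs) d = sh i (cyc_nth xs) 0"
  then obtain d where d: "d \<noteq> 0" "\<bar>d\<bar> \<le> Rs" "cyc_nth xs (d + i) = cyc_nth xs i" by (auto simp: sh_apply)
  then have "int (length xs) dvd d"
    by (simp add: cyc_nth_eq_iff[OF dist ne'] mod_eq_dvd_iff)
  then have "int (length xs) \<le> \<bar>d\<bar>" using d(1) zdvd_imp_le[of "int (length xs)" "\<bar>d\<bar>"] by simp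
  then show "int (length xs) \<le> Rs" using d(2) by simp
next
  assume "int (length xs) \<le> Rs"
  then show "\<exists>d. d \<noteq> 0 \<and> \<bar>d\<bar> \<le> Rs \<and> sh i (cyc_nth xs) d = sh i (cyc_nth xs) 0"
    using ne' by (intro exI[of _ "int (length xs)"]) (simp add: sh_apply cyc_nth_eq_iff[OF dist ne'])
qed

private lemma drop0: "drop_bit L (cyc_nth xs i) = 0"
  using lt[OF cyc_nth_in_set[OF ne']] by (simp add: drop_bit_eq_div)

lemma gap_main_keep: "gap_le g (main_keep (int D) L Rs) (cyc_nth xs)"
  unfolding gap_le_def
proof
  fix i :: int
  \<comment> \<open>The leaders within \<open>L * D\<close> of this point lie between
    \<open>i + 1\<close> and \<open>i + 2 * L * D + 1\<close>, which explains the form of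
    \<open>g\<close>.\<close>
  define a where "a = i + int L * int D + 1"
  obtain d where d: "\<bar>d\<bar> \<le> int L * int D" "lead (int D) L (sh d (sh a (cyc_nth xs)))"
    using lead_dominates[of "int D" L "sh a (cyc_nth xs)"] D(1) by auto
  have eq: "d + a = i + (d + int L * int D + 1)" by (simp add: a_def)
  show "\<exists>j. 0 < j \<and> j \<le> g \<and> main_keep (int D) L Rs (sh (i + j) (cyc_nth xs))"
  proof (intro exI[of _ "d + int L * int D + 1"] conjI)
    show "0 < d + int L * int D + 1" using d(1) by linarith
    show "d + int L * int D + 1 \<le> g" using d(1) unfolding g by linarith
    show "main_keep (int D) L Rs (sh (i + (d + int L * int D + 1)) (cyc_nth xs))"
      using d(2) unfolding main_keep_def sh_sh eq by blast
  qed
qed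

text \<open>Separation of leaders gives the packing bound on long cycles. Since
  \<open>3 * g \<le> Rs\<close>, a cycle longer than \<open>Rs\<close> with a survivor in every
  stretch of \<open>g\<close> positions retains more than 3 vertices.\<close>

lemma length_main_keep:
  assumes Q: "\<And>i. Q (cyc_nth xs i) \<longleftrightarrow> main_keep (int D) L Rs (sh i (cyc_nth xs))"
  shows "D * length (filter Q xs) \<le> length xs \<or> filter Q xs = xs \<and> int (length xs) \<le> Rs"
    and "3 \<le> length (filter Q xs)"
proof -
  have small: "filter Q xs = xs" if "int (length xs) \<le> Rs"
  proof -
    have "Q (cyc_nth xs i)" for i using Q small_iff[of i] that by (simp add: main_keep_def)
    then have "Q v" if "v \<in> set xs" for v using in_set_cyc_nth[OF that] by auto
    then show ?thesis by (simp add: filter_id_conv)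
  qed
  have large: "D * length (filter Q xs) \<le> length xs \<and> 3 \<le> length (filter Q xs)" if "\<not> int (length xs) \<le> Rs"
  proof
    have Q': "Q (cyc_nth xs i) \<longleftrightarrow> lead (int D) L (sh i (cyc_nth xs))" for i
      using Q[of i] small_iff[of i] that unfolding main_keep_def by blast
    show "D * length (filter Q xs) \<le> length xs"
    proof (rule length_ge_packing[OF dist ne'])
      show "D \<le> length xs" using that D by linarith
      fix i m assume m: "0 < m" "m < int D" "Q (cyc_nth xs i)"
      show "\<not> Q (cyc_nth xs (i + m))"
      proof
        assume "Q (cyc_nth xs (i + m))"
        then have "lead (int D) L (sh m (sh i (cyc_nth xs)))" by (simp add: Q' add.commute)
        then have "sh i (cyc_nth xs) m = sh i (cyc_nth xs) 0"
          using lead_separated[of "int D" L "sh i (cyc_nth xs)" m] m by (simp add: Q' sh_apply drop0)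
        then have "int (length xs) \<le> Rs"
          using m D(2) by (subst small_iff[of i, symmetric]) (intro exI[of _ m], auto)
        then show False using that by simp
      qed
    qed
    have "length xs \<le> card {1..g} * length (filter Q xs)"
    proof (intro length_le_cover dist ne')
      fix i
      obtain j where "0 < j" "j \<le> g" "main_keep (int D) L Rs (sh (i + j) (cyc_nth xs))"
        using gap_main_keep unfolding gap_le_def by blast
      then show "\<exists>d\<in>{1..g}. Q (cyc_nth xs (i + d))" by (intro bexI[of _ j]) (auto simp: Q)
    qed auto
    then have "length xs \<le> nat g * length (filter Q xs)" by simp
    then have "int (length xs) \<le> int (nat g * length (filter Q xs))" by (simp only: of_nat_le_iff)
    moreover have g0: "0 < g" using g by (simp add: add_nonneg_pos)
    ultimately have "int (length xs) \<le> g * int (length (filter Q xs))" by simp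
    then have "3 * g < g * int (length (filter Q xs))" using that Rs by linarith
    with g0 have "3 < int (length (filter Q xs))" by (simp add: mult.commute)
    then show "3 \<le> length (filter Q xs)" by simp
  qed
  show "D * length (filter Q xs) \<le> length xs \<or> filter Q xs = xs \<and> int (length xs) \<le> Rs"
    using small large by blast
  show "3 \<le> length (filter Q xs)" using small large len by metis
qed

end

section \<open>Random walks cover neighbourhoods on the cycles\<close>

definition uses :: "nat \<Rightarrow> nat \<Rightarrow> nat list \<Rightarrow> bool" where
  "uses a b ys \<longleftrightarrow> (\<exists>t. Suc t < length ys \<and> ys ! t = a \<and> ys ! Suc t = b)"

definition miss :: "nat set set \<Rightarrow> nat \<Rightarrow> nat \<Rightarrow> nat \<Rightarrow> nat \<Rightarrow> real" where
  "miss E a b t x = measure_pmf.prob (random_walk E t x) {ys. \<not> uses a b ys}"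

lemma random_walk_Suc:
  "random_walk E (Suc l) v =
     bind_pmf (pmf_of_set (nbs E v)) (\<lambda>u. map_pmf (\<lambda>xs. v # xs) (random_walk E l u))"
  by (simp add: nbs_def)

lemma random_walk_hd: "ys \<in> set_pmf (random_walk E l v) \<Longrightarrow> length ys = Suc l \<and> ys ! 0 = v"
  by (induction l arbitrary: v ys) auto

lemma uses_Cons: "uses a b ys \<Longrightarrow> uses a b (x # ys)"
  unfolding uses_def by (metis Suc_less_eq length_Cons nth_Cons_Suc)

lemma uses_Cons_hd: "ys \<noteq> [] \<Longrightarrow> ys ! 0 = b \<Longrightarrow> uses a b (a # ys)"
  unfolding uses_def by (intro exI[of _ 0]) auto

lemma miss_bounds: "0 \<le> miss E a b t x" "miss E a b t x \<le> 1"
  by (auto simp: miss_def)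

text \<open>Condition on the first step. On the step from \<open>a\<close> to \<open>b\<close> the
  bound \<open>g u\<close> may be as small as 0, because that step settles the matter.\<close>

lemma miss_Suc_le:
  assumes "finite (nbs E x)" "nbs E x \<noteq> {}"
    and "\<And>u. u \<in> nbs E x \<Longrightarrow> 0 \<le> g u \<and> (x = a \<and> u = b \<or> miss E a b t u \<le> g u)"
  shows "miss E a b (Suc t) x \<le> (\<Sum>u\<in>nbs E x. g u) / real (card (nbs E x))"
proof -
  let ?p = "\<lambda>u. measure_pmf.prob (map_pmf (\<lambda>xs. x # xs) (random_walk E t u)) {ys. \<not> uses a b ys}"
  have "miss E a b (Suc t) x = (\<Sum>u\<in>nbs E x. ?p u) / real (card (nbs E x))"
    unfolding miss_def random_walk_Suc measure_bind_pmf_eq_expectation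
    using assms(1,2) by (simp add: integral_pmf_of_set)
  also have "\<dots> \<le> (\<Sum>u\<in>nbs E x. g u) / real (card (nbs E x))"
  proof (intro divide_right_mono sum_mono)
    fix u assume u: "u \<in> nbs E x"
    have p: "?p u = measure_pmf.prob (random_walk E t u) {ys. \<not> uses a b (x # ys)}"
      by (simp add: vimage_def)
    show "?p u \<le> g u"
    proof (cases "x = a \<and> u = b")
      case True
      have "?p u = 0" unfolding p measure_pmf_zero_iff
      proof -
        have "uses a b (x # ys)" if "ys \<in> set_pmf (random_walk E t u)" for ys
          using random_walk_hd[OF that] True uses_Cons_hd[of ys b a] by force
        then show "set_pmf (random_walk E t u) \<inter> {ys. \<not> uses a b (x # ys)} = {}" by auto
      qed
      then show ?thesis using assms(3)[OF u] by simp
    next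
      case False
      have "?p u \<le> miss E a b t u"
        unfolding p miss_def by (intro measure_pmf.finite_measure_mono) (auto intro: uses_Cons)
      then show ?thesis using assms(3)[OF u] False by force
    qed
  qed auto
  finally show ?thesis .
qed

text \<open>A cycle with pendant vertices, unrolled to the integers. The spine \<open>c\<close> may
  be periodic: only the neighbours of a single vertex have to differ, so all cycles of length at
  least 3 qualify.\<close>

locale comb_walk =
  fixes E :: "nat set set" and c pend :: "int \<Rightarrow> nat"
  assumes nbs_c: "\<And>i. nbs E (c i) = {c (i - 1), c (i + 1), pend i}"
    and distinct_nbs: "\<And>i. c (i - 1) \<noteq> c (i + 1)" "\<And>i j. pend i \<noteq> c j"
    and nbs_pend: "\<And>i. nbs E (pend i) = {c i}"
begin

lemma sum_nbs: "(\<Sum>u\<in>nbs E (c i). g u) = g (c (i - 1)) + g (c (i + 1)) + (g (pend i) :: real)"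
  "card (nbs E (c i)) = 3"
  using distinct_nbs(1)[of i] distinct_nbs(2)[of i "i - 1"] distinct_nbs(2)[of i "i + 1"]
  by (auto simp: nbs_c card_insert_if insert_commute)

lemma miss_pend: "miss E a b (Suc t) (pend i) \<le> miss E a b t (c i)"
  using miss_Suc_le[of E "pend i" "miss E a b t" a b t] miss_bounds by (simp add: nbs_pend)

text \<open>\<open>z\<close> bounds the contribution of the step towards the edge. At
  \<open>i = -1\<close> this step crosses the edge, and \<open>z\<close> may be 0.\<close>

lemma miss_c:
  assumes "i + 1 = 0 \<or> miss E (c (-1)) (c 0) t (c (i + 1)) \<le> z" "0 \<le> z"
  shows "3 * miss E (c (-1)) (c 0) (Suc t) (c i) \<le>
    miss E (c (-1)) (c 0) t (c (i - 1)) + z + miss E (c (-1)) (c 0) t (pend i)"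
proof -
  let ?m = "miss E (c (-1)) (c 0)"
  define g where "g u = (if u = c (i + 1) then z else ?m t u)" for u
  have "?m (Suc t) (c i) \<le> (\<Sum>u\<in>nbs E (c i). g u) / real (card (nbs E (c i)))"
  proof (rule miss_Suc_le)
    fix u assume "u \<in> nbs E (c i)"
    have "c i = c (-1) \<and> u = c 0" if "u = c (i + 1)" "i + 1 = 0"
    proof -
      have "i = -1" using that(2) by simp
      then show ?thesis using that(1) by simp
    qed
    then show "0 \<le> g u \<and> (c i = c (-1) \<and> u = c 0 \<or> ?m t u \<le> g u)"
      using assms miss_bounds by (auto simp: g_def)
  qed (auto simp: nbs_c)
  also have "\<dots> = (?m t (c (i - 1)) + z + ?m t (pend i)) / 3"
    unfolding sum_nbs using distinct_nbs(1)[of i] distinct_nbs(2)[of i "i + 1"] by (simp add: g_def)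
  finally show ?thesis by simp
qed

text \<open>The number of steps until the walk crosses the edge or reaches distance \<open>L\<close> has expectation
  at most \<open>2 y (L - y)\<close>, and it reaches distance \<open>L\<close> first with probability at most \<open>y / L\<close>.\<close>

lemma miss_potential:
  fixes L :: nat and y :: int
  defines "Phi \<equiv> \<lambda>y :: int. 2 * real_of_int y * (real L - real_of_int y)"
  assumes "1 \<le> y" "y \<le> int L"
  shows "real t * miss E (c (-1)) (c 0) t (c (- y)) \<le> real t * real_of_int y / real L + Phi y"
    and "real t * miss E (c (-1)) (c 0) t (pend (- y)) \<le> real t * real_of_int y / real L + Phi y + 1"
proof -
  let ?m = "miss E (c (-1)) (c 0)"
  \<comment> \<open>Markov's inequality multiplied by \<open>t\<close>: a miss means that the walk
    escapes to distance \<open>L\<close> first or needs more than \<open>t\<close> steps. A pendant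
    vertex costs one extra step, hence the \<open>+ 1\<close>.\<close>
  have "\<forall>y. 1 \<le> y \<and> y \<le> int L \<longrightarrow>
      real t * ?m t (c (- y)) \<le> real t * real_of_int y / real L + Phi y \<and>
      real t * ?m t (pend (- y)) \<le> real t * real_of_int y / real L + Phi y + 1"
  proof (induction t)
    case 0
    then show ?case by (simp add: Phi_def)
  next
    case (Suc t)
    show ?case
    proof (intro allI impI)
      fix y :: int assume y: "1 \<le> y \<and> y \<le> int L"
      then have L: "0 < L" by simp
      have IH1: "real t * ?m t (c (- z)) \<le> real t * real_of_int z / real L + Phi z"
        and IH2: "real t * ?m t (pend (- z)) \<le> real t * real_of_int z / real L + Phi z + 1"
        if "1 \<le> z" "z \<le> int L" for z using Suc.IH that by auto
      have yL: "0 \<le> real_of_int y / real L" "real_of_int y \<le> real L" using y by auto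
      have b: "?m (Suc t) (c (- y)) \<le> 1" "?m t (c (- y)) \<le> 1" by (rule miss_bounds)+
      show "real (Suc t) * ?m (Suc t) (c (- y)) \<le> real (Suc t) * real_of_int y / real L + Phi y \<and>
        real (Suc t) * ?m (Suc t) (pend (- y)) \<le> real (Suc t) * real_of_int y / real L + Phi y + 1"
      proof
        have "real (Suc t) * ?m (Suc t) (pend (- y)) \<le> real (Suc t) * ?m t (c (- y))"
          by (intro mult_left_mono miss_pend) auto
        also have "\<dots> \<le> real t * ?m t (c (- y)) + 1" using b by (simp add: algebra_simps)
        also have "\<dots> \<le> real t * real_of_int y / real L + Phi y + 1" using IH1[of y] y by simp
        also have "\<dots> \<le> real (Suc t) * real_of_int y / real L + Phi y + 1"
          using yL(1) by (simp add: add_divide_distrib distrib_right)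
        finally show "real (Suc t) * ?m (Suc t) (pend (- y)) \<le> real (Suc t) * real_of_int y / real L + Phi y + 1" .
        show "real (Suc t) * ?m (Suc t) (c (- y)) \<le> real (Suc t) * real_of_int y / real L + Phi y"
        proof (cases "y = int L")
          \<comment> \<open>At distance \<open>L\<close> the right-hand side is the full number of
            steps, so the bound is trivial.\<close>
          case True
          have "real (Suc t) * ?m (Suc t) (c (- y)) \<le> real (Suc t) * 1"
            using b by (intro mult_left_mono) auto
          then show ?thesis using True L by (simp add: Phi_def)
        next
          case False
          define z where "z = (if y = 1 then 0 else ?m t (c (- y + 1)))"
          have z: "real t * z \<le> real t * real_of_int (y - 1) / real L + Phi (y - 1)"
            using IH1[of "y - 1"] y by (auto simp: z_def Phi_def)
          have "3 * ?m (Suc t) (c (- y)) \<le> ?m t (c (- y - 1)) + z + ?m t (pend (- y))"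
            by (rule miss_c) (auto simp: z_def miss_bounds)
          then have "real t * (3 * ?m (Suc t) (c (- y))) \<le>
             real t * (?m t (c (- y - 1)) + z + ?m t (pend (- y)))" by (intro mult_left_mono) auto
          moreover have "real t * ?m t (c (- y - 1)) \<le> real t * real_of_int (y + 1) / real L + Phi (y + 1)"
            using IH1[of "y + 1"] y False by simp
          moreover note IH2[of y] z
          ultimately have "real t * (3 * ?m (Suc t) (c (- y))) \<le>
              real t * real_of_int (y + 1) / real L + Phi (y + 1) +
              (real t * real_of_int (y - 1) / real L + Phi (y - 1)) +
              (real t * real_of_int y / real L + Phi y + 1)"
            using y by (simp only: distrib_left, linarith)
          \<comment> \<open>The second difference of \<open>Phi\<close> is -4 and the pendant term
            returns 1, so the average over the three neighbours is \<open>Phi y - 1\<close>: each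
            step pays for itself.\<close>
          also have "\<dots> = 3 * (real t * real_of_int y / real L + Phi y) - 3"
            using L by (simp add: Phi_def field_simps)
          finally have "real t * ?m (Suc t) (c (- y)) \<le> real t * real_of_int y / real L + Phi y - 1" by simp
          then have "real (Suc t) * ?m (Suc t) (c (- y)) \<le> real t * real_of_int y / real L + Phi y"
            using b by (simp add: algebra_simps)
          also have "\<dots> \<le> real (Suc t) * real_of_int y / real L + Phi y"
            using yL(1) by (simp add: add_divide_distrib distrib_right)
          finally show ?thesis .
        qed
      qed
    qed
  qed
  then show "real t * ?m t (c (- y)) \<le> real t * real_of_int y / real L + Phi y"
    "real t * ?m t (pend (- y)) \<le> real t * real_of_int y / real L + Phi y + 1"
    using assms by auto
qed

lemma miss_le:
  assumes "1 \<le> y" "y \<le> R" "R \<le> L" "0 < l"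
  shows "miss E (c (-1)) (c 0) l (c (- int y)) \<le> real R / L + 2 * real R * L / l"
proof -
  have "real l * miss E (c (-1)) (c 0) l (c (- int y)) \<le> real l * real y / L + 2 * real y * (real L - real y)"
    using miss_potential(1)[of "int y" L l] assms by simp
  also have "\<dots> \<le> real l * (real R / L + 2 * real R * L / l)"
  proof -
    have "real l * real y / L \<le> real l * real R / L" using assms by (intro divide_right_mono mult_left_mono) auto
    moreover have "2 * real y * (real L - real y) \<le> 2 * real R * real L"
      using assms by (intro mult_mono) auto
    moreover have "real l * (real R / L + 2 * real R * L / l) = real l * real R / L + 2 * real R * real L"
      using assms(4) by (simp add: distrib_left)
    ultimately show ?thesis by linarith
  qed
  finally show ?thesis using assms(4) by simp
qed

end

subsection \<open>Many independent walks\<close>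

definition covers :: "nat list list \<Rightarrow> nat \<Rightarrow> nat \<Rightarrow> (nat \<times> nat \<Rightarrow> nat list) \<Rightarrow> bool" where
  "covers css k R W \<longleftrightarrow> (\<forall>xs\<in>set css. \<forall>a m. - int R \<le> m \<and> m < int R \<longrightarrow>
     (\<exists>j<k. \<exists>x y. {x, y} = {cyc_nth xs (a + m), cyc_nth xs (a + m + 1)} \<and> uses x y (W (cyc_nth xs a, j))))"

lemma prob_independent_walks_all_miss:
  assumes "v < n"
  shows "measure_pmf.prob (independent_walks n E k l) {W. \<forall>j<k. \<not> uses x y (W (v, j))} = miss E x y l v ^ k"
proof -
  define B where "B = (\<lambda>(u, j :: nat). if u = v then {ys. \<not> uses x y ys} else UNIV)"
  have "measure_pmf.prob (independent_walks n E k l) {W. \<forall>j<k. \<not> uses x y (W (v, j))} =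
    measure_pmf.prob (independent_walks n E k l) (Pi ({..<n} \<times> {..<k}) B)"
    using assms by (intro arg_cong[where f="measure _"]) (auto simp: Pi_def B_def)
  also have "\<dots> = (\<Prod>z\<in>{..<n} \<times> {..<k}. measure_pmf.prob (case z of (u, j) \<Rightarrow> random_walk E l u) (B z))"
    unfolding independent_walks_def by (rule measure_Pi_pmf_Pi) auto
  also have "\<dots> = (\<Prod>u<n. \<Prod>j<k. if u = v then miss E x y l v else 1)"
    by (subst prod.cartesian_product) (auto intro!: prod.cong simp: B_def miss_def)
  also have "\<dots> = (\<Prod>u<n. if u = v then miss E x y l v ^ k else 1)"
    by (intro prod.cong) auto
  also have "\<dots> = miss E x y l v ^ k"
    using assms by (simp add: prod.delta)
  finally show ?thesis .
qed

text \<open>Union bound over at most \<open>n\<close> vertices with \<open>2 * R\<close> edges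
  around each; by independence an edge is missed by all \<open>k\<close> walks with probability at
  most \<open>e ^ k\<close>.\<close>

lemma prob_covers:
  fixes n k l R L q :: nat and e :: real
  assumes good: "good_cycles css" and verts: "cycles_verts css \<subseteq> {..<n}"
    and pend: "\<And>v. v \<in> cycles_verts css \<Longrightarrow> nbs E v = nbs (cycles_edges css) v \<union> {v + q} \<and> nbs E (v + q) = {v}"
    and q: "\<And>u v. u \<in> cycles_verts css \<Longrightarrow> u + q \<notin> cycles_verts css"
    and R: "R \<le> L" "0 < l" and eps: "real R / L + 2 * real R * L / l \<le> e"
  shows "measure_pmf.prob (independent_walks n E k l) {W. \<not> covers css k R W} \<le> real n * (2 * real R) * e ^ k"
proof -
  \<comment> \<open>One position per vertex is fixed, so that the union runs over vertices rather
    than over infinitely many integer positions.\<close>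
  define rep where "rep v = (SOME p. fst p \<in> set css \<and> v = cyc_nth (fst p) (snd p))" for v
  have rep: "fst (rep v) \<in> set css \<and> v = cyc_nth (fst (rep v)) (snd (rep v))" if v: "v \<in> cycles_verts css" for v
  proof -
    have "\<exists>p. fst p \<in> set css \<and> v = cyc_nth (fst p) (snd p)"
      using cycles_vertsE[OF v] by (metis fst_conv snd_conv)
    then show ?thesis unfolding rep_def by (rule someI_ex)
  qed
  \<comment> \<open>The edge is oriented away from \<open>v\<close>, because only outward crossings
    were estimated; for \<open>m < 0\<close> the reversed comb is used.\<close>
  define X where "X v m = (let c = cyc_nth (fst (rep v)); a = snd (rep v) in
     if m \<ge> 0 then (c (a + m), c (a + m + 1)) else (c (a + m + 1), c (a + m)))" for v m
  define Bad where "Bad = (\<lambda>(v, m). {W. \<forall>j<k. \<not> uses (fst (X v m)) (snd (X v m)) (W (v, j))})"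
  let ?I = "cycles_verts css \<times> {- int R..<int R}"
  let ?P = "independent_walks n E k l"
  have e0: "0 \<le> e" using eps by (rule order_trans[rotated]) auto
  have single: "measure_pmf.prob ?P (Bad (v, m)) \<le> e ^ k" if "v \<in> cycles_verts css" "- int R \<le> m" "m < int R" for v m
  proof -
    define xs where "xs = fst (rep v)"
    define a where "a = snd (rep v)"
    have xs: "xs \<in> set css" "v = cyc_nth xs a" using rep[OF that(1)] by (auto simp: xs_def a_def)
    have Xv: "X v m = (if m \<ge> 0 then (cyc_nth xs (a + m), cyc_nth xs (a + m + 1))
        else (cyc_nth xs (a + m + 1), cyc_nth xs (a + m)))"
      by (simp add: X_def xs_def a_def Let_def)
    note D = good_cyclesD[OF good xs(1)]
    have in_v: "cyc_nth xs i \<in> cycles_verts css" for i using cyc_nth_in_verts[OF good xs(1)] .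
    have comb: "comb_walk E (\<lambda>i. cyc_nth xs (b + i)) (\<lambda>i. cyc_nth xs (b + i) + q)" for b
    proof
      fix i j
      show "nbs E (cyc_nth xs (b + i)) = {cyc_nth xs (b + (i - 1)), cyc_nth xs (b + (i + 1)), cyc_nth xs (b + i) + q}"
        using pend[OF in_v] nbs_cycles_edges[OF good xs(1), of "b + i"] by (auto simp: algebra_simps)
      show "cyc_nth xs (b + (i - 1)) \<noteq> cyc_nth xs (b + (i + 1))"
        using cyc_nth_neq(2)[OF D(1,3), of "b + i"] by (simp add: algebra_simps)
      show "cyc_nth xs (b + i) + q \<noteq> cyc_nth xs (b + j)" using q in_v by metis
      show "nbs E (cyc_nth xs (b + i) + q) = {cyc_nth xs (b + i)}" using pend[OF in_v] by blast
    qed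
    have comb': "comb_walk E (\<lambda>i. cyc_nth xs (b - i)) (\<lambda>i. cyc_nth xs (b - i) + q)" for b
    proof
      fix i j
      show "nbs E (cyc_nth xs (b - i)) = {cyc_nth xs (b - (i - 1)), cyc_nth xs (b - (i + 1)), cyc_nth xs (b - i) + q}"
        using pend[OF in_v] nbs_cycles_edges[OF good xs(1), of "b - i"] by (auto simp: algebra_simps)
      show "cyc_nth xs (b - (i - 1)) \<noteq> cyc_nth xs (b - (i + 1))"
        using cyc_nth_neq(2)[OF D(1,3), of "b - i"] by (simp add: algebra_simps)
      show "cyc_nth xs (b - i) + q \<noteq> cyc_nth xs (b - j)" using q in_v by metis
      show "nbs E (cyc_nth xs (b - i) + q) = {cyc_nth xs (b - i)}" using pend[OF in_v] by blast
    qed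
    have "miss E (fst (X v m)) (snd (X v m)) l v \<le> real R / L + 2 * real R * L / l"
    proof (cases "m \<ge> 0")
      case True
      have "miss E (cyc_nth xs (a + m + 1 + - 1)) (cyc_nth xs (a + m + 1 + 0)) l
          (cyc_nth xs (a + m + 1 + - int (nat (m + 1)))) \<le> real R / L + 2 * real R * L / l"
        by (rule comb_walk.miss_le[OF comb]) (use True that R in auto)
      then show ?thesis using True by (simp add: Xv xs(2)[symmetric])
    next
      case False
      have "miss E (cyc_nth xs (a + m - - 1)) (cyc_nth xs (a + m - 0)) l
          (cyc_nth xs (a + m - - int (nat (- m)))) \<le> real R / L + 2 * real R * L / l"
        by (rule comb_walk.miss_le[OF comb']) (use False that R in auto)
      then show ?thesis using False by (simp add: Xv xs(2)[symmetric])
    qed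
    then have "miss E (fst (X v m)) (snd (X v m)) l v ^ k \<le> e ^ k"
      using eps by (intro power_mono miss_bounds) auto
    moreover have "v < n" using that(1) verts by auto
    ultimately show ?thesis by (simp add: Bad_def prob_independent_walks_all_miss)
  qed
  have "{W. \<not> covers css k R W} \<subseteq> (\<Union>i\<in>?I. Bad i)"
  proof
    fix W assume "W \<in> {W. \<not> covers css k R W}"
    then obtain xs a m where xs: "xs \<in> set css" and m: "- int R \<le> m" "m < int R"
      and no: "\<And>j x y. j < k \<Longrightarrow> {x, y} = {cyc_nth xs (a + m), cyc_nth xs (a + m + 1)} \<Longrightarrow> \<not> uses x y (W (cyc_nth xs a, j))"
      unfolding covers_def mem_Collect_eq by blast
    define v where "v = cyc_nth xs a"
    have v: "v \<in> cycles_verts css" unfolding v_def by (rule cyc_nth_in_verts[OF good xs])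
    have r: "fst (rep v) = xs" "cyc_nth xs (snd (rep v)) = cyc_nth xs a"
    proof -
      show "fst (rep v) = xs" using rep[OF v] good_cycles_unique[OF good] xs unfolding v_def by metis
      then show "cyc_nth xs (snd (rep v)) = cyc_nth xs a" using rep[OF v] by (metis v_def)
    qed
    have eq: "cyc_nth xs (snd (rep v) + d) = cyc_nth xs (a + d)" for d
      by (rule cyc_nth_cong_add[OF good_cyclesD(1,2)[OF good xs] r(2)])
    have "{fst (X v m), snd (X v m)} = {cyc_nth xs (a + m), cyc_nth xs (a + m + 1)}"
      using eq[of m] eq[of "m + 1"] by (auto simp: X_def r(1) Let_def add.assoc)
    then have "W \<in> Bad (v, m)" using no by (auto simp: Bad_def v_def)
    then show "W \<in> (\<Union>i\<in>?I. Bad i)" using v m by (intro UN_I[of "(v, m)"]) auto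
  qed
  then have "measure_pmf.prob ?P {W. \<not> covers css k R W} \<le> measure_pmf.prob ?P (\<Union>i\<in>?I. Bad i)"
    by (intro measure_pmf.finite_measure_mono) auto
  also have "\<dots> \<le> (\<Sum>i\<in>?I. measure_pmf.prob ?P (Bad i))"
    by (intro measure_pmf.finite_measure_subadditive_finite) auto
  also have "\<dots> \<le> (\<Sum>i\<in>?I. e ^ k)"
    by (intro sum_mono) (use single in \<open>auto simp del: set_concat\<close>)
  also have "\<dots> = real (card (cycles_verts css)) * (2 * real R) * e ^ k"
    by (simp add: card_cartesian_product)
  also have "\<dots> \<le> real n * (2 * real R) * e ^ k"
    using card_mono[OF _ verts] e0 by (intro mult_right_mono) auto
  finally show ?thesis .
qed

lemma random_walk_edges:
  assumes "\<And>v. v < n \<Longrightarrow> finite (nbs E v) \<and> nbs E v \<noteq> {} \<and> nbs E v \<subseteq> {..<n}"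
    and "v < n" "ys \<in> set_pmf (random_walk E l v)" "Suc t < length ys"
  shows "{ys ! t, ys ! Suc t} \<in> E"
  using assms(2-)
proof (induction l arbitrary: v ys t)
  case (Suc l)
  have nb: "finite (nbs E v)" "nbs E v \<noteq> {}" "nbs E v \<subseteq> {..<n}" using assms(1) Suc.prems(1) by auto
  have "ys \<in> (\<Union>u\<in>nbs E v. (#) v ` set_pmf (random_walk E l u))"
    using Suc.prems(2) nb(1,2) unfolding random_walk_Suc by simp
  then obtain u zs where u: "u \<in> nbs E v" "zs \<in> set_pmf (random_walk E l u)" "ys = v # zs"
    by blast
  show ?case
  proof (cases t)
    case 0
    then show ?thesis using u random_walk_hd[OF u(2)] by (simp add: nbs_def)
  next
    case (Suc t')
    then show ?thesis using Suc.IH[of u zs t'] u nb(3) Suc.prems(3) by auto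
  qed
qed auto

lemma independent_walks_support:
  assumes "\<And>v. v < n \<Longrightarrow> finite (nbs E v) \<and> nbs E v \<noteq> {} \<and> nbs E v \<subseteq> {..<n}"
    and "W \<in> set_pmf (independent_walks n E k l)" "v < n" "j < k"
  shows "length (W (v, j)) = Suc l"
    and "\<And>t. t < l \<Longrightarrow> {W (v, j) ! t, W (v, j) ! Suc t} \<in> E"
proof -
  have "W (v, j) \<in> set_pmf (random_walk E l v)"
    using assms(2-) set_Pi_pmf_subset'[of "{..<n} \<times> {..<k}"]
    unfolding independent_walks_def by (force simp: PiE_dflt_def)
  then show "length (W (v, j)) = Suc l" "\<And>t. t < l \<Longrightarrow> {W (v, j) ! t, W (v, j) ! Suc t} \<in> E"
    using random_walk_hd[of "W (v, j)" E l v] random_walk_edges[OF assms(1), where v=v] assms(3)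
    by auto
qed

section \<open>A small family of balanced hash functions\<close>

lemma card_mod_class_le:
  fixes f p q c :: nat
  assumes "0 < f" "q \<le> p"
  shows "card {z. z < f ^ p \<and> z mod f ^ q = c} \<le> f ^ (p - q)"
proof -
  have "inj_on (\<lambda>z. z div f ^ q) {z. z < f ^ p \<and> z mod f ^ q = c}"
  proof (rule inj_onI)
    fix x y assume "x \<in> {z. z < f ^ p \<and> z mod f ^ q = c}" "y \<in> {z. z < f ^ p \<and> z mod f ^ q = c}"
      and "x div f ^ q = y div f ^ q"
    then show "x = y" using div_mult_mod_eq[of x "f ^ q"] div_mult_mod_eq[of y "f ^ q"] by simp
  qed
  moreover have "(\<lambda>z. z div f ^ q) ` {z. z < f ^ p \<and> z mod f ^ q = c} \<subseteq> {..<f ^ (p - q)}"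
    using assms by (auto simp: div_less_iff_less_mult simp flip: power_add)
  ultimately have "card {z. z < f ^ p \<and> z mod f ^ q = c} \<le> card {..<f ^ (p - q)}"
    by (rule card_inj_on_le) auto
  then show ?thesis by simp
qed

text \<open>Counting form of an exponential moment bound. A function has weight 2 to the number of
  hits; the total weight factorizes over the arguments, and each factor belonging to
  \<open>Y\<close> grows by at most \<open>1 + 1 / f ^ q\<close>.\<close>

lemma card_skewed_functions_le:
  fixes f p q c t :: nat
  assumes "finite C" "Y \<subseteq> C" "0 < f" "q \<le> p"
  shows "real (card {g \<in> C \<rightarrow>\<^sub>E {..<f ^ p}. t \<le> card {y \<in> Y. g y mod f ^ q = c}}) * 2 ^ t
    \<le> real (card (C \<rightarrow>\<^sub>E {..<f ^ p})) * (1 + 1 / f ^ q) ^ card Y"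
proof -
  let ?\<Omega> = "C \<rightarrow>\<^sub>E {..<f ^ p}"
  let ?B = "{g \<in> ?\<Omega>. t \<le> card {y \<in> Y. g y mod f ^ q = c}}"
  define w :: "'a \<Rightarrow> nat \<Rightarrow> real" where "w y z = (if y \<in> Y \<and> z mod f ^ q = c then 2 else 1)" for y z
  have finY: "finite Y" using assms finite_subset by blast
  have fin: "finite ?\<Omega>" using assms(1) by (intro finite_PiE) auto
  have W: "(\<Prod>y\<in>C. w y (g y)) = 2 ^ card {y \<in> Y. g y mod f ^ q = c}" for g
  proof -
    have "(\<Prod>y\<in>C. w y (g y)) = (\<Prod>y\<in>{y \<in> Y. g y mod f ^ q = c}. w y (g y))"
      using assms(1,2) by (intro prod.mono_neutral_right) (auto simp: w_def)
    also have "\<dots> = 2 ^ card {y \<in> Y. g y mod f ^ q = c}" by (simp add: w_def)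
    finally show ?thesis .
  qed
  have "real (card ?B) * 2 ^ t = (\<Sum>g\<in>?B. 2 ^ t)" by simp
  also have "\<dots> \<le> (\<Sum>g\<in>?B. \<Prod>y\<in>C. w y (g y))"
    unfolding W by (intro sum_mono power_increasing) auto
  also have "\<dots> \<le> (\<Sum>g\<in>?\<Omega>. \<Prod>y\<in>C. w y (g y))"
    using fin by (intro sum_mono2) (auto intro!: prod_nonneg simp: w_def)
  also have "\<dots> = (\<Prod>y\<in>C. \<Sum>z<f ^ p. w y z)"
    using assms(1) by (subst prod_sum_PiE) auto
  also have "\<dots> \<le> (\<Prod>y\<in>C. if y \<in> Y then real (f ^ p) * (1 + 1 / f ^ q) else real (f ^ p))"
  proof (intro prod_mono conjI)
    fix y assume "y \<in> C"
    show "0 \<le> (\<Sum>z<f ^ p. w y z)" by (intro sum_nonneg) (auto simp: w_def)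
    show "(\<Sum>z<f ^ p. w y z) \<le> (if y \<in> Y then real (f ^ p) * (1 + 1 / f ^ q) else real (f ^ p))"
    proof (cases "y \<in> Y")
      case True
      have "(\<Sum>z<f ^ p. w y z) = (\<Sum>z<f ^ p. 1 + (if z mod f ^ q = c then 1 else 0))"
        using True by (intro sum.cong) (auto simp: w_def)
      also have "\<dots> = real (f ^ p) + real (card {z. z < f ^ p \<and> z mod f ^ q = c})"
        by (simp add: sum.distrib sum.If_cases Int_def)
      also have "\<dots> \<le> real (f ^ p) + real (f ^ (p - q))"
        using card_mod_class_le[OF assms(3,4)] by (intro add_mono) (auto simp only: of_nat_le_iff)
      also have "real (f ^ (p - q)) = real (f ^ p) / real (f ^ q)"
        unfolding of_nat_power using assms(3,4) by (subst power_diff) auto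
      finally show ?thesis using True by (simp add: distrib_left)
    qed (simp add: w_def)
  qed
  also have "\<dots> = (\<Prod>y\<in>C. real (f ^ p)) * (\<Prod>y\<in>C. if y \<in> Y then 1 + 1 / real f ^ q else 1)"
    by (subst prod.distrib[symmetric]) (intro prod.cong, auto)
  also have "\<dots> = real (card ?\<Omega>) * (1 + 1 / f ^ q) ^ card Y"
  proof (rule arg_cong2[where f="(*)"])
    show "(\<Prod>y\<in>C. if y \<in> Y then 1 + 1 / real f ^ q else 1) = (1 + 1 / f ^ q) ^ card Y"
      using assms(1,2) by (subst prod.If_cases) (auto simp: Int_absorb1)
    show "(\<Prod>y\<in>C. real (f ^ p)) = real (card ?\<Omega>)"
      using assms(1) by (simp add: card_PiE)
  qed
  finally show ?thesis .
qed

text \<open>A seed of logarithmic length suffices: with \<open>S\<close> independent random functions, the probability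
  that \<open>2 n\<close> of them are unbalanced on a given set beats the number of sets.\<close>

theorem hash_family_exists:
  fixes n f p S T0 :: nat
  assumes f: "0 < f" and n: "0 < n"
    and size: "2 ^ n * (p + 1) * f ^ p * (n + 1) * S ^ (2 * n) < (2 :: nat) ^ (4 * n * T0)"
  shows "\<exists>H :: nat \<Rightarrow> nat \<Rightarrow> nat. (\<forall>s v. H s v < f ^ p) \<and>
    (\<forall>X q c T. X \<subseteq> {..<n} \<longrightarrow> q \<le> p \<longrightarrow> card X \<le> f ^ q * T \<longrightarrow> T0 \<le> T \<longrightarrow>
       card {s. s < S \<and> 4 * T < card {v \<in> X. H s v mod f ^ q = c}} \<le> 2 * n)"
proof -
  let ?C = "{..<S} \<times> {..<n}"
  let ?\<Omega> = "?C \<rightarrow>\<^sub>E {..<f ^ p}"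
  \<comment> \<open>An index is a way to fail: a set, a number of digits, a class, a threshold, and
    \<open>2 * n\<close> seeds that are all unbalanced. Thresholds above \<open>n\<close> need no
    entry, which keeps the family finite.\<close>
  define Ix where "Ix = {(X, q, c, T, J). X \<subseteq> {..<n} \<and> q \<le> p \<and> c < f ^ p \<and> T \<le> n \<and> T0 \<le> T \<and>
     card X \<le> f ^ q * T \<and> J \<subseteq> {..<S} \<and> card J = 2 * n}"
  \<comment> \<open>The hits of all seeds in \<open>J\<close> are added up, so that the moment bound
    is applied once to \<open>J \<times> X\<close> and gains from the independence of the
    seeds.\<close>
  define Bad where "Bad = (\<lambda>(X, q, c, T, J). {g \<in> ?\<Omega>. 4 * T * (2 * n) \<le> card {y \<in> J \<times> X. g y mod f ^ q = c}})"
  have finO: "finite ?\<Omega>" by (intro finite_PiE) auto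
  have sub: "Ix \<subseteq> Pow {..<n} \<times> {..p} \<times> {..<f ^ p} \<times> {..n} \<times> {J. J \<subseteq> {..<S} \<and> card J = 2 * n}"
    by (auto simp: Ix_def)
  have finI: "finite Ix"
    by (rule finite_subset[OF sub]) auto
  have "card {J. J \<subseteq> {..<S} \<and> card J = 2 * n} = S choose (2 * n)"
    by (simp add: n_subsets)
  also have "\<dots> \<le> S ^ (2 * n)"
    by (cases "2 * n \<le> S") (auto simp: binomial_le_pow binomial_eq_0)
  finally have cJ: "card {J. J \<subseteq> {..<S} \<and> card J = 2 * n} \<le> S ^ (2 * n)" .
  have "card Ix \<le> card (Pow {..<n} \<times> {..p} \<times> {..<f ^ p} \<times> {..n} \<times> {J. J \<subseteq> {..<S} \<and> card J = 2 * n})"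
    by (rule card_mono[OF _ sub]) auto
  also have "\<dots> \<le> 2 ^ n * ((p + 1) * (f ^ p * ((n + 1) * S ^ (2 * n))))"
    unfolding card_cartesian_product using cJ by (intro mult_le_mono) (auto simp: card_Pow)
  finally have cI: "card Ix < 2 ^ (4 * n * T0)"
    using size unfolding mult.assoc by (rule order_le_less_trans)
  have bad: "real (card (Bad i)) * 2 ^ (4 * n * T0) \<le> real (card ?\<Omega>)" if "i \<in> Ix" for i
  proof -
    obtain X q c T J where i: "i = (X, q, c, T, J)" by (metis surj_pair)
    have I: "X \<subseteq> {..<n}" "q \<le> p" "T0 \<le> T" "card X \<le> f ^ q * T" "J \<subseteq> {..<S}" "card J = 2 * n"
      using that by (auto simp: i Ix_def)
    let ?e = "real (card (J \<times> X)) / real f ^ q"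
    have "real (card X) \<le> real (f ^ q * T)" using I(4) by (simp only: of_nat_le_iff)
    then have "real (card X) / real f ^ q \<le> real T"
      using f by (simp add: field_simps)
    then have "2 * real n * (real (card X) / real f ^ q) \<le> 2 * real n * real T"
      by (intro mult_left_mono) auto
    then have e: "?e \<le> 2 * real n * real T"
      by (simp add: card_cartesian_product I(6))
    have "(1 + 1 / real (f ^ q)) ^ card (J \<times> X) \<le> exp (1 / real f ^ q) ^ card (J \<times> X)"
      by (intro power_mono) (auto intro: order_trans[OF _ exp_ge_add_one_self])
    also have "\<dots> = exp ?e" by (simp flip: exp_of_nat_mult)
    also have "\<dots> \<le> exp (2 * real n * real T)" using e by simp
    also have "\<dots> = exp 1 ^ (2 * n * T)" by (simp flip: exp_of_nat_mult)
    \<comment> \<open>The threshold contributes the exponent \<open>8 * n * T\<close> and the moment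
      costs \<open>4 * n * T\<close>; at least \<open>4 * n * T0\<close> is left to outweigh the
      number of indices.\<close>
    also have "\<dots> \<le> (4 :: real) ^ (2 * n * T)"
      using exp_le by (intro power_mono) auto
    also have "\<dots> = (2 ^ 2) ^ (2 * n * T)" by simp
    also have "\<dots> = 2 ^ (4 * n * T)" by (subst power_mult[symmetric]) (simp add: mult.assoc)
    finally have pow: "(1 + 1 / real (f ^ q)) ^ card (J \<times> X) \<le> 2 ^ (4 * n * T)" .
    have "real (card (Bad i)) * 2 ^ (4 * T * (2 * n)) \<le> real (card ?\<Omega>) * (1 + 1 / real (f ^ q)) ^ card (J \<times> X)"
      unfolding i Bad_def prod.case using I f by (intro card_skewed_functions_le) auto
    also have "\<dots> \<le> real (card ?\<Omega>) * 2 ^ (4 * n * T)"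
      using pow by (intro mult_left_mono) auto
    finally have "real (card (Bad i)) * 2 ^ (4 * T * (2 * n)) \<le> real (card ?\<Omega>) * 2 ^ (4 * n * T)" .
    moreover have "(2 :: real) ^ (4 * T * (2 * n)) = 2 ^ (4 * n * T) * 2 ^ (4 * n * T)"
      by (simp flip: power_add)
    ultimately have "real (card (Bad i)) * 2 ^ (4 * n * T) \<le> real (card ?\<Omega>)"
      by simp
    moreover have "real (card (Bad i)) * 2 ^ (4 * n * T0) \<le> real (card (Bad i)) * 2 ^ (4 * n * T)"
      using I(3) by (intro mult_left_mono power_increasing) auto
    ultimately show ?thesis by linarith
  qed
  have "real (card (\<Union>i\<in>Ix. Bad i)) * 2 ^ (4 * n * T0) \<le> (\<Sum>i\<in>Ix. real (card (Bad i))) * 2 ^ (4 * n * T0)"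
    using card_UN_le[OF finI, of Bad] by (intro mult_right_mono) (auto simp flip: of_nat_sum)
  also have "\<dots> \<le> (\<Sum>i\<in>Ix. real (card ?\<Omega>))"
    unfolding sum_distrib_right by (intro sum_mono bad)
  also have "\<dots> = real (card Ix) * real (card ?\<Omega>)" by simp
  also have "\<dots> < 2 ^ (4 * n * T0) * real (card ?\<Omega>)"
  proof (rule mult_strict_right_mono)
    have "real (card Ix) < real (2 ^ (4 * n * T0))" using cI by (simp only: of_nat_less_iff)
    then show "real (card Ix) < 2 ^ (4 * n * T0)" by simp
    show "0 < real (card ?\<Omega>)" using f by (simp add: card_PiE)
  qed
  finally have "card (\<Union>i\<in>Ix. Bad i) < card ?\<Omega>" by (simp add: mult.commute)
  then have "\<not> ?\<Omega> \<subseteq> (\<Union>i\<in>Ix. Bad i)"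
    using card_mono[of "\<Union>i\<in>Ix. Bad i" ?\<Omega>] finI finO by (auto simp: Bad_def intro: finite_subset[OF _ finO])
  then obtain g where g: "g \<in> ?\<Omega>" "\<And>i. i \<in> Ix \<Longrightarrow> g \<notin> Bad i" by blast
  define H where "H s v = (if s < S \<and> v < n then g (s, v) else 0)" for s v
  have Hlt: "H s v < f ^ p" for s v
    using g(1) f by (auto simp: H_def PiE_def Pi_def)
  have "card {s. s < S \<and> 4 * T < card {v \<in> X. H s v mod f ^ q = c}} \<le> 2 * n"
    if X: "X \<subseteq> {..<n}" "q \<le> p" "card X \<le> f ^ q * T" "T0 \<le> T" for X q c T
  proof (rule ccontr)
    let ?Z = "{s. s < S \<and> 4 * T < card {v \<in> X. H s v mod f ^ q = c}}"
    assume "\<not> card ?Z \<le> 2 * n"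
    then obtain J where J: "J \<subseteq> ?Z" "card J = 2 * n"
      using obtain_subset_with_card_n[of "2 * n" ?Z] by (auto simp: not_le)
    \<comment> \<open>A single overloaded seed shows \<open>4 * T < card X \<le> n\<close> and that
      the class is attained, so this failure occurs among the indices.\<close>
    then obtain s0 where s0: "s0 \<in> ?Z" using n by (cases "J = {}") auto
    have finX: "finite X" using X(1) finite_subset by blast
    have "4 * T < card X"
      using s0 card_mono[OF finX, of "{v \<in> X. H s0 v mod f ^ q = c}"] by force
    moreover have "card X \<le> n" using card_mono[OF _ X(1)] by simp
    ultimately have T: "T \<le> n" by simp
    have "{v \<in> X. H s0 v mod f ^ q = c} \<noteq> {}" using s0 by force
    then obtain v where "H s0 v mod f ^ q = c" by blast
    then have c: "c < f ^ p" using Hlt[of s0 v] by (metis mod_less_eq_dividend order_le_less_trans)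
    have JS: "J \<subseteq> {..<S}" using J by auto
    have "(X, q, c, T, J) \<in> Ix" using X T c J JS by (auto simp: Ix_def)
    then have "card {y \<in> J \<times> X. g y mod f ^ q = c} < 4 * T * (2 * n)"
      using g by (force simp: Bad_def)
    moreover have "card {y \<in> J \<times> X. g y mod f ^ q = c} = (\<Sum>s\<in>J. card {v \<in> X. H s v mod f ^ q = c})"
    proof -
      have "{y \<in> J \<times> X. g y mod f ^ q = c} = (SIGMA s:J. {v \<in> X. H s v mod f ^ q = c})"
        using X(1) JS by (auto simp: H_def subset_iff)
      moreover have "finite J" using JS finite_subset by blast
      ultimately show ?thesis using finX by simp
    qed
    moreover have "(\<Sum>s\<in>J. card {v \<in> X. H s v mod f ^ q = c}) \<ge> (\<Sum>s\<in>J. 4 * T)"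
      using J(1) by (intro sum_mono) auto
    ultimately show False using J(2) by (simp add: mult.commute)
  qed
  then show ?thesis using Hlt by blast
qed

section \<open>Communication phases\<close>

declare set_concat [simp del]

lemma card_Sigma_le:
  assumes "finite A" "\<And>a. a \<in> A \<Longrightarrow> finite (B a) \<and> card (B a) \<le> b"
  shows "card (Sigma A B) \<le> card A * b"
proof -
  have "card (Sigma A B) = (\<Sum>a\<in>A. card (B a))"
    using assms by (intro card_SigmaI) auto
  also have "\<dots> \<le> card A * b" using assms(2) by (intro sum_bounded_above[THEN order_trans]) auto
  finally show ?thesis .
qed

lemma card_mod_le:
  assumes "0 < m" "V \<subseteq> {..<n}"
  shows "card {v \<in> V. v mod m = i} \<le> n div m + 1" (is "card ?A \<le> _")
proof -
  have "inj_on (\<lambda>v. v div m) ?A"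
  proof (rule inj_onI)
    fix x y assume "x \<in> ?A" "y \<in> ?A" "x div m = y div m"
    then show "x = y" using div_mult_mod_eq[of x m] div_mult_mod_eq[of y m] by simp
  qed
  moreover have "(\<lambda>v. v div m) ` ?A \<subseteq> {..n div m}"
    using assms(2) by (auto intro!: div_le_mono)
  ultimately have "card ?A \<le> card {..n div m}" by (rule card_inj_on_le) simp
  then show ?thesis by simp
qed

text \<open>One index set \<open>U\<close> lists all messages of a round with source and
  destination, so both budgets become sizes of fibres. Several indices may stand for the same
  message.\<close>

lemma fits_indexed:
  fixes src dst :: "'a \<Rightarrow> nat" and fc :: "'a \<Rightarrow> fact"
  assumes fin: "finite U"
    and Z: "\<And>i. i < M \<Longrightarrow> Z i \<subseteq> (\<lambda>u. (dst u, fc u)) ` {u \<in> U. src u = i}"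
    and sent: "\<And>i. i < M \<Longrightarrow> card {u \<in> U. src u = i} \<le> W"
    and received: "\<And>j. j < M \<Longrightarrow> card {u \<in> U. dst u = j} \<le> W"
    and ok: "\<And>u. u \<in> U \<Longrightarrow> dst u < M \<and> enc (fc u) < 2 ^ wb"
  shows "fits M W wb Z"
  unfolding fits_def
proof (intro conjI allI impI)
  fix i assume i: "i < M"
  show "finite (Z i)" using finite_subset[OF Z[OF i]] fin by simp
  have "card (Z i) \<le> card ((\<lambda>u. (dst u, fc u)) ` {u \<in> U. src u = i})"
    using fin by (intro card_mono Z i) auto
  also have "\<dots> \<le> card {u \<in> U. src u = i}" using fin by (intro card_image_le) auto
  finally show "card (Z i) \<le> W" using sent[OF i] by simp
  show "\<forall>(j, t)\<in>Z i. j < M \<and> enc t < 2 ^ wb" using Z[OF i] ok by auto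
next
  fix j assume j: "j < M"
  let ?S = "SIGMA i:{..<M}. {t. (j, t) \<in> Z i}"
  have sub: "?S \<subseteq> (\<lambda>u. (src u, fc u)) ` {u \<in> U. dst u = j}"
    using Z by (fastforce simp: image_iff)
  have fib: "finite {t. (j, t) \<in> Z i}" if "i < M" for i
  proof -
    have "finite (Z i)" using finite_subset[OF Z[OF that]] fin by simp
    then have "finite (Pair j -` Z i)" by (intro finite_vimageI) (auto simp: inj_on_def)
    then show ?thesis by (simp add: vimage_def)
  qed
  have "(\<Sum>i<M. card {t. (j, t) \<in> Z i}) = card ?S"
    using fib by (intro card_SigmaI[symmetric]) auto
  also have "\<dots> \<le> card ((\<lambda>u. (src u, fc u)) ` {u \<in> U. dst u = j})"
    using fin by (intro card_mono sub) auto
  also have "\<dots> \<le> card {u \<in> U. dst u = j}" using fin by (intro card_image_le) auto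
  finally show "(\<Sum>i<M. card {t. (j, t) \<in> Z i}) \<le> W" using received[OF j] by simp
qed

text \<open>The cycles \<open>css\<close> as facts: the edges at \<open>v\<close> are known to the machine \<open>v mod m\<close>.\<close>

definition adj_facts :: "nat \<Rightarrow> nat list list \<Rightarrow> nat \<Rightarrow> fact set" where
  "adj_facts m css i = {Edge v v u | v u. v mod m = i \<and> u \<in> nbs (cycles_edges css) v}"

lemma nbs_sym: "u \<in> nbs E v \<longleftrightarrow> v \<in> nbs E u"
  by (simp add: nbs_def insert_commute)

definition adj_pairs :: "nat list list \<Rightarrow> (nat \<times> nat) set" where
  "adj_pairs css = {(v, u). u \<in> nbs (cycles_edges css) v}"

lemma adj_pairs:
  assumes "good_cycles css"
  shows "adj_pairs css = (SIGMA v:cycles_verts css. nbs (cycles_edges css) v)"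
    and "finite (adj_pairs css)"
    and "finite V \<Longrightarrow> card {p \<in> adj_pairs css. fst p \<in> V} \<le> 2 * card (V \<inter> cycles_verts css)"
    and "card (adj_pairs css) \<le> 2 * card (cycles_verts css)"
proof -
  show *: "adj_pairs css = (SIGMA v:cycles_verts css. nbs (cycles_edges css) v)"
    using nbs_subset_verts(2)[OF assms] by (auto simp: adj_pairs_def)
  show "finite (adj_pairs css)" unfolding * using card_nbs_le[OF assms] by auto
  have b: "card (SIGMA v:V. nbs (cycles_edges css) v) \<le> card V * 2" if "finite V" for V
    using card_nbs_le[OF assms] that by (intro card_Sigma_le) auto
  have "{p \<in> adj_pairs css. fst p \<in> V} = (SIGMA v:V \<inter> cycles_verts css. nbs (cycles_edges css) v)"
    unfolding * by auto
  then show "card {p \<in> adj_pairs css. fst p \<in> V} \<le> 2 * card (V \<inter> cycles_verts css)" if "finite V"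
    using b[of "V \<inter> cycles_verts css"] that by simp
  show "card (adj_pairs css) \<le> 2 * card (cycles_verts css)"
    unfolding * using b[of "cycles_verts css"] by simp
qed

lemma card_adj_pairs_home:
  assumes "good_cycles css" "cycles_verts css \<subseteq> {..<n}" "0 < m"
  shows "card {p \<in> adj_pairs css. fst p mod m = i} \<le> 2 * (n div m + 1)"
proof -
  have "{p \<in> adj_pairs css. fst p mod m = i} = {p \<in> adj_pairs css. fst p \<in> {v \<in> cycles_verts css. v mod m = i}}"
    by (auto simp: adj_pairs(1)[OF assms(1)])
  also have "card \<dots> \<le> 2 * card ({v \<in> cycles_verts css. v mod m = i} \<inter> cycles_verts css)"
    by (rule adj_pairs(3)[OF assms(1)]) auto
  also have "{v \<in> cycles_verts css. v mod m = i} \<inter> cycles_verts css = {v \<in> cycles_verts css. v mod m = i}"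
    by auto
  also have "2 * card \<dots> \<le> 2 * (n div m + 1)"
    using card_mod_le[OF assms(3,2), of i] by simp
  finally show ?thesis .
qed

text \<open>Machines are numbered by \<open>p\<close> digits in base \<open>f\<close>, for broadcast
  trees and digit-wise routing of depth \<open>p\<close>. \<open>K\<close> bounds every number
  occurring in a fact.\<close>

locale net =
  fixes f p W wb K :: nat
  assumes f: "0 < f" and bits: "\<And>t. fact_lt K t \<Longrightarrow> enc t < 2 ^ wb"
begin

abbreviation M :: nat where "M \<equiv> f ^ p"

lemma M: "0 < M" using f by simp

abbreviation reach :: "round_fun list \<Rightarrow> config \<Rightarrow> config set \<Rightarrow> real" where
  "reach \<equiv> prob_reach M W wb"

subsection \<open>Flooding\<close>

primrec ball :: "nat list list \<Rightarrow> nat \<Rightarrow> nat \<Rightarrow> (nat \<times> nat) set" where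
  "ball css 0 v = Pair v ` nbs (cycles_edges css) v"
| "ball css (Suc t) v = (\<Union>u\<in>insert v (nbs (cycles_edges css) v). ball css t u)"

lemma ball_edge: "(x, y) \<in> ball css t v \<Longrightarrow> y \<in> nbs (cycles_edges css) x"
  by (induction t arbitrary: v) auto

lemma ball_self: "u \<in> nbs (cycles_edges css) v \<Longrightarrow> (v, u) \<in> ball css t v"
  by (induction t) auto

text \<open>The crude exponential bound suffices because flooding is used for a constant radius
  only; larger neighbourhoods are left to the walks.\<close>

lemma card_ball:
  assumes "good_cycles css"
  shows "finite (ball css t v) \<and> card (ball css t v) \<le> 2 * 3 ^ t"
proof (induction t arbitrary: v)
  case 0
  show ?case using card_nbs_le[OF assms, of v] by (auto intro: order_trans[OF card_image_le])
next
  case (Suc t)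
  let ?N = "insert v (nbs (cycles_edges css) v)"
  have N: "finite ?N" "card ?N \<le> 3" using card_nbs_le[OF assms, of v] by (auto simp: card_insert_if)
  have "card (ball css (Suc t) v) \<le> (\<Sum>u\<in>?N. card (ball css t u))"
    using card_UN_le[OF N(1)] by simp
  also have "\<dots> \<le> (\<Sum>u\<in>?N. 2 * 3 ^ t)" using Suc by (intro sum_mono) auto
  also have "\<dots> = card ?N * (2 * 3 ^ t)" by simp
  also have "\<dots> \<le> 3 * (2 * 3 ^ t)" using N(2) by (rule mult_right_mono) simp
  finally show ?case using Suc N(1) by auto
qed

lemma ball_cyc_nth:
  assumes "good_cycles css" "xs \<in> set css" "\<bar>i\<bar> \<le> int t" "e = 1 \<or> e = - 1"
  shows "(cyc_nth xs (a + i), cyc_nth xs (a + i + e)) \<in> ball css t (cyc_nth xs a)"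
  using assms(3)
proof (induction t arbitrary: a i)
  case 0
  then have i: "i = 0" by simp
  have "cyc_nth xs (a + e) \<in> nbs (cycles_edges css) (cyc_nth xs a)"
    unfolding nbs_cycles_edges[OF assms(1,2), of a] using assms(4) by (elim disjE) simp_all
  then show ?case unfolding i ball.simps by simp
next
  case (Suc t)
  define d :: int where "d = sgn i"
  have d: "\<bar>i - d\<bar> \<le> int t" using Suc.prems by (auto simp: d_def sgn_if)
  have "cyc_nth xs (a + d) \<in> insert (cyc_nth xs a) (nbs (cycles_edges css) (cyc_nth xs a))"
    unfolding nbs_cycles_edges[OF assms(1,2), of a] by (simp add: d_def sgn_if)
  moreover have "(cyc_nth xs (a + i), cyc_nth xs (a + i + e)) \<in> ball css t (cyc_nth xs (a + d))"
    using Suc.IH[OF d, of "a + d"] by (simp add: algebra_simps)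
  ultimately show ?case by auto
qed

definition ball_facts :: "nat list list \<Rightarrow> nat \<Rightarrow> nat \<Rightarrow> fact set" where
  "ball_facts css t i = {Edge v x y | v x y. v mod M = i \<and> v \<in> cycles_verts css \<and> (x, y) \<in> ball css t v}"

lemma ball_facts_0:
  assumes "good_cycles css"
  shows "ball_facts css 0 = adj_facts M css"
  using nbs_subset_verts(2)[OF assms] by (fastforce simp: ball_facts_def adj_facts_def)

definition flood :: "nat \<Rightarrow> fact set \<Rightarrow> (nat \<times> fact) set" where
  "flood i X = {(u mod M, Edge u x y) | u x y. \<exists>v. Edge v x y \<in> X \<and> (u = v \<or> Edge v v u \<in> X)}"

text \<open>Adjacency is symmetric, so the receiving load is counted like the sending load: each
  vertex exchanges balls with itself and at most two neighbours.\<close>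

lemma flood_step:
  assumes good: "good_cycles css" and n: "cycles_verts css \<subseteq> {..<n}" "n \<le> K"
    and W: "6 * 3 ^ t * (n div M + 1) \<le> W"
    and h: "holds M (ball_facts css t) c"
    and cont: "\<And>c'. holds M (ball_facts css (Suc t)) c' \<Longrightarrow> 1 - e \<le> reach gs c' Q"
  shows "1 - e \<le> reach (fact_round facts_in flood # gs) c Q"
proof (rule prob_reach_fact_round[OF h])
  let ?V = "cycles_verts css" and ?nb = "nbs (cycles_edges css)"
  define U where "U = (SIGMA v:?V. SIGMA u:insert v (?nb v). ball css t v)"
  have Z: "flood i (ball_facts css t i) =
      (\<lambda>(v, u, x, y). (u mod M, Edge u x y)) ` {z \<in> U. fst z mod M = i}" for i
  proof (intro equalityI subsetI)
    fix z assume "z \<in> flood i (ball_facts css t i)"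
    then obtain u x y v where *: "z = (u mod M, Edge u x y)" "Edge v x y \<in> ball_facts css t i"
      "u = v \<or> Edge v v u \<in> ball_facts css t i" by (auto simp: flood_def)
    have "u \<in> insert v (?nb v)" using *(3) ball_edge by (auto simp: ball_facts_def)
    then have "(v, u, x, y) \<in> {z \<in> U. fst z mod M = i}" using *(2) by (auto simp: U_def ball_facts_def)
    then show "z \<in> (\<lambda>(v, u, x, y). (u mod M, Edge u x y)) ` {z \<in> U. fst z mod M = i}"
      using *(1) by (force intro: rev_image_eqI)
  next
    fix z assume "z \<in> (\<lambda>(v, u, x, y). (u mod M, Edge u x y)) ` {z \<in> U. fst z mod M = i}"
    then obtain v u x y where *: "z = (u mod M, Edge u x y)" "v \<in> ?V" "u = v \<or> u \<in> ?nb v"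
      "(x, y) \<in> ball css t v" "v mod M = i" unfolding U_def by force
    then have "Edge v x y \<in> ball_facts css t i" "u = v \<or> Edge v v u \<in> ball_facts css t i"
      using ball_self by (auto simp: ball_facts_def)
    then show "z \<in> flood i (ball_facts css t i)" using *(1) by (auto simp: flood_def)
  qed
  have finU: "finite U" unfolding U_def using card_ball[OF good] card_nbs_le[OF good] by auto
  have nb3: "finite (insert v (?nb v))" "card (insert v (?nb v)) \<le> 3" for v
    using card_nbs_le[OF good, of v] by (auto simp: card_insert_if)
  have count: "card (SIGMA v:{v \<in> ?V. v mod M = i}. SIGMA u:insert v (?nb v). B v u) \<le> W"
    if B: "\<And>u v. finite (B v u) \<and> card (B v u) \<le> 2 * 3 ^ t" for B i
  proof -
    have "card (SIGMA v:{v \<in> ?V. v mod M = i}. SIGMA u:insert v (?nb v). B v u) \<le>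
        card {v \<in> ?V. v mod M = i} * (3 * (2 * 3 ^ t))"
    proof (intro card_Sigma_le conjI)
      fix v
      show "finite (SIGMA u:insert v (?nb v). B v u)" using nb3 B by auto
      have "card (SIGMA u:insert v (?nb v). B v u) \<le> card (insert v (?nb v)) * (2 * 3 ^ t)"
        using nb3 B by (intro card_Sigma_le) auto
      also have "\<dots> \<le> 3 * (2 * 3 ^ t)" using nb3 by (intro mult_right_mono) auto
      finally show "card (SIGMA u:insert v (?nb v). B v u) \<le> 3 * (2 * 3 ^ t)" .
    qed auto
    also have "\<dots> \<le> (n div M + 1) * (3 * (2 * 3 ^ t))"
      using card_mod_le[OF M n(1)] by (intro mult_right_mono) auto
    also have "\<dots> \<le> W" using W by (simp add: mult.commute)
    finally show ?thesis .
  qed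
  have V: "u \<in> ?V" if "v \<in> ?V" "u \<in> insert v (?nb v)" for u v
    using that nbs_subset_verts(1)[OF good] by blast
  show "fits M W wb (\<lambda>i. flood i (ball_facts css t i))"
  proof (rule fits_indexed[where U=U and src="\<lambda>z. fst z mod M" and dst="\<lambda>z. fst (snd z) mod M"
        and fc="\<lambda>(v, u, x, y). Edge u x y"])
    show "finite U" by (rule finU)
    show "flood i (ball_facts css t i) \<subseteq> (\<lambda>z. (fst (snd z) mod M, case z of (v, u, x, y) \<Rightarrow> Edge u x y)) `
        {z \<in> U. fst z mod M = i}" for i
      unfolding Z by (intro equalityD1 image_cong) auto
    show "card {z \<in> U. fst z mod M = i} \<le> W" for i
    proof -
      have "{z \<in> U. fst z mod M = i} = (SIGMA v:{v \<in> ?V. v mod M = i}. SIGMA u:insert v (?nb v). ball css t v)"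
        by (auto simp: U_def)
      then show ?thesis using count[of "\<lambda>v u. ball css t v" i] card_ball[OF good] by simp
    qed
    show "card {z \<in> U. fst (snd z) mod M = j} \<le> W" for j
    proof -
      let ?S = "SIGMA u:{u \<in> ?V. u mod M = j}. SIGMA v:insert u (?nb u). ball css t v"
      have "{z \<in> U. fst (snd z) mod M = j} \<subseteq> (\<lambda>(u, v, e). (v, u, e)) ` ?S"
      proof
        fix z assume "z \<in> {z \<in> U. fst (snd z) mod M = j}"
        then obtain v u xy where "z = (v, u, xy)" "v \<in> ?V" "u \<in> insert v (?nb v)" "xy \<in> ball css t v" "u mod M = j"
          by (auto simp: U_def)
        then have "z = (\<lambda>(u, v, e). (v, u, e)) (u, v, xy)" "(u, v, xy) \<in> ?S"
          using V[of v u] nbs_sym[of u _ v] by auto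
        then show "z \<in> (\<lambda>(u, v, e). (v, u, e)) ` ?S" by blast
      qed
      moreover have "finite ?S" using card_ball[OF good] nb3 by auto
      ultimately have "card {z \<in> U. fst (snd z) mod M = j} \<le> card ?S"
        by (meson card_image_le card_mono finite_imageI order_trans)
      then show ?thesis using count[of "\<lambda>u v. ball css t v" j] card_ball[OF good] by simp
    qed
    show "fst (snd z) mod M < M \<and> enc (case z of (v, u, x, y) \<Rightarrow> Edge u x y) < 2 ^ wb" if z: "z \<in> U" for z
    proof -
      obtain v u x y where *: "z = (v, u, x, y)" by (metis surj_pair)
      then have "u \<in> ?V" "y \<in> ?nb x" using z V[of v u] ball_edge[of x y css t v] by (auto simp: U_def)
      moreover have "x \<in> ?V" "y \<in> ?V"
        using calculation(2) nbs_subset_verts[OF good] nbs_sym by (metis subset_iff empty_iff)+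
      ultimately show ?thesis using * M bits[of "Edge u x y"] n by (auto dest!: subsetD[OF n(1)])
    qed
  qed
  fix c' assume h': "holds M (delivered M (\<lambda>i. flood i (ball_facts css t i))) c'"
  have "delivered M (\<lambda>i. flood i (ball_facts css t i)) j = ball_facts css (Suc t) j" for j
  proof (intro equalityI subsetI)
    fix z assume "z \<in> delivered M (\<lambda>i. flood i (ball_facts css t i)) j"
    then obtain v u x y where "z = Edge u x y" "u mod M = j" "v \<in> ?V" "u \<in> insert v (?nb v)" "(x, y) \<in> ball css t v"
      unfolding delivered_def Z by (auto simp: U_def)
    then show "z \<in> ball_facts css (Suc t) j"
      using V[of v u] nbs_sym[of u "cycles_edges css" v] by (auto simp: ball_facts_def)
  next
    fix z assume "z \<in> ball_facts css (Suc t) j"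
    then obtain u x y v where *: "z = Edge u x y" "u mod M = j" "u \<in> ?V" "v \<in> insert u (?nb u)" "(x, y) \<in> ball css t v"
      by (auto simp: ball_facts_def)
    then have "(v, u, x, y) \<in> U" using V[of u v] nbs_sym[of v "cycles_edges css" u] by (auto simp: U_def)
    then show "z \<in> delivered M (\<lambda>i. flood i (ball_facts css t i)) j"
      unfolding delivered_def Z using * M by (auto intro!: exI[of _ "v mod M"] rev_image_eqI[of "(v, u, x, y)"])
  qed
  then show "1 - e \<le> reach gs c' Q" using cont h' by (simp add: holds_def)
qed

end

context net
begin

text \<open>The common last step of every phase that produces a new graph or a new placement.
  \<open>own\<close> is the machine that computed an oriented edge, \<open>v mod m\<close> its new
  home; residues spread the labels evenly.\<close>

lemma deliver_adj_facts:
  assumes good: "good_cycles css" and n: "cycles_verts css \<subseteq> {..<n}" "n \<le> K" and m: "0 < m" "m \<le> M"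
    and own: "\<And>q. q \<in> adj_pairs css \<Longrightarrow> own q < M"
    and Z: "\<And>i. i < M \<Longrightarrow> Z i = (\<lambda>q. (fst q mod m, Edge (fst q) (fst q) (snd q))) ` {q \<in> adj_pairs css. own q = i}"
    and sent: "\<And>i. i < M \<Longrightarrow> card {q \<in> adj_pairs css. own q = i} \<le> W"
    and received: "2 * (n div m + 1) \<le> W"
  shows "fits M W wb Z" and "holds M (delivered M Z) = holds M (adj_facts m css)"
proof -
  have lt: "fst q < n" "snd q < n" if "q \<in> adj_pairs css" for q
    using that n(1) nbs_subset_verts(1)[OF good] unfolding adj_pairs(1)[OF good] by fastforce+
  show "fits M W wb Z"
  proof (rule fits_indexed[where U="adj_pairs css" and src=own and dst="\<lambda>q. fst q mod m"
        and fc="\<lambda>q. Edge (fst q) (fst q) (snd q)"])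
    show "finite (adj_pairs css)" by (rule adj_pairs(2)[OF good])
    show "card {q \<in> adj_pairs css. fst q mod m = j} \<le> W" for j
      using card_adj_pairs_home[OF good n(1) m(1), of j] received by simp
    show "fst q mod m < M \<and> enc (Edge (fst q) (fst q) (snd q)) < 2 ^ wb" if "q \<in> adj_pairs css" for q
      using lt[OF that] n(2) m bits[of "Edge (fst q) (fst q) (snd q)"]
      by (auto intro: less_le_trans[OF mod_less_divisor])
  qed (use Z sent in auto)
  have "delivered M Z j = adj_facts m css j" for j
  proof -
    have "delivered M Z j = {Edge (fst q) (fst q) (snd q) | q. q \<in> adj_pairs css \<and> fst q mod m = j}"
    proof (intro equalityI subsetI)
      fix t assume "t \<in> {Edge (fst q) (fst q) (snd q) | q. q \<in> adj_pairs css \<and> fst q mod m = j}"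
      then obtain q where q: "t = Edge (fst q) (fst q) (snd q)" "q \<in> adj_pairs css" "fst q mod m = j" by blast
      then have "(j, t) \<in> Z (own q)" unfolding Z[OF own[OF q(2)]] by blast
      then show "t \<in> delivered M Z j" using own[OF q(2)] by (auto simp: delivered_def)
    qed (auto simp: delivered_def Z)
    also have "\<dots> = adj_facts m css j"
      unfolding adj_facts_def adj_pairs_def by force
    finally show ?thesis .
  qed
  then show "holds M (delivered M Z) = holds M (adj_facts m css)" by (simp add: holds_def fun_eq_iff)
qed

subsection \<open>Initial distribution of the edges\<close>

fun word_pairs :: "nat list \<Rightarrow> (nat \<times> nat) set" where
  "word_pairs (u # v # ws) = insert (u, v) (word_pairs ws)"
| "word_pairs _ = {}"

lemma word_pairs_concat: "word_pairs (concat (map (\<lambda>(u, v). [u, v]) es)) = set es"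
  by (induction es) auto

definition init_step :: "nat \<Rightarrow> (nat \<times> nat) set \<Rightarrow> (nat \<times> fact) set" where
  "init_step i X = {(u mod M, Edge u u v) | u v. (u, v) \<in> X \<or> (v, u) \<in> X}"

text \<open>The input lists each edge once, in one orientation. This makes the machine that owns an
  edge well defined for both orientations.\<close>

lemma edge_input_unique:
  assumes "edge_input N cap E I" "i < N" "i' < N" "(u, v) \<in> set (I i)"
    and "(u, v) \<in> set (I i') \<or> (v, u) \<in> set (I i')"
  shows "i = i'"
proof -
  let ?h = "\<lambda>(u :: nat, v). {u, v}"
  have d: "distinct (concat (map (\<lambda>i. map ?h (I i)) [0..<N]))"
    using assms(1) by (simp add: edge_input_def Let_def map_concat o_def)
  have key: False if "a < b" "b < N" "e \<in> ?h ` set (I a)" "e \<in> ?h ` set (I b)" for a b e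
  proof -
    have "[0..<N] = [0..<b] @ [b..<N]" using that(2) upt_add_eq_append[of 0 b "N - b"] by simp
    then have "set (concat (map (\<lambda>i. map ?h (I i)) [0..<b])) \<inter> set (concat (map (\<lambda>i. map ?h (I i)) [b..<N])) = {}"
      using d by simp
    moreover have "set (concat (map (\<lambda>i. map ?h (I i)) A)) = (\<Union>i\<in>set A. ?h ` set (I i))" for A
      by (simp add: set_concat)
    ultimately have "(\<Union>i\<in>set [0..<b]. ?h ` set (I i)) \<inter> (\<Union>i\<in>set [b..<N]. ?h ` set (I i)) = {}" by simp
    moreover have "e \<in> (\<Union>i\<in>set [0..<b]. ?h ` set (I i))" using that(1,3) by (intro UN_I[of a]) auto
    moreover have "e \<in> (\<Union>i\<in>set [b..<N]. ?h ` set (I i))" using that(2,4) by (intro UN_I[of b]) auto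
    ultimately show False by (metis IntI empty_iff)
  qed
  have "{u, v} \<in> ?h ` set (I i)" "{u, v} \<in> ?h ` set (I i')"
    using assms(4,5) by (force simp: insert_commute)+
  then show ?thesis using key[of i i'] key[of i' i] assms(2,3) by (metis linorder_neqE_nat)
qed

lemma init_phase:
  assumes good: "good_cycles css" and n: "cycles_verts css \<subseteq> {..<n}" "n \<le> K"
    and I: "edge_input M cap (cycles_edges css) I"
    and W: "2 * cap \<le> W" "2 * (n div M + 1) \<le> W"
    and cont: "\<And>c'. holds M (adj_facts M css) c' \<Longrightarrow> 1 - e \<le> reach gs c' Q"
  shows "1 - e \<le> reach (fact_round (\<lambda>m b. word_pairs m) init_step # gs) (init_config M I) Q"
proof -
  define own where "own = (\<lambda>(u, v). THE i. i < M \<and> ((u, v) \<in> set (I i) \<or> (v, u) \<in> set (I i)))"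
  have E: "{u, v} \<in> cycles_edges css \<longleftrightarrow> (\<exists>i<M. (u, v) \<in> set (I i) \<or> (v, u) \<in> set (I i))" for u v
  proof -
    have "cycles_edges css = (\<lambda>(u, v). {u, v}) ` (\<Union>i<M. set (I i))"
      using I by (auto simp: edge_input_def Let_def set_concat atLeast0LessThan)
    then show ?thesis by (auto simp: doubleton_eq_iff image_iff Bex_def)
  qed
  have uniq: "i = i'" if "i < M" "i' < M" "(u, v) \<in> set (I i) \<or> (v, u) \<in> set (I i)"
    "(u, v) \<in> set (I i') \<or> (v, u) \<in> set (I i')" for i i' u v
    using that edge_input_unique[OF I] by metis
  have own: "own (u, v) = i" if "i < M" "(u, v) \<in> set (I i) \<or> (v, u) \<in> set (I i)" for u v i
    unfolding own_def prod.case using that uniq by (intro the_equality) blast+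
  have own_ex: "own q < M \<and> (q \<in> set (I (own q)) \<or> prod.swap q \<in> set (I (own q)))" if adj: "q \<in> adj_pairs css" for q
  proof -
    obtain u v where q: "q = (u, v)" by force
    then obtain i where "i < M" "(u, v) \<in> set (I i) \<or> (v, u) \<in> set (I i)"
      using adj E[of u v] by (auto simp: adj_pairs_def nbs_def)
    then show ?thesis using own[of i u v] q by auto
  qed
  have Zi: "{(u, v). (u, v) \<in> set (I i) \<or> (v, u) \<in> set (I i)} = {q \<in> adj_pairs css. own q = i}" if "i < M" for i
  proof (intro equalityI subsetI)
    fix q assume "q \<in> {(u, v). (u, v) \<in> set (I i) \<or> (v, u) \<in> set (I i)}"
    then show "q \<in> {q \<in> adj_pairs css. own q = i}"
      using E own[OF that] that by (auto simp: adj_pairs_def nbs_def)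
  next
    fix q assume "q \<in> {q \<in> adj_pairs css. own q = i}"
    then show "q \<in> {(u, v). (u, v) \<in> set (I i) \<or> (v, u) \<in> set (I i)}"
      using own_ex[of q] by (cases q) auto
  qed
  have Z: "init_step i (set (I i)) = (\<lambda>q. (fst q mod M, Edge (fst q) (fst q) (snd q))) ` {q \<in> adj_pairs css. own q = i}"
    if "i < M" for i
    unfolding Zi[OF that, symmetric] init_step_def by force
  have sent: "card {q \<in> adj_pairs css. own q = i} \<le> W" if "i < M" for i
  proof -
    have "{q \<in> adj_pairs css. own q = i} \<subseteq> set (I i) \<union> prod.swap ` set (I i)"
      unfolding Zi[OF that, symmetric] by force
    then have "card {q \<in> adj_pairs css. own q = i} \<le> card (set (I i) \<union> prod.swap ` set (I i))"
      by (intro card_mono) auto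
    also have "\<dots> \<le> card (set (I i)) + card (prod.swap ` set (I i))" by (rule card_Un_le)
    also have "\<dots> \<le> length (I i) + length (I i)"
      by (intro add_mono card_length order_trans[OF card_image_le]) (auto simp: card_length)
    also have "\<dots> \<le> W" using I W that by (force simp: edge_input_def)
    finally show ?thesis .
  qed
  note D = deliver_adj_facts[OF good n M order_refl, where own=own and Z="\<lambda>i. init_step i (set (I i))"]
  show ?thesis
  proof (rule prob_reach_fact_round_rd[where X="\<lambda>i. set (I i)"])
    show "word_pairs (fst (init_config M I i)) = set (I i)" if "i < M" for i
      using that by (simp add: init_config_def word_pairs_concat)
    show "fits M W wb (\<lambda>i. init_step i (set (I i)))"
      by (rule D) (use own_ex Z sent W in auto)
    fix c' assume "holds M (delivered M (\<lambda>i. init_step i (set (I i)))) c'"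
    moreover have "holds M (delivered M (\<lambda>i. init_step i (set (I i)))) = holds M (adj_facts M css)"
      by (rule D) (use own_ex Z sent W in auto)
    ultimately show "1 - e \<le> reach gs c' Q" using cont by simp
  qed
qed

subsection \<open>Contraction by a constant radius rule\<close>

text \<open>The radius 5 is the locality 3 of \<open>pre_keep\<close> plus the gap 2. Four floodings
  reach it, because a ball also contains the edges that leave its outermost vertices.\<close>

definition pre_step :: "nat \<Rightarrow> fact set \<Rightarrow> (nat \<times> fact) set" where
  "pre_step i X = {(v mod M, Edge v v u) | v u. u \<in> new_nbs pre_keep 5 2 v {{x, y} | x y. Edge v x y \<in> X}}"

definition pre_stage :: "round_fun list" where
  "pre_stage = replicate 4 (fact_round facts_in flood) @ [fact_round facts_in pre_step]"

lemma good_cycles_contract: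
  assumes "good_cycles css" "\<And>xs. xs \<in> set css \<Longrightarrow> 3 \<le> length (filter (keep P css) xs)"
  shows "good_cycles (contract P css)" "cycles_verts (contract P css) \<subseteq> cycles_verts css"
proof -
  have "distinct (concat (contract P css))"
    using assms(1) by (simp add: good_cycles_def contract_def filter_concat[symmetric])
  then show "good_cycles (contract P css)" using assms by (auto simp: good_cycles_def contract_def)
  show "cycles_verts (contract P css) \<subseteq> cycles_verts css" by (auto simp: contract_def set_concat)
qed

lemma pre_stage_phase:
  assumes good: "good_cycles css" and good': "good_cycles (contract pre_keep css)"
    and n: "cycles_verts css \<subseteq> {..<n}" "n \<le> K" "n \<le> 2 ^ L" and L1: "16 * L\<^sup>2 \<le> 2 ^ L1"
    and W: "162 * (n div M + 1) \<le> W"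
    and h: "holds M (adj_facts M css) c"
    and cont: "\<And>c'. holds M (adj_facts M (contract pre_keep css)) c' \<Longrightarrow> 1 - e \<le> reach gs c' Q"
  shows "1 - e \<le> reach (pre_stage @ gs) c Q"
proof -
  let ?V = "cycles_verts css" and ?css' = "contract pre_keep css"
  have V': "cycles_verts ?css' \<subseteq> ?V" by (auto simp: contract_def set_concat)
  have nb: "new_nbs pre_keep 5 2 v {{x, y} | x y. Edge v x y \<in> ball_facts css 4 i} =
      (if v mod M = i then nbs (cycles_edges ?css') v else {})" for v i
  proof (cases "v mod M = i \<and> v \<in> ?V")
    case True
    then have F: "{{x, y} | x y. Edge v x y \<in> ball_facts css 4 i} = {{x, y} | x y. (x, y) \<in> ball css 4 v}"
      by (simp add: ball_facts_def)
    from True have "v \<in> ?V" by simp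
    then obtain xs a where xs: "xs \<in> set css" "v = cyc_nth xs a" by (rule cycles_vertsE)
    have "new_nbs pre_keep 5 2 (cyc_nth xs a) {{x, y} | x y. (x, y) \<in> ball css 4 v} =
        nbs (cycles_edges ?css') (cyc_nth xs a)"
    proof (rule new_nbs_correct[OF good xs(1) good' local_sym_pre_keep])
      note D = good_cyclesD[OF good xs(1)]
      show "gap_le 2 pre_keep (cyc_nth xs)"
        using xs(1) n by (intro gap_pre_keep[OF D(1,3) _ L1]) (force simp: set_concat)
      show "{{x, y} | x y. (x, y) \<in> ball css 4 v} \<subseteq> cycles_edges css"
        using ball_edge by (auto simp: nbs_def)
      fix m :: int assume m: "- 5 \<le> m" "m < 5"
      show "{cyc_nth xs (a + m), cyc_nth xs (a + m + 1)} \<in> {{x, y} | x y. (x, y) \<in> ball css 4 v}"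
      proof (cases "m = - 5")
        \<comment> \<open>The leftmost edge is recorded only from its inner end, which is at
          distance 4.\<close>
        case True
        have "(cyc_nth xs (a + (m + 1)), cyc_nth xs (a + (m + 1) + - 1)) \<in> ball css 4 v"
          unfolding xs(2) by (rule ball_cyc_nth[OF good xs(1)]) (use True in auto)
        then show ?thesis by (auto simp: insert_commute algebra_simps)
      next
        case False
        have "(cyc_nth xs (a + m), cyc_nth xs (a + m + 1)) \<in> ball css 4 v"
          unfolding xs(2) by (rule ball_cyc_nth[OF good xs(1)]) (use m False in auto)
        then show ?thesis by blast
      qed
    qed auto
    then show ?thesis using True F xs(2) by simp
  next
    case False
    then have "{{x, y} | x y. Edge v x y \<in> ball_facts css 4 i} = {}"
      by (auto simp: ball_facts_def)
    moreover have "nbs (cycles_edges ?css') v = {}" if "v \<notin> ?V"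
      using that V' nbs_subset_verts(2)[OF good'] by blast
    ultimately show ?thesis using False by (auto simp: new_nbs_empty)
  qed
  have final: "1 - e \<le> reach (fact_round facts_in pre_step # gs) c Q" if "holds M (ball_facts css 4) c" for c
  proof -
    have Z: "pre_step i (ball_facts css 4 i) =
        (\<lambda>q. (fst q mod M, Edge (fst q) (fst q) (snd q))) ` {q \<in> adj_pairs ?css'. fst q mod M = i}" for i
      unfolding pre_step_def nb adj_pairs_def by force
    have W': "2 * (n div M + 1) \<le> W" using W by simp
    note D = deliver_adj_facts[OF good' order_trans[OF V' n(1)] n(2) M order_refl,
        where own="\<lambda>q. fst q mod M" and Z="\<lambda>i. pre_step i (ball_facts css 4 i)"]
    have sent: "card {q \<in> adj_pairs ?css'. fst q mod M = i} \<le> W" for i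
      using card_adj_pairs_home[OF good' order_trans[OF V' n(1)] M, of i] W' by simp
    show ?thesis
      by (rule prob_reach_fact_round[OF that]) (use D M Z sent W' cont in auto)
  qed
  have "1 - e \<le> reach (replicate k (fact_round facts_in flood) @ fact_round facts_in pre_step # gs) c Q"
    if "k \<le> 4" "holds M (ball_facts css (4 - k)) c" for k c
    using that
  proof (induction k arbitrary: c)
    case 0
    then show ?case using final by simp
  next
    case (Suc k)
    \<comment> \<open>The last flooding sends balls of index 3, and
      \<open>6 * 3 ^ 3 = 162\<close>.\<close>
    have "6 * 3 ^ (4 - Suc k) * (n div M + 1) \<le> 162 * (n div M + 1)"
    proof (rule mult_right_mono)
      have "(3::nat) ^ (4 - Suc k) \<le> 3 ^ 3" by (intro power_increasing) auto
      then show "(6::nat) * 3 ^ (4 - Suc k) \<le> 162" by simp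
    qed simp
    then have "6 * 3 ^ (4 - Suc k) * (n div M + 1) \<le> W" using W by linarith
    moreover have "Suc (4 - Suc k) = 4 - k" using Suc.prems by simp
    ultimately show ?case
      using flood_step[OF good n(1,2) _ Suc.prems(2)] Suc.IH Suc.prems(1) by (auto simp del: ball.simps)
  qed
  from this[of 4 c] h show ?thesis by (simp add: pre_stage_def ball_facts_0[OF good])
qed

subsection \<open>Broadcasting a seed\<close>

text \<open>Before step \<open>q\<close> the machines below \<open>f ^ q\<close> know the seed; each
  passes it to the \<open>f\<close> machines that share its low \<open>q\<close> digits, one for
  each value of the next digit.\<close>

definition bcast :: "nat \<Rightarrow> nat \<Rightarrow> fact set \<Rightarrow> (nat \<times> fact) set" where
  "bcast q i X = Pair i ` X \<union> {(i + d * f ^ q, Seed s) | d s. d < f \<and> i < f ^ q \<and> Seed s \<in> X}"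

lemma bcast_step:
  assumes q: "q < p" and Y: "\<And>i s. i < M \<Longrightarrow> Seed s \<notin> Y i"
    and W: "\<And>i. i < M \<Longrightarrow> finite (Y i) \<and> card (Y i) + f + 2 \<le> W"
    and lt: "\<And>i t. i < M \<Longrightarrow> t \<in> Y i \<Longrightarrow> fact_lt K t" "s < K"
    and h: "holds M (with_seed Y s (f ^ q)) c"
    and cont: "\<And>c'. holds M (with_seed Y s (f ^ Suc q)) c' \<Longrightarrow> 1 - e \<le> reach gs c' Q"
  shows "1 - e \<le> reach (fact_round facts_in (bcast q) # gs) c Q"
proof (rule prob_reach_fact_round[OF h])
  let ?X = "with_seed Y s (f ^ q)"
  have fM: "f ^ Suc q \<le> M" using q f by (intro power_increasing) auto
  have seed: "Seed s' \<in> ?X i \<longleftrightarrow> s' = s \<and> i < f ^ q" if "i < M" for s' i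
    using Y[OF that] by (auto simp: with_seed_def)
  have dq: "i + d * f ^ q < f ^ Suc q" if "i < f ^ q" "d < f" for i d
  proof -
    have "i + d * f ^ q < Suc d * f ^ q" using that by simp
    also have "\<dots> \<le> f * f ^ q" using that by (intro mult_right_mono) auto
    finally show ?thesis by simp
  qed
  define U where "U = (\<lambda>(i, t). (i, i, t)) ` (SIGMA i:{..<M}. ?X i) \<union>
    (\<lambda>(i, d). (i, i + d * f ^ q, Seed s)) ` ({..<f ^ q} \<times> {..<f})"
  have finX: "finite (?X i)" "card (?X i) \<le> card (Y i) + 1" if "i < M" for i
    using W[OF that] by (auto simp: with_seed_def card_insert_if)
  have Z: "bcast q i (?X i) = (\<lambda>u. (fst (snd u), snd (snd u))) ` {u \<in> U. fst u = i}" if "i < M" for i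
  proof -
    have "{u \<in> U. fst u = i} = (\<lambda>t. (i, i, t)) ` ?X i \<union> (if i < f ^ q then (\<lambda>d. (i, i + d * f ^ q, Seed s)) ` {..<f} else {})"
      using that by (auto simp: U_def)
    then show ?thesis using seed[OF that] by (auto simp: bcast_def image_Un image_image)
  qed
  show "fits M W wb (\<lambda>i. bcast q i (?X i))"
  proof (rule fits_indexed[where U=U and src=fst and dst="\<lambda>u. fst (snd u)" and fc="\<lambda>u. snd (snd u)"])
    show "finite U" unfolding U_def using finX by (intro finite_UnI finite_imageI finite_SigmaI) auto
    show "bcast q i (?X i) \<subseteq> (\<lambda>u. (fst (snd u), snd (snd u))) ` {u \<in> U. fst u = i}" if "i < M" for i
      using Z[OF that] by simp
    show "card {u \<in> U. fst u = i} \<le> W" if "i < M" for i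
    proof -
      have "{u \<in> U. fst u = i} \<subseteq> (\<lambda>t. (i, i, t)) ` ?X i \<union> (\<lambda>d. (i, i + d * f ^ q, Seed s)) ` {..<f}"
        by (auto simp: U_def)
      then have "card {u \<in> U. fst u = i} \<le> card ((\<lambda>t. (i, i, t)) ` ?X i \<union> (\<lambda>d. (i, i + d * f ^ q, Seed s)) ` {..<f})"
        using finX[OF that] by (intro card_mono) auto
      also have "\<dots> \<le> card ((\<lambda>t. (i, i, t)) ` ?X i) + card ((\<lambda>d. (i, i + d * f ^ q, Seed s)) ` {..<f})"
        by (rule card_Un_le)
      also have "\<dots> \<le> card (?X i) + card {..<f}"
        using finX[OF that] by (intro add_mono card_image_le) auto
      finally show ?thesis using finX[OF that] W[OF that] by simp
    qed
    show "card {u \<in> U. fst (snd u) = j} \<le> W" if "j < M" for j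
    proof -
      have "{u \<in> U. fst (snd u) = j} \<subseteq> (\<lambda>t. (j, j, t)) ` ?X j \<union> {(j mod f ^ q, j, Seed s)}"
        by (auto simp: U_def)
      then have "card {u \<in> U. fst (snd u) = j} \<le> card ((\<lambda>t. (j, j, t)) ` ?X j \<union> {(j mod f ^ q, j, Seed s)})"
        using finX[OF that] by (intro card_mono) auto
      also have "\<dots> \<le> card ((\<lambda>t. (j, j, t)) ` ?X j) + 1"
        by (rule order_trans[OF card_Un_le]) simp
      also have "\<dots> \<le> card (?X j) + 1"
        using finX[OF that] by (intro add_mono card_image_le) auto
      finally show ?thesis using finX[OF that] W[OF that] by simp
    qed
    show "fst (snd u) < M \<and> enc (snd (snd u)) < 2 ^ wb" if "u \<in> U" for u
    proof -
      have "fact_lt K (snd (snd u)) \<and> fst (snd u) < M"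
        using that lt less_le_trans[OF dq fM] by (auto simp: U_def with_seed_def split: if_splits)
      then show ?thesis using bits by blast
    qed
  qed
  fix c' assume h': "holds M (delivered M (\<lambda>i. bcast q i (?X i))) c'"
  have "delivered M (\<lambda>i. bcast q i (?X i)) j = with_seed Y s (f ^ Suc q) j" if j: "j < M" for j
  proof (intro equalityI subsetI)
    fix t assume "t \<in> delivered M (\<lambda>i. bcast q i (?X i)) j"
    then obtain i where i: "i < M" "(j, t) \<in> bcast q i (?X i)" by (auto simp: delivered_def)
    then consider "i = j" "t \<in> ?X j" | d where "j = i + d * f ^ q" "d < f" "i < f ^ q" "t = Seed s"
      using seed[OF i(1)] by (auto simp: bcast_def)
    then show "t \<in> with_seed Y s (f ^ Suc q) j"
    proof cases
      case 1
      have "f ^ q \<le> f ^ Suc q" using f by simp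
      then have "j < f ^ q \<Longrightarrow> j < f ^ Suc q" by linarith
      then show ?thesis using 1 by (auto simp: with_seed_def simp del: power_Suc split: if_splits)
    next
      case 2
      then show ?thesis using dq by (simp add: with_seed_def)
    qed
  next
    fix t assume t: "t \<in> with_seed Y s (f ^ Suc q) j"
    show "t \<in> delivered M (\<lambda>i. bcast q i (?X i)) j"
    proof (cases "t \<in> Y j")
      case True
      then show ?thesis using j by (auto simp: delivered_def bcast_def with_seed_def)
    next
      case False
      then have ts: "t = Seed s" "j < f ^ Suc q" using t by (auto simp: with_seed_def split: if_splits)
      define i where "i = j mod f ^ q"
      have i: "i < f ^ q" "j = i + (j div f ^ q) * f ^ q"
        using f mod_div_mult_eq[of j "f ^ q"] by (simp_all add: i_def)
      have "j div f ^ q < f" using ts(2) f by (simp add: div_less_iff_less_mult mult.commute)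
      moreover have "i < M" using i(1) j unfolding i_def by (meson le_less_trans mod_less_eq_dividend)
      ultimately have "(j, t) \<in> bcast q i (?X i)" "i < M"
        using i seed[of i s] ts(1) unfolding bcast_def by blast+
      then show ?thesis by (auto simp: delivered_def)
    qed
  qed
  then show "1 - e \<le> reach gs c' Q" using cont h' by (simp add: holds_def)
qed

definition bcasts :: "round_fun list" where
  "bcasts = map (\<lambda>q. fact_round facts_in (bcast q)) [0..<p]"

lemma bcast_phase:
  assumes Y: "\<And>i s. i < M \<Longrightarrow> Seed s \<notin> Y i"
    and W: "\<And>i. i < M \<Longrightarrow> finite (Y i) \<and> card (Y i) + f + 2 \<le> W"
    and lt: "\<And>i t. i < M \<Longrightarrow> t \<in> Y i \<Longrightarrow> fact_lt K t" "s < K"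
    and h: "holds M (with_seed Y s 1) c"
    and cont: "\<And>c'. holds M (\<lambda>i. insert (Seed s) (Y i)) c' \<Longrightarrow> 1 - e \<le> reach gs c' Q"
  shows "1 - e \<le> reach (bcasts @ gs) c Q"
proof -
  have "1 - e \<le> reach (map (\<lambda>q. fact_round facts_in (bcast q)) [p - k..<p] @ gs) c Q"
    if "k \<le> p" "holds M (with_seed Y s (f ^ (p - k))) c" for k c
    using that
  proof (induction k arbitrary: c)
    case 0
    have "holds M (\<lambda>i. insert (Seed s) (Y i)) c"
      using 0(2) by (auto simp: holds_def with_seed_def)
    then show ?case using cont by simp
  next
    case (Suc k)
    have eq: "[p - Suc k..<p] = (p - Suc k) # [p - k..<p]"
      using Suc.prems(1) by (subst upt_conv_Cons) (auto simp: Suc_diff_Suc)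
    have "Suc (p - Suc k) = p - k" using Suc.prems(1) by simp
    then show ?case unfolding eq list.map append_Cons
      using Suc by (intro bcast_step[OF _ Y W lt Suc.prems(2)]) auto
  qed
  from this[of p c] h show ?thesis by (simp add: bcasts_def)
qed

end

section \<open>Counting of messages, and cycles under injective relabelling\<close>

lemma fits_triples:
  assumes "finite U" and Z: "\<And>i j t. i < M \<Longrightarrow> (j, t) \<in> Z i \<longleftrightarrow> (i, j, t) \<in> U"
    and sent: "\<And>i. i < M \<Longrightarrow> card {u \<in> U. fst u = i} \<le> W"
    and received: "\<And>j. j < M \<Longrightarrow> card {u \<in> U. fst (snd u) = j} \<le> W"
    and ok: "\<And>i j t. (i, j, t) \<in> U \<Longrightarrow> j < M \<and> enc t < 2 ^ wb"
  shows "fits M W wb Z"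
proof (rule fits_indexed[where U=U and src=fst and dst="\<lambda>u. fst (snd u)" and fc="\<lambda>u. snd (snd u)"])
  show "Z i \<subseteq> (\<lambda>u. (fst (snd u), snd (snd u))) ` {u \<in> U. fst u = i}" if "i < M" for i
  proof
    fix z assume "z \<in> Z i"
    then have "(i, fst z, snd z) \<in> U" using Z[OF that, of "fst z" "snd z"] by simp
    then show "z \<in> (\<lambda>u. (fst (snd u), snd (snd u))) ` {u \<in> U. fst u = i}"
      by (intro image_eqI[of _ _ "(i, fst z, snd z)"]) auto
  qed
  show "fst (snd u) < M \<and> enc (snd (snd u)) < 2 ^ wb" if "u \<in> U" for u
    using ok[of "fst u" "fst (snd u)" "snd (snd u)"] that by simp
qed (use assms in auto)

lemma card_filter_union_le:
  assumes "finite A" "finite B"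
  shows "card {u \<in> A \<union> B. P u} \<le> card {u \<in> A. P u} + card {u \<in> B. P u}"
proof -
  have "{u \<in> A \<union> B. P u} = {u \<in> A. P u} \<union> {u \<in> B. P u}" by auto
  then show ?thesis using card_Un_le by metis
qed

lemma card_filter_image_le:
  assumes "finite A"
  shows "card {u \<in> g ` A. P u} \<le> card {a \<in> A. P (g a)}"
proof -
  have "{u \<in> g ` A. P u} = g ` {a \<in> A. P (g a)}" by auto
  then show ?thesis using assms by (simp add: card_image_le)
qed

lemma card_filter_single_le: "finite A \<Longrightarrow> (\<And>a b. a \<in> A \<Longrightarrow> b \<in> A \<Longrightarrow> P a \<Longrightarrow> P b \<Longrightarrow> a = b) \<Longrightarrow> card {a \<in> A. P a} \<le> 1"
  by (metis (mono_tags, lifting) card_le_Suc0_iff_eq finite_Collect_conjI mem_Collect_eq One_nat_def finite_subset subsetI)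

lemma cyc_nth_map: "xs \<noteq> [] \<Longrightarrow> cyc_nth (map g xs) i = g (cyc_nth xs i)"
  by (simp add: cyc_nth_def nth_map nat_less_iff)

lemma good_cycles_map:
  assumes "good_cycles css" "inj_on g (cycles_verts css)"
  shows "good_cycles (map (map g) css)" "cycles_verts (map (map g) css) = g ` cycles_verts css"
    and "v \<in> cycles_verts css \<Longrightarrow> nbs (cycles_edges (map (map g) css)) (g v) = g ` nbs (cycles_edges css) v"
    and "adj_pairs (map (map g) css) = map_prod g g ` adj_pairs css"
proof -
  show good: "good_cycles (map (map g) css)"
    using assms by (auto simp: good_cycles_def distinct_map simp flip: map_concat)
  show verts: "cycles_verts (map (map g) css) = g ` cycles_verts css"
    by (simp flip: map_concat)
  show nb: "nbs (cycles_edges (map (map g) css)) (g v) = g ` nbs (cycles_edges css) v" if v: "v \<in> cycles_verts css" for v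
  proof -
    obtain xs i where xs: "xs \<in> set css" "v = cyc_nth xs i" using cycles_vertsE[OF v] by blast
    have "map g xs \<in> set (map (map g) css)" using xs(1) by simp
    from nbs_cycles_edges[OF good this, of i] nbs_cycles_edges[OF assms(1) xs(1), of i]
    show ?thesis using xs(2) good_cyclesD(2)[OF assms(1) xs(1)] by (simp add: cyc_nth_map)
  qed
  show "adj_pairs (map (map g) css) = map_prod g g ` adj_pairs css"
    unfolding adj_pairs(1)[OF good] adj_pairs(1)[OF assms(1)] verts
  proof (intro equalityI subsetI)
    fix z assume "z \<in> (SIGMA v:g ` cycles_verts css. nbs (cycles_edges (map (map g) css)) v)"
    then obtain v u where "z = (g v, g u)" "v \<in> cycles_verts css" "u \<in> nbs (cycles_edges css) v"
      using nb by auto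
    then show "z \<in> map_prod g g ` (SIGMA v:cycles_verts css. nbs (cycles_edges css) v)"
      by (intro image_eqI[of _ _ "(v, u)"]) auto
  qed (use nb in auto)
qed

context net
begin

subsection \<open>Renaming the remaining vertices\<close>

text \<open>Renaming is needed because surviving labels are scattered below \<open>n\<close>,
  whereas the sampler accepts labels below \<open>N\<close> only. Vertices are gathered by a
  balanced hash, numbered on their machine, and neighbours exchange the new names.\<close>

definition move_step :: "(nat \<Rightarrow> nat \<Rightarrow> nat) \<Rightarrow> nat \<Rightarrow> fact set \<Rightarrow> (nat \<times> fact) set" where
  "move_step H i X = {(i, Seed s) | s. Seed s \<in> X} \<union> {(H s v, Edge v v u) | s v u. Seed s \<in> X \<and> Edge v v u \<in> X}"

definition rank_in :: "fact set \<Rightarrow> nat \<Rightarrow> nat" where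
  "rank_in X v = card {v'. v' < v \<and> (\<exists>u. Edge v' v' u \<in> X)}"

definition name_step :: "nat \<Rightarrow> (nat \<Rightarrow> nat \<Rightarrow> nat) \<Rightarrow> nat \<Rightarrow> fact set \<Rightarrow> (nat \<times> fact) set" where
  "name_step slots H i X = Pair i ` X \<union>
     {(H s w, Name v (i * slots + rank_in X v)) | s v w.
        Seed s \<in> X \<and> (\<exists>u. Edge v v u \<in> X) \<and> (w = v \<or> Edge v v w \<in> X)}"

definition relabel_step :: "nat \<Rightarrow> nat \<Rightarrow> fact set \<Rightarrow> (nat \<times> fact) set" where
  "relabel_step m i X = {(a mod m, Edge a a b) | v u a b. Edge v v u \<in> X \<and> Name v a \<in> X \<and> Name u b \<in> X}"

definition rename_phase_prog :: "nat \<Rightarrow> (nat \<Rightarrow> nat \<Rightarrow> nat) \<Rightarrow> nat \<Rightarrow> nat \<Rightarrow> round_fun list" where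
  "rename_phase_prog S H slots m = seed_round S facts_in # bcasts @
     [fact_round facts_in (move_step H), fact_round facts_in (name_step slots H), fact_round facts_in (relabel_step m)]"

lemma rename_moves:
  fixes css slots m h s H
  defines "V \<equiv> cycles_verts css" and "nb \<equiv> nbs (cycles_edges css)"
  assumes good: "good_cycles css" and n: "V \<subseteq> {..<n}" "n \<le> K" and s: "s < K"
    and H: "\<And>v. H s v < M" and bal: "\<And>j. j < M \<Longrightarrow> card {v \<in> V. H s v = j} \<le> slots"
    and h: "M * slots \<le> h" "h \<le> K" and m: "0 < m" "m \<le> M"
    and W: "2 * (n div M + 1) + 1 \<le> W" "5 * slots + 1 \<le> W" "2 * (h div m + 1) \<le> W"
    and hold: "holds M (\<lambda>i. insert (Seed s) (adj_facts M css i)) c"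
    and cont: "\<And>css' c'. good_cycles css' \<Longrightarrow> map length css' = map length css \<Longrightarrow> cycles_verts css' \<subseteq> {..<h} \<Longrightarrow>
       holds M (adj_facts m css') c' \<Longrightarrow> 1 - e \<le> reach gs c' Q"
  shows "1 - e \<le> reach ([fact_round facts_in (move_step H), fact_round facts_in (name_step slots H),
     fact_round facts_in (relabel_step m)] @ gs) c Q"
proof -
  let ?P = "adj_pairs css"
  have finV: "finite V" by (simp add: V_def)
  have finP: "finite ?P" by (rule adj_pairs(2)[OF good])
  have P: "?P = (SIGMA v:V. nb v)" unfolding V_def nb_def by (rule adj_pairs(1)[OF good])
  have Vn: "v < K" if "v \<in> V" for v using that n by auto
  have nbV: "nb v \<subseteq> V" for v unfolding nb_def V_def by (rule nbs_subset_verts(1)[OF good])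
  have nb0: "v \<in> V \<longleftrightarrow> nb v \<noteq> {}" for v
  proof
    assume "v \<in> V"
    then obtain xs i where "xs \<in> set css" "v = cyc_nth xs i" unfolding V_def by (rule cycles_vertsE)
    then show "nb v \<noteq> {}" unfolding nb_def using nbs_cycles_edges[OF good] by auto
  qed (use nbs_subset_verts(2)[OF good] in \<open>auto simp: V_def nb_def\<close>)
  \<comment> \<open>Exchanging the two ends of a message reduces the receiving load to the sending
    load.\<close>
  have mem: "v \<in> V \<and> w \<in> insert v (nb v) \<longleftrightarrow> w \<in> V \<and> v \<in> insert w (nb w)" for v w
    using nbV nbs_sym[of v "cycles_edges css" w] unfolding nb_def by blast
  have nb2: "card (nb v) \<le> 2" "finite (nb v)" for v unfolding nb_def by (rule card_nbs_le[OF good])+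
  have nb3: "finite (insert v (nb v))" "card (insert v (nb v)) \<le> 3" for v
    using nb2[of v] by (auto simp: card_insert_if)
  have cardPH: "card {q \<in> ?P. H s (fst q) = j} \<le> 2 * slots" if "j < M" for j
  proof -
    have "{q \<in> ?P. H s (fst q) = j} = {q \<in> ?P. fst q \<in> {v \<in> V. H s v = j}}" by (auto simp: P)
    also have "card \<dots> \<le> 2 * card ({v \<in> V. H s v = j} \<inter> cycles_verts css)"
      using finV by (intro adj_pairs(3)[OF good]) auto
    also have "{v \<in> V. H s v = j} \<inter> cycles_verts css = {v \<in> V. H s v = j}" by (auto simp: V_def)
    finally show ?thesis using bal[OF that] by simp
  qed
  define X0 where "X0 = (\<lambda>i. insert (Seed s) (adj_facts M css i))"
  define X1 where "X1 = (\<lambda>i. insert (Seed s) {Edge v v u | v u. H s v = i \<and> u \<in> nb v})"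
  \<comment> \<open>Each machine owns a block of \<open>slots\<close> labels and assigns ranks
    within it. Division by \<open>slots\<close> recovers the machine, which gives injectivity across
    machines.\<close>
  define nu where "nu v = H s v * slots + card {v' \<in> V. v' < v \<and> H s v' = H s v}" for v
  define X2 where "X2 = (\<lambda>i. X1 i \<union> {Name v (nu v) | v w. w \<in> V \<and> H s w = i \<and> v \<in> insert w (nb w)})"
  have rank: "rank_in (X1 i) v = card {v' \<in> V. v' < v \<and> H s v' = i}" for i v
  proof -
    have "{v'. v' < v \<and> (\<exists>u. Edge v' v' u \<in> X1 i)} = {v' \<in> V. v' < v \<and> H s v' = i}"
      using nb0 by (auto simp: X1_def)
    then show ?thesis by (simp add: rank_in_def)
  qed
  have rank_lt: "card {v' \<in> V. v' < v \<and> H s v' = H s v} < slots" if "v \<in> V" for v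
  proof -
    have "{v' \<in> V. v' < v \<and> H s v' = H s v} \<subset> {v' \<in> V. H s v' = H s v}" using that by auto
    then have "card {v' \<in> V. v' < v \<and> H s v' = H s v} < card {v' \<in> V. H s v' = H s v}"
      using finV by (intro psubset_card_mono) auto
    then show ?thesis using bal[OF H, of v] by simp
  qed
  have nu_div: "nu v div slots = H s v" if "v \<in> V" for v
    using rank_lt[OF that] by (simp add: nu_def)
  have inj: "inj_on nu V"
  proof (rule inj_onI)
    have key: "nu v \<noteq> nu w" if "v \<in> V" "w \<in> V" "v < w" for v w
    proof
      assume eq: "nu v = nu w"
      then have Heq: "H s v = H s w" using nu_div that by metis
      have "{v' \<in> V. v' < v \<and> H s v' = H s v} \<subset> {v' \<in> V. v' < w \<and> H s v' = H s w}"
        using that Heq by auto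
      then have "card {v' \<in> V. v' < v \<and> H s v' = H s v} < card {v' \<in> V. v' < w \<and> H s v' = H s w}"
        using finV by (intro psubset_card_mono) auto
      then show False using eq Heq by (simp add: nu_def)
    qed
    fix v w assume "v \<in> V" "w \<in> V" "nu v = nu w"
    then show "v = w" using key[of v w] key[of w v] by (metis linorder_neqE_nat)
  qed
  have nu_lt: "nu v < h" if "v \<in> V" for v
  proof -
    have "nu v < H s v * slots + slots" using rank_lt[OF that] by (simp add: nu_def)
    also have "\<dots> = Suc (H s v) * slots" by simp
    also have "\<dots> \<le> M * slots" using H[of v] by (intro mult_right_mono) auto
    finally show ?thesis using h by simp
  qed
  define css' where "css' = map (map nu) css"
  note gm = good_cycles_map[OF good inj[unfolded V_def], folded css'_def]
  have verts': "cycles_verts css' \<subseteq> {..<h}" unfolding gm(2) using nu_lt by (auto simp: V_def)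
  have step3: "1 - e \<le> reach (fact_round facts_in (relabel_step m) # gs) c Q" if "holds M X2 c" for c
  proof (rule prob_reach_fact_round[OF that])
    have E2: "Edge v v u \<in> X2 i \<longleftrightarrow> H s v = i \<and> u \<in> nb v" for v u i by (auto simp: X2_def X1_def)
    have N2: "Name v a \<in> X2 i \<longleftrightarrow> a = nu v \<and> (\<exists>w\<in>V. H s w = i \<and> v \<in> insert w (nb w))" for v a i
      by (auto simp: X2_def X1_def)
    have Z: "relabel_step m i (X2 i) =
        (\<lambda>q. (fst q mod m, Edge (fst q) (fst q) (snd q))) ` {q \<in> adj_pairs css'. fst q div slots = i}" for i
    proof (intro equalityI subsetI)
      fix z assume "z \<in> relabel_step m i (X2 i)"
      then obtain v u where *: "z = (nu v mod m, Edge (nu v) (nu v) (nu u))" "H s v = i" "u \<in> nb v"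
        unfolding relabel_step_def E2 N2 by blast
      then have v: "v \<in> V" using nb0 by blast
      then have "(nu v, nu u) \<in> {q \<in> adj_pairs css'. fst q div slots = i}"
        using * nu_div[OF v] unfolding gm(4) P by auto
      then show "z \<in> (\<lambda>q. (fst q mod m, Edge (fst q) (fst q) (snd q))) ` {q \<in> adj_pairs css'. fst q div slots = i}"
        using *(1) by (force intro: rev_image_eqI)
    next
      fix z assume "z \<in> (\<lambda>q. (fst q mod m, Edge (fst q) (fst q) (snd q))) ` {q \<in> adj_pairs css'. fst q div slots = i}"
      then obtain v u where *: "z = (nu v mod m, Edge (nu v) (nu v) (nu u))" "v \<in> V" "u \<in> nb v" "nu v div slots = i"
        unfolding gm(4) P by auto
      then have "H s v = i" using nu_div by simp
      then show "z \<in> relabel_step m i (X2 i)" unfolding relabel_step_def E2 N2 using * by blast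
    qed
    have sent: "card {q \<in> adj_pairs css'. fst q div slots = i} \<le> W" if "i < M" for i
    proof -
      have "card {q \<in> adj_pairs css'. fst q div slots = i} \<le> card {q \<in> ?P. fst (map_prod nu nu q) div slots = i}"
        unfolding gm(4) by (rule card_filter_image_le[OF finP])
      also have "{q \<in> ?P. fst (map_prod nu nu q) div slots = i} = {q \<in> ?P. H s (fst q) = i}"
        using nu_div by (auto simp: P)
      finally show ?thesis using cardPH[OF that] W(2) by simp
    qed
    have own: "fst q div slots < M" if q: "q \<in> adj_pairs css'" for q
      using q H nu_div unfolding gm(4) P by auto
    note D = deliver_adj_facts[OF gm(1) verts' h(2) m own Z sent W(3)]
    show "fits M W wb (\<lambda>i. relabel_step m i (X2 i))" by (rule D(1))
    fix c' assume "holds M (delivered M (\<lambda>i. relabel_step m i (X2 i))) c'"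
    then have "holds M (adj_facts m css') c'" using D(2) by simp
    then show "1 - e \<le> reach gs c' Q"
      using gm(1) verts' by (intro cont[of css']) (auto simp: css'_def)
  qed
  have seed1: "Seed s' \<in> X1 i \<longleftrightarrow> s' = s" for s' i by (auto simp: X1_def)
  have finX1: "finite (X1 i)" "card (X1 i) \<le> 2 * slots + 1" if "i < M" for i
  proof -
    have eq: "X1 i = insert (Seed s) ((\<lambda>q. Edge (fst q) (fst q) (snd q)) ` {q \<in> ?P. H s (fst q) = i})"
      using nb0 by (force simp: X1_def P)
    show "finite (X1 i)" unfolding eq using finP by simp
    have "card (X1 i) \<le> Suc (card ((\<lambda>q. Edge (fst q) (fst q) (snd q)) ` {q \<in> ?P. H s (fst q) = i}))"
      unfolding eq by (rule card_insert_le_m1) auto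
    also have "\<dots> \<le> Suc (card {q \<in> ?P. H s (fst q) = i})" using finP by (simp add: card_image_le)
    finally show "card (X1 i) \<le> 2 * slots + 1" using cardPH[OF that] by simp
  qed
  have ltX1: "fact_lt K t" if "t \<in> X1 i" for t i
    using that s Vn nbV nb0 by (fastforce simp: X1_def)
  have step2: "1 - e \<le> reach (fact_round facts_in (name_step slots H) # fact_round facts_in (relabel_step m) # gs) c Q"
    if "holds M X1 c" for c
  proof (rule prob_reach_fact_round[OF that])
    define U1 where "U1 = (\<lambda>(i, t). (i, i, t)) ` (SIGMA i:{..<M}. X1 i)"
    define U2 where "U2 = (\<lambda>(v, w). (H s v, H s w, Name v (nu v))) ` (SIGMA v:V. insert v (nb v))"
    have fin: "finite U1" "finite U2"
      unfolding U1_def U2_def using finX1 finV nb3 by (auto intro!: finite_imageI finite_SigmaI)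
    have Z: "(j, t) \<in> name_step slots H i (X1 i) \<longleftrightarrow> (i, j, t) \<in> U1 \<union> U2" if i: "i < M" for i j t
    proof -
      have ex: "(\<exists>u. Edge v v u \<in> X1 i) \<longleftrightarrow> v \<in> V \<and> H s v = i" for v
        using nb0 by (auto simp: X1_def)
      have e: "Edge v v w \<in> X1 i \<longleftrightarrow> H s v = i \<and> w \<in> nb v" for v w by (auto simp: X1_def)
      have "(j, t) \<in> name_step slots H i (X1 i) \<longleftrightarrow>
        (j = i \<and> t \<in> X1 i) \<or> (\<exists>v w. j = H s w \<and> t = Name v (i * slots + rank_in (X1 i) v) \<and> v \<in> V \<and> H s v = i \<and> w \<in> insert v (nb v))"
        unfolding name_step_def ex unfolding e seed1 by auto
      also have "\<dots> \<longleftrightarrow> (i, j, t) \<in> U1 \<union> U2"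
        unfolding rank U1_def U2_def nu_def using i by (auto simp: image_iff)
      finally show ?thesis .
    qed
    show "fits M W wb (\<lambda>i. name_step slots H i (X1 i))"
    proof (rule fits_triples[OF _ Z])
      show "finite (U1 \<union> U2)" using fin by simp
      have V3: "card (SIGMA v:{v \<in> V. H s v = i}. insert v (nb v)) \<le> 3 * slots" if "i < M" for i
      proof -
        have "card (SIGMA v:{v \<in> V. H s v = i}. insert v (nb v)) \<le> card {v \<in> V. H s v = i} * 3"
          using finV nb3 by (intro card_Sigma_le) auto
        then show ?thesis using bal[OF that] by simp
      qed
      show "card {u \<in> U1 \<union> U2. fst u = i} \<le> W" if i: "i < M" for i
      proof -
        have "card {u \<in> U1. fst u = i} \<le> card (Pair i ` X1 i)"
          unfolding U1_def using finX1 i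
          by (intro order_trans[OF card_filter_image_le] card_mono) auto
        also have "\<dots> \<le> card (X1 i)" using finX1[OF i] by (intro card_image_le)
        finally have a: "card {u \<in> U1. fst u = i} \<le> 2 * slots + 1" using finX1[OF i] by simp
        have "card {u \<in> U2. fst u = i} \<le> card {x \<in> (SIGMA v:V. insert v (nb v)). fst (case x of (v, w) \<Rightarrow> (H s v, H s w, Name v (nu v))) = i}"
          unfolding U2_def using finV nb3 by (intro card_filter_image_le) auto
        also have "{x \<in> (SIGMA v:V. insert v (nb v)). fst (case x of (v, w) \<Rightarrow> (H s v, H s w, Name v (nu v))) = i} =
            (SIGMA v:{v \<in> V. H s v = i}. insert v (nb v))" by auto
        finally show ?thesis using a V3[OF i] W(2) card_filter_union_le[OF fin, of "\<lambda>u. fst u = i"] by linarith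
      qed
      show "card {u \<in> U1 \<union> U2. fst (snd u) = j} \<le> W" if j: "j < M" for j
      proof -
        have "card {u \<in> U1. fst (snd u) = j} \<le> card (Pair j ` X1 j)"
          unfolding U1_def using finX1 j
          by (intro order_trans[OF card_filter_image_le] card_mono) auto
        also have "\<dots> \<le> card (X1 j)" using finX1[OF j] by (intro card_image_le)
        finally have a: "card {u \<in> U1. fst (snd u) = j} \<le> 2 * slots + 1" using finX1[OF j] by simp
        have "card {u \<in> U2. fst (snd u) = j} \<le> card {x \<in> (SIGMA v:V. insert v (nb v)). fst (snd (case x of (v, w) \<Rightarrow> (H s v, H s w, Name v (nu v)))) = j}"
          unfolding U2_def using finV nb3 by (intro card_filter_image_le) auto
        also have "{x \<in> (SIGMA v:V. insert v (nb v)). fst (snd (case x of (v, w) \<Rightarrow> (H s v, H s w, Name v (nu v)))) = j} =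
            prod.swap ` (SIGMA v:{v \<in> V. H s v = j}. insert v (nb v))"
        proof (rule set_eqI)
          fix x :: "nat \<times> nat"
          obtain v w where x: "x = (v, w)" by force
          have "(v, w) \<in> prod.swap ` (SIGMA v:{v \<in> V. H s v = j}. insert v (nb v)) \<longleftrightarrow>
              w \<in> V \<and> H s w = j \<and> v \<in> insert w (nb w)" by force
          then show "x \<in> {x \<in> (SIGMA v:V. insert v (nb v)). fst (snd (case x of (v, w) \<Rightarrow> (H s v, H s w, Name v (nu v)))) = j} \<longleftrightarrow>
              x \<in> prod.swap ` (SIGMA v:{v \<in> V. H s v = j}. insert v (nb v))"
            using mem[of v w] unfolding x by auto
        qed
        also have "card \<dots> \<le> card (SIGMA v:{v \<in> V. H s v = j}. insert v (nb v))"
          using finV nb3 by (intro card_image_le) auto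
        finally show ?thesis using a V3[OF j] W(2) card_filter_union_le[OF fin, of "\<lambda>u. fst (snd u) = j"] by linarith
      qed
      fix i j t assume u: "(i, j, t) \<in> U1 \<union> U2"
      have "fact_lt K t \<and> j < M"
      proof (cases "(i, j, t) \<in> U1")
        case True
        then show ?thesis using ltX1 by (auto simp: U1_def)
      next
        case False
        then obtain v where "v \<in> V" "t = Name v (nu v)" "j < M" using u H by (auto simp: U2_def)
        then show ?thesis using Vn nu_lt[of v] h(2) by auto
      qed
      then show "j < M \<and> enc t < 2 ^ wb" using bits by blast
    qed
    fix c' assume h': "holds M (delivered M (\<lambda>i. name_step slots H i (X1 i))) c'"
    have "delivered M (\<lambda>i. name_step slots H i (X1 i)) j = X2 j" if j: "j < M" for j
    proof -
      have "t \<in> delivered M (\<lambda>i. name_step slots H i (X1 i)) j \<longleftrightarrow> (\<exists>i<M. (i, j, t) \<in> U1 \<union> U2)" for t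
        using Z by (auto simp: delivered_def)
      also have "(\<exists>i<M. (i, j, t) \<in> U1 \<union> U2) \<longleftrightarrow> t \<in> X2 j" for t
      proof -
        have "(\<exists>i<M. (i, j, t) \<in> U1 \<union> U2) \<longleftrightarrow>
            t \<in> X1 j \<or> (\<exists>v w. (v \<in> V \<and> w \<in> insert v (nb v)) \<and> H s w = j \<and> t = Name v (nu v))"
          unfolding U1_def U2_def using j H by (auto simp: image_iff)
        also have "\<dots> \<longleftrightarrow> t \<in> X1 j \<or> (\<exists>v w. (w \<in> V \<and> v \<in> insert w (nb w)) \<and> H s w = j \<and> t = Name v (nu v))"
          by (intro arg_cong2[where f="(\<or>)"] arg_cong2[where f="(\<and>)"] ex_cong1 refl mem)
        also have "\<dots> \<longleftrightarrow> t \<in> X2 j" unfolding X2_def by blast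
        finally show ?thesis .
      qed
      finally show ?thesis by blast
    qed
    then have "holds M X2 c'" using h' by (simp add: holds_def)
    then show "1 - e \<le> reach (fact_round facts_in (relabel_step m) # gs) c' Q" by (rule step3)
  qed
  have "1 - e \<le> reach (fact_round facts_in (move_step H) # fact_round facts_in (name_step slots H) # fact_round facts_in (relabel_step m) # gs) c Q"
  proof (rule prob_reach_fact_round)
    show "holds M X0 c" using hold by (simp add: X0_def)
    define U1 where "U1 = (\<lambda>i. (i, i, Seed s)) ` {..<M}"
    define U2 where "U2 = (\<lambda>(v, u). (v mod M, H s v, Edge v v u)) ` ?P"
    have fin: "finite U1" "finite U2" unfolding U1_def U2_def using finP by auto
    have Z: "(j, t) \<in> move_step H i (X0 i) \<longleftrightarrow> (i, j, t) \<in> U1 \<union> U2" if i: "i < M" for i j t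
    proof -
      have "Seed s' \<in> X0 i \<longleftrightarrow> s' = s" "Edge v v u \<in> X0 i \<longleftrightarrow> v mod M = i \<and> (v, u) \<in> ?P" for s' v u
        by (auto simp: X0_def adj_facts_def adj_pairs_def)
      then show ?thesis unfolding move_step_def U1_def U2_def using i by (auto simp: image_iff)
    qed
    show "fits M W wb (\<lambda>i. move_step H i (X0 i))"
    proof (rule fits_triples[OF _ Z])
      show "finite (U1 \<union> U2)" using fin by simp
      show "card {u \<in> U1 \<union> U2. fst u = i} \<le> W" if i: "i < M" for i
      proof -
        have "card {u \<in> U1. fst u = i} \<le> 1" unfolding U1_def by (intro card_filter_single_le) auto
        moreover have "card {u \<in> U2. fst u = i} \<le> card {q \<in> ?P. fst q mod M = i}"
          unfolding U2_def using finP by (intro order_trans[OF card_filter_image_le] card_mono) auto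
        moreover have "card {q \<in> ?P. fst q mod M = i} \<le> 2 * (n div M + 1)"
          using card_adj_pairs_home[OF good _ M] n(1) by (simp add: V_def)
        ultimately show ?thesis using W(1) card_filter_union_le[OF fin, of "\<lambda>u. fst u = i"] by linarith
      qed
      show "card {u \<in> U1 \<union> U2. fst (snd u) = j} \<le> W" if j: "j < M" for j
      proof -
        have "card {u \<in> U1. fst (snd u) = j} \<le> 1" unfolding U1_def by (intro card_filter_single_le) auto
        moreover have "card {u \<in> U2. fst (snd u) = j} \<le> card {q \<in> ?P. H s (fst q) = j}"
          unfolding U2_def using finP by (intro order_trans[OF card_filter_image_le] card_mono) auto
        ultimately show ?thesis
          using W(2) cardPH[OF j] card_filter_union_le[OF fin, of "\<lambda>u. fst (snd u) = j"] by linarith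
      qed
      fix i j t assume u: "(i, j, t) \<in> U1 \<union> U2"
      have "fact_lt K t \<and> j < M"
        using u s Vn nbV H by (fastforce simp: U1_def U2_def P)
      then show "j < M \<and> enc t < 2 ^ wb" using bits by blast
    qed
    fix c' assume h': "holds M (delivered M (\<lambda>i. move_step H i (X0 i))) c'"
    have "delivered M (\<lambda>i. move_step H i (X0 i)) j = X1 j" if j: "j < M" for j
    proof -
      have "t \<in> delivered M (\<lambda>i. move_step H i (X0 i)) j \<longleftrightarrow> (\<exists>i<M. (i, j, t) \<in> U1 \<union> U2)" for t
        using Z by (auto simp: delivered_def)
      also have "(\<exists>i<M. (i, j, t) \<in> U1 \<union> U2) \<longleftrightarrow> t \<in> X1 j" for t
        unfolding X1_def U1_def U2_def using j M nb0 by (auto simp: image_iff P)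
      finally show ?thesis by blast
    qed
    then have "holds M X1 c'" using h' by (simp add: holds_def)
    then show "1 - e \<le> reach (fact_round facts_in (name_step slots H) # fact_round facts_in (relabel_step m) # gs) c' Q"
      by (rule step2)
  qed
  then show ?thesis by simp
qed

text \<open>The new labels depend on the random seed, so the rest of the program must succeed on
  every cycle system with the same lengths and labels below \<open>h\<close>.\<close>

lemma rename_phase:
  assumes good: "good_cycles css" and n: "cycles_verts css \<subseteq> {..<n}" "n \<le> K" and S: "0 < S" "S \<le> K"
    and H: "\<And>s v. H s v < M"
    and bal: "real (card {s. s < S \<and> \<not> (\<forall>j<M. card {v \<in> cycles_verts css. H s v = j} \<le> slots)}) \<le> d * real S"
    and h: "M * slots \<le> h" "h \<le> K" and m: "0 < m" "m \<le> M"
    and W: "2 * (n div M + 1) + f + 2 \<le> W" "5 * slots + 1 \<le> W" "2 * (h div m + 1) \<le> W"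
    and hold: "holds M (adj_facts M css) c" and e: "0 \<le> e"
    and cont: "\<And>css' c'. good_cycles css' \<Longrightarrow> map length css' = map length css \<Longrightarrow> cycles_verts css' \<subseteq> {..<h} \<Longrightarrow>
       holds M (adj_facts m css') c' \<Longrightarrow> 1 - e \<le> reach gs c' Q"
  shows "1 - (d + e) \<le> reach (rename_phase_prog S H slots m @ gs) c Q"
proof -
  let ?Y = "adj_facts M css"
  have Y: "?Y i = (\<lambda>q. Edge (fst q) (fst q) (snd q)) ` {q \<in> adj_pairs css. fst q mod M = i}" for i
    unfolding adj_facts_def adj_pairs_def by force
  have cY: "finite (?Y i) \<and> card (?Y i) + f + 2 \<le> W" for i
  proof
    show "finite (?Y i)" unfolding Y using adj_pairs(2)[OF good] by simp
    have "card (?Y i) \<le> card {q \<in> adj_pairs css. fst q mod M = i}"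
      unfolding Y using adj_pairs(2)[OF good] by (intro card_image_le) simp
    then show "card (?Y i) + f + 2 \<le> W" using card_adj_pairs_home[OF good n(1) M, of i] W(1) by linarith
  qed
  have ltY: "fact_lt K t" if "t \<in> ?Y i" for t i
  proof -
    obtain v u where t: "t = Edge v v u" "u \<in> nbs (cycles_edges css) v" using \<open>t \<in> ?Y i\<close> by (auto simp: adj_facts_def)
    have "v \<in> cycles_verts css" "u \<in> cycles_verts css"
      using t(2) nbs_subset_verts[OF good, of v] by auto
    then show ?thesis using t(1) n by auto
  qed
  have W1: "2 * (n div M + 1) + 1 \<le> W" using W(1) by simp
  show ?thesis
    unfolding rename_phase_prog_def append_Cons
  proof (rule prob_reach_seed_round[OF M S(1), where X="?Y"])
    show "facts_in (fst (c i)) (snd (c i)) = ?Y i" if "i < M" for i using hold that by (simp add: holds_def)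
    show "finite (?Y i) \<and> card (?Y i) + 1 \<le> W" for i using cY[of i] by simp
    show "enc t < 2 ^ wb" if "t \<in> ?Y i" for i t using ltY[OF that] bits by blast
    show "enc (Seed s) < 2 ^ wb" if "s < S" for s using that S(2) bits[of "Seed s"] by simp
    show "real (card {s. s < S \<and> \<not> (\<forall>j<M. card {v \<in> cycles_verts css. H s v = j} \<le> slots)}) \<le> d * real S"
      by (rule bal)
    fix s c' assume s: "s < S" "\<forall>j<M. card {v \<in> cycles_verts css. H s v = j} \<le> slots"
      and h': "holds M (with_seed ?Y s 1) c'"
    show "1 - e \<le> reach ((bcasts @ [fact_round facts_in (move_step H), fact_round facts_in (name_step slots H),
         fact_round facts_in (relabel_step m)]) @ gs) c' Q"
      unfolding append_assoc
    proof (rule bcast_phase[OF _ _ _ _ h'])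
      show "Seed s' \<notin> ?Y i" for i s' by (auto simp: adj_facts_def)
      show "s < K" using s S by simp
      fix c'' assume h'': "holds M (\<lambda>i. insert (Seed s) (?Y i)) c''"
      show "1 - e \<le> reach ([fact_round facts_in (move_step H), fact_round facts_in (name_step slots H),
         fact_round facts_in (relabel_step m)] @ gs) c'' Q"
        by (rule rename_moves[OF good n _ H _ h m W1 W(2,3) h'' cont]) (use s S in auto)
    qed (use cY ltY in auto)
  qed (rule e)
qed

end

section \<open>Running the walk sampler\<close>

subsection \<open>The input graph\<close>

text \<open>Vertices outside the cycles are attached as pendant vertices, so that no vertex is isolated.\<close>

definition pads :: "nat \<Rightarrow> (nat \<times> nat) list" where
  "pads N = map (\<lambda>u. (u, min (u - N div 2) (N div 2 - 1))) [N div 2..<N]"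

definition padded :: "nat \<Rightarrow> nat list list \<Rightarrow> nat set set" where
  "padded N css = cycles_edges css \<union> (\<lambda>(u, v). {u, v}) ` set (pads N)"

text \<open>Every machine writes its part without communication: a pendant edge by the residue of
  the pendant vertex, a cycle edge at the home of its smaller end.\<close>

definition padded_input :: "nat \<Rightarrow> nat \<Rightarrow> fact set \<Rightarrow> nat \<Rightarrow> (nat \<times> nat) list" where
  "padded_input m N X i = filter (\<lambda>(u, v). u mod m = i) (pads N) @ list_of {(v, u). Edge v v u \<in> X \<and> v < u}"

lemma set_pads: "4 \<le> N \<Longrightarrow> (u, v) \<in> set (pads N) \<longleftrightarrow> N div 2 \<le> u \<and> u < N \<and> v = min (u - N div 2) (N div 2 - 1)"
  by (auto simp: pads_def)

text \<open>The truncation by \<open>min\<close> acts only on the last vertex of an odd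
  \<open>N\<close>, which would otherwise be attached to \<open>N div 2\<close> in the upper
  half.\<close>

lemma pads_lt: "4 \<le> N \<Longrightarrow> (u, v) \<in> set (pads N) \<Longrightarrow> v < N div 2 \<and> N div 2 \<le> u \<and> u < N"
proof -
  assume *: "4 \<le> N" "(u, v) \<in> set (pads N)"
  then have "2 \<le> N div 2" by simp
  moreover have "v \<le> N div 2 - 1" using *(2) by (auto simp: pads_def)
  ultimately have "v < N div 2" by linarith
  then show ?thesis using *(2) by (auto simp: pads_def)
qed

lemma nbs_padded:
  "nbs (padded N css) w = nbs (cycles_edges css) w \<union> {u. (w, u) \<in> set (pads N) \<or> (u, w) \<in> set (pads N)}"
  by (auto simp: nbs_def padded_def doubleton_eq_iff image_iff Bex_def)

locale padded_graph =
  fixes N h :: nat and css :: "nat list list"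
  assumes N: "4 \<le> N" and h: "h < N div 2"
    and good: "good_cycles css" and verts: "cycles_verts css \<subseteq> {..<h}"
begin

text \<open>Strictness of \<open>h < N div 2\<close> keeps the vertex \<open>N div 2 - 1\<close>,
  which gets two pendants for odd \<open>N\<close>, off the cycles. So each cycle vertex has exactly
  one pendant, as in the comb.\<close>

lemma nbs_cycle_vertex:
  assumes "v \<in> cycles_verts css"
  shows "nbs (padded N css) v = nbs (cycles_edges css) v \<union> {v + N div 2}"
    and "nbs (padded N css) (v + N div 2) = {v}"
proof -
  have v: "v < h" using assms verts by auto
  have "{u. (v, u) \<in> set (pads N) \<or> (u, v) \<in> set (pads N)} = {v + N div 2}"
    using v h N by (auto simp: set_pads min_def split: if_splits)
  then show "nbs (padded N css) v = nbs (cycles_edges css) v \<union> {v + N div 2}"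
    by (simp add: nbs_padded)
  have "v + N div 2 \<notin> cycles_verts css" using verts h by auto
  then have "nbs (cycles_edges css) (v + N div 2) = {}" by (rule nbs_subset_verts(2)[OF good])
  moreover have "{u. (v + N div 2, u) \<in> set (pads N) \<or> (u, v + N div 2) \<in> set (pads N)} = {v}"
    using v h N by (auto simp: set_pads min_def split: if_splits)
  ultimately show "nbs (padded N css) (v + N div 2) = {v}" by (simp add: nbs_padded)
qed

lemma nbs_ok: "finite (nbs (padded N css) w) \<and> nbs (padded N css) w \<subseteq> {..<N}"
proof -
  have "nbs (padded N css) w \<subseteq> {..<N}"
    unfolding nbs_padded using nbs_subset_verts(1)[OF good, of w] verts h pads_lt[OF N] by fastforce
  then show ?thesis using finite_subset by blast
qed

lemma nbs_nonempty:
  assumes "w < N"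
  shows "nbs (padded N css) w \<noteq> {}"
proof (cases "w < N div 2")
  case True
  then have "(w + N div 2, w) \<in> set (pads N)" using N by (auto simp: set_pads)
  then show ?thesis by (auto simp: nbs_padded)
next
  case False
  then have "(w, min (w - N div 2) (N div 2 - 1)) \<in> set (pads N)" using assms N by (auto simp: set_pads)
  then show ?thesis by (auto simp: nbs_padded)
qed

lemma simple_padded: "simple_graph N (padded N css)"
  unfolding simple_graph_def
proof
  fix e assume "e \<in> padded N css"
  then consider "e \<in> cycles_edges css" | u v where "e = {u, v}" "(u, v) \<in> set (pads N)"
    by (auto simp: padded_def)
  then show "\<exists>u v. u < N \<and> v < N \<and> u \<noteq> v \<and> e = {u, v}"
  proof cases
    case 1
    then obtain xs i where xs: "xs \<in> set css" "e = {cyc_nth xs i, cyc_nth xs (i + 1)}"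
      by (auto simp: cycles_edges_def cyc_edges_def)
    have "cyc_nth xs j < N" for j
      using subsetD[OF verts cyc_nth_in_verts[OF good xs(1), of j]] h by simp
    then show ?thesis using xs cyc_nth_neq(1) good_cyclesD[OF good xs(1)] by blast
  next
    case 2
    then show ?thesis using pads_lt[OF N 2(2)] by (intro exI[of _ u] exI[of _ v]) auto
  qed
qed

lemma no_isolated_padded: "no_isolated N (padded N css)"
  using nbs_nonempty by (auto simp: no_isolated_def nbs_def)

text \<open>Pendant edges have an end in the upper half, so restricting to labels below
  \<open>h\<close> extracts the cycle edges from the walks.\<close>

lemma small_edge: "x < h \<Longrightarrow> y < h \<Longrightarrow> {x, y} \<in> padded N css \<Longrightarrow> {x, y} \<in> cycles_edges css"
  using pads_lt[OF N] h by (fastforce simp: padded_def doubleton_eq_iff)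

lemma edge_input_padded:
  assumes m: "0 < m" and cap: "(N - N div 2) div m + 2 + 2 * (h div m + 1) \<le> cap"
  shows "edge_input m cap (padded N css) (\<lambda>i. padded_input m N (adj_facts m css i) i)"
proof -
  let ?I = "\<lambda>i. padded_input m N (adj_facts m css i) i"
  let ?A = "\<lambda>i. {(v, u). Edge v v u \<in> adj_facts m css i \<and> v < u}"
  have A: "?A i = {q \<in> adj_pairs css. fst q mod m = i \<and> fst q < snd q}" for i
    by (auto simp: adj_facts_def adj_pairs_def)
  have finA: "finite (?A i)" for i unfolding A using adj_pairs(2)[OF good] by simp
  have set_I: "set (?I i) = {q \<in> set (pads N). fst q mod m = i} \<union> ?A i" for i
    by (auto simp: padded_input_def set_list_of[OF finA])
  have A_lt: "fst q < h \<and> snd q < h" if "q \<in> adj_pairs css" for q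
    using that verts nbs_subset_verts(1)[OF good] unfolding adj_pairs(1)[OF good] by fastforce
  have dist_pads: "distinct (pads N)"
    unfolding pads_def by (simp add: distinct_map inj_on_def)
  have dist_I: "distinct (?I i)" for i
    unfolding padded_input_def using dist_pads distinct_list_of[OF finA, of i] A_lt h pads_lt[OF N]
    by (auto simp: set_list_of[OF finA]) (fastforce simp: A)
  have tag: "fst q mod m = i" if "q \<in> set (?I i)" for q i using that unfolding set_I A by auto
  have dist: "distinct (concat (map ?I [0..<r]))" for r
  proof (induction r)
    case (Suc r)
    have "fst q mod m < r" if "q \<in> set (concat (map ?I [0..<r]))" for q
    proof -
      obtain i where "i < r" "q \<in> set (?I i)" using \<open>q \<in> _\<close> by (auto simp: set_concat)
      then show ?thesis using tag[of q i] by simp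
    qed
    then have "set (concat (map ?I [0..<r])) \<inter> set (?I r) = {}" using tag[of _ r] by fastforce
    then show ?case using Suc dist_I by simp
  qed simp
  have set_all: "set (concat (map ?I [0..<m])) = set (pads N) \<union> {q \<in> adj_pairs css. fst q < snd q}"
  proof (intro equalityI subsetI)
    fix q assume "q \<in> set (pads N) \<union> {q \<in> adj_pairs css. fst q < snd q}"
    then have "q \<in> set (?I (fst q mod m))" unfolding set_I A by auto
    moreover have "fst q mod m \<in> set [0..<m]" using m by simp
    ultimately show "q \<in> set (concat (map ?I [0..<m]))" by (auto simp: set_concat)
  qed (auto simp: set_concat set_I A)
  \<comment> \<open>Pendant edges list their upper end first, cycle edges their smaller end first
    with both ends in the lower half; hence no edge appears in two orientations.\<close>
  have inj: "inj_on (\<lambda>(u, v). {u, v}) (set (pads N) \<union> {q \<in> adj_pairs css. fst q < snd q})"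
  proof (rule inj_onI)
    fix a b assume ab: "a \<in> set (pads N) \<union> {q \<in> adj_pairs css. fst q < snd q}"
      "b \<in> set (pads N) \<union> {q \<in> adj_pairs css. fst q < snd q}" "(case a of (u, v) \<Rightarrow> {u, v}) = (case b of (u, v) \<Rightarrow> {u, v})"
    have c: "(q \<in> set (pads N) \<and> N div 2 \<le> fst q \<and> snd q < N div 2) \<or> (fst q < snd q \<and> snd q < N div 2)"
      if "q \<in> set (pads N) \<union> {q \<in> adj_pairs css. fst q < snd q}" for q
      using that pads_lt[OF N, of "fst q" "snd q"] A_lt[of q] h by auto
    have "{fst a, snd a} = {fst b, snd b}" using ab(3) by (simp add: case_prod_beta)
    then show "a = b" using c[OF ab(1)] c[OF ab(2)] by (auto simp: doubleton_eq_iff prod_eq_iff)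
  qed
  have img: "(\<lambda>(u, v). {u, v}) ` {q \<in> adj_pairs css. fst q < snd q} = cycles_edges css"
  proof (intro equalityI subsetI)
    fix e assume e: "e \<in> cycles_edges css"
    then obtain xs i where xs: "xs \<in> set css" "e = {cyc_nth xs i, cyc_nth xs (i + 1)}"
      by (auto simp: cycles_edges_def cyc_edges_def)
    define x y where "x = cyc_nth xs i" and "y = cyc_nth xs (i + 1)"
    have "x \<noteq> y" unfolding x_def y_def using cyc_nth_neq(1) good_cyclesD[OF good xs(1)] by blast
    moreover have "(x, y) \<in> adj_pairs css" "(y, x) \<in> adj_pairs css" "e = {x, y}"
      using e xs(2) by (auto simp: adj_pairs_def nbs_def x_def y_def insert_commute)
    ultimately show "e \<in> (\<lambda>(u, v). {u, v}) ` {q \<in> adj_pairs css. fst q < snd q}"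
      by (cases "x < y") (force intro: rev_image_eqI)+
  qed (auto simp: adj_pairs_def nbs_def)
  have len: "length (?I i) \<le> cap" for i
  proof -
    have "length (filter (\<lambda>(u, v). u mod m = i) (pads N)) = card {u. u < length [N div 2..<N] \<and> ([N div 2..<N] ! u) mod m = i}"
      unfolding pads_def length_filter_map by (simp add: length_filter_conv_card o_def case_prod_beta)
    also have "\<dots> \<le> (N - N div 2) div m + 2"
    proof -
      let ?B = "{u. u < length [N div 2..<N] \<and> ([N div 2..<N] ! u) mod m = i}"
      have "inj_on (\<lambda>u. u div m) ?B"
      proof (rule inj_onI)
        fix x y assume x: "x \<in> ?B" and y: "y \<in> ?B" and xy: "x div m = y div m"
        have "(N div 2 + x) mod m = (N div 2 + y) mod m" using x y by auto
        then have "(int (N div 2 + x)) mod int m = (int (N div 2 + y)) mod int m" by (metis zmod_int)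
        from mod_diff_cong[OF this refl, of "int (N div 2)"] have "x mod m = y mod m"
          by (simp flip: zmod_int)
        then show "x = y" using xy by (metis div_mult_mod_eq)
      qed
      moreover have "(\<lambda>u. u div m) ` ?B \<subseteq> {..(N - N div 2) div m}"
      proof
        fix z assume "z \<in> (\<lambda>u. u div m) ` ?B"
        then obtain u where "z = u div m" "u < N - N div 2" by auto
        then show "z \<in> {..(N - N div 2) div m}" by (simp add: div_le_mono)
      qed
      ultimately have "card ?B \<le> card {..(N - N div 2) div m}" by (rule card_inj_on_le) simp
      then show ?thesis by simp
    qed
    finally have a: "length (filter (\<lambda>(u, v). u mod m = i) (pads N)) \<le> (N - N div 2) div m + 2" .
    have "card (?A i) \<le> card {q \<in> adj_pairs css. fst q mod m = i}"
      unfolding A using adj_pairs(2)[OF good] by (intro card_mono) auto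
    also have "\<dots> \<le> 2 * (h div m + 1)" by (rule card_adj_pairs_home[OF good verts m])
    finally show ?thesis using a cap by (simp add: padded_input_def length_list_of[OF finA])
  qed
  show ?thesis
    unfolding edge_input_def Let_def
  proof (intro conjI allI impI)
    show "length (?I i) \<le> cap" for i by (rule len)
    show "distinct (map (\<lambda>(u, v). {u, v}) (concat (map ?I [0..<m])))"
      using dist[of m] inj set_all by (simp add: distinct_map)
    show "set (map (\<lambda>(u, v). {u, v}) (concat (map ?I [0..<m]))) = padded N css"
      using set_all img by (simp add: image_Un padded_def Un_commute)
  qed
qed

end

subsection \<open>The outcome of the sampler\<close>

definition sampler :: "mpc \<Rightarrow> nat \<Rightarrow> nat \<Rightarrow> nat \<Rightarrow> nat \<Rightarrow> real \<Rightarrow> bool" where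
  "sampler A N k l cap dt \<longleftrightarrow> (\<forall>E I. simple_graph N E \<and> no_isolated N E \<and> edge_input (machines A N) cap E I \<longrightarrow>
     (\<forall>X. \<bar>measure (measure_spmf (map_spmf (output_records (machines A N)) (mpc_run A N I))) X
        - measure_pmf.prob (map_pmf (walk_records N k l) (independent_walks N E k l)) X\<bar> \<le> dt))"

definition confined :: "nat \<Rightarrow> nat \<Rightarrow> nat \<Rightarrow> config set" where
  "confined M W wb = {c. (\<forall>i<M. length (fst (c i)) + length (snd (c i)) \<le> W \<and>
      set (fst (c i)) \<union> set (snd (c i)) \<subseteq> {..<2 ^ wb}) \<and> (\<forall>i\<ge>M. c i = ([], []))}"

text \<open>Every accepted round ends in a confined configuration, so the space bound of the sampler
  on its final memory comes for free.\<close>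

lemma prob_reach_confined:
  assumes "c \<in> confined M W wb"
  shows "prob_reach M W wb gs c Q = prob_reach M W wb gs c (Q \<inter> confined M W wb)"
  using assms
proof (induction gs arbitrary: c)
  case Nil
  then show ?case by (simp add: prob_reach_Nil indicator_def)
next
  case (Cons g gs)
  have "exchange M L \<in> confined M W wb" if "round_ok M W wb L" for L
    using that by (auto simp: confined_def round_ok_def exchange_def)
  then show ?case unfolding prob_reach_Cons using Cons.IH
    by (intro Bochner_Integration.integral_cong) auto
qed

text \<open>Only the set of records is observable, so the walks appear under an existential
  quantifier. Their steps must be edges, so that consecutive records can be trusted.\<close>

definition sampled :: "mpc \<Rightarrow> nat \<Rightarrow> nat list list \<Rightarrow> nat \<Rightarrow> nat \<Rightarrow> nat \<Rightarrow> config set" where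
  "sampled A N css k l R = {s \<in> confined (machines A N) (mem_words A N) (word_bits A N).
     \<exists>Wk. covers css k R Wk \<and> output_records (machines A N) s = walk_records N k l Wk \<and>
       (\<forall>v<N. \<forall>j<k. length (Wk (v, j)) = Suc l \<and> (\<forall>t<l. {Wk (v, j) ! t, Wk (v, j) ! Suc t} \<in> padded N css))}"

text \<open>Closeness in total variation is applied to a single event: the records come from
  covering walks in the support of the true law.\<close>

lemma (in padded_graph) sampler_run:
  fixes A :: mpc and k l R L cap :: nat and e dt :: real
  defines "m \<equiv> machines A N" and "c0 \<equiv> init_config (machines A N) (\<lambda>i. padded_input (machines A N) N (adj_facts (machines A N) css i) i)"
  assumes samp: "sampler A N k l cap dt" and m: "0 < m"
    and cap: "(N - N div 2) div m + 2 + 2 * (h div m + 1) \<le> cap"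
    and R: "R \<le> L" "0 < l" and eps: "real R / L + 2 * real R * L / l \<le> e"
    and small: "dt + real N * (2 * real R) * e ^ k < 1"
  shows "c0 \<in> confined m (mem_words A N) (word_bits A N)"
    and "1 - (dt + real N * (2 * real R) * e ^ k) \<le>
      prob_reach m (mem_words A N) (word_bits A N) (map (local_step A N) [0..<num_rounds A N]) c0 (sampled A N css k l R)"
proof -
  let ?E = "padded N css" and ?I = "\<lambda>i. padded_input m N (adj_facts m css i) i"
  let ?P = "independent_walks N ?E k l" and ?eta = "real N * (2 * real R) * e ^ k"
  have c0: "c0 = init_config m ?I" by (simp add: c0_def m_def)
  define X where "X = {walk_records N k l Wk | Wk. Wk \<in> set_pmf ?P \<and> covers css k R Wk}"
  have nbs': "finite (nbs ?E v) \<and> nbs ?E v \<noteq> {} \<and> nbs ?E v \<subseteq> {..<N}" if "v < N" for v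
    using nbs_ok nbs_nonempty[OF that] by blast
  have "measure_pmf.prob ?P {W. \<not> covers css k R W} \<le> ?eta"
  proof (rule prob_covers[OF good _ _ _ R eps])
    show "cycles_verts css \<subseteq> {..<N}" using verts h by auto
    show "nbs ?E v = nbs (cycles_edges css) v \<union> {v + N div 2} \<and> nbs ?E (v + N div 2) = {v}"
      if "v \<in> cycles_verts css" for v using nbs_cycle_vertex[OF that] by blast
    show "u + N div 2 \<notin> cycles_verts css" for u using verts h by auto
  qed
  moreover have "measure_pmf.prob ?P {W. \<not> covers css k R W} = 1 - measure_pmf.prob ?P {W. covers css k R W}"
    using measure_pmf.prob_compl[of "{W. covers css k R W}" ?P] by (simp add: set_diff_eq)
  moreover have "measure_pmf.prob ?P {W. covers css k R W} \<le> measure_pmf.prob ?P (walk_records N k l -` X)"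
    by (intro measure_pmf.finite_measure_mono_AE AE_pmfI) (auto simp: X_def)
  ultimately have 1: "1 - ?eta \<le> measure_pmf.prob (map_pmf (walk_records N k l) ?P) X" by simp
  have "edge_input m cap ?E ?I" by (rule edge_input_padded[OF m cap])
  then have "\<bar>measure (measure_spmf (map_spmf (output_records m) (mpc_run A N ?I))) X
        - measure_pmf.prob (map_pmf (walk_records N k l) ?P) X\<bar> \<le> dt"
    using samp simple_padded no_isolated_padded unfolding sampler_def m_def by blast
  then have 2: "1 - (dt + ?eta) \<le> measure (measure_spmf (mpc_run A N ?I)) (output_records m -` X)"
    using 1 by (simp add: measure_map_spmf)
  \<comment> \<open>If the input did not fit, every run would abort and the event would have mass 0,
    against the lower bound just obtained. So the fit of the input follows from the correctness of
    the sampler.\<close>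
  have ok: "config_ok A N (init_config m ?I)"
  proof (rule ccontr)
    assume "\<not> config_ok A N (init_config m ?I)"
    then have "mpc_steps A N (init_config m ?I) r = return_pmf None" for r
      by (induction r) (auto simp: check_config_def)
    then have "measure (measure_spmf (mpc_run A N ?I)) (output_records m -` X) = 0"
      by (simp add: mpc_run_def m_def)
    then show False using 2 small by simp
  qed
  then show conf: "c0 \<in> confined m (mem_words A N) (word_bits A N)"
    by (auto simp: confined_def config_ok_def c0 init_config_def m_def)
  have run: "mpc_run A N ?I = exec m (mem_words A N) (word_bits A N) (map (local_step A N) [0..<num_rounds A N]) c0"
    using mpc_steps_eq_exec[OF ok] by (simp add: mpc_run_def m_def c0)
  have "1 - (dt + ?eta) \<le> prob_reach m (mem_words A N) (word_bits A N) (map (local_step A N) [0..<num_rounds A N]) c0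
      ((output_records m -` X) \<inter> confined m (mem_words A N) (word_bits A N))"
    using 2 prob_reach_confined[OF conf] unfolding run prob_reach_def by simp
  also have "\<dots> \<le> prob_reach m (mem_words A N) (word_bits A N) (map (local_step A N) [0..<num_rounds A N]) c0 (sampled A N css k l R)"
  proof (intro prob_reach_mono subsetI)
    fix s assume s: "s \<in> (output_records m -` X) \<inter> confined m (mem_words A N) (word_bits A N)"
    then obtain Wk where Wk: "Wk \<in> set_pmf ?P" "covers css k R Wk" "output_records m s = walk_records N k l Wk"
      by (auto simp: X_def)
    then show "s \<in> sampled A N css k l R"
      using s independent_walks_support[OF nbs' Wk(1)] unfolding sampled_def m_def by blast
  qed
  finally show "1 - (dt + ?eta) \<le> prob_reach m (mem_words A N) (word_bits A N) (map (local_step A N) [0..<num_rounds A N]) c0 (sampled A N css k l R)" .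
qed

lemma finite_records: "finite (records ws) \<and> card (records ws) \<le> length ws"
proof (induction ws rule: records.induct)
  case (1 v j t x ws)
  then show ?case using card_insert_le_m1[of "Suc (length ws)" "records ws" "(v, j, t, x)"] by auto
qed auto

text \<open>Walks from labels at or above \<open>h\<close> are dropped, since no such label lies on
  a cycle.\<close>

definition collect_records :: "nat \<Rightarrow> nat list \<Rightarrow> nat list \<Rightarrow> fact set" where
  "collect_records h m b = (\<lambda>(v, j, t, x). Rec v j t x) ` {r \<in> records m. fst r < h}"

text \<open>After \<open>q\<close> rounds of routing, a record of a walk from \<open>v\<close> sits on a machine whose last \<open>q\<close>
  digits in base \<open>f\<close> are those of the hash value of \<open>v\<close>.\<close>

locale routing = net +
  fixes Y :: "nat \<Rightarrow> fact set" and Hs :: "nat \<Rightarrow> nat" and s k l B N :: nat and X :: "nat \<Rightarrow> nat \<Rightarrow> nat \<Rightarrow> nat"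
  assumes Hs: "\<And>v. Hs v < f ^ p"
    and recs: "\<And>i t. i < f ^ p \<Longrightarrow> t \<in> Y i \<Longrightarrow> \<exists>v j u. t = Rec v j u (X v j u) \<and> j < k \<and> u \<le> l"
    and lt: "\<And>i t. i < f ^ p \<Longrightarrow> t \<in> Y i \<Longrightarrow> fact_lt K t" "s < K"
    and balanced: "\<And>q g c. q < p \<Longrightarrow> card {v. (\<exists>i<f ^ p. i div f ^ q = g \<and> (\<exists>j t x. Rec v j t x \<in> Y i)) \<and> Hs v mod f ^ Suc q = c} \<le> B"
    and finY: "\<And>i. i < f ^ p \<Longrightarrow> finite (Y i)"
begin

definition keys :: "nat \<Rightarrow> nat \<Rightarrow> nat \<Rightarrow> nat set" where
  "keys q g c = {v. (\<exists>i<M. i div f ^ q = g \<and> (\<exists>j t x. Rec v j t x \<in> Y i)) \<and> Hs v mod f ^ Suc q = c}"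

definition routed :: "nat \<Rightarrow> nat \<Rightarrow> fact set" where
  "routed q i = {Rec v j t x | v j t x. Hs v mod f ^ q = i mod f ^ q \<and>
      (\<exists>i'<M. i' div f ^ q = i div f ^ q \<and> Rec v j t x \<in> Y i')}"

lemma finite_keys: "finite (keys q g c)"
proof -
  have "keys q g c \<subseteq> (\<lambda>t. case t of Rec v j u x \<Rightarrow> v | _ \<Rightarrow> 0) ` (\<Union>i<M. Y i)"
    unfolding keys_def by (force simp: image_iff split: fact.splits)
  then show ?thesis using finY by (auto intro: finite_subset)
qed

lemma card_keys: "q < p \<Longrightarrow> card (keys q g c) \<le> B"
  using balanced unfolding keys_def by blast

lemma routed_0: "i < M \<Longrightarrow> routed 0 i = Y i"
  using recs by (force simp: routed_def)

lemma routed_p: "i < M \<Longrightarrow> Rec v j t x \<in> routed p i \<longleftrightarrow> Hs v = i \<and> (\<exists>i'<M. Rec v j t x \<in> Y i')"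
  using Hs[of v] by (auto simp: routed_def)

text \<open>Butterfly routing: the low \<open>q + 1\<close> digits become those of the hash value,
  while the higher digits of the current machine are kept.\<close>

definition dest :: "nat \<Rightarrow> nat \<Rightarrow> nat \<Rightarrow> nat" where
  "dest q i v = Hs v mod f ^ Suc q + f ^ Suc q * (i div f ^ Suc q)"

lemma dest_mod_div: "dest q i v mod f ^ Suc q = Hs v mod f ^ Suc q" "dest q i v div f ^ Suc q = i div f ^ Suc q"
  using f unfolding dest_def by (auto simp del: power_Suc)

lemma div_div: "i div f ^ Suc q = i div f ^ q div f"
  by (metis div_mult2_eq power_Suc2)

lemma dest_lt:
  assumes "q < p" "i < M"
  shows "dest q i v < M"
proof -
  have "f ^ p = f ^ Suc q * f ^ (p - Suc q)" using assms(1) by (simp add: power_add[symmetric] del: power_Suc)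
  moreover have "i div f ^ Suc q < f ^ (p - Suc q)"
    using assms(2) calculation f by (simp add: div_less_iff_less_mult mult.commute del: power_Suc)
  ultimately have "f ^ Suc q * Suc (i div f ^ Suc q) \<le> M" by (metis Suc_leI mult_le_mono2)
  moreover have "dest q i v < f ^ Suc q * Suc (i div f ^ Suc q)"
    using f unfolding dest_def by (simp del: power_Suc)
  ultimately show ?thesis by simp
qed

text \<open>All that machine \<open>j\<close> can receive in step \<open>q\<close> originates from
  \<open>f\<close> groups of machines, one for each value of digit \<open>q\<close> with the higher
  digits of \<open>j\<close>. In each group at most \<open>B\<close> start vertices qualify, with
  \<open>k * (l + 1)\<close> records each.\<close>

definition batch :: "nat \<Rightarrow> nat \<Rightarrow> (nat \<times> nat \<times> nat \<times> nat) set" where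
  "batch q j = (SIGMA g:{f * (j div f ^ Suc q)..<f * (j div f ^ Suc q) + f}.
      keys q g (j mod f ^ Suc q) \<times> {..<k} \<times> {..l})"

lemma card_batch: "q < p \<Longrightarrow> finite (batch q j) \<and> card (batch q j) \<le> f * (B * (k * (l + 1)))"
proof -
  assume q: "q < p"
  have "card (batch q j) \<le> card {f * (j div f ^ Suc q)..<f * (j div f ^ Suc q) + f} * (B * (k * (l + 1)))"
    unfolding batch_def using card_keys[OF q] finite_keys
    by (intro card_Sigma_le) (auto simp: card_cartesian_product intro!: mult_right_mono)
  then show ?thesis unfolding batch_def using finite_keys by auto
qed

lemma in_batch:
  assumes "i' < M" "t \<in> Y i'" "i' div f ^ Suc q = j div f ^ Suc q" "t = Rec v a u x" "Hs v mod f ^ Suc q = j mod f ^ Suc q"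
  shows "(i' div f ^ q, v, a, u) \<in> batch q j" and "x = X v a u"
proof -
  show "x = X v a u" using recs[OF assms(1,2)] assms(4) by auto
  have "v \<in> keys q (i' div f ^ q) (j mod f ^ Suc q)" using assms by (auto simp: keys_def)
  moreover have "f * (j div f ^ Suc q) \<le> i' div f ^ q \<and> i' div f ^ q < f * (j div f ^ Suc q) + f"
  proof -
    have "j div f ^ Suc q = i' div f ^ q div f" using assms(3) div_div by metis
    then show ?thesis
      using dividend_less_times_div[OF f, of "i' div f ^ q"] by (simp add: add.commute del: power_Suc)
  qed
  moreover have "a < k" "u \<le> l" using recs[OF assms(1,2)] assms(4) by auto
  ultimately show "(i' div f ^ q, v, a, u) \<in> batch q j" by (auto simp: batch_def)
qed

lemma card_routed: "q < p \<Longrightarrow> finite (routed (Suc q) j) \<and> card (routed (Suc q) j) \<le> f * (B * (k * (l + 1)))"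
proof -
  assume q: "q < p"
  have "routed (Suc q) j \<subseteq> (\<lambda>(g, v, a, u). Rec v a u (X v a u)) ` batch q j"
  proof
    fix t assume "t \<in> routed (Suc q) j"
    then obtain v a u x i' where *: "t = Rec v a u x" "Hs v mod f ^ Suc q = j mod f ^ Suc q"
      "i' < M" "i' div f ^ Suc q = j div f ^ Suc q" "t \<in> Y i'" by (auto simp: routed_def simp del: power_Suc)
    from in_batch[OF *(3,5,4,1,2)] show "t \<in> (\<lambda>(g, v, a, u). Rec v a u (X v a u)) ` batch q j"
      using *(1) by (intro image_eqI[of _ _ "(i' div f ^ q, v, a, u)"]) auto
  qed
  then have "finite (routed (Suc q) j) \<and> card (routed (Suc q) j) \<le> card (batch q j)"
    using card_batch[OF q, of j] by (meson card_image_le card_mono finite_imageI finite_subset order_trans)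
  then show ?thesis using card_batch[OF q, of j] by linarith
qed

end

context net
begin

definition route :: "(nat \<Rightarrow> nat \<Rightarrow> nat) \<Rightarrow> nat \<Rightarrow> nat \<Rightarrow> fact set \<Rightarrow> (nat \<times> fact) set" where
  "route H q i X = {(i, Seed s) | s. Seed s \<in> X} \<union>
     {(H s v mod f ^ Suc q + f ^ Suc q * (i div f ^ Suc q), Rec v j t x) | s v j t x. Seed s \<in> X \<and> Rec v j t x \<in> X}"

definition routes :: "(nat \<Rightarrow> nat \<Rightarrow> nat) \<Rightarrow> round_fun list" where
  "routes H = map (\<lambda>q. fact_round facts_in (route H q)) [0..<p]"

end

context routing
begin

lemma route_step:
  assumes q: "q < p" and H: "Hs = H s"
    and W: "\<And>i. i < M \<Longrightarrow> card (Y i) + 1 \<le> W" "f * (B * (k * (l + 1))) + 1 \<le> W"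
    and hold: "holds M (\<lambda>i. insert (Seed s) (routed q i)) c"
    and cont: "\<And>c'. holds M (\<lambda>i. insert (Seed s) (routed (Suc q) i)) c' \<Longrightarrow> 1 - e \<le> reach gs c' Q"
  shows "1 - e \<le> reach (fact_round facts_in (route H q) # gs) c Q"
proof (rule prob_reach_fact_round[OF hold])
  let ?X = "\<lambda>i. insert (Seed s) (routed q i)"
  have fin: "finite (routed q i)" "card (routed q i) + 1 \<le> W" if "i < M" for i
  proof -
    have "finite (routed q i) \<and> card (routed q i) + 1 \<le> W"
    proof (cases q)
      case 0
      then show ?thesis using W(1)[OF that] finY[OF that] routed_0[OF that] by simp
    next
      case (Suc q')
      then show ?thesis using card_routed[of q' i] q W(2) by simp
    qed
    then show "finite (routed q i)" "card (routed q i) + 1 \<le> W" by auto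
  qed
  have rec_routed: "\<exists>v a u x i'. t = Rec v a u x \<and> i' < M \<and> i' div f ^ q = i div f ^ q \<and> t \<in> Y i' \<and> Hs v mod f ^ q = i mod f ^ q"
    if "t \<in> routed q i" for t i using that by (auto simp: routed_def)
  define U1 where "U1 = (\<lambda>i. (i, i, Seed s)) ` {..<M}"
  define U2 where "U2 = {(i, dest q i v, Rec v a u x) | i v a u x. i < M \<and> Rec v a u x \<in> routed q i}"
  have finU2: "finite U2"
  proof (rule finite_subset)
    show "U2 \<subseteq> {..<M} \<times> {..<M} \<times> (\<Union>i<M. routed q i)" using dest_lt[OF q] by (auto simp: U2_def)
    show "finite ({..<M} \<times> {..<M} \<times> (\<Union>i<M. routed q i))" using fin(1) by auto
  qed
  have finU: "finite U1" "finite U2" using finU2 by (auto simp: U1_def)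
  have Z: "(j, t) \<in> route H q i (?X i) \<longleftrightarrow> (i, j, t) \<in> U1 \<union> U2" if i: "i < M" for i j t
  proof -
    have "Seed s' \<in> ?X i \<longleftrightarrow> s' = s" "Rec v a u x \<in> ?X i \<longleftrightarrow> Rec v a u x \<in> routed q i" for s' v a u x
      by (auto simp: routed_def)
    then show ?thesis unfolding route_def U1_def U2_def dest_def
      using i by (auto simp: H[symmetric] simp del: power_Suc)
  qed
  show "fits M W wb (\<lambda>i. route H q i (?X i))"
  proof (rule fits_triples[OF _ Z])
    show "finite (U1 \<union> U2)" using finU by simp
    show "card {u \<in> U1 \<union> U2. fst u = i} \<le> W" if i: "i < M" for i
    proof -
      have "card {u \<in> U1. fst u = i} \<le> 1" unfolding U1_def by (intro card_filter_single_le) auto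
      moreover have "{u \<in> U2. fst u = i} \<subseteq> (\<lambda>t. (i, dest q i (case t of Rec v a u x \<Rightarrow> v | _ \<Rightarrow> 0), t)) ` routed q i"
      proof
        fix z assume "z \<in> {u \<in> U2. fst u = i}"
        then obtain v a u x where "z = (i, dest q i v, Rec v a u x)" "Rec v a u x \<in> routed q i"
          by (auto simp: U2_def)
        then show "z \<in> (\<lambda>t. (i, dest q i (case t of Rec v a u x \<Rightarrow> v | _ \<Rightarrow> 0), t)) ` routed q i"
          by (intro image_eqI[of _ _ "Rec v a u x"]) auto
      qed
      then have "card {u \<in> U2. fst u = i} \<le> card (routed q i)"
        using fin(1)[OF i] by (meson card_image_le card_mono finite_imageI order_trans)
      ultimately show ?thesis using fin(2)[OF i] card_filter_union_le[OF finU, of "\<lambda>u. fst u = i"] by linarith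
    qed
    show "card {u \<in> U1 \<union> U2. fst (snd u) = j} \<le> W" if j: "j < M" for j
    proof -
      have "card {u \<in> U1. fst (snd u) = j} \<le> 1" unfolding U1_def by (intro card_filter_single_le) auto
      moreover have "{u \<in> U2. fst (snd u) = j} \<subseteq>
          (\<lambda>(g, v, a, u). (Hs v mod f ^ q + f ^ q * g, j, Rec v a u (X v a u))) ` batch q j"
      proof
        fix z assume "z \<in> {u \<in> U2. fst (snd u) = j}"
        then obtain i v a u x where z: "z = (i, dest q i v, Rec v a u x)" "i < M" "Rec v a u x \<in> routed q i" "dest q i v = j"
          by (auto simp: U2_def)
        obtain i' where i': "i' < M" "i' div f ^ q = i div f ^ q" "Rec v a u x \<in> Y i'" "Hs v mod f ^ q = i mod f ^ q"
          using rec_routed[OF z(3)] by auto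
        have "i' div f ^ Suc q = j div f ^ Suc q" "Hs v mod f ^ Suc q = j mod f ^ Suc q"
          using dest_mod_div[of q i v] z(4) i'(2) unfolding div_div by (auto simp del: power_Suc)
        note b = in_batch[OF i'(1,3) this(1) refl this(2)]
        \<comment> \<open>The sender is determined by start vertex and group, its low digits being
          those of the hash; hence a batch index determines the whole message.\<close>
        have "i = Hs v mod f ^ q + f ^ q * (i' div f ^ q)" using i'(2,4) by simp
        then show "z \<in> (\<lambda>(g, v, a, u). (Hs v mod f ^ q + f ^ q * g, j, Rec v a u (X v a u))) ` batch q j"
          using b z(1,4) by (intro image_eqI[OF _ b(1)]) auto
      qed
      then have "card {u \<in> U2. fst (snd u) = j} \<le> card (batch q j)"
        using card_batch[OF q, of j] by (meson card_image_le card_mono finite_imageI order_trans)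
      ultimately show ?thesis
        using W(2) card_batch[OF q, of j] card_filter_union_le[OF finU, of "\<lambda>u. fst (snd u) = j"] by linarith
    qed
    fix i j t assume u: "(i, j, t) \<in> U1 \<union> U2"
    have "fact_lt K t \<and> j < M"
    proof (cases "(i, j, t) \<in> U1")
      case True
      then show ?thesis using lt(2) by (auto simp: U1_def)
    next
      case False
      then have "t \<in> routed q i" "j < M" using u dest_lt[OF q] by (auto simp: U2_def)
      then show ?thesis using rec_routed lt(1) by blast
    qed
    then show "j < M \<and> enc t < 2 ^ wb" using bits by blast
  qed
  fix c' assume h': "holds M (delivered M (\<lambda>i. route H q i (?X i))) c'"
  have "delivered M (\<lambda>i. route H q i (?X i)) j = insert (Seed s) (routed (Suc q) j)" if j: "j < M" for j
  proof -
    have "t \<in> delivered M (\<lambda>i. route H q i (?X i)) j \<longleftrightarrow> (\<exists>i<M. (i, j, t) \<in> U1 \<union> U2)" for t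
      using Z by (auto simp: delivered_def)
    also have "(\<exists>i<M. (i, j, t) \<in> U1 \<union> U2) \<longleftrightarrow> t \<in> insert (Seed s) (routed (Suc q) j)" for t
    proof
      assume "\<exists>i<M. (i, j, t) \<in> U1 \<union> U2"
      then obtain i where i: "i < M" "(i, j, t) \<in> U1 \<or> (i, j, t) \<in> U2" by auto
      then show "t \<in> insert (Seed s) (routed (Suc q) j)"
      proof (cases "(i, j, t) \<in> U1")
        case False
        then obtain v a u x where z: "t = Rec v a u x" "Rec v a u x \<in> routed q i" "dest q i v = j"
          using i by (auto simp: U2_def)
        obtain i' where i': "i' < M" "i' div f ^ q = i div f ^ q" "Rec v a u x \<in> Y i'"
          using rec_routed[OF z(2)] by auto
        have "i' div f ^ Suc q = j div f ^ Suc q" "Hs v mod f ^ Suc q = j mod f ^ Suc q"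
          using dest_mod_div[of q i v] z(3) i'(2) unfolding div_div by (auto simp del: power_Suc)
        then show ?thesis using z(1) i' unfolding routed_def by blast
      qed (auto simp: U1_def)
    next
      assume "t \<in> insert (Seed s) (routed (Suc q) j)"
      then consider "t = Seed s" | "t \<in> routed (Suc q) j" by blast
      then show "\<exists>i<M. (i, j, t) \<in> U1 \<union> U2"
      proof cases
        case 1
        then show ?thesis using j by (auto simp: U1_def)
      next
        case 2
        then obtain v a u x i' where *: "t = Rec v a u x" "Hs v mod f ^ Suc q = j mod f ^ Suc q"
          "i' < M" "i' div f ^ Suc q = j div f ^ Suc q" "Rec v a u x \<in> Y i'" by (auto simp: routed_def simp del: power_Suc)
        \<comment> \<open>The machine that holds the record before step \<open>q\<close>: low digits
          from the hash, higher digits from the place of origin.\<close>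
        define i where "i = Hs v mod f ^ q + f ^ q * (i' div f ^ q)"
        have i: "i mod f ^ q = Hs v mod f ^ q" "i div f ^ q = i' div f ^ q"
          using f by (auto simp: i_def)
        have "i < M"
        proof -
          have "f ^ p = f ^ q * f ^ (p - q)" using q by (simp add: power_add[symmetric])
          moreover have "i' div f ^ q < f ^ (p - q)"
            using *(3) calculation f by (simp add: div_less_iff_less_mult mult.commute)
          ultimately have "f ^ q * Suc (i' div f ^ q) \<le> M" by (metis Suc_leI mult_le_mono2)
          moreover have "i < f ^ q * Suc (i' div f ^ q)" using f unfolding i_def by simp
          ultimately show ?thesis by simp
        qed
        moreover have "Rec v a u x \<in> routed q i" using * i unfolding routed_def by force
        moreover have "dest q i v = j"
        proof -
          have "i div f ^ Suc q = j div f ^ Suc q" using i(2) *(4) unfolding div_div by simp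
          then have "dest q i v = j mod f ^ Suc q + f ^ Suc q * (j div f ^ Suc q)"
            using *(2) by (simp add: dest_def del: power_Suc)
          then show ?thesis by (simp del: power_Suc)
        qed
        ultimately have "(i, j, t) \<in> U2" using *(1) unfolding U2_def by blast
        then show ?thesis using \<open>i < M\<close> by blast
      qed
    qed
    finally show ?thesis by blast
  qed
  then show "1 - e \<le> reach gs c' Q" using cont h' by (simp add: holds_def)
qed

lemma route_phase:
  assumes H: "Hs = H s"
    and W: "\<And>i. i < M \<Longrightarrow> card (Y i) + 1 \<le> W" "f * (B * (k * (l + 1))) + 1 \<le> W"
    and hold: "holds M (\<lambda>i. insert (Seed s) (Y i)) c"
    and cont: "\<And>c'. holds M (\<lambda>i. insert (Seed s) (routed p i)) c' \<Longrightarrow> 1 - e \<le> reach gs c' Q"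
  shows "1 - e \<le> reach (routes H @ gs) c Q"
proof -
  have "1 - e \<le> reach (map (\<lambda>q. fact_round facts_in (route H q)) [p - r..<p] @ gs) c Q"
    if "r \<le> p" "holds M (\<lambda>i. insert (Seed s) (routed (p - r) i)) c" for r c
    using that
  proof (induction r arbitrary: c)
    case 0
    then show ?case using cont by simp
  next
    case (Suc r)
    have eq: "[p - Suc r..<p] = (p - Suc r) # [p - r..<p]"
      using Suc.prems(1) by (subst upt_conv_Cons) (auto simp: Suc_diff_Suc)
    have "Suc (p - Suc r) = p - r" using Suc.prems(1) by simp
    then show ?case unfolding eq list.map append_Cons
      using Suc by (intro route_step[where q="p - Suc r" and H=H, OF _ H W Suc.prems(2)]) auto
  qed
  from this[of p c] show ?thesis using hold by (simp add: holds_def routed_0 routes_def)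
qed

end

section \<open>One contraction by means of the sampler\<close>

context net
begin

definition main_step ::
    "nat \<Rightarrow> nat \<Rightarrow> ((int \<Rightarrow> nat) \<Rightarrow> bool) \<Rightarrow> int \<Rightarrow> int \<Rightarrow> nat \<Rightarrow> fact set \<Rightarrow> (nat \<times> fact) set" where
  "main_step h m P R g i X = {(v mod m, Edge v v u) | v u. v < h \<and> u \<in> new_nbs P R g v
     {{x, y} | x y. x < h \<and> y < h \<and> (\<exists>j t. Rec v j t x \<in> X \<and> Rec v j (Suc t) y \<in> X)}}"

definition post_prog ::
    "nat \<Rightarrow> nat \<Rightarrow> nat \<Rightarrow> (nat \<Rightarrow> nat \<Rightarrow> nat) \<Rightarrow> ((int \<Rightarrow> nat) \<Rightarrow> bool) \<Rightarrow> int \<Rightarrow> int \<Rightarrow> round_fun list" where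
  "post_prog h m S H P R g = seed_round S (collect_records h) # bcasts @ routes H @
     [fact_round facts_in (main_step h m P R g)]"

text \<open>The seed is drawn after the sampler has stopped. The sets to be spread evenly are then
  fixed, although they depend on the random output, and the hash family applies to them.\<close>

lemma post_phase:
  fixes A :: mpc and N h k l n S T0 T :: nat and css P r g Rn H
  defines "m \<equiv> machines A N" and "WA \<equiv> mem_words A N" and "css' \<equiv> contract P css"
  assumes pg: "padded_graph N h css" and s: "sm \<in> sampled A N css k l Rn"
    and good': "good_cycles css'"
    and loc: "local_sym r P" "0 \<le> r" "1 \<le> g" "r + g \<le> int Rn"
    and gap: "\<And>xs. xs \<in> set css \<Longrightarrow> gap_le g P (cyc_nth xs)"
    and pos: "0 < p" "0 < k" "0 < l" "0 < m" "m \<le> M"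
    and H: "\<And>s v. H s v < M"
    and HF: "\<And>X q c T. X \<subseteq> {..<n} \<Longrightarrow> q \<le> p \<Longrightarrow> card X \<le> f ^ q * T \<Longrightarrow> T0 \<le> T \<Longrightarrow>
       card {s. s < S \<and> 4 * T < card {v \<in> X. H s v mod f ^ q = c}} \<le> 2 * n"
    and T: "T0 \<le> T" "WA \<le> f * T" and hn: "h \<le> n"
    and S: "0 < S" and K: "S \<le> K" "N \<le> K" "k \<le> K" "l < K"
    and W: "WA + f + 2 \<le> W" "2 * (f * (4 * T * (k * (l + 1)))) + 1 \<le> W" "2 * (h div m + 1) \<le> W"
    and e: "0 \<le> e"
    and cont: "\<And>c'. holds M (adj_facts m css') c' \<Longrightarrow> 1 - e \<le> reach gs c' Q"
  shows "1 - (real (p * M * M * (2 * n)) / real S + e) \<le> reach (post_prog h m S H P (int Rn) g @ gs) sm Q"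
proof -
  interpret padded_graph N h css by (rule pg)
  obtain Wk where conf: "sm \<in> confined m WA (word_bits A N)"
    and cov: "covers css k Rn Wk" and out: "output_records m sm = walk_records N k l Wk"
    and walk: "\<And>v j. v < N \<Longrightarrow> j < k \<Longrightarrow> length (Wk (v, j)) = Suc l"
      "\<And>v j t. v < N \<Longrightarrow> j < k \<Longrightarrow> t < l \<Longrightarrow> {Wk (v, j) ! t, Wk (v, j) ! Suc t} \<in> padded N css"
    using s unfolding sampled_def m_def WA_def by blast
  have hN: "h < N" using h N by simp
  define Y where "Y i = collect_records h (fst (sm i)) (snd (sm i))" for i
  have Yi: "Y i = {}" if "m \<le> i" for i
    using conf that by (auto simp: Y_def collect_records_def confined_def)
  have Y_iff: "(\<exists>i<M. Rec v j t x \<in> Y i) \<longleftrightarrow> v < h \<and> j < k \<and> t \<le> l \<and> x = Wk (v, j) ! t" for v j t x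
  proof -
    have "(\<exists>i<M. Rec v j t x \<in> Y i) \<longleftrightarrow> (\<exists>i<m. Rec v j t x \<in> Y i)"
      using Yi pos(5) by (metis empty_iff leI less_le_trans)
    also have "\<dots> \<longleftrightarrow> v < h \<and> (v, j, t, x) \<in> output_records m sm"
    proof -
      have "Rec v j t x \<in> Y i \<longleftrightarrow> v < h \<and> (v, j, t, x) \<in> records (fst (sm i))" for i
        unfolding Y_def collect_records_def by force
      then show ?thesis by (auto simp: output_records_def)
    qed
    also have "\<dots> \<longleftrightarrow> v < h \<and> j < k \<and> t \<le> l \<and> x = Wk (v, j) ! t"
      unfolding out walk_records_def using hN by auto
    finally show ?thesis .
  qed
  have finY: "finite (Y i)" for i
    unfolding Y_def collect_records_def using finite_records[of "fst (sm i)"] by simp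
  have cardY: "card (Y i) \<le> WA" for i
  proof (cases "i < m")
    case True
    have "card (Y i) \<le> card {r \<in> records (fst (sm i)). fst r < h}"
      unfolding Y_def collect_records_def using finite_records[of "fst (sm i)"] by (intro card_image_le) simp
    also have "\<dots> \<le> card (records (fst (sm i)))" using finite_records[of "fst (sm i)"] by (intro card_mono) auto
    also have "\<dots> \<le> length (fst (sm i))" using finite_records by blast
    also have "\<dots> \<le> WA"
    proof -
      have "\<forall>i<m. length (fst (sm i)) + length (snd (sm i)) \<le> WA" using conf by (simp add: confined_def)
      from this[rule_format, OF True] show ?thesis by simp
    qed
    finally show ?thesis .
  next
    case False
    then show ?thesis using Yi[of i] by simp
  qed
  have recY: "\<exists>v j u. t = Rec v j u (Wk (v, j) ! u) \<and> v < h \<and> j < k \<and> u \<le> l" if "i < M" "t \<in> Y i" for i t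
  proof -
    from that(2) obtain v j u x where t: "t = Rec v j u x" by (auto simp: Y_def collect_records_def)
    then have "\<exists>i<M. Rec v j u x \<in> Y i" using that by blast
    then show ?thesis unfolding Y_iff using t by blast
  qed
  have xN: "Wk (v, j) ! u < N" if "v < N" "j < k" "u \<le> l" for v j u
  proof -
    define t where "t = (if u < l then u else l - 1)"
    have t: "t < l" "u = t \<or> u = Suc t" using that(3) pos(3) by (auto simp: t_def)
    from walk(2)[OF that(1,2) t(1)] obtain a b where "a < N" "b < N" "{Wk (v, j) ! t, Wk (v, j) ! Suc t} = {a, b}"
      using simple_padded unfolding simple_graph_def by metis
    then show ?thesis using t(2) by (auto simp: doubleton_eq_iff)
  qed
  have ltY: "fact_lt K t" if "i < M" "t \<in> Y i" for i t
  proof -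
    from recY[OF that] obtain v j u where t: "t = Rec v j u (Wk (v, j) ! u)" "v < h" "j < k" "u \<le> l" by blast
    have "Wk (v, j) ! u < N" by (rule xN) (use t hN in auto)
    then show ?thesis using t hN K by simp
  qed
  define Kq where "Kq q g = {v. \<exists>i<M. i div f ^ q = g \<and> (\<exists>j t x. Rec v j t x \<in> Y i)}" for q g
  have Kq_sub: "Kq q g \<subseteq> {..<n}" for q g
  proof
    fix v assume "v \<in> Kq q g"
    then obtain j t x where "\<exists>i<M. Rec v j t x \<in> Y i" by (auto simp: Kq_def)
    then show "v \<in> {..<n}" unfolding Y_iff using hn by simp
  qed
  \<comment> \<open>A group consists of \<open>f ^ q\<close> machines with at most
    \<open>WA \<le> f * T\<close> records each; the extra factor \<open>f\<close> matches the
    additional digit by which the keys are split in step \<open>q\<close>.\<close>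
  have Kq_card: "card (Kq q g) \<le> f ^ Suc q * T" for q g
  proof -
    let ?I = "{i. i div f ^ q = g}"
    have I: "?I \<subseteq> (\<lambda>r. r + f ^ q * g) ` {..<f ^ q}"
    proof
      fix i assume "i \<in> ?I"
      then have "i = i mod f ^ q + f ^ q * g" by auto
      moreover have "i mod f ^ q < f ^ q" using f by simp
      ultimately show "i \<in> (\<lambda>r. r + f ^ q * g) ` {..<f ^ q}" by blast
    qed
    have finI: "finite ?I" by (rule finite_subset[OF I]) simp
    have "card ?I \<le> card ((\<lambda>r. r + f ^ q * g) ` {..<f ^ q})" by (rule card_mono[OF _ I]) simp
    also have "\<dots> \<le> f ^ q" using card_image_le[of "{..<f ^ q}"] by simp
    finally have cI: "card ?I \<le> f ^ q" .
    have "Kq q g \<subseteq> (\<lambda>t. case t of Rec v j u x \<Rightarrow> v | _ \<Rightarrow> 0) ` (\<Union>i\<in>?I. Y i)"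
      unfolding Kq_def by (force simp: image_iff)
    then have "card (Kq q g) \<le> card (\<Union>i\<in>?I. Y i)"
      using finI finY by (meson card_image_le card_mono finite_UN_I finite_imageI order_trans)
    also have "\<dots> \<le> (\<Sum>i\<in>?I. card (Y i))" by (rule card_UN_le[OF finI])
    also have "\<dots> \<le> card ?I * WA" using cardY by (intro sum_bounded_above[THEN order_trans]) auto
    also have "\<dots> \<le> f ^ q * (f * T)" using cI T(2) by (intro mult_le_mono)
    finally show ?thesis by (simp add: algebra_simps)
  qed
  \<comment> \<open>There are \<open>p * M * M\<close> balance requirements, and each is violated by
    at most \<open>2 * n\<close> seeds.\<close>
  define G where "G s \<longleftrightarrow> (\<forall>q<p. \<forall>g<M. \<forall>c<M. card {v \<in> Kq q g. H s v mod f ^ Suc q = c} \<le> 4 * T)" for s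
  have "card {s. s < S \<and> \<not> G s} \<le> card (\<Union>(q, g, c)\<in>{..<p} \<times> {..<M} \<times> {..<M}.
      {s. s < S \<and> 4 * T < card {v \<in> Kq q g. H s v mod f ^ Suc q = c}})"
    by (intro card_mono) (auto simp: G_def not_le)
  also have "\<dots> \<le> (\<Sum>(q, g, c)\<in>{..<p} \<times> {..<M} \<times> {..<M}.
      card {s. s < S \<and> 4 * T < card {v \<in> Kq q g. H s v mod f ^ Suc q = c}})"
    by (rule order_trans[OF card_UN_le]) (auto intro!: sum_mono)
  also have "\<dots> \<le> (\<Sum>(q, g, c)\<in>{..<p} \<times> {..<M} \<times> {..<M}. 2 * n)"
    by (intro sum_mono) (auto intro!: HF Kq_sub Kq_card T simp del: power_Suc)
  also have "\<dots> = p * M * M * (2 * n)" by (simp add: case_prod_beta card_cartesian_product)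
  finally have bad: "real (card {s. s < S \<and> \<not> G s}) \<le> real (p * M * M * (2 * n)) / real S * real S"
    using S by (simp del: of_nat_mult)
  show ?thesis
    unfolding post_prog_def append_Cons
  proof (rule prob_reach_seed_round[OF M S, where X=Y and G=G])
    show "collect_records h (fst (sm i)) (snd (sm i)) = Y i" for i by (simp add: Y_def)
    show "finite (Y i) \<and> card (Y i) + 1 \<le> W" for i using finY cardY[of i] W(1) by simp
    show "enc t < 2 ^ wb" if "i < M" "t \<in> Y i" for i t using ltY[OF that] bits by blast
    show "enc (Seed s) < 2 ^ wb" if "s < S" for s using that K(1) bits[of "Seed s"] by simp
    show "real (card {s. s < S \<and> \<not> G s}) \<le> real (p * M * M * (2 * n)) / real S * real S" by (rule bad)
    show "0 \<le> e" by (rule e)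
    fix s c1 assume s: "s < S" "G s" and h1: "holds M (with_seed Y s 1) c1"
    have sK: "s < K" using s(1) K(1) by simp
    interpret rt: routing f p W wb K Y "H s" s k l "4 * T" N "\<lambda>v j u. Wk (v, j) ! u"
    proof
      show "H s v < f ^ p" for v by (rule H)
      show "\<exists>v j u. t = Rec v j u (Wk (v, j) ! u) \<and> j < k \<and> u \<le> l" if "i < f ^ p" "t \<in> Y i" for i t
        using recY[OF that] by blast
      show "fact_lt K t" if "i < f ^ p" "t \<in> Y i" for i t by (rule ltY[OF that])
      show "card {v. (\<exists>i<f ^ p. i div f ^ q = g \<and> (\<exists>j t x. Rec v j t x \<in> Y i)) \<and> H s v mod f ^ Suc q = c} \<le> 4 * T"
        if q: "q < p" for q g c
      proof (cases "g < M \<and> c < M")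
        case True
        then have "card {v \<in> Kq q g. H s v mod f ^ Suc q = c} \<le> 4 * T" using s(2) q unfolding G_def by blast
        then show ?thesis by (simp add: Kq_def del: power_Suc)
      next
        case False
        have "{v. (\<exists>i<f ^ p. i div f ^ q = g \<and> (\<exists>j t x. Rec v j t x \<in> Y i)) \<and> H s v mod f ^ Suc q = c} = {}"
        proof (rule ccontr)
          assume "\<not> ?thesis"
          then obtain v i where "i < M" "i div f ^ q = g" "H s v mod f ^ Suc q = c" by blast
          then have "g < M" "c < M"
            using H[of s v] by (meson div_le_dividend le_less_trans mod_less_eq_dividend)+
          then show False using False by simp
        qed
        then show ?thesis by (simp only: card.empty)
      qed
    qed (use sK finY in auto)
    have W2: "f * (4 * T * (k * (l + 1))) + 1 \<le> W" using W(2) by linarith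
    show "1 - e \<le> reach ((bcasts @ routes H @ [fact_round facts_in (main_step h m P (int Rn) g)]) @ gs) c1 Q"
      unfolding append_assoc
    proof (rule bcast_phase[OF _ _ _ sK h1])
      show "Seed s' \<notin> Y i" if "i < M" for i s' using recY[OF that] by blast
      show "finite (Y i) \<and> card (Y i) + f + 2 \<le> W" for i using finY cardY[of i] W(1) by simp
      show "fact_lt K t" if "i < M" "t \<in> Y i" for i t by (rule ltY[OF that])
      fix c2 assume h2: "holds M (\<lambda>i. insert (Seed s) (Y i)) c2"
      show "1 - e \<le> reach (routes H @ [fact_round facts_in (main_step h m P (int Rn) g)] @ gs) c2 Q"
      proof (rule rt.route_phase[where H=H, OF refl _ W2 h2])
        show "card (Y i) + 1 \<le> W" for i using cardY[of i] W(1) by simp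
        fix c3 assume h3: "holds M (\<lambda>i. insert (Seed s) (rt.routed p i)) c3"
        let ?X = "\<lambda>i. insert (Seed s) (rt.routed p i)"
        let ?F = "\<lambda>v i. {{x, y} | x y. x < h \<and> y < h \<and> (\<exists>j t. Rec v j t x \<in> ?X i \<and> Rec v j (Suc t) y \<in> ?X i)}"
        have R_iff: "Rec v j t x \<in> ?X i \<longleftrightarrow> H s v = i \<and> v < h \<and> j < k \<and> t \<le> l \<and> x = Wk (v, j) ! t"
          if "i < M" for v j t x i
          using rt.routed_p[OF that] Y_iff by simp
        have F_sub: "?F v i \<subseteq> cycles_edges css" if iM: "i < M" for v i
        proof
          fix ee assume "ee \<in> ?F v i"
          then obtain x y j t where *: "ee = {x, y}" "x < h" "y < h" "v < h" "j < k" "Suc t \<le> l"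
            "x = Wk (v, j) ! t" "y = Wk (v, j) ! Suc t" unfolding R_iff[OF iM] by blast
          have "{x, y} \<in> padded N css" using walk(2)[of v j t] * hN by simp
          then show "ee \<in> cycles_edges css" using small_edge[OF *(2,3)] *(1) by simp
        qed
        have nb: "new_nbs P (int Rn) g v (?F v i) = (if H s v = i then nbs (cycles_edges css') v else {})"
          if i: "i < M" for v i
        proof (cases "H s v = i \<and> v \<in> cycles_verts css")
          case True
          from True have "v \<in> cycles_verts css" by simp
          then obtain xs a where xs: "xs \<in> set css" "v = cyc_nth xs a" by (rule cycles_vertsE)
          have vs: "cyc_nth xs b < h" for b using subsetD[OF verts cyc_nth_in_verts[OF good xs(1), of b]] by simp
          have "new_nbs P (int Rn) g (cyc_nth xs a) (?F v i) = nbs (cycles_edges css') (cyc_nth xs a)"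
            unfolding css'_def
          proof (rule new_nbs_correct[OF good xs(1) good'[unfolded css'_def] loc(1) loc(4,2,3) gap[OF xs(1)] F_sub[OF i]])
            fix b :: int assume b: "- int Rn \<le> b" "b < int Rn"
            obtain j x y where j: "j < k" "{x, y} = {cyc_nth xs (a + b), cyc_nth xs (a + b + 1)}" "uses x y (Wk (v, j))"
              using cov xs b unfolding covers_def by blast
            obtain t where t: "Suc t < length (Wk (v, j))" "Wk (v, j) ! t = x" "Wk (v, j) ! Suc t = y"
              using j(3) by (auto simp: uses_def)
            have vh: "v < h" using vs xs(2) by simp
            have "Suc t \<le> l" using t(1) walk(1)[of v j] vh hN j(1) by simp
            then have "Rec v j t x \<in> ?X i" "Rec v j (Suc t) y \<in> ?X i"
              unfolding R_iff[OF i] using True vh j(1) t by auto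
            moreover have "x < h" "y < h" using j(2) vs by (metis doubleton_eq_iff)+
            ultimately have "{x, y} \<in> ?F v i" by blast
            then show "{cyc_nth xs (a + b), cyc_nth xs (a + b + 1)} \<in> ?F v i" using j(2) by simp
          qed
          then show ?thesis using True xs(2) by simp
        next
          case False
          have "{v, u} \<notin> ?F v i" for u
          proof
            assume u: "{v, u} \<in> ?F v i"
            then have "{v, u} \<in> cycles_edges css" using F_sub[OF i] by blast
            then have "v \<in> cycles_verts css" using nbs_subset_verts(2)[OF good, of v] by (auto simp: nbs_def)
            moreover have "H s v = i" using u unfolding R_iff[OF i] by blast
            ultimately show False using False by simp
          qed
          then have "new_nbs P (int Rn) g v (?F v i) = {}"
            using loc by (intro new_nbs_empty) auto
          moreover have "nbs (cycles_edges css') v = {}" if "v \<notin> cycles_verts css"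
          proof (rule nbs_subset_verts(2)[OF good'])
            show "v \<notin> cycles_verts css'" using that by (auto simp: css'_def contract_def set_concat)
          qed
          ultimately show ?thesis using False by auto
        qed
        have verts': "cycles_verts css' \<subseteq> cycles_verts css" by (auto simp: css'_def contract_def set_concat)
        have adj_h: "fst q < h" if "q \<in> adj_pairs css'" for q
          using that verts verts' unfolding adj_pairs(1)[OF good'] by auto
        have Z: "main_step h m P (int Rn) g i (?X i) =
            (\<lambda>q. (fst q mod m, Edge (fst q) (fst q) (snd q))) ` {q \<in> adj_pairs css'. H s (fst q) = i}" if iM: "i < M" for i
        proof (intro equalityI subsetI)
          fix z assume "z \<in> main_step h m P (int Rn) g i (?X i)"
          then obtain v u where "z = (v mod m, Edge v v u)" "H s v = i" "u \<in> nbs (cycles_edges css') v"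
            unfolding main_step_def nb[OF iM] by (auto split: if_splits)
          then show "z \<in> (\<lambda>q. (fst q mod m, Edge (fst q) (fst q) (snd q))) ` {q \<in> adj_pairs css'. H s (fst q) = i}"
            by (intro image_eqI[of _ _ "(v, u)"]) (auto simp: adj_pairs_def)
        next
          fix z assume "z \<in> (\<lambda>q. (fst q mod m, Edge (fst q) (fst q) (snd q))) ` {q \<in> adj_pairs css'. H s (fst q) = i}"
          then obtain v u where *: "z = (v mod m, Edge v v u)" "H s v = i" "(v, u) \<in> adj_pairs css'" by auto
          then have "v < h" "u \<in> nbs (cycles_edges css') v" using adj_h[of "(v, u)"] by (auto simp: adj_pairs_def)
          then show "z \<in> main_step h m P (int Rn) g i (?X i)"
            unfolding main_step_def nb[OF iM] using *(1,2) by auto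
        qed
        \<comment> \<open>The vertices on a machine are counted through their records of walk 0 at
          time 0, all of which arrived there within the routing budget.\<close>
        have sent: "card {q \<in> adj_pairs css'. H s (fst q) = i} \<le> W" if iM: "i < M" for i
        proof -
          let ?V = "{v \<in> cycles_verts css'. H s v = i}"
          obtain q where q: "p = Suc q" using pos(1) by (cases p) auto
          have rc: "finite (rt.routed p i) \<and> card (rt.routed p i) \<le> f * (4 * T * (k * (l + 1)))"
            using rt.card_routed[of q i] q by (simp del: power_Suc)
          have "card ?V = card ((\<lambda>v. Rec v 0 0 (Wk (v, 0) ! 0)) ` ?V)"
            by (intro card_image[symmetric] inj_onI) auto
          also have "\<dots> \<le> card (rt.routed p i)"
          proof (rule card_mono)
            show "finite (rt.routed p i)" using rc by blast
            show "(\<lambda>v. Rec v 0 0 (Wk (v, 0) ! 0)) ` ?V \<subseteq> rt.routed p i"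
            proof
              fix t assume "t \<in> (\<lambda>v. Rec v 0 0 (Wk (v, 0) ! 0)) ` ?V"
              then obtain v where v: "t = Rec v 0 0 (Wk (v, 0) ! 0)" "v \<in> cycles_verts css'" "H s v = i" by blast
              then have "v < h" using verts verts' by blast
              then show "t \<in> rt.routed p i" using R_iff[OF iM, of v 0 0 "Wk (v, 0) ! 0"] v pos(2) by simp
            qed
          qed
          finally have cV: "card ?V \<le> f * (4 * T * (k * (l + 1)))" using rc by linarith
          have "{q \<in> adj_pairs css'. H s (fst q) = i} = {q \<in> adj_pairs css'. fst q \<in> ?V}"
            unfolding adj_pairs(1)[OF good'] by auto
          also have "card \<dots> \<le> 2 * card (?V \<inter> cycles_verts css')"
            by (rule adj_pairs(3)[OF good']) simp
          also have "?V \<inter> cycles_verts css' = ?V" by auto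
          finally show ?thesis using cV W(2) by linarith
        qed
        have hK: "h \<le> K" using hN K(2) by simp
        note D = deliver_adj_facts[OF good' order_trans[OF verts' verts] hK pos(4,5),
            where own="\<lambda>q. H s (fst q)" and Z="\<lambda>i. main_step h m P (int Rn) g i (?X i)"]
        show "1 - e \<le> reach ([fact_round facts_in (main_step h m P (int Rn) g)] @ gs) c3 Q"
          unfolding append_Cons append_Nil
        proof (rule prob_reach_fact_round[OF h3])
          show "fits M W wb (\<lambda>i. main_step h m P (int Rn) g i (?X i))"
            by (rule D(1)) (use H Z sent W(3) in auto)
          fix c4 assume "holds M (delivered M (\<lambda>i. main_step h m P (int Rn) g i (?X i))) c4"
          moreover have "holds M (delivered M (\<lambda>i. main_step h m P (int Rn) g i (?X i))) = holds M (adj_facts m css')"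
            by (rule D(2)) (use H Z sent W(3) in auto)
          ultimately show "1 - e \<le> reach gs c4 Q" using cont by simp
        qed
      qed
    qed
  qed
qed

definition iter_prog ::
    "mpc \<Rightarrow> nat \<Rightarrow> nat \<Rightarrow> nat \<Rightarrow> (nat \<Rightarrow> nat \<Rightarrow> nat) \<Rightarrow> ((int \<Rightarrow> nat) \<Rightarrow> bool) \<Rightarrow> int \<Rightarrow> int \<Rightarrow> round_fun list" where
  "iter_prog A N h S H P R g =
     write_round (\<lambda>i X. if i < machines A N then concat (map (\<lambda>(u, v). [u, v]) (padded_input (machines A N) N X i)) else []) #
     map (lift_round (machines A N)) (map (local_step A N) [0..<num_rounds A N]) @
     post_prog h (machines A N) S H P R g"

text \<open>One round each for writing the input, drawing the seed and contracting, and
  \<open>p\<close> rounds each for broadcast and routing.\<close>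

lemma length_iter_prog: "length (iter_prog A N h S H P R g) = num_rounds A N + 2 * p + 3"
  by (simp add: iter_prog_def post_prog_def bcasts_def routes_def)

lemma iter_phase:
  fixes A :: mpc and N h k l n S T0 T cap L :: nat and css P r g Rn H and e dt eps :: real
  defines "m \<equiv> machines A N" and "WA \<equiv> mem_words A N"
  assumes pg: "padded_graph N h css"
    and good': "good_cycles (contract P css)"
    and loc: "local_sym r P" "0 \<le> r" "1 \<le> g" "r + g \<le> int Rn"
    and gap: "\<And>xs. xs \<in> set css \<Longrightarrow> gap_le g P (cyc_nth xs)"
    and pos: "0 < p" "0 < k" "0 < l" "0 < m" "m \<le> M"
    and H: "\<And>s v. H s v < M"
    and HF: "\<And>X q c T. X \<subseteq> {..<n} \<Longrightarrow> q \<le> p \<Longrightarrow> card X \<le> f ^ q * T \<Longrightarrow> T0 \<le> T \<Longrightarrow>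
       card {s. s < S \<and> 4 * T < card {v \<in> X. H s v mod f ^ q = c}} \<le> 2 * n"
    and T: "T0 \<le> T" "WA \<le> f * T" and hn: "h \<le> n"
    and S: "0 < S" and K: "S \<le> K" "N \<le> K" "k \<le> K" "l < K"
    and W: "WA + f + 2 \<le> W" "2 * (f * (4 * T * (k * (l + 1)))) + 1 \<le> W" "2 * (h div m + 1) \<le> W"
    and wbA: "word_bits A N \<le> wb"
    and samp: "sampler A N k l cap dt"
    and cap: "(N - N div 2) div m + 2 + 2 * (h div m + 1) \<le> cap"
    and Rn: "Rn \<le> L" and eps: "real Rn / L + 2 * real Rn * L / l \<le> eps"
    and small: "dt + real N * (2 * real Rn) * eps ^ k < 1"
    and e: "0 \<le> e"
    and hold: "holds M (adj_facts m css) c"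
    and cont: "\<And>c'. holds M (adj_facts m (contract P css)) c' \<Longrightarrow> 1 - e \<le> reach gs c' Q"
  shows "1 - (dt + real N * (2 * real Rn) * eps ^ k + real (p * M * M * (2 * n)) / real S + e)
    \<le> reach (iter_prog A N h S H P (int Rn) g @ gs) c Q"
proof -
  interpret padded_graph N h css by (rule pg)
  let ?eta = "dt + real N * (2 * real Rn) * eps ^ k" and ?d = "real (p * M * M * (2 * n)) / real S"
  let ?K = "\<lambda>i X. if i < m then concat (map (\<lambda>(u, v). [u, v]) (padded_input m N X i)) else []"
  define c0 where "c0 = init_config m (\<lambda>i. padded_input m N (adj_facts m css i) i)"
  note run = sampler_run[OF samp _ _ Rn pos(3) eps small, folded m_def WA_def, OF pos(4) cap, folded c0_def]
  have c0: "(\<lambda>i. if i < M then (?K i (adj_facts m css i), []) else ([], [])) = c0"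
    using pos(5) by (auto simp: c0_def init_config_def fun_eq_iff)
  have okK: "length (?K i (adj_facts m css i)) \<le> W \<and> set (?K i (adj_facts m css i)) \<subseteq> {..<2 ^ wb}" for i
  proof (cases "i < m")
    case True
    have "length (fst (c0 i)) \<le> WA" "set (fst (c0 i)) \<subseteq> {..<2 ^ word_bits A N}"
      using run(1) True by (auto simp: confined_def)
    moreover have "fst (c0 i) = ?K i (adj_facts m css i)" using True by (simp add: c0_def init_config_def)
    moreover have "(2::nat) ^ word_bits A N \<le> 2 ^ wb" using wbA by (simp add: power_increasing)
    ultimately show ?thesis using W(1) by (auto intro: less_le_trans)
  qed simp
  have sim: "1 - ?eta \<le> reach (map (lift_round m) (map (local_step A N) [0..<num_rounds A N])) c0 (sampled A N css k l Rn)"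
  proof -
    have "prob_reach m WA (word_bits A N) (map (local_step A N) [0..<num_rounds A N]) c0 (sampled A N css k l Rn)
      \<le> reach (map (lift_round m) (map (local_step A N) [0..<num_rounds A N])) c0 (sampled A N css k l Rn)"
      using pos(5) W(1) wbA by (intro prob_reach_simulation) (auto simp: c0_def init_config_def)
    then show ?thesis using run(2) by linarith
  qed
  have "1 - (?eta + (?d + e)) \<le> reach (map (lift_round m) (map (local_step A N) [0..<num_rounds A N]) @
      (post_prog h m S H P (int Rn) g @ gs)) c0 Q"
  proof (rule prob_reach_append[OF sim])
    fix sm assume "sm \<in> sampled A N css k l Rn"
    then show "1 - (?d + e) \<le> reach (post_prog h m S H P (int Rn) g @ gs) sm Q"
      unfolding m_def
      by (rule post_phase[OF pg _ good' loc gap pos(1-3) pos(4,5)[unfolded m_def] H HF T[unfolded WA_def] hn S K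
            W[unfolded m_def WA_def] e cont[unfolded m_def]])
  qed (use e S in auto)
  also have "\<dots> = reach (iter_prog A N h S H P (int Rn) g @ gs) c Q"
  proof -
    have "reach (write_round ?K # gs') c Q = reach gs' (\<lambda>i. if i < M then (?K i (adj_facts m css i), []) else ([], [])) Q" for gs'
      by (rule prob_reach_write_round[where K="?K", OF hold]) (rule okK)
    then show ?thesis unfolding iter_prog_def m_def[symmetric] append_Cons append_assoc c0 by simp
  qed
  finally show ?thesis by (simp add: algebra_simps)
qed

end

section \<open>The algorithm for a fixed number of vertices\<close>

lemma card_cycles_verts_le:
  assumes "good_cycles css" "\<And>xs. xs \<in> set css \<Longrightarrow> real (length xs) \<le> b"
  shows "real (card (cycles_verts css)) \<le> real (length css) * b"
proof -
  have "card (cycles_verts css) \<le> length (concat css)" by (rule card_length)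
  also have "length (concat css) = sum_list (map length css)" by (simp add: length_concat)
  finally have "real (card (cycles_verts css)) \<le> real (sum_list (map length css))" by simp
  also have "\<dots> \<le> real (length css) * b"
    using assms(2)
  proof (induction css)
    case (Cons a css)
    have "real (length a) \<le> b" using Cons.prems[of a] by simp
    moreover have "real (sum_list (map length css)) \<le> real (length css) * b"
      using Cons.prems by (intro Cons.IH) auto
    ultimately show ?case by (simp add: algebra_simps)
  qed simp
  finally show ?thesis .
qed

definition all_edges :: "fact set \<Rightarrow> nat set set" where
  "all_edges X = {{v, u} | v u. Edge v v u \<in> X}"

definition gather_step :: "nat \<Rightarrow> fact set \<Rightarrow> (nat \<times> fact) set" where
  "gather_step i X = Pair 0 ` X"

definition verdict :: "nat \<Rightarrow> fact set \<Rightarrow> nat list" where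
  "verdict i X = (if i = 0 then [if single_cycle (all_edges X) then 1 else 0] else [])"

text \<open>\<open>T\<close> and \<open>Tr\<close> are the load thresholds of routing and of
  renaming, \<open>Lw\<close> is the escape distance in the walk analysis, and \<open>LB\<close> and
  \<open>L1\<close> are the bit lengths of labels and of once reduced colours.\<close>

locale reduction = net +
  fixes A :: mpc and N h k l n S T0 T Tr cap D LB L1 Lw :: nat
    and H :: "nat \<Rightarrow> nat \<Rightarrow> nat" and dt eps :: real
  assumes pos: "0 < p" "0 < k" "0 < l" "0 < machines A N" "machines A N \<le> f ^ p" "0 < D" "0 < L1" "0 < LB"
    and H: "\<And>s v. H s v < f ^ p"
    and HF: "\<And>X q c T. X \<subseteq> {..<n} \<Longrightarrow> q \<le> p \<Longrightarrow> card X \<le> f ^ q * T \<Longrightarrow> T0 \<le> T \<Longrightarrow>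
       card {s. s < S \<and> 4 * T < card {v \<in> X. H s v mod f ^ q = c}} \<le> 2 * n"
    and T: "T0 \<le> T" "mem_words A N \<le> f * T" "T0 \<le> Tr" and hn: "h \<le> n"
    and S: "0 < S" and K: "S \<le> K" "N \<le> K" "k \<le> K" "l < K" "n \<le> K"
    and W: "mem_words A N + f + 2 \<le> W" "2 * (f * (4 * T * (k * (l + 1)))) + 1 \<le> W"
      "2 * (h div machines A N + 1) \<le> W" "162 * (n div f ^ p + 1) + f + 2 \<le> W" "5 * (4 * Tr) + 1 \<le> W"
    and wbA: "word_bits A N \<le> wb" "0 < wb"
    and samp: "sampler A N k l cap dt"
    and cap: "(N - N div 2) div machines A N + 2 + 2 * (h div machines A N + 1) \<le> cap"
    and Nh: "4 \<le> N" "h < N div 2" "f ^ p * (4 * Tr) \<le> h"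
    and LB: "n \<le> 2 ^ LB" "16 * LB\<^sup>2 \<le> 2 ^ L1"
    and Lw: "4 * (2 * LB * D + 1) \<le> Lw"
    and eps: "real (4 * (2 * LB * D + 1)) / Lw + 2 * real (4 * (2 * LB * D + 1)) * Lw / l \<le> eps"
    and small: "dt + real N * (2 * real (4 * (2 * LB * D + 1))) * eps ^ k < 1" and dt: "0 \<le> dt"
begin

abbreviation m :: nat where "m \<equiv> machines A N"
abbreviation gn :: nat where "gn \<equiv> 2 * LB * D + 1"
text \<open>The locality \<open>3 * gn\<close> of \<open>PK\<close>, chosen so that long cycles keep
  at least 3 vertices, plus the gap \<open>gn\<close>.\<close>

abbreviation Rn :: nat where "Rn \<equiv> 4 * gn"
abbreviation PK :: "(int \<Rightarrow> nat) \<Rightarrow> bool" where "PK \<equiv> main_keep (int D) LB (int (3 * gn))"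
abbreviation iter :: "round_fun list" where "iter \<equiv> iter_prog A N h S H PK (int Rn) (int gn)"

text \<open>The failure sources of one contraction, in this order: deviation of the sampled law, an
  uncovered neighbourhood, an unbalanced seed.\<close>

definition err :: real where
  "err = dt + real N * (2 * real Rn) * eps ^ k + real (p * M * M * (2 * n)) / real S"

lemma shrink_factor: "1 \<le> 32 * real L1 ^ 2"
proof -
  have "1 \<le> real L1" using pos(7) by simp
  then have "1 \<le> real L1 ^ 2" by (rule one_le_power)
  then show ?thesis by linarith
qed

lemma eps_nonneg: "0 \<le> eps"
proof -
  have "0 \<le> real (4 * gn) / Lw + 2 * real (4 * gn) * Lw / l" by (intro add_nonneg_nonneg divide_nonneg_nonneg mult_nonneg_nonneg) auto
  then show ?thesis using eps by linarith
qed

lemma err_nonneg: "0 \<le> err"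
  unfolding err_def using dt eps_nonneg by (intro add_nonneg_nonneg) auto

text \<open>A stage at most halves a cycle, so the initial length \<open>6 * 2 ^ tau\<close>
  guarantees valid cycles through all stages.\<close>

lemma pre_loop:
  assumes "good_cycles css" "cycles_verts css \<subseteq> {..<n}" "\<And>xs. xs \<in> set css \<Longrightarrow> 6 * 2 ^ tau \<le> length xs"
    and "\<And>xs. xs \<in> set css \<Longrightarrow> real (length xs) \<le> b" "holds M (adj_facts M css) c"
    and "\<And>css' c'. good_cycles css' \<Longrightarrow> length css' = length css \<Longrightarrow> cycles_verts css' \<subseteq> {..<n} \<Longrightarrow>
       (\<And>xs. xs \<in> set css' \<Longrightarrow> real (length xs) \<le> (1 - 1 / (32 * real L1 ^ 2)) ^ tau * b) \<Longrightarrow>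
       holds M (adj_facts M css') c' \<Longrightarrow> 1 - e \<le> reach gs c' Q"
  shows "1 - e \<le> reach (concat (replicate tau pre_stage) @ gs) c Q"
  using assms
proof (induction tau arbitrary: css b c)
  case 0
  then show ?case by simp
next
  case (Suc tau)
  note good = Suc.prems(1)
  have kp: "keep pre_keep css (cyc_nth xs i) \<longleftrightarrow> pre_keep (sh i (cyc_nth xs))" if "xs \<in> set css" for xs i
    by (rule keep_cyc_nth[OF good that])
  have lt: "v < 2 ^ LB" if "xs \<in> set css" "v \<in> set xs" for xs v
    using that Suc.prems(2) LB(1) by (fastforce simp: set_concat)
  have len: "32 * L1\<^sup>2 * length (filter (keep pre_keep css) xs) \<le> (32 * L1\<^sup>2 - 1) * length xs"
    "length xs \<le> 2 * length (filter (keep pre_keep css) xs)" if "xs \<in> set css" for xs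
    using length_pre_keep[OF good_cyclesD(1,3)[OF good that] lt[OF that] LB(2) kp[OF that]] by auto
  have six: "6 * 2 ^ tau \<le> length (filter (keep pre_keep css) xs)" if "xs \<in> set css" for xs
    using len(2)[OF that] Suc.prems(3)[OF that] by simp
  have three: "3 \<le> length (filter (keep pre_keep css) xs)" if "xs \<in> set css" for xs
  proof -
    have "(6::nat) * 1 \<le> 6 * 2 ^ tau" by (intro mult_left_mono) auto
    then show ?thesis using six[OF that] by linarith
  qed
  have good': "good_cycles (contract pre_keep css)" "cycles_verts (contract pre_keep css) \<subseteq> cycles_verts css"
    using good_cycles_contract[OF good three] by auto
  have b: "real (length (filter (keep pre_keep css) xs)) \<le> (1 - 1 / (32 * real L1 ^ 2)) * b" if "xs \<in> set css" for xs
  proof -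
    let ?K = "32 * real L1 ^ 2"
    have K: "1 \<le> ?K" by (rule shrink_factor)
    have "1 \<le> 32 * L1\<^sup>2" using pos(7) by simp
    then have "real ((32 * L1\<^sup>2 - 1) * length xs) = (?K - 1) * real (length xs)"
      by (simp add: of_nat_diff)
    moreover have "real (32 * L1\<^sup>2 * length (filter (keep pre_keep css) xs)) \<le> real ((32 * L1\<^sup>2 - 1) * length xs)"
      using len(1)[OF that] by (simp only: of_nat_le_iff)
    moreover have "real (32 * L1\<^sup>2 * length (filter (keep pre_keep css) xs)) = real (length (filter (keep pre_keep css) xs)) * ?K"
      by simp
    ultimately have "real (length (filter (keep pre_keep css) xs)) * ?K \<le> (?K - 1) * real (length xs)" by linarith
    also have "\<dots> \<le> (?K - 1) * b" using K Suc.prems(4)[OF that] by (intro mult_left_mono) auto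
    finally have "real (length (filter (keep pre_keep css) xs)) \<le> (?K - 1) * b / ?K"
      using K by (intro mult_imp_le_div_pos) linarith+
    also have "\<dots> = (1 - 1 / ?K) * b" using pos(7) by (simp add: left_diff_distrib diff_divide_distrib)
    finally show ?thesis .
  qed
  have "162 * (n div M + 1) \<le> W" using W(4) by simp
  then show ?case
    unfolding replicate_Suc concat.simps append_assoc
  proof (rule pre_stage_phase[OF good good'(1) Suc.prems(2) K(5) LB _ Suc.prems(5)])
    fix c' assume h': "holds M (adj_facts M (contract pre_keep css)) c'"
    show "1 - e \<le> reach (concat (replicate tau pre_stage) @ gs) c' Q"
    proof (rule Suc.IH[OF good'(1) _ _ _ h'])
      show "cycles_verts (contract pre_keep css) \<subseteq> {..<n}" using good'(2) Suc.prems(2) by blast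
      show "6 * 2 ^ tau \<le> length xs" if "xs \<in> set (contract pre_keep css)" for xs
        using that six by (auto simp: contract_def)
      show "real (length xs) \<le> (1 - 1 / (32 * real L1 ^ 2)) * b" if "xs \<in> set (contract pre_keep css)" for xs
        using that b by (auto simp: contract_def)
      fix css' c' assume *: "good_cycles css'" "length css' = length (contract pre_keep css)" "cycles_verts css' \<subseteq> {..<n}"
        "\<And>xs. xs \<in> set css' \<Longrightarrow> real (length xs) \<le> (1 - 1 / (32 * real L1 ^ 2)) ^ tau * ((1 - 1 / (32 * real L1 ^ 2)) * b)"
        "holds M (adj_facts M css') c'"
      show "1 - e \<le> reach gs c' Q"
        by (rule Suc.prems(6)) (use * in \<open>auto simp: contract_def algebra_simps\<close>)
    qed
  qed
qed

text \<open>The maximum in the length bound reflects that cycles of length at most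
  \<open>3 * gn\<close> are no longer contracted.\<close>

lemma main_loop:
  fixes b :: real
  assumes "good_cycles css" "cycles_verts css \<subseteq> {..<h}"
    and "\<And>xs. xs \<in> set css \<Longrightarrow> real (length xs) \<le> max b (real (3 * gn))" "holds M (adj_facts m css) c" "0 \<le> e"
    and "\<And>css' c'. good_cycles css' \<Longrightarrow> length css' = length css \<Longrightarrow> cycles_verts css' \<subseteq> {..<h} \<Longrightarrow>
       (\<And>xs. xs \<in> set css' \<Longrightarrow> real (length xs) \<le> max (b / D ^ Tm) (real (3 * gn))) \<Longrightarrow>
       holds M (adj_facts m css') c' \<Longrightarrow> 1 - e \<le> reach gs c' Q"
  shows "1 - (real Tm * err + e) \<le> reach (concat (replicate Tm iter) @ gs) c Q"
  using assms(1-4,6)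
proof (induction Tm arbitrary: css b c)
  case 0
  then show ?case by simp
next
  case (Suc Tm)
  note good = Suc.prems(1)
  let ?css' = "contract PK css"
  have kp: "keep PK css (cyc_nth xs i) \<longleftrightarrow> PK (sh i (cyc_nth xs))" if "xs \<in> set css" for xs i
    by (rule keep_cyc_nth[OF good that])
  have lt: "v < 2 ^ LB" if "xs \<in> set css" "v \<in> set xs" for xs v
    using that Suc.prems(2) LB(1) hn by (fastforce simp: set_concat)
  have gnD: "int D \<le> int (3 * gn)"
  proof -
    have "1 * D \<le> LB * D" using pos(8) by (intro mult_right_mono) auto
    also have "LB * D \<le> 3 * gn" by simp
    finally have "D \<le> 3 * gn" by simp
    then show ?thesis by (simp only: of_nat_le_iff)
  qed
  have gap: "gap_le (int gn) PK (cyc_nth xs)" if "xs \<in> set css" for xs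
    by (rule gap_main_keep[OF good_cyclesD(1,3)[OF good that] lt[OF that] pos(6) gnD]) auto
  have len: "D * length (filter (keep PK css) xs) \<le> length xs \<or> filter (keep PK css) xs = xs \<and> int (length xs) \<le> int (3 * gn)"
    "3 \<le> length (filter (keep PK css) xs)" if "xs \<in> set css" for xs
    using length_main_keep[OF good_cyclesD(1,3)[OF good that] lt[OF that] pos(6) gnD, of "int gn", OF _ _ _ kp[OF that]] by auto
  have good': "good_cycles ?css'" "cycles_verts ?css' \<subseteq> cycles_verts css"
    using good_cycles_contract[OF good len(2)] by auto
  have b: "real (length (filter (keep PK css) xs)) \<le> max (b / D) (real (3 * gn))" if "xs \<in> set css" for xs
    using len(1)[OF that]
  proof
    assume "D * length (filter (keep PK css) xs) \<le> length xs"
    then have "real D * real (length (filter (keep PK css) xs)) \<le> real (length xs)"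
      by (metis of_nat_le_iff of_nat_mult)
    also have "\<dots> \<le> max b (real (3 * gn))" by (rule Suc.prems(3)[OF that])
    finally have "real (length (filter (keep PK css) xs)) \<le> max b (real (3 * gn)) / D"
      using pos(6) by (simp add: field_simps)
    also have "\<dots> \<le> max (b / D) (real (3 * gn))"
    proof -
      have "real (3 * gn) / D \<le> real (3 * gn) / 1" using pos(6) by (intro divide_left_mono) auto
      then show ?thesis by (auto simp: max_def)
    qed
    finally show ?thesis .
  next
    assume *: "filter (keep PK css) xs = xs \<and> int (length xs) \<le> int (3 * gn)"
    then have "real (length xs) \<le> real (3 * gn)" by (simp only: of_nat_le_iff)
    then show ?thesis unfolding *[THEN conjunct1] by (rule order_trans) (rule max.cobounded2)
  qed
  have loc: "local_sym (int (3 * gn)) PK"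
    by (rule local_sym_main_keep) auto
  have r0: "0 \<le> int (3 * gn)" and g1: "1 \<le> int gn" and rg: "int (3 * gn) + int gn \<le> int Rn" by auto
  have e0: "0 \<le> real Tm * err + e" using err_nonneg assms(5) by simp
  have pg: "padded_graph N h css" using Nh good Suc.prems(2) by unfold_locales auto
  have F: "1 - (dt + real N * (2 * real Rn) * eps ^ k + real (p * M * M * (2 * n)) / real S + (real Tm * err + e))
    \<le> reach (iter @ (concat (replicate Tm iter) @ gs)) c Q"
  proof (rule iter_phase[where T=T and L=Lw and eps=eps, OF pg good'(1) loc r0 g1 rg gap pos(1-5) H HF T(1,2) hn
        S K(1-4) W(1-3) wbA(1) samp cap Lw eps small e0 Suc.prems(4)])
    show "1 - (real Tm * err + e) \<le> reach (concat (replicate Tm iter) @ gs) c' Q" if h': "holds M (adj_facts m ?css') c'" for c'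
    proof (rule Suc.IH[OF good'(1) _ _ h'])
      show "cycles_verts ?css' \<subseteq> {..<h}" using good'(2) Suc.prems(2) by blast
      show "real (length xs) \<le> max (b / D) (real (3 * gn))" if "xs \<in> set ?css'" for xs
        using that b by (auto simp: contract_def)
      fix css' c' assume *: "good_cycles css'" "length css' = length ?css'" "cycles_verts css' \<subseteq> {..<h}"
        "\<And>xs. xs \<in> set css' \<Longrightarrow> real (length xs) \<le> max (b / D / D ^ Tm) (real (3 * gn))" "holds M (adj_facts m css') c'"
      show "1 - e \<le> reach gs c' Q"
        by (rule Suc.prems(5)) (use * in \<open>auto simp: contract_def\<close>)
    qed
  qed
  have eq: "real (Suc Tm) * err + e = err + (real Tm * err + e)" by (simp add: algebra_simps)
  show ?case unfolding eq replicate_Suc concat.simps append_assoc using F[folded err_def] .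
qed

text \<open>Machine 0 receives at most two oriented edges per remaining vertex, which explains the
  factor 2 in the space condition.\<close>

lemma final_phase:
  assumes good: "good_cycles css" and verts: "cycles_verts css \<subseteq> {..<h}" and ne: "css \<noteq> []"
    and small: "2 * card (cycles_verts css) \<le> W" and hold: "holds M (adj_facts m css) c"
  shows "reach [fact_round facts_in gather_step, write_round verdict] c
    {c'. fst (c' 0) = [if length css = 1 then 1 else 0]} = 1"
proof -
  let ?Q = "{c'. fst (c' 0) = [if length css = 1 then 1 else 0 :: nat]}"
  have W1: "1 \<le> W" using W(4) by simp
  have hK: "h \<le> K" using hn K by simp
  have "1 - 0 \<le> reach [fact_round facts_in gather_step, write_round verdict] c ?Q"
  proof (rule prob_reach_fact_round[OF hold])
    let ?Z = "\<lambda>i. gather_step i (adj_facts m css i)"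
    have Z: "?Z i = (\<lambda>q. (0, Edge (fst q) (fst q) (snd q))) ` {q \<in> adj_pairs css. fst q mod m = i}" for i
      unfolding gather_step_def adj_facts_def adj_pairs_def by force
    show "fits M W wb ?Z"
    proof (rule fits_indexed[where U="adj_pairs css" and src="\<lambda>q. fst q mod m" and dst="\<lambda>q. 0"
          and fc="\<lambda>q. Edge (fst q) (fst q) (snd q)"])
      show "finite (adj_pairs css)" by (rule adj_pairs(2)[OF good])
      show "?Z i \<subseteq> (\<lambda>q. (0, Edge (fst q) (fst q) (snd q))) ` {q \<in> adj_pairs css. fst q mod m = i}" for i
        using Z by simp
      show "card {q \<in> adj_pairs css. fst q mod m = i} \<le> W" for i
        using card_adj_pairs_home[OF good verts pos(4), of i] W(3) by simp
      show "card {q \<in> adj_pairs css. 0 = j} \<le> W" for j :: nat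
        using adj_pairs(4)[OF good] small by (cases "j = 0") auto
      show "0 < M \<and> enc (Edge (fst q) (fst q) (snd q)) < 2 ^ wb" if "q \<in> adj_pairs css" for q
      proof -
        have "fst q \<in> cycles_verts css" "snd q \<in> cycles_verts css"
          using that nbs_subset_verts(1)[OF good, of "fst q"] unfolding adj_pairs(1)[OF good] by auto
        then have "fact_lt K (Edge (fst q) (fst q) (snd q))" using verts hK by auto
        then show ?thesis using M bits by blast
      qed
    qed
    fix c' assume h': "holds M (delivered M ?Z) c'"
    have X0: "delivered M ?Z 0 = (\<lambda>q. Edge (fst q) (fst q) (snd q)) ` adj_pairs css"
    proof (intro equalityI subsetI)
      fix t assume "t \<in> (\<lambda>q. Edge (fst q) (fst q) (snd q)) ` adj_pairs css"
      then obtain q where q: "t = Edge (fst q) (fst q) (snd q)" "q \<in> adj_pairs css" by blast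
      have "fst q mod m < M" using pos by (meson less_le_trans mod_less_divisor)
      then show "t \<in> delivered M ?Z 0" unfolding delivered_def Z using q by blast
    qed (auto simp: delivered_def Z)
    have "all_edges (delivered M ?Z 0) = {{fst q, snd q} | q. q \<in> adj_pairs css}"
      unfolding all_edges_def X0 by force
    also have "\<dots> = cycles_edges css"
    proof (intro equalityI subsetI)
      fix ee assume e: "ee \<in> cycles_edges css"
      then obtain xs i where "ee = {cyc_nth xs i, cyc_nth xs (i + 1)}"
        by (auto simp: cycles_edges_def cyc_edges_def)
      then show "ee \<in> {{fst q, snd q} | q. q \<in> adj_pairs css}"
        using e by (auto simp: adj_pairs_def nbs_def intro!: exI[of _ "(cyc_nth xs i, cyc_nth xs (i + 1))"])
    qed (auto simp: adj_pairs_def nbs_def)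
    finally have E: "single_cycle (all_edges (delivered M ?Z 0)) \<longleftrightarrow> length css = 1"
      using single_cycle_iff[OF good ne] by simp
    have two: "1 < (2::nat) ^ wb" using one_less_power[of "2::nat" wb] wbA(2) by simp
    have "reach [write_round verdict] c' ?Q = reach [] (\<lambda>i. if i < M then (verdict i (delivered M ?Z i), []) else ([], [])) ?Q"
      by (rule prob_reach_write_round[OF h']) (use W1 two in \<open>auto simp: verdict_def\<close>)
    also have "\<dots> = 1" using M E by (simp add: prob_reach_Nil verdict_def)
    finally show "1 - 0 \<le> reach [write_round verdict] c' ?Q" by simp
  qed
  then show ?thesis using prob_reach_le_1[of M W wb] by (simp add: antisym)
qed

definition prog :: "nat \<Rightarrow> nat \<Rightarrow> round_fun list" where
  "prog tau Tm = fact_round (\<lambda>m b. word_pairs m) init_step # concat (replicate tau pre_stage) @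
     rename_phase_prog S H (4 * Tr) m @ concat (replicate Tm iter) @
     [fact_round facts_in gather_step, write_round verdict]"

text \<open>The 7 counts one round for the input, four of renaming apart from its broadcast, and two
  final rounds. A pre-stage has four floodings and one contraction.\<close>

lemma length_prog: "length (prog tau Tm) = 7 + 5 * tau + p + Tm * (num_rounds A N + 2 * p + 3)"
  by (simp add: prog_def length_concat sum_list_replicate pre_stage_def rename_phase_prog_def bcasts_def length_iter_prog)

text \<open>All phases preserve the number of cycles, and only this number decides the
  verdict.\<close>

theorem prog_correct:
  assumes good: "good_cycles css" and verts: "cycles_verts css = {..<n}" and ne: "css \<noteq> []" "length css \<le> 2"
    and len: "\<And>xs. xs \<in> set css \<Longrightarrow> 6 * 2 ^ tau \<le> length xs"
    and I: "edge_input M capB (cycles_edges css) I" "2 * capB \<le> W"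
    and shrink: "2 * ((1 - 1 / (32 * real L1 ^ 2)) ^ tau * n) \<le> real (M * Tr)"
    and fin: "4 * max (real h / D ^ Tm) (real (3 * gn)) \<le> real W"
  shows "1 - (real (M * (2 * n)) / real S + real Tm * err) \<le>
    reach (prog tau Tm) (init_config M I) {c. fst (c 0) = [if length css = 1 then 1 else 0]}"
proof -
  let ?d = "real (M * (2 * n)) / real S" and ?Q = "\<lambda>css. {c. fst (c 0) = [if length css = 1 then 1 else 0 :: nat]}"
  let ?fin = "[fact_round facts_in gather_step, write_round verdict]"
  have lenn: "length xs \<le> n" if "xs \<in> set css" for xs
  proof -
    have "length xs = card (set xs)" using good_cyclesD(1)[OF good that] by (simp add: distinct_card)
    also have "\<dots> \<le> card {..<n}" using that verts by (intro card_mono) (auto simp: set_concat)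
    finally show ?thesis by simp
  qed
  have fin': "1 - 0 \<le> reach ?fin c (?Q css)"
    if "good_cycles css'" "length css' = length css" "cycles_verts css' \<subseteq> {..<h}"
      "\<And>xs. xs \<in> set css' \<Longrightarrow> real (length xs) \<le> max (real h / D ^ Tm) (real (3 * gn))" "holds M (adj_facts m css') c" for css' c
  proof -
    have "real (card (cycles_verts css')) \<le> real (length css') * max (real h / D ^ Tm) (real (3 * gn))"
      by (rule card_cycles_verts_le[OF that(1,4)])
    also have "\<dots> \<le> 2 * max (real h / D ^ Tm) (real (3 * gn))"
      using that(2) ne(2) by (intro mult_right_mono) (auto simp: le_max_iff_disj)
    finally have "real (2 * card (cycles_verts css')) \<le> real W" using fin by simp
    then have "2 * card (cycles_verts css') \<le> W" by (simp only: of_nat_le_iff)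
    moreover have "css' \<noteq> []" using that(2) ne(1) by auto
    ultimately show ?thesis using final_phase[OF that(1,3) _ _ that(5)] that(2) by simp
  qed
  have main: "1 - (real Tm * err + 0) \<le> reach (concat (replicate Tm iter) @ ?fin) c (?Q css)"
    if "good_cycles css'" "length css' = length css" "cycles_verts css' \<subseteq> {..<h}" "holds M (adj_facts m css') c" for css' c
  proof (rule main_loop[where b="real h", OF that(1,3) _ that(4)])
    fix xs assume xs: "xs \<in> set css'"
    have "length xs = card (set xs)" using good_cyclesD(1)[OF that(1) xs] by (simp add: distinct_card)
    also have "\<dots> \<le> card {..<h}" using xs that(3) by (intro card_mono) (auto simp: set_concat)
    finally show "real (length xs) \<le> max (real h) (real (3 * gn))" by simp
  next
    fix css'' c'
    assume "good_cycles css''" "length css'' = length css'" "cycles_verts css'' \<subseteq> {..<h}"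
      "\<And>xs. xs \<in> set css'' \<Longrightarrow> real (length xs) \<le> max (real h / D ^ Tm) (real (3 * gn))" "holds M (adj_facts m css'') c'"
    then show "1 - 0 \<le> reach ?fin c' (?Q css)" using that(2) by (intro fin'[of css'']) auto
  qed simp
  have rename: "1 - (?d + real Tm * err) \<le> reach (rename_phase_prog S H (4 * Tr) m @ concat (replicate Tm iter) @ ?fin) c (?Q css)"
    if css': "good_cycles css'" "length css' = length css" "cycles_verts css' \<subseteq> {..<n}"
      "\<And>xs. xs \<in> set css' \<Longrightarrow> real (length xs) \<le> (1 - 1 / (32 * real L1 ^ 2)) ^ tau * n" "holds M (adj_facts M css') c" for css' c
  proof (rule rename_phase[OF css'(1,3) K(5) S K(1) H _ Nh(3) _ pos(4,5) _ W(5,3) css'(5)])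
    let ?V = "cycles_verts css'"
    have "0 \<le> 1 - 1 / (32 * real L1 ^ 2)" using shrink_factor pos(7) by (simp add: divide_le_eq_1)
    then have nn: "0 \<le> (1 - 1 / (32 * real L1 ^ 2)) ^ tau * n" by (intro mult_nonneg_nonneg zero_le_power) auto
    have "real (card ?V) \<le> real (length css') * ((1 - 1 / (32 * real L1 ^ 2)) ^ tau * n)"
      by (rule card_cycles_verts_le[OF css'(1,4)])
    also have "\<dots> \<le> 2 * ((1 - 1 / (32 * real L1 ^ 2)) ^ tau * n)"
      using css'(2) ne(2) nn by (intro mult_right_mono) auto
    finally have "real (card ?V) \<le> real (M * Tr)" using shrink by linarith
    then have cV: "card ?V \<le> f ^ p * Tr" by (simp only: of_nat_le_iff)
    have "card {s. s < S \<and> \<not> (\<forall>j<M. card {v \<in> ?V. H s v = j} \<le> 4 * Tr)} \<le>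
        card (\<Union>j\<in>{..<M}. {s. s < S \<and> 4 * Tr < card {v \<in> ?V. H s v mod f ^ p = j}})"
      using H by (intro card_mono) (auto simp: not_le)
    also have "\<dots> \<le> (\<Sum>j<M. card {s. s < S \<and> 4 * Tr < card {v \<in> ?V. H s v mod f ^ p = j}})"
      by (rule card_UN_le) simp
    also have "\<dots> \<le> (\<Sum>j<M. 2 * n)" by (intro sum_mono HF css'(3) cV T) auto
    also have "\<dots> = M * (2 * n)" by simp
    finally show "real (card {s. s < S \<and> \<not> (\<forall>j<M. card {v \<in> ?V. H s v = j} \<le> 4 * Tr)}) \<le> ?d * real S"
      using S by (simp del: of_nat_mult)
    show "h \<le> K" using hn K by simp
    show "2 * (n div M + 1) + f + 2 \<le> W" using W(4) by simp
    show "0 \<le> real Tm * err" using err_nonneg by simp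
    fix css'' c' assume *: "good_cycles css''" "map length css'' = map length css'" "cycles_verts css'' \<subseteq> {..<h}"
      "holds M (adj_facts m css'') c'"
    have "length css'' = length css" using *(2) css'(2) by (metis length_map)
    then show "1 - real Tm * err \<le> reach (concat (replicate Tm iter) @ ?fin) c' (?Q css)"
      using main[OF *(1) _ *(3,4)] by simp
  qed
  show ?thesis
    unfolding prog_def
  proof (rule init_phase[OF good _ K(5) I])
    show "cycles_verts css \<subseteq> {..<n}" using verts by simp
    show "2 * (n div M + 1) \<le> W" using W(4) by simp
    fix c' assume h': "holds M (adj_facts M css) c'"
    show "1 - (?d + real Tm * err) \<le> reach (concat (replicate tau pre_stage) @
       rename_phase_prog S H (4 * Tr) m @ concat (replicate Tm iter) @ ?fin) c' (?Q css)"
      by (rule pre_loop[where b="real n", OF good _ len _ h']) (use verts lenn rename in auto)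
  qed
qed

end

section \<open>Choice of parameters\<close>

lemma sum_length_filter_eq:
  fixes m :: nat
  assumes "\<And>q. q \<in> set xs \<Longrightarrow> g q < m"
  shows "(\<Sum>i<m. length (filter (\<lambda>q. g q = i) xs)) = length xs"
  using assms
proof (induction xs)
  case (Cons a xs)
  have "(\<Sum>i<m. length (filter (\<lambda>q. g q = i) (a # xs))) =
      (\<Sum>i<m. (if i = g a then 1 else 0) + length (filter (\<lambda>q. g q = i) xs))"
    by (intro sum.cong) auto
  also have "\<dots> = 1 + length xs" using Cons by (simp add: sum.distrib)
  finally show ?case by simp
qed simp

lemma length_flat_pairs: "length (concat (map (\<lambda>(u, v). [u, v]) xs)) = 2 * length xs"
  by (induction xs) auto

text \<open>A sampler must hold its input. The graph of pendant edges alone, obtained from the empty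
  cycle system, has at least \<open>N / 2\<close> edges of two words each.\<close>

lemma sampler_space:
  assumes samp: "sampler A N k l cap dt" and N: "4 \<le> N" "h < N div 2" and m: "0 < machines A N"
    and cap: "(N - N div 2) div machines A N + 2 + 2 * (h div machines A N + 1) \<le> cap"
    and l: "0 < l" and dt: "dt < 1"
  shows "N \<le> machines A N * mem_words A N"
proof -
  interpret padded_graph N h "[]" using N by unfold_locales (auto simp: good_cycles_def)
  let ?m = "machines A N"
  let ?I = "\<lambda>i. padded_input ?m N (adj_facts ?m [] i) i"
  let ?g = "\<lambda>i. filter (\<lambda>q. fst q mod ?m = i) (pads N)"
  have c0: "init_config ?m ?I \<in> confined ?m (mem_words A N) (word_bits A N)"
    by (rule sampler_run(1)[OF samp m cap, of 0 0 0]) (use l dt in auto)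
  have "2 * length (?g i) \<le> mem_words A N" if "i < ?m" for i
  proof -
    have "length (fst (init_config ?m ?I i)) + length (snd (init_config ?m ?I i)) \<le> mem_words A N"
      using c0 that unfolding confined_def by blast
    then have "2 * length (?I i) \<le> mem_words A N" using that by (simp add: init_config_def length_flat_pairs)
    moreover have "length (?g i) \<le> length (?I i)" by (simp add: padded_input_def case_prod_unfold)
    ultimately show ?thesis by linarith
  qed
  then have "(\<Sum>i<?m. 2 * length (?g i)) \<le> ?m * mem_words A N"
    using sum_bounded_above[of "{..<?m}" "\<lambda>i. 2 * length (?g i)" "mem_words A N"] by simp
  moreover have "(\<Sum>i<?m. 2 * length (?g i)) = 2 * length (pads N)"
    using m by (subst sum_distrib_left[symmetric], subst sum_length_filter_eq) auto
  moreover have "N \<le> 2 * length (pads N)" by (simp add: pads_def)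
  ultimately show ?thesis by linarith
qed

text \<open>Chosen so that its \<open>p\<close>-th power is about
  \<open>n powr (1 - \<gamma>)\<close>, the permitted number of machines.\<close>

definition fan_in :: "real \<Rightarrow> nat \<Rightarrow> nat \<Rightarrow> nat" where
  "fan_in \<gamma> p n = nat \<lceil>real n powr ((1 - \<gamma>) / real p)\<rceil>"

definition share :: "real \<Rightarrow> nat \<Rightarrow> nat" where
  "share \<gamma> n = nat \<lceil>real n powr \<gamma>\<rceil>"

definition label_bits :: "nat \<Rightarrow> nat" where
  "label_bits n = nat \<lceil>log 2 (real n)\<rceil>"

text \<open>Facts about numbers below \<open>n ^ 6\<close> have codes below
  \<open>2 ^ 30 * n ^ 96\<close>; the term with \<open>C\<close> accommodates the words of the
  sampler.\<close>

definition net_bits :: "real \<Rightarrow> nat \<Rightarrow> nat" where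
  "net_bits C n = 30 + (96 + nat \<lceil>C\<rceil>) * label_bits n"

text \<open>Ensures \<open>16 * (label_bits n)^2 \<le> 2 ^ short_bits n\<close>, so that once
  reduced colours have this many bits.\<close>

definition short_bits :: "nat \<Rightarrow> nat" where
  "short_bits n = 4 + 2 * nat \<lceil>log 2 (real (label_bits n))\<rceil>"

text \<open>A stage shrinks lengths by the factor \<open>1 - 1 / (32 * L1^2)\<close>, so these
  stages give at most \<open>exp (- 9 - (ex + 1) * L1)\<close>, which lies below a small constant
  times \<open>1 / (ln n) ^ (ex + 1)\<close>.\<close>

definition pre_stages :: "nat \<Rightarrow> nat \<Rightarrow> nat" where
  "pre_stages ex n = 32 * (short_bits n)\<^sup>2 * (9 + (ex + 1) * short_bits n)"

definition shrinkage :: "nat \<Rightarrow> nat" where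
  "shrinkage n = nat \<lfloor>real (label_bits n) powr (1 / 4)\<rfloor>"

definition main_stages :: "nat \<Rightarrow> nat \<Rightarrow> nat" where
  "main_stages n N = nat \<lceil>ln (real N) / ln (real (shrinkage n))\<rceil>"

text \<open>All asymptotic inequalities are isolated as one condition on a real number, so that the
  work at a fixed \<open>n\<close> is plain arithmetic. Two of them are quantified over
  \<open>b \<ge> ln x\<close>, because they are used at the rounded value
  \<open>label_bits n\<close>.\<close>

definition large :: "real \<Rightarrow> real \<Rightarrow> real \<Rightarrow> nat \<Rightarrow> nat \<Rightarrow> real \<Rightarrow> bool" where
  "large \<gamma> C c p ex x \<longleftrightarrow>
     1000 \<le> ln x \<and> 14 \<le> ln (ln x) \<and> C \<le> ln x \<and>
     12 * ln x + 3 \<le> x powr \<gamma> / (64 * 2 ^ p * ln x ^ (ex + 1)) \<and>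
     2 ^ p * x powr (1 - \<gamma>) + 1 \<le> x / (100 * ln x ^ (ex + 1)) \<and>
     8 * ((x powr (\<gamma> / 2) + 1) * (12 * ln x + 1) + C * (x powr \<gamma> / ln x ^ 7)) * (C * ln x * (C * ln x ^ 4 + 1)) + 1
       \<le> x powr \<gamma> \<and>
     x powr (\<gamma> / 2) + 300 + C * (x powr \<gamma> / ln x ^ 7) \<le> x powr \<gamma> \<and>
     C * ln x ^ 4 + C * ln x + 1 \<le> x \<and>
     (\<forall>b\<ge>ln x. 4 * (2 * b * b powr (1 / 4) + 1) \<le> b\<^sup>2) \<and>
     (\<forall>b\<ge>ln x. 4 * (2 * b * b powr (1 / 4) + 1) / b\<^sup>2 +
        2 * (4 * (2 * b * b powr (1 / 4) + 1)) * b\<^sup>2 * (1296 * C / b ^ 4) \<le> exp (- (3 * C))) \<and>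
     12 * exp (800 * (9 + 5 * real (ex + 1)) * ln (ln x) ^ 3) \<le> x \<and>
     27 * (ln x)\<^sup>2 \<le> x powr \<gamma> \<and>
     ln (ln x) / 8 \<le> ln (ln x powr (1 / 4) - 1) \<and> 3 \<le> ln x powr (1 / 4) \<and>
     8 * ln x / ln (ln x) + 1 \<le> 9 * ln x / ln (ln x) \<and> 9 * ln x / ln (ln x) \<le> ln x \<and>
     18 * (ln x)\<^sup>2 / x \<le> x powr (- 1 / 2) \<and> 2 * real p / x ^ 3 \<le> x powr (- 1 / 2) \<and>
     2 * x powr (- c / 2) < 1 \<and>
     x powr (- c / 2) + ln x * (3 * x powr (- c / 2)) \<le> x powr (- c / 4)"

lemma eventually_large:
  assumes "0 < \<gamma>" "\<gamma> < 1" "1 \<le> C" "0 < c" "0 < p"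
  shows "eventually (large \<gamma> C c p ex) at_top"
proof -
  have ln: "filterlim (ln :: real \<Rightarrow> real) at_top at_top" by (rule ln_at_top)
  have all: "eventually (\<lambda>x. \<forall>b\<ge>ln x. P b) at_top" if "eventually P (at_top :: real filter)" for P
  proof -
    from that obtain B where "\<And>b. B \<le> b \<Longrightarrow> P b" by (auto simp: eventually_at_top_linorder)
    moreover have "eventually (\<lambda>x. B \<le> ln x) at_top" using ln by (auto simp: filterlim_at_top)
    ultimately show ?thesis by (auto elim!: eventually_mono)
  qed
  \<comment> \<open>Naming the constants keeps them symbolic with a known sign for the asymptotic
    evaluation.\<close>
  define E where "E = 800 * (9 + 5 * real (ex + 1))"
  define q where "q = real p"
  have E: "0 < E" "0 < q" using assms by (auto simp: E_def q_def add_pos_nonneg)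
  show ?thesis unfolding large_def E_def[symmetric] q_def[symmetric]
    using assms E by (intro eventually_conj all) real_asymp+
qed

text \<open>\<open>n\<close> is the size of the cycle instance and \<open>N\<close> the size at
  which the sampler runs. The savings \<open>ln n ^ 7\<close> in space and \<open>ln n\<close> in
  machines are what the gap between them buys; the 7 exceeds the five logarithmic factors of
  \<open>k * (l + 1)\<close>.\<close>

locale scale =
  fixes \<gamma> C c :: real and p ex n N k l cap :: nat and A :: mpc
  assumes gam: "0 < \<gamma>" "\<gamma> < 1" and p: "0 < p" "(1 - \<gamma>) / p \<le> \<gamma> / 2" and C: "1 \<le> C" and c: "0 < c" "c \<le> 1"
    and N: "N \<le> n" "ln (real n) \<le> 2 * ln (real N)" "real n \<le> real N * ln (real n) ^ (ex + 1)"
    and m: "real (machines A N) \<le> C * (real n powr (1 - \<gamma>) / ln (real n))" "20 * machines A N \<le> N"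
    and WA: "real (mem_words A N) \<le> C * (real n powr \<gamma> / ln (real n) ^ 7)"
    and wbA: "real (word_bits A N) \<le> C * ln (real n)"
    and k: "ln (real N) \<le> C * k" "real k \<le> C * ln (real n)"
    and l: "ln (real N) ^ 4 \<le> C * l" "real l \<le> C * ln (real n) ^ 4"
    and capN: "N \<le> machines A N * cap" and samp: "sampler A N k l cap (real N powr - c)"
    and large: "large \<gamma> C c p ex (real n)"
begin

abbreviation x :: real where "x \<equiv> real n"
abbreviation L :: real where "L \<equiv> ln x"
abbreviation f :: nat where "f \<equiv> fan_in \<gamma> p n"
abbreviation M :: nat where "M \<equiv> f ^ p"
abbreviation W :: nat where "W \<equiv> 1000 * share \<gamma> n"
abbreviation b :: nat where "b \<equiv> label_bits n"
abbreviation h :: nat where "h \<equiv> N div 16"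
abbreviation Tr :: nat where "Tr \<equiv> h div (4 * M)"
abbreviation T :: nat where "T \<equiv> 4 * b + mem_words A N div f + 1"
abbreviation D :: nat where "D \<equiv> shrinkage n"
abbreviation L1 :: nat where "L1 \<equiv> short_bits n"
abbreviation Rn :: nat where "Rn \<equiv> 4 * (2 * b * D + 1)"
abbreviation tau :: nat where "tau \<equiv> pre_stages ex n"
abbreviation Tm :: nat where "Tm \<equiv> main_stages n N"

lemma big:
  "1000 \<le> L" "14 \<le> ln L" "C \<le> L"
  "12 * L + 3 \<le> x powr \<gamma> / (64 * 2 ^ p * L ^ (ex + 1))"
  "2 ^ p * x powr (1 - \<gamma>) + 1 \<le> x / (100 * L ^ (ex + 1))"
  "8 * ((x powr (\<gamma> / 2) + 1) * (12 * L + 1) + C * (x powr \<gamma> / L ^ 7)) * (C * L * (C * L ^ 4 + 1)) + 1 \<le> x powr \<gamma>"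
  "x powr (\<gamma> / 2) + 300 + C * (x powr \<gamma> / L ^ 7) \<le> x powr \<gamma>"
  "C * L ^ 4 + C * L + 1 \<le> x"
  "12 * exp (800 * (9 + 5 * real (ex + 1)) * ln L ^ 3) \<le> x"
  "27 * L\<^sup>2 \<le> x powr \<gamma>"
  "ln L / 8 \<le> ln (L powr (1 / 4) - 1)" "3 \<le> L powr (1 / 4)"
  "8 * L / ln L + 1 \<le> 9 * L / ln L" "9 * L / ln L \<le> L"
  "18 * L\<^sup>2 / x \<le> x powr (- 1 / 2)" "2 * real p / x ^ 3 \<le> x powr (- 1 / 2)"
  "2 * x powr (- c / 2) < 1" "x powr (- c / 2) + L * (3 * x powr (- c / 2)) \<le> x powr (- c / 4)"
  using large unfolding large_def by blast+

lemma big_b: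
  assumes "L \<le> r"
  shows "4 * (2 * r * r powr (1 / 4) + 1) \<le> r\<^sup>2"
    "4 * (2 * r * r powr (1 / 4) + 1) / r\<^sup>2 + 2 * (4 * (2 * r * r powr (1 / 4) + 1)) * r\<^sup>2 * (1296 * C / r ^ 4) \<le> exp (- (3 * C))"
  using large assms unfolding large_def by blast+

section \<open>Numerical bounds on the parameters at a fixed size\<close>

lemma x_ge: "1000 \<le> x"
proof -
  have "0 < x" using big(1) by (cases "n = 0") auto
  then show ?thesis using ln_bound[of x] big(1) by linarith
qed

lemma ln_N: "ln (real N) \<le> L" "500 \<le> ln (real N)" "0 < N"
proof -
  show *: "0 < N" using N(2) big(1) by (cases "N = 0") auto
  then show "ln (real N) \<le> L" using N(1) x_ge by simp
  show "500 \<le> ln (real N)" using N(2) big(1) by linarith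
qed

lemma N_ge: "500 \<le> N"
proof -
  have "500 \<le> real N" using ln_bound[of "real N"] ln_N by simp
  then show ?thesis by linarith
qed

lemma ln_2: "1 / 2 \<le> ln (2 :: real)" "ln (2 :: real) \<le> 1"
proof -
  have "ln (1 / 2 :: real) \<le> 1 / 2 - 1" by (rule ln_le_minus_one) simp
  then show "1 / 2 \<le> ln (2 :: real)" by (simp add: ln_div)
  show "ln (2 :: real) \<le> 1" using ln_le_minus_one[of 2] by simp
qed

lemma log_2: assumes "1 \<le> r" shows "ln r \<le> log 2 r" "log 2 r \<le> 2 * ln r"
proof -
  have r: "0 \<le> ln r" using assms by simp
  have "ln r * ln 2 \<le> ln r * 1" using r ln_2 by (intro mult_left_mono) auto
  then show "ln r \<le> log 2 r" using ln_2 by (simp add: log_def field_simps)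
  have "ln r * 1 \<le> ln r * (2 * ln 2)" using r ln_2 by (intro mult_left_mono) auto
  then show "log 2 r \<le> 2 * ln r" using ln_2 by (simp add: log_def field_simps)
qed

lemma nat_ceiling:
  assumes "0 \<le> r" shows "r \<le> real (nat \<lceil>r\<rceil>)" "real (nat \<lceil>r\<rceil>) \<le> r + 1"
  using assms by linarith+

lemma le_two_power_log:
  assumes "1 \<le> r" shows "r \<le> 2 ^ nat \<lceil>log 2 r\<rceil>"
proof -
  have "r = 2 powr log 2 r" using assms by simp
  also have "\<dots> \<le> 2 powr real (nat \<lceil>log 2 r\<rceil>)" by (intro powr_mono real_nat_ceiling_ge) auto
  also have "\<dots> = 2 ^ nat \<lceil>log 2 r\<rceil>" by (simp add: powr_realpow)
  finally show ?thesis .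
qed

lemma b: "L \<le> real b" "real b \<le> 3 * L" "n \<le> 2 ^ b"
proof -
  have l: "L \<le> log 2 x" "log 2 x \<le> 2 * L" using log_2 x_ge by auto
  have "0 \<le> log 2 x" using l big(1) by linarith
  note nc = nat_ceiling[OF this, folded label_bits_def]
  show "L \<le> real b" "real b \<le> 3 * L" using nc l big(1) by linarith+
  have "x \<le> 2 ^ b" using le_two_power_log[of x] x_ge by (simp add: label_bits_def)
  then show "n \<le> 2 ^ b" using of_nat_le_iff[where 'a=real] by fastforce
qed

lemma b_ge: "1000 \<le> b" using b(1) big(1) by linarith

lemma L1: "16 * b\<^sup>2 \<le> 2 ^ L1" "real L1 \<le> 5 * ln L" "ln L \<le> real L1" "0 < L1"
proof -
  let ?r = "nat \<lceil>log 2 (real b)\<rceil>"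
  have rb: "1 \<le> real b" using b_ge by simp
  have "real b \<le> 2 ^ ?r" using le_two_power_log[OF rb] .
  then have "real b \<le> real (2 ^ ?r)" by simp
  then have "b \<le> 2 ^ ?r" using of_nat_le_iff[where 'a=real] by blast
  then have "b\<^sup>2 \<le> (2 ^ ?r)\<^sup>2" by (rule power_mono) simp
  then show "16 * b\<^sup>2 \<le> 2 ^ L1" by (simp add: short_bits_def power_add power_mult[symmetric] mult.commute)
  have l: "ln (real b) \<le> log 2 (real b)" "log 2 (real b) \<le> 2 * ln (real b)" using log_2[OF rb] .
  have "ln (real b) \<le> ln (3 * L)" using b(2) rb big(1) by simp
  also have "\<dots> = ln 3 + ln L" using big(1) by (simp add: ln_mult)
  also have "ln (3 :: real) \<le> 2" using ln_le_minus_one[of 3] by simp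
  finally have lb: "ln (real b) \<le> 2 + ln L" by simp
  have lL: "ln L \<le> ln (real b)" using b(1) big(1) by simp
  have "0 \<le> log 2 (real b)" using l lL big(2) by linarith
  note nc = nat_ceiling[OF this]
  have eq: "real L1 = 4 + 2 * real ?r" by (simp add: short_bits_def)
  show "real L1 \<le> 5 * ln L" using eq nc(2) l(2) lb big(2) by linarith
  show "ln L \<le> real L1" using eq nc(1) l(1) lL by linarith
  show "0 < L1" by (simp add: short_bits_def)
qed

lemma D: "2 \<le> D" "real D \<le> real b powr (1 / 4)" "ln L / 8 \<le> ln (real D)"
proof -
  have mono: "L powr (1 / 4) \<le> real b powr (1 / 4)" using b(1) big(1) by (intro powr_mono2) auto
  have D: "real D \<le> real b powr (1 / 4)" "real b powr (1 / 4) - 1 \<le> real D"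
    unfolding shrinkage_def by (linarith | simp)+
  show "real D \<le> real b powr (1 / 4)" by fact
  have "2 \<le> real D" using D(2) mono big(12) by linarith
  then show "2 \<le> D" by linarith
  have "ln (L powr (1 / 4) - 1) \<le> ln (real D)" using D(2) mono big(12) by simp
  then show "ln L / 8 \<le> ln (real D)" using big(11) by linarith
qed

lemma Rn_le: "real Rn \<le> 4 * (2 * real b * real b powr (1 / 4) + 1)"
proof -
  have "real b * real D \<le> real b * real b powr (1 / 4)" using D(2) by (intro mult_left_mono) auto
  then show ?thesis by simp
qed

lemma Rn: "Rn \<le> b\<^sup>2" "real Rn \<le> 9 * L\<^sup>2"
proof -
  have *: "real Rn \<le> (real b)\<^sup>2" using Rn_le big_b(1)[OF b(1)] by linarith
  then have "real Rn \<le> real (b\<^sup>2)" by simp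
  then show "Rn \<le> b\<^sup>2" using of_nat_le_iff[where 'a=real] by blast
  have "(real b)\<^sup>2 \<le> (3 * L)\<^sup>2" using b(2) by (intro power_mono) auto
  then show "real Rn \<le> 9 * L\<^sup>2" using * by (simp add: power2_eq_square)
qed

lemma l_ge: "real b ^ 4 \<le> 1296 * C * l" "0 < l"
proof -
  have "real b \<le> 6 * ln (real N)" using b(2) N(2) by linarith
  then have "real b ^ 4 \<le> (6 * ln (real N)) ^ 4" by (intro power_mono) auto
  also have "\<dots> = 1296 * ln (real N) ^ 4" by (simp add: power_mult_distrib)
  also have "\<dots> \<le> 1296 * (C * l)" using l(1) by linarith
  finally show *: "real b ^ 4 \<le> 1296 * C * l" by simp
  have "0 < real b ^ 4" using b_ge by simp
  then show "0 < l" using * by (cases "l = 0") auto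
qed

text \<open>Both terms vanish asymptotically, so any constant could be reached. The value
  \<open>exp (- (3 * C))\<close> becomes at most \<open>N powr (-3)\<close> after
  \<open>k \<ge> ln N / C\<close> walks.\<close>

lemma eps: "real Rn / real (b\<^sup>2) + 2 * real Rn * real (b\<^sup>2) / real l \<le> exp (- (3 * C))"
proof -
  let ?R = "4 * (2 * real b * real b powr (1 / 4) + 1)"
  have b4: "0 < real b ^ 4" using b_ge by simp
  have inv: "1 / real l \<le> 1296 * C / real b ^ 4"
    using l_ge b4 by (simp add: field_simps)
  have "real Rn / real (b\<^sup>2) \<le> ?R / (real b)\<^sup>2" using Rn_le by (simp add: divide_right_mono)
  moreover have "2 * real Rn * real (b\<^sup>2) / real l \<le> 2 * ?R * (real b)\<^sup>2 * (1296 * C / real b ^ 4)"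
  proof -
    have "2 * real Rn * real (b\<^sup>2) * (1 / real l) \<le> 2 * ?R * (real b)\<^sup>2 * (1296 * C / real b ^ 4)"
      using Rn_le inv by (intro mult_mono) (auto intro!: mult_nonneg_nonneg)
    then show ?thesis by simp
  qed
  ultimately show ?thesis using big_b(2)[OF b(1)] by linarith
qed

text \<open>Rounding up costs at most a factor 2 per digit, hence \<open>2 ^ p\<close>. The choice
  of \<open>p\<close> keeps \<open>f\<close> near \<open>n powr (\<gamma> / 2)\<close> or below,
  which leaves room for polylogarithmic factors within the space.\<close>

lemma f: "x powr (1 - \<gamma>) \<le> real M" "real M \<le> 2 ^ p * x powr (1 - \<gamma>)" "real f \<le> x powr (\<gamma> / 2) + 1" "0 < f" "M \<le> n"
proof -
  let ?a = "(1 - \<gamma>) / real p"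
  let ?z = "x powr ?a"
  have a: "0 \<le> ?a" using gam by simp
  have z1: "1 \<le> ?z" using a x_ge by (simp add: ge_one_powr_ge_zero)
  have f: "?z \<le> real f" "real f \<le> ?z + 1" using nat_ceiling[of ?z] z1 by (auto simp: fan_in_def)
  have zp: "?z ^ p = x powr (1 - \<gamma>)"
  proof -
    have "?z ^ p = ?z powr real p" using z1 x_ge by (subst powr_realpow) auto
    also have "\<dots> = x powr (1 - \<gamma>)" using p by (simp add: powr_powr)
    finally show ?thesis .
  qed
  show "0 < f" using f(1) z1 by linarith
  have "?z ^ p \<le> real f ^ p" using f z1 by (intro power_mono) auto
  then show "x powr (1 - \<gamma>) \<le> real M" using zp by simp
  have "real f ^ p \<le> (2 * ?z) ^ p" using f z1 by (intro power_mono) auto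
  then show *: "real M \<le> 2 ^ p * x powr (1 - \<gamma>)" using zp by (simp add: power_mult_distrib)
  have "?z \<le> x powr (\<gamma> / 2)" using p x_ge by (intro powr_mono) auto
  then show "real f \<le> x powr (\<gamma> / 2) + 1" using f(2) by linarith
  have L1: "1 \<le> L ^ (ex + 1)" using big(1) by (intro one_le_power) auto
  then have "x / (100 * L ^ (ex + 1)) \<le> x / 1" using x_ge by (intro divide_left_mono) auto
  then have "real M \<le> x" using * big(5) by linarith
  then show "M \<le> n" using of_nat_le_iff[where 'a=real] by blast
qed

lemma W: "1000 * x powr \<gamma> \<le> real W"
  unfolding share_def using nat_ceiling(1)[of "x powr \<gamma>"] by simp

lemma N_lower: "x / L ^ (ex + 1) \<le> real N"
proof -
  have "0 < L ^ (ex + 1)" using big(1) by simp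
  then show ?thesis using N(3) by (simp add: field_simps)
qed

lemma m_pos: "0 < machines A N"
  using capN ln_N(3) by (cases "machines A N = 0") auto

lemma m_le: "machines A N \<le> M"
proof -
  have "C * (x powr (1 - \<gamma>) / L) \<le> L * (x powr (1 - \<gamma>) / L)" using big(1,3) by (intro mult_right_mono) auto
  moreover have "L * (x powr (1 - \<gamma>) / L) = x powr (1 - \<gamma>)" using big(1) by simp
  ultimately have "real (machines A N) \<le> real M" using m(1) f(1) by linarith
  then show ?thesis using of_nat_le_iff[where 'a=real] by blast
qed

text \<open>With \<open>4 * Tr\<close> slots on each of the \<open>M\<close> machines all new labels
  stay below \<open>h\<close>. Since \<open>N\<close> is only polylogarithmically smaller than
  \<open>n\<close>, the threshold \<open>Tr\<close> still exceeds the minimum \<open>4 * b\<close>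
  required for hashing.\<close>

lemma Tr: "h / 4 - real M \<le> real (M * Tr)" "real N / 64 - 1 / 4 - real M \<le> real (M * Tr)" "4 * b \<le> Tr" "M * (4 * Tr) \<le> h"
  "real Tr \<le> x powr \<gamma>"
proof -
  have M: "0 < M" using f(4) by simp
  have "h = 4 * M * Tr + h mod (4 * M)" by simp
  moreover have "h mod (4 * M) < 4 * M" using M by simp
  ultimately have *: "h < 4 * (M * Tr) + 4 * M" "4 * (M * Tr) \<le> h" by linarith+
  then show "M * (4 * Tr) \<le> h" by simp
  have "real h < real (4 * (M * Tr) + 4 * M)" using *(1) by (subst of_nat_less_iff)
  then show h4: "h / 4 - real M \<le> real (M * Tr)" by simp
  have "N < 16 * (h + 1)" by presburger
  then have "real N < real (16 * (h + 1))" by (subst of_nat_less_iff)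
  then have hN: "real N / 16 - 1 \<le> real h" by simp
  then show NT: "real N / 64 - 1 / 4 - real M \<le> real (M * Tr)" using h4 by linarith
  let ?e = "L ^ (ex + 1)" and ?z = "x powr (1 - \<gamma>)"
  have e: "0 < ?e" and z: "0 < ?z" using big(1) x_ge by auto
  have "x = x powr \<gamma> * ?z" using x_ge by (simp add: powr_add[symmetric])
  then have xz: "x / ?z = x powr \<gamma>" using z by (simp add: field_simps)
  have zM: "0 < real M" using M by simp
  have M1: "1 \<le> real M" using M by linarith
  have "x powr \<gamma> / (64 * 2 ^ p * ?e) = x / ?z / (64 * 2 ^ p * ?e)" using xz by simp
  also have "\<dots> = (x / ?e / 64) / (2 ^ p * ?z)" by simp
  also have "\<dots> \<le> (real N / 64) / (2 ^ p * ?z)"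
    using N_lower z by (intro divide_right_mono) auto
  also have "\<dots> \<le> (real N / 64) / real M" using f(2) zM z by (intro divide_left_mono) auto
  finally have "12 * L + 3 \<le> (real N / 64) / real M" using big(4) by linarith
  then have "(12 * L + 3) * real M \<le> real N / 64" using zM by (simp add: field_simps)
  then have "(12 * L + 3) * real M - real M - real M \<le> real (M * Tr)" using NT M1 by linarith
  then have "(12 * L + 1) * real M \<le> real Tr * real M" by (simp add: algebra_simps)
  then have "12 * L + 1 \<le> real Tr" using zM by (rule mult_right_le_imp_le)
  then show "4 * b \<le> Tr" using b(2) by linarith
  have "real Tr * real M \<le> real h"
  proof -
    have "M * Tr \<le> h" using *(2) by linarith
    then have "real (M * Tr) \<le> real h" by (subst of_nat_le_iff)
    then show ?thesis by (simp add: mult.commute)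
  qed
  moreover have "h \<le> n" using N(1) div_le_dividend[of N 16] by linarith
  then have "real h \<le> x" by (subst of_nat_le_iff)
  ultimately have "real Tr * real M \<le> x" by linarith
  moreover have "real Tr * ?z \<le> real Tr * real M" using f(1) by (intro mult_left_mono) auto
  ultimately have "real Tr \<le> x / ?z" using z by (simp add: field_simps)
  then show "real Tr \<le> x powr \<gamma>" using xz by simp
qed


text \<open>The value \<open>h = N div 16\<close> is so small that the cycle edges and about
  \<open>N / 2\<close> pendant edges stay within a capacity that suffices for \<open>N\<close>
  edges.\<close>

lemma cap: "(N - N div 2) div machines A N + 2 + 2 * (h div machines A N + 1) \<le> cap"
proof -
  let ?m = "machines A N" and ?a = "N - N div 2"
  have "(?a div ?m + 2 + 2 * (h div ?m + 1)) * ?m = ?a div ?m * ?m + 4 * ?m + 2 * (h div ?m * ?m)"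
    by (simp add: algebra_simps)
  also have "\<dots> \<le> ?a + 4 * ?m + 2 * h" by (intro add_mono mult_left_mono) auto
  also have "\<dots> \<le> N"
  proof -
    have "2 * ?a \<le> N + 1" "16 * h \<le> N" by presburger+
    then show ?thesis using m(2) N_ge by linarith
  qed
  also have "\<dots> \<le> cap * ?m" using capN by (simp add: mult.commute)
  finally show ?thesis using m_pos by (rule mult_right_le_imp_le)
qed

lemma dt_le: "real N powr - c \<le> x powr (- c / 2)" and dt_lt: "real N powr - c < 1"
proof -
  have "c * L \<le> c * (2 * ln (real N))" using N(2) c by (intro mult_left_mono) auto
  then have "- c * ln (real N) \<le> - c / 2 * L" by simp
  then show *: "real N powr - c \<le> x powr (- c / 2)" using ln_N(3) x_ge by (simp add: powr_def)
  show "real N powr - c < 1" using * big(17) powr_ge_zero[of x "- c / 2"] by linarith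
qed

lemma half_le: "x powr (- 1 / 2) \<le> x powr (- c / 2)"
  using c x_ge by (intro powr_mono) auto

text \<open>Of the bound \<open>N powr (-3)\<close>, one factor cancels the number of vertices and
  two give \<open>1 / n\<close> by \<open>ln n \<le> 2 * ln N\<close>.\<close>

lemma miss_le: "real N * (2 * real Rn) * exp (- (3 * C)) ^ k \<le> x powr (- c / 2)"
proof -
  have N0: "0 < real N" using ln_N(3) by simp
  have "exp (- (3 * C)) ^ k = exp (- (3 * (C * k)))" by (simp add: exp_of_nat_mult[symmetric] algebra_simps)
  also have "\<dots> \<le> exp (- (3 * ln (real N)))" using k(1) by simp
  also have "\<dots> = exp (- ln (real N)) * exp (- (2 * ln (real N)))" by (simp add: exp_add[symmetric])
  also have "\<dots> \<le> exp (- ln (real N)) * exp (- L)" using N(2) by simp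
  also have "\<dots> = 1 / real N * (1 / x)" using N0 x_ge by (simp add: exp_minus field_simps)
  finally have e: "exp (- (3 * C)) ^ k \<le> 1 / real N * (1 / x)" .
  have "real N * (2 * real Rn) * exp (- (3 * C)) ^ k \<le> real N * (2 * (9 * L\<^sup>2)) * (1 / real N * (1 / x))"
    using Rn(2) e by (intro mult_mono) (auto intro!: mult_nonneg_nonneg)
  also have "\<dots> = 18 * L\<^sup>2 / x" using N0 by simp
  finally show ?thesis using big(15) half_le by linarith
qed

lemma small: "real N powr - c + real N * (2 * real Rn) * exp (- (3 * C)) ^ k < 1"
  using dt_le miss_le big(17) by linarith

text \<open>With \<open>n ^ 6\<close> seeds, the at most \<open>p * M * M * 2 * n\<close> unbalanced
  ones are a fraction of order at most \<open>n powr (-3)\<close>.\<close>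

lemma hash_err: "real (M * (2 * n)) / real (n ^ 6) \<le> x powr (- c / 2)"
  "real (p * M * M * (2 * n)) / real (n ^ 6) \<le> x powr (- c / 2)"
proof -
  have x0: "0 < x" using x_ge by simp
  have Mx: "real M \<le> x" using f(5) by (subst of_nat_le_iff)
  have "real p * real M * real M * (2 * x) \<le> real p * x * x * (2 * x)"
    using Mx by (intro mult_mono) (auto intro!: mult_nonneg_nonneg)
  then have "real (p * M * M * (2 * n)) / real (n ^ 6) \<le> real p * x * x * (2 * x) / x ^ 6"
    by (simp add: divide_right_mono)
  also have "\<dots> = 2 * real p / x ^ 3" using x0 by (simp add: field_simps power_numeral_reduce)
  finally have *: "real (p * M * M * (2 * n)) / real (n ^ 6) \<le> 2 * real p / x ^ 3" .
  then show "real (p * M * M * (2 * n)) / real (n ^ 6) \<le> x powr (- c / 2)" using big(16) half_le by linarith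
  have "M * (2 * n) \<le> p * M * (M * (2 * n))" using p(1) f(4) by simp
  then have "real (M * (2 * n)) / real (n ^ 6) \<le> real (p * M * M * (2 * n)) / real (n ^ 6)"
    by (intro divide_right_mono) (simp_all only: of_nat_le_iff mult.assoc of_nat_0_le_iff)
  then show "real (M * (2 * n)) / real (n ^ 6) \<le> x powr (- c / 2)" using * big(16) half_le by linarith
qed

text \<open>\<open>ln D\<close> is at least \<open>ln ln n / 8\<close>, so there are
  \<open>O(ln n / ln ln n)\<close> contractions. This quotient is the source of the doubly
  logarithmic lower bound.\<close>

lemma Tm: "real Tm \<le> 9 * L / ln L" "real Tm \<le> L" "real N \<le> real D ^ Tm"
proof -
  have D1: "1 < real D" "0 < ln (real D)" using D(1) by auto
  have "0 \<le> ln (real N) / ln (real D)" using ln_N(2) D1 by simp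
  note nc = nat_ceiling[OF this, folded main_stages_def]
  have lL: "0 < ln L / 8" using big(2) by simp
  have "ln (real N) / ln (real D) \<le> L / (ln L / 8)"
    using ln_N D(3) D1 lL by (intro frac_le) auto
  then have "ln (real N) / ln (real D) \<le> 8 * L / ln L" by (simp add: mult.commute)
  then have "real Tm \<le> 8 * L / ln L + 1" using nc(2) by linarith
  then show "real Tm \<le> 9 * L / ln L" "real Tm \<le> L" using big(13,14) by linarith+
  have "ln (real N) \<le> real Tm * ln (real D)" using nc(1) D1(2) by (simp add: field_simps)
  then have "ln (real N) \<le> ln (real D ^ Tm)" using D1 by (simp add: ln_realpow)
  then show "real N \<le> real D ^ Tm" using ln_N(3) D1 by (simp add: ln_le_cancel_iff)
qed

text \<open>The second bound lets cycles of length \<open>n / 2\<close> survive \<open>tau\<close>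
  halvings; it holds because \<open>exp (O((ln ln n)^3))\<close> is below every power of
  \<open>n\<close>.\<close>

lemma tau: "real tau \<le> 800 * (9 + 5 * real (ex + 1)) * ln L ^ 3" "12 * 2 ^ tau \<le> n"
proof -
  let ?u = "ln L"
  have u: "1 \<le> ?u" using big(2) by linarith
  have "real tau = 32 * real L1 ^ 2 * (9 + real (ex + 1) * real L1)"
    by (simp add: pre_stages_def algebra_simps)
  also have "\<dots> \<le> 32 * (5 * ?u) ^ 2 * (9 * ?u + real (ex + 1) * (5 * ?u))"
    using L1(2) u by (intro mult_mono add_mono power_mono) auto
  also have "\<dots> = 800 * (9 + 5 * real (ex + 1)) * ?u ^ 3"
    by (simp add: power2_eq_square power3_eq_cube algebra_simps)
  finally show *: "real tau \<le> 800 * (9 + 5 * real (ex + 1)) * ?u ^ 3" .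
  have "(2::real) ^ tau \<le> exp 1 ^ tau" using exp_ge_add_one_self[of 1] by (intro power_mono) auto
  also have "\<dots> = exp (real tau)" by (simp add: exp_of_nat_mult[symmetric])
  also have "\<dots> \<le> exp (800 * (9 + 5 * real (ex + 1)) * ?u ^ 3)" using * by simp
  finally have "12 * (2::real) ^ tau \<le> x" using big(9) by linarith
  then have "real (12 * 2 ^ tau) \<le> x" by simp
  then show "12 * 2 ^ tau \<le> n" using of_nat_le_iff[where 'a=real] by blast
qed

text \<open>From \<open>L1 \<ge> ln ln n\<close> the factor \<open>1 / (ln n) ^ (ex + 1)\<close>
  arises, which turns \<open>n\<close> into at most \<open>N\<close>; the constant 1 / 512 leaves
  slack against \<open>M * Tr\<close>, which is about \<open>N / 64\<close>.\<close>

lemma shrink: "2 * ((1 - 1 / (32 * real L1 ^ 2)) ^ tau * x) \<le> real (M * Tr)"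
proof -
  let ?q = "32 * real L1 ^ 2" and ?t = "9 + real (ex + 1) * real L1"
  have l1: "1 \<le> real L1" using L1(4) by simp
  have q: "1 \<le> ?q" using one_le_power[OF l1, of 2] by linarith
  have "1 - 1 / ?q \<le> exp (- (1 / ?q))" using exp_ge_add_one_self[of "- (1 / ?q)"] by simp
  moreover have "1 / ?q \<le> 1" using q by (subst divide_le_eq_1_pos) linarith+
  ultimately have "(1 - 1 / ?q) ^ tau \<le> exp (- (1 / ?q)) ^ tau" by (intro power_mono) linarith+
  also have "\<dots> = exp (- (real tau / ?q))" by (simp add: exp_of_nat_mult[symmetric])
  also have "real tau / ?q = ?t" using l1 by (simp add: pre_stages_def field_simps)
  also have "exp (- ?t) = exp (- 9) * exp (- (real (ex + 1) * real L1))" by (simp add: exp_add[symmetric])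
  also have "\<dots> \<le> 1 / 512 * (1 / L ^ (ex + 1))"
  proof (intro mult_mono)
    have "(2::real) ^ 9 \<le> exp 1 ^ 9" using exp_ge_add_one_self[of 1] by (intro power_mono) auto
    then have "512 \<le> exp (9 :: real)" by (simp add: exp_of_nat_mult[symmetric])
    then show "exp (- 9) \<le> (1 / 512 :: real)" by (simp add: exp_minus field_simps)
    have "exp (- (real (ex + 1) * real L1)) \<le> exp (- (real (ex + 1) * ln L))"
      using L1(3) by (simp add: mult_left_mono)
    also have "\<dots> = 1 / exp (real (ex + 1) * ln L)" by (simp only: exp_minus inverse_eq_divide)
    also have "exp (real (ex + 1) * ln L) = exp (ln L) ^ (ex + 1)" by (rule exp_of_nat_mult)
    also have "exp (ln L) = L" using big(1) by simp
    finally show "exp (- (real (ex + 1) * real L1)) \<le> 1 / L ^ (ex + 1)" .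
  qed auto
  finally have "(1 - 1 / ?q) ^ tau \<le> 1 / 512 * (1 / L ^ (ex + 1))" .
  then have "(1 - 1 / ?q) ^ tau * x \<le> 1 / 512 * (1 / L ^ (ex + 1)) * x" using x_ge by (intro mult_right_mono) auto
  then have a: "(1 - 1 / ?q) ^ tau * x \<le> 1 / 512 * (x / L ^ (ex + 1))" by simp
  have "x / (100 * L ^ (ex + 1)) = 1 / 100 * (x / L ^ (ex + 1))" by simp
  then have "real M + 1 \<le> 1 / 100 * (x / L ^ (ex + 1))" using f(2) big(5) by linarith
  then show ?thesis using a N_lower Tr(2) by linarith
qed

lemma fin: "4 * max (real h / real (D ^ Tm)) (real (3 * (2 * b * D + 1))) \<le> real W"
proof -
  have g1: "1 \<le> x powr \<gamma>" using x_ge gam by (simp add: ge_one_powr_ge_zero)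
  have D0: "0 < real (D ^ Tm)" using D(1) by simp
  have "real h \<le> real (D ^ Tm)" using Tm(3) div_le_dividend[of N 16] by simp
  then have "real h / real (D ^ Tm) \<le> 1" using D0 by (subst divide_le_eq_1_pos)
  then have u: "real h / real (D ^ Tm) \<le> real W / 4" using W g1 by linarith
  have "4 * real (3 * (2 * b * D + 1)) = 3 * real Rn" by simp
  then have "4 * real (3 * (2 * b * D + 1)) \<le> real W" using Rn(2) big(10) W g1 by linarith
  then have "real (3 * (2 * b * D + 1)) \<le> real W / 4" by linarith
  with u have "max (real h / real (D ^ Tm)) (real (3 * (2 * b * D + 1))) \<le> real W / 4" by (rule max.boundedI)
  then show ?thesis by linarith
qed

lemma K_bounds: "N \<le> n ^ 6" "k \<le> n ^ 6" "l < n ^ 6" "n \<le> n ^ 6" "4 \<le> n ^ 6"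
proof -
  have n: "1000 \<le> n" using x_ge by linarith
  have "n ^ 1 \<le> n ^ 6" using n by (intro power_increasing) auto
  then show n6: "n \<le> n ^ 6" by simp
  show "N \<le> n ^ 6" "4 \<le> n ^ 6" using n6 N(1) n by linarith+
  have "0 \<le> C * L ^ 4" "0 \<le> C * L" using C big(1) by auto
  then have "real k < x" "real l < x" using k(2) l(2) big(8) by linarith+
  then show "k \<le> n ^ 6" "l < n ^ 6" using n6 by linarith+
qed

lemma k_pos: "0 < k"
  using k(1) ln_N(2) by (cases "k = 0") auto

lemma bits:
  assumes "fact_lt (n ^ 6) t" shows "enc t < 2 ^ net_bits C n"
proof -
  have "enc t < 2 ^ 30 * (n ^ 6) ^ 16" using enc_lt[OF assms K_bounds(5)] .
  also have "(n ^ 6) ^ 16 = n ^ 96" by (simp add: power_mult[symmetric])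
  also have "2 ^ 30 * n ^ 96 \<le> 2 ^ 30 * (2 ^ b) ^ 96" using b(3) by (intro mult_left_mono power_mono) auto
  also have "\<dots> = 2 ^ (30 + b * 96)" by (simp only: power_add power_mult)
  also have "\<dots> \<le> 2 ^ net_bits C n" unfolding net_bits_def by (intro power_increasing) (auto simp: algebra_simps)
  finally show ?thesis .
qed

lemma word_bits_le: "word_bits A N \<le> net_bits C n"
proof -
  have "C \<le> real (nat \<lceil>C\<rceil>)" by (rule real_nat_ceiling_ge)
  then have "C * L \<le> real (nat \<lceil>C\<rceil>) * real b" using b(1) big(1) C by (intro mult_mono) auto
  then have "real (word_bits A N) \<le> real (nat \<lceil>C\<rceil> * b)" using wbA by simp
  then have "word_bits A N \<le> nat \<lceil>C\<rceil> * b" using of_nat_le_iff[where 'a=real] by blast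
  also have "\<dots> \<le> net_bits C n" by (simp add: net_bits_def algebra_simps)
  finally show ?thesis .
qed

text \<open>For \<open>n ^ 6\<close> seeds the dominant factor is at most
  \<open>2 ^ (12 * n * b)\<close>, against \<open>2 ^ (16 * n * b)\<close> on the right, which comes
  from the threshold \<open>4 * b\<close>.\<close>

lemma hash_size: "2 ^ n * (p + 1) * f ^ p * (n + 1) * (n ^ 6) ^ (2 * n) < (2 :: nat) ^ (4 * n * (4 * b))"
proof -
  have n: "1000 \<le> n" using x_ge by linarith
  have "p < n"
  proof -
    have "p < 2 ^ p" by (rule less_exp)
    then have "real p < 2 ^ p" by (metis of_nat_less_iff of_nat_numeral of_nat_power)
    moreover have "2 ^ p * 1 \<le> 2 ^ p * x powr (1 - \<gamma>)"
      using gam x_ge by (intro mult_left_mono) (auto simp: ge_one_powr_ge_zero)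
    moreover have "x / (100 * L ^ (ex + 1)) \<le> x / 1"
    proof -
      have "1 \<le> L ^ (ex + 1)" using big(1) by (intro one_le_power) auto
      then show ?thesis using x_ge by (intro divide_left_mono) auto
    qed
    ultimately have "real p < x" using big(5) by linarith
    then show ?thesis by simp
  qed
  then have p2: "p + 1 \<le> 2 ^ b" using b(3) by linarith
  have f2: "f ^ p \<le> 2 ^ b" using f(5) b(3) by linarith
  have n2: "n + 1 \<le> 2 ^ (b + 1)" using b(3) n by simp
  have "(n ^ 6) ^ (2 * n) = n ^ (12 * n)" by (simp add: power_mult[symmetric])
  also have "\<dots> \<le> (2 ^ b) ^ (12 * n)" using b(3) by (intro power_mono) auto
  finally have s2: "(n ^ 6) ^ (2 * n) \<le> 2 ^ (b * (12 * n))" by (simp add: power_mult)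
  have "2 ^ n * (p + 1) * f ^ p * (n + 1) * (n ^ 6) ^ (2 * n) \<le> 2 ^ n * 2 ^ b * 2 ^ b * 2 ^ (b + 1) * 2 ^ (b * (12 * n))"
    using p2 f2 n2 s2 by (intro mult_mono) auto
  also have "\<dots> = 2 ^ (n + b + b + (b + 1) + b * (12 * n))" by (simp only: power_add)
  also have "\<dots> < 2 ^ (4 * n * (4 * b))"
  proof (intro power_strict_increasing)
    have "n * 1000 \<le> n * b" "1000 * b \<le> n * b" using b_ge n by (auto intro: mult_mono)
    moreover have "b * (12 * n) = 12 * (n * b)" "4 * n * (4 * b) = 16 * (n * b)" by simp_all
    ultimately show "n + b + b + (b + 1) + b * (12 * n) < 4 * n * (4 * b)" using n b_ge by linarith
  qed simp
  finally show ?thesis .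
qed

lemma space: "mem_words A N \<le> f * T" "mem_words A N + f + 2 \<le> W" "2 * (f * (4 * T * (k * (l + 1)))) + 1 \<le> W"
  "2 * (h div machines A N + 1) \<le> W" "162 * (n div M + 1) + f + 2 \<le> W" "5 * (4 * Tr) + 1 \<le> W"
proof -
  let ?w = "mem_words A N" and ?g = "x powr \<gamma>"
  have g1: "1 \<le> ?g" using x_ge gam by (simp add: ge_one_powr_ge_zero)
  have div: "f * (?w div f) \<le> ?w" by simp
  have "?w < f * (?w div f) + f" using mod_less_divisor[OF f(4), of ?w] mult_div_mod_eq[of f ?w] by linarith
  then show "?w \<le> f * T" by (simp add: algebra_simps)
  have w: "real ?w + real f + 299 \<le> ?g" using WA f(3) big(7) by linarith
  then show "?w + f + 2 \<le> W" using W g1 by linarith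
  have "real (f * T) \<le> real (f * (4 * b + 1) + ?w)"
    using div by (subst of_nat_le_iff) (simp add: algebra_simps)
  also have "\<dots> = real f * (4 * real b + 1) + real ?w" by (simp add: algebra_simps)
  also have "\<dots> \<le> (x powr (\<gamma> / 2) + 1) * (12 * L + 1) + C * (?g / L ^ 7)"
  proof -
    have "4 * real b + 1 \<le> 12 * L + 1" using b(2) by linarith
    from add_mono[OF mult_mono[OF f(3) this] WA] show ?thesis by simp
  qed
  finally have fT: "real (f * T) \<le> (x powr (\<gamma> / 2) + 1) * (12 * L + 1) + C * (?g / L ^ 7)" .
  have kl: "real (k * (l + 1)) \<le> C * L * (C * L ^ 4 + 1)"
    using k(2) l(2) C big(1) by (simp only: of_nat_mult of_nat_add) (intro mult_mono add_mono, auto)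
  have "real (f * T) * real (k * (l + 1)) \<le>
      ((x powr (\<gamma> / 2) + 1) * (12 * L + 1) + C * (?g / L ^ 7)) * (C * L * (C * L ^ 4 + 1))"
    using fT kl by (rule mult_mono) (use C big(1) in auto)
  then have "8 * (real (f * T) * real (k * (l + 1))) + 1 \<le> ?g" using big(6) by linarith
  moreover have "real (2 * (f * (4 * T * (k * (l + 1)))) + 1) = 8 * (real (f * T) * real (k * (l + 1))) + 1"
    by (simp only: of_nat_mult of_nat_add of_nat_numeral of_nat_1 mult.assoc mult.left_commute)
  ultimately have "real (2 * (f * (4 * T * (k * (l + 1)))) + 1) \<le> real W" using W g1 by linarith
  then show "2 * (f * (4 * T * (k * (l + 1)))) + 1 \<le> W" by (subst (asm) of_nat_le_iff)
  \<comment> \<open>The homes of labels below \<open>h\<close> are the machines of the sampler only.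
    That such a share fits is not assumed but follows from the sampler being able to hold its
    input.\<close>
  have hN: "h < N div 2" "4 \<le> N" using N_ge by linarith+
  have "N \<le> machines A N * ?w"
    by (rule sampler_space[OF samp hN(2,1) m_pos cap l_ge(2) dt_lt])
  then have "h \<le> machines A N * ?w" using div_le_dividend[of N 16] by linarith
  then have "h div machines A N \<le> ?w" using m_pos by (metis div_le_mono nonzero_mult_div_cancel_left not_gr_zero)
  then have "2 * (h div machines A N + 1) \<le> 2 * ?w + 2" by simp
  moreover have "real (2 * ?w + 2) \<le> real W" using w W g1 by simp
  then have "2 * ?w + 2 \<le> W" by (subst (asm) of_nat_le_iff)
  ultimately show "2 * (h div machines A N + 1) \<le> W" by linarith
  have z: "0 < x powr (1 - \<gamma>)" using x_ge by simp
  have "x = ?g * x powr (1 - \<gamma>)" using x_ge by (simp add: powr_add[symmetric])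
  also have "\<dots> \<le> ?g * real M" using f(1) by (intro mult_left_mono) auto
  finally have "x / real M \<le> ?g" using f(4) by (simp add: field_simps)
  then have "real (n div M) \<le> ?g" using of_nat_div_le_of_nat[of n M, where 'a=real] by linarith
  then have "real (162 * (n div M + 1) + f + 2) \<le> real W" using w W g1 by simp
  then show "162 * (n div M + 1) + f + 2 \<le> W" by (subst (asm) of_nat_le_iff)
  have "real (5 * (4 * Tr) + 1) \<le> real W" using Tr(5) W g1 by simp
  then show "5 * (4 * Tr) + 1 \<le> W" by (subst (asm) of_nat_le_iff)
qed


lemma program_exists:
  "\<exists>gs. length gs = 7 + 5 * tau + p + Tm * (num_rounds A N + 2 * p + 3) \<and>
     (\<forall>E I. edge_input M (share \<gamma> n) E I \<longrightarrow>
        (one_cycle n E \<longrightarrow> 1 - x powr (- c / 4) \<le>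
           prob_reach M W (net_bits C n) gs (init_config M I) {s. fst (s 0) = [1]}) \<and>
        (two_cycles n E \<longrightarrow> 1 - x powr (- c / 4) \<le>
           prob_reach M W (net_bits C n) gs (init_config M I) {s. fst (s 0) = [0]}))"
proof -
  have n: "1000 \<le> n" using x_ge by linarith
  then have n0: "0 < n" by simp
  obtain H where H: "\<And>s v. H s v < f ^ p"
    "\<And>X q c T. X \<subseteq> {..<n} \<Longrightarrow> q \<le> p \<Longrightarrow> card X \<le> f ^ q * T \<Longrightarrow> 4 * b \<le> T \<Longrightarrow>
       card {s. s < n ^ 6 \<and> 4 * T < card {v \<in> X. H s v mod f ^ q = c}} \<le> 2 * n"
    using hash_family_exists[OF f(4) n0 hash_size] by blast
  have side: "0 < D" "0 < b" "4 * b \<le> T" "h \<le> n" "0 < n ^ 6" "0 < net_bits C n" "4 \<le> N" "h < N div 2"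
    "0 \<le> real N powr - c" "n ^ 6 \<le> n ^ 6"
    using D(1) b_ge N(1) n N_ge div_le_dividend[of N 16] by (auto simp: net_bits_def)
  interpret R: reduction f p W "net_bits C n" "n ^ 6" A N h k l n "n ^ 6" "4 * b" T Tr cap D b L1 "b\<^sup>2" H
    "real N powr - c" "exp (- (3 * C))"
    by (intro reduction.intro net.intro reduction_axioms.intro)
      (rule f(4) p(1) bits H k_pos l_ge(2) m_pos m_le side L1 Tr(3,4) space K_bounds(1-4) word_bits_le samp cap b(3)
         Rn(1) eps small | assumption)+
  have err: "R.err \<le> 3 * x powr (- c / 2)"
    unfolding R.err_def using dt_le miss_le hash_err(2) by linarith
  have ok: "1 - x powr (- c / 4) \<le> prob_reach M W (net_bits C n) (R.prog tau Tm) (init_config M I)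
      {s. fst (s 0) = [if length css = 1 then 1 else 0]}"
    if "good_cycles css" "cycles_verts css = {..<n}" "css \<noteq> []" "length css \<le> 2" "\<And>xs. xs \<in> set css \<Longrightarrow> n \<le> 2 * length xs"
      "edge_input M (share \<gamma> n) (cycles_edges css) I" for css I
  proof -
    have "6 * 2 ^ tau \<le> length xs" if "xs \<in> set css" for xs
      using tau(2) \<open>\<And>xs. xs \<in> set css \<Longrightarrow> n \<le> 2 * length xs\<close>[OF that] by linarith
    then have "1 - (real (M * (2 * n)) / real (n ^ 6) + real Tm * R.err) \<le>
        prob_reach M W (net_bits C n) (R.prog tau Tm) (init_config M I) {s. fst (s 0) = [if length css = 1 then 1 else 0]}"
      by (intro R.prog_correct[OF that(1-4) _ that(6) _ shrink fin]) auto
    \<comment> \<open>\<open>Tm \<le> ln n\<close> suffices here; the logarithmic factor is absorbed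
      by passing from the exponent \<open>c / 2\<close> to \<open>c / 4\<close>.\<close>
    moreover have "real Tm * R.err \<le> L * (3 * x powr (- c / 2))"
      using Tm(2) err R.err_nonneg big(1) by (intro mult_mono) auto
    ultimately show ?thesis using hash_err(1) big(18) by linarith
  qed
  show ?thesis
  proof (intro exI[of _ "R.prog tau Tm"] conjI allI impI)
    show "length (R.prog tau Tm) = 7 + 5 * tau + p + Tm * (num_rounds A N + 2 * p + 3)" by (rule R.length_prog)
  next
    fix E I assume I: "edge_input M (share \<gamma> n) E I"
    {
      assume "one_cycle n E"
      then obtain css where css: "good_cycles css" "length css = 1" "cycles_verts css = {..<n}" "E = cycles_edges css"
        "\<And>xs. xs \<in> set css \<Longrightarrow> length xs = n" by (rule one_cycle_cycles) blast
      have "1 - x powr (- c / 4) \<le> prob_reach M W (net_bits C n) (R.prog tau Tm) (init_config M I)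
          {s. fst (s 0) = [if length css = 1 then 1 else 0]}"
        by (rule ok) (use css(1,2,3,5) I[unfolded css(4)] in auto)
      then show "1 - x powr (- c / 4) \<le>
          prob_reach M W (net_bits C n) (R.prog tau Tm) (init_config M I) {s. fst (s 0) = [1]}"
        unfolding css(2) by simp
    }
    {
      assume "two_cycles n E"
      then obtain css where css: "good_cycles css" "length css = 2" "cycles_verts css = {..<n}" "E = cycles_edges css"
        "\<And>xs. xs \<in> set css \<Longrightarrow> 2 * length xs = n" by (rule two_cycles_cycles) blast
      have "1 - x powr (- c / 4) \<le> prob_reach M W (net_bits C n) (R.prog tau Tm) (init_config M I)
          {s. fst (s 0) = [if length css = 1 then 1 else 0]}"
        by (rule ok) (use css(1,2,3,5) I[unfolded css(4)] in auto)
      then show "1 - x powr (- c / 4) \<le>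
          prob_reach M W (net_bits C n) (R.prog tau Tm) (init_config M I) {s. fst (s 0) = [0]}"
        unfolding css(2) by simp
    }
  qed
qed

lemma resources:
  "real W \<le> 2000 * x powr \<gamma>" "real (net_bits C n) \<le> (30 + 3 * (96 + real (nat \<lceil>C\<rceil>))) * L" "n \<le> M * share \<gamma> n"
  "n \<le> 2 ^ net_bits C n"
proof -
  have g1: "1 \<le> x powr \<gamma>" using x_ge gam by (simp add: ge_one_powr_ge_zero)
  show "real W \<le> 2000 * x powr \<gamma>" 
  proof -
    have "real (share \<gamma> n) \<le> x powr \<gamma> + 1" unfolding share_def by (rule nat_ceiling(2)) simp
    then show ?thesis using g1 by simp
  qed
  let ?a = "96 + real (nat \<lceil>C\<rceil>)"
  have "real (net_bits C n) = 30 * 1 + ?a * real b" by (simp add: net_bits_def)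
  also have "\<dots> \<le> 30 * L + ?a * (3 * L)" using b(2) big(1) by (intro add_mono mult_left_mono) auto
  finally show "real (net_bits C n) \<le> (30 + 3 * ?a) * L" by (simp add: algebra_simps)
  have "x = x powr (1 - \<gamma>) * x powr \<gamma>" using x_ge by (simp add: powr_add[symmetric])
  also have "\<dots> \<le> real M * real (share \<gamma> n)"
    unfolding share_def using f(1) nat_ceiling(1)[of "x powr \<gamma>"] by (intro mult_mono) auto
  finally have "x \<le> real (M * share \<gamma> n)" by simp
  then show "n \<le> M * share \<gamma> n" using of_nat_le_iff[where 'a=real] by blast
  have "b \<le> net_bits C n" by (simp add: net_bits_def algebra_simps)
  then have "(2::nat) ^ b \<le> 2 ^ net_bits C n" by (intro power_increasing) auto
  then show "n \<le> 2 ^ net_bits C n" using b(3) by linarith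
qed

end

section \<open>The lower bound\<close>

lemma cycle_graph_edges:
  assumes "cycle_graph V E" "e \<in> E" shows "e \<subseteq> V"
proof -
  obtain xs where xs: "set xs = V" "E = (\<lambda>i. {xs ! i, xs ! (Suc i mod length xs)}) ` {..<length xs}"
    using assms(1) unfolding cycle_graph_def by blast
  then obtain i where i: "i < length xs" "e = {xs ! i, xs ! (Suc i mod length xs)}" using assms(2) by blast
  then have "Suc i mod length xs < length xs" by (intro mod_less_divisor) linarith
  then show ?thesis using i xs(1) nth_mem by auto
qed

lemma eventually_even_sizesI: "eventually P sequentially \<Longrightarrow> eventually P even_sizes"
  by (rule filter_leD[OF inf_le1])

lemma init_config_ok:
  assumes I: "edge_input (machines B n) cap E I" and E: "one_cycle n E \<or> two_cycles n E"
    and cap: "2 * cap \<le> mem_words B n" and n: "n \<le> 2 ^ word_bits B n"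
  shows "config_ok B n (init_config (machines B n) I)"
proof -
  have sub: "e \<subseteq> {..<n}" if "e \<in> E" for e
    using E that cycle_graph_edges unfolding one_cycle_def two_cycles_def by blast
  have "u < n \<and> v < n" if "i < machines B n" "(u, v) \<in> set (I i)" for i u v
  proof -
    have "{u, v} \<in> E" using I that unfolding edge_input_def Let_def by (force simp: set_concat)
    then show ?thesis using sub by auto
  qed
  then have lt: "w < n" if "i < machines B n" "w \<in> set (concat (map (\<lambda>(u, v). [u, v]) (I i)))" for i w
    using that by (fastforce simp: set_concat)
  show ?thesis unfolding config_ok_def
  proof (intro allI impI conjI)
    fix i assume i: "i < machines B n"
    have "length (I i) \<le> cap" using I i by (simp add: edge_input_def)
    then show "length (fst (init_config (machines B n) I i)) + length (snd (init_config (machines B n) I i)) \<le> mem_words B n"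
      using cap i by (simp add: init_config_def length_flat_pairs)
    show "set (fst (init_config (machines B n) I i)) \<union> set (snd (init_config (machines B n) I i)) \<subseteq> {..<2 ^ word_bits B n}"
      using lt[OF i] i n by (fastforce simp: init_config_def)
  qed
qed

text \<open>The programs for the single sizes are glued into one algorithm, which is allowed since
  \<open>local_step\<close> may depend on \<open>n\<close> arbitrarily. The conjecture then bounds
  their lengths from below.\<close>

lemma simulation_rounds:
  assumes conj: "one_vs_two_cycle_conjecture \<gamma>"
    and ev: "\<forall>\<^sub>F n in sequentially. scale \<gamma> C c p ex n (N n) (k n) (l n) (cap n) A"
  shows "\<exists>c0>0. \<forall>\<^sub>F n in even_sizes. c0 * ln (real n) \<le>
    real (7 + 5 * pre_stages ex n + p + main_stages n (N n) * (num_rounds A (N n) + 2 * p + 3))"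
proof -
  let ?M = "\<lambda>n. fan_in \<gamma> p n ^ p" and ?W = "\<lambda>n. 1000 * share \<gamma> n"
  let ?len = "\<lambda>n. 7 + 5 * pre_stages ex n + p + main_stages n (N n) * (num_rounds A (N n) + 2 * p + 3)"
  define spec where "spec n gs \<longleftrightarrow> length gs = ?len n \<and>
     (\<forall>E I. edge_input (?M n) (share \<gamma> n) E I \<longrightarrow>
        (one_cycle n E \<longrightarrow> 1 - real n powr (- c / 4) \<le>
           prob_reach (?M n) (?W n) (net_bits C n) gs (init_config (?M n) I) {s. fst (s 0) = [1]}) \<and>
        (two_cycles n E \<longrightarrow> 1 - real n powr (- c / 4) \<le>
           prob_reach (?M n) (?W n) (net_bits C n) gs (init_config (?M n) I) {s. fst (s 0) = [0]}))" for n gs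
  define G where "G n = (SOME gs. spec n gs)" for n
  have G: "spec n (G n)" if "scale \<gamma> C c p ex n (N n) (k n) (l n) (cap n) A" for n
    unfolding G_def by (rule someI_ex) (use scale.program_exists[OF that] in \<open>simp add: spec_def\<close>)
  define B where "B = \<lparr>machines = ?M, mem_words = ?W, word_bits = net_bits C,
     num_rounds = (\<lambda>n. length (G n)), local_step = (\<lambda>n r. G n ! r)\<rparr>"
  have B: "machines B n = ?M n" "mem_words B n = ?W n" "word_bits B n = net_bits C n"
    "num_rounds B n = length (G n)" "local_step B n = (!) (G n)" for n
    by (simp_all add: B_def)
  have c: "0 < c"
    using eventually_happens'[OF sequentially_bot ev] by (auto simp: scale_def)
  have "(\<lambda>n. real (machines B n)) \<in> O(\<lambda>n. real n powr (1 - \<gamma>))"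
  proof (rule bigoI[of _ "2 ^ p"], rule eventually_mono[OF ev])
    fix n assume *: "scale \<gamma> C c p ex n (N n) (k n) (l n) (cap n) A"
    then show "norm (real (machines B n)) \<le> 2 ^ p * norm (real n powr (1 - \<gamma>))"
      using scale.f(2)[OF *] by (simp add: B)
  qed
  moreover have "(\<lambda>n. real (mem_words B n)) \<in> O(\<lambda>n. real n powr \<gamma>)"
  proof (rule bigoI[of _ 2000], rule eventually_mono[OF ev])
    fix n assume *: "scale \<gamma> C c p ex n (N n) (k n) (l n) (cap n) A"
    then show "norm (real (mem_words B n)) \<le> 2000 * norm (real n powr \<gamma>)"
      using scale.resources(1)[OF *] by (simp add: B)
  qed
  moreover have "(\<lambda>n. real (word_bits B n)) \<in> O(\<lambda>n. ln (real n))"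
  proof (rule bigoI[of _ "30 + 3 * (96 + real (nat \<lceil>C\<rceil>))"], rule eventually_mono[OF ev])
    fix n assume *: "scale \<gamma> C c p ex n (N n) (k n) (l n) (cap n) A"
    then show "norm (real (word_bits B n)) \<le> (30 + 3 * (96 + real (nat \<lceil>C\<rceil>))) * norm (ln (real n))"
      using scale.resources(2)[OF *] scale.big(1)[OF *] by (simp add: B)
  qed
  moreover have "distinguishes_cycles B" unfolding distinguishes_cycles_def
  proof (intro exI[of _ "share \<gamma>"] exI[of _ "c / 4"] conjI eventually_even_sizesI)
    show "\<forall>\<^sub>F n in sequentially. n \<le> machines B n * share \<gamma> n \<and>
           (\<forall>E I. edge_input (machines B n) (share \<gamma> n) E I \<longrightarrow>
              (one_cycle n E \<longrightarrow>
                 measure (measure_spmf (mpc_run B n I)) {s. fst (s 0) = [1]} \<ge> 1 - real n powr (- (c / 4))) \<and>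
              (two_cycles n E \<longrightarrow>
                 measure (measure_spmf (mpc_run B n I)) {s. fst (s 0) = [0]} \<ge> 1 - real n powr (- (c / 4))))"
      using ev
    proof eventually_elim
      case (elim n)
      have run: "measure (measure_spmf (mpc_run B n I)) Q =
          prob_reach (?M n) (?W n) (net_bits C n) (G n) (init_config (?M n) I) Q"
        if "edge_input (?M n) (share \<gamma> n) E I" "one_cycle n E \<or> two_cycles n E" for E I Q
      proof -
        have "config_ok B n (init_config (machines B n) I)"
          by (rule init_config_ok[of _ _ "share \<gamma> n" E]) (use that scale.resources(4)[OF elim] in \<open>auto simp: B\<close>)
        from mpc_steps_eq_exec[OF this] show ?thesis
          by (simp add: mpc_run_def prob_reach_def B map_nth)
      qed
      have sp: "spec n (G n)" by (rule G[OF elim])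
      show ?case
      proof (intro conjI allI impI)
        show "n \<le> machines B n * share \<gamma> n" using scale.resources(3)[OF elim] by (simp add: B)
        fix E I assume "edge_input (machines B n) (share \<gamma> n) E I"
        then have I: "edge_input (?M n) (share \<gamma> n) E I" by (simp add: B)
        note sp' = sp[unfolded spec_def, THEN conjunct2, rule_format, OF I]
        show "1 - real n powr - (c / 4) \<le> measure (measure_spmf (mpc_run B n I)) {s. fst (s 0) = [1]}" if "one_cycle n E"
          using conjunct1[OF sp', rule_format, OF that] run[OF I disjI1[OF that]] by simp
        show "1 - real n powr - (c / 4) \<le> measure (measure_spmf (mpc_run B n I)) {s. fst (s 0) = [0]}" if "two_cycles n E"
          using conjunct2[OF sp', rule_format, OF that] run[OF I disjI2[OF that]] by simp
      qed
    qed
  qed (use c in simp)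
  ultimately have "(\<lambda>n. real (num_rounds B n)) \<in> \<Omega>[even_sizes](\<lambda>n. ln (real n))"
    using conj unfolding one_vs_two_cycle_conjecture_def by blast
  then obtain c0 where c0: "0 < c0" "\<forall>\<^sub>F n in even_sizes. c0 * norm (ln (real n)) \<le> norm (real (num_rounds B n))"
    by (auto elim: landau_omega.bigE)
  have "\<forall>\<^sub>F n in even_sizes. c0 * ln (real n) \<le> real (?len n)"
    using c0(2) eventually_even_sizesI[OF ev]
  proof eventually_elim
    case (elim n)
    have "length (G n) = ?len n" using G[OF elim(2)] by (simp add: spec_def)
    then show ?case using elim(1) scale.big(1)[OF elim(2)] by (simp only: B) simp
  qed
  then show ?thesis using c0(1) by blast
qed

text \<open>The sampler is run with \<open>N\<close> vertices where \<open>n\<close> is about \<open>2 N (ln N) ^ ex\<close>: this polylogarithmic gap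
  makes the \<open>polylog\<close> factors in the resources of the sampler fit into the resources allowed at \<open>n\<close>.\<close>

definition log_size :: "nat \<Rightarrow> nat" where
  "log_size N = nat \<lceil>ln (real N)\<rceil> + 1"

definition blow_up :: "nat \<Rightarrow> nat \<Rightarrow> nat" where
  "blow_up ex N = 2 * N * log_size N ^ ex"

text \<open>A left inverse of \<open>blow_up\<close>, extended to all sizes by rounding
  down.\<close>

definition scale_down :: "nat \<Rightarrow> nat \<Rightarrow> nat" where
  "scale_down ex n = (SOME N. blow_up ex N \<le> n \<and> n < blow_up ex (Suc N))"

lemma log_size_mono: "a \<le> b \<Longrightarrow> log_size a \<le> log_size b"
proof -
  assume "a \<le> b"
  then have "ln (real a) \<le> ln (real b)" by (cases "a = 0"; cases "b = 0") auto
  then show ?thesis unfolding log_size_def by (intro add_right_mono nat_mono ceiling_mono)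
qed

lemma log_size_ge: "ln (real N) \<le> real (log_size N)"
  using real_nat_ceiling_ge[of "ln (real N)"] by (simp add: log_size_def)

lemma log_size_le: "0 < N \<Longrightarrow> real (log_size N) \<le> ln (real N) + 2"
proof -
  assume "0 < N"
  then have "0 \<le> ln (real N)" by simp
  then show ?thesis unfolding log_size_def by linarith
qed

lemma strict_mono_blow_up: "strict_mono (blow_up ex)"
proof (rule strict_monoI)
  fix a b :: nat assume "a < b"
  then have "log_size a ^ ex \<le> log_size b ^ ex" by (intro power_mono log_size_mono) auto
  then have "2 * a * log_size a ^ ex \<le> 2 * a * log_size b ^ ex" by simp
  also have "\<dots> < 2 * b * log_size b ^ ex" using \<open>a < b\<close> by (simp add: log_size_def)
  finally show "blow_up ex a < blow_up ex b" by (simp add: blow_up_def)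
qed

lemma le_blow_up: "N \<le> blow_up ex N"
  by (rule strict_mono_imp_increasing[OF strict_mono_blow_up])

text \<open>The purpose of the factor 2 in \<open>blow_up\<close>: the conjecture informs about even
  sizes only.\<close>

lemma even_blow_up: "even (blow_up ex N)"
  by (simp add: blow_up_def)

lemma scale_down: "blow_up ex (scale_down ex n) \<le> n" "n < blow_up ex (Suc (scale_down ex n))"
proof -
  have "\<exists>N. blow_up ex N \<le> n \<and> n < blow_up ex (Suc N)"
  proof (induction n)
    case 0
    have "blow_up ex 0 < blow_up ex 1" by (rule strict_monoD[OF strict_mono_blow_up]) simp
    then show ?case by (intro exI[of _ 0]) (simp add: blow_up_def)
  next
    case (Suc n)
    then obtain N where N: "blow_up ex N \<le> n" "n < blow_up ex (Suc N)" by blast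
    have less: "blow_up ex (Suc N) < blow_up ex (Suc (Suc N))"
      by (rule strict_monoD[OF strict_mono_blow_up]) simp
    show ?case
    proof (cases "Suc n < blow_up ex (Suc N)")
      case True
      then show ?thesis using N by (intro exI[of _ N]) simp
    next
      case False
      then show ?thesis using N less by (intro exI[of _ "Suc N"]) simp
    qed
  qed
  from someI_ex[OF this] show "blow_up ex (scale_down ex n) \<le> n" "n < blow_up ex (Suc (scale_down ex n))"
    by (simp_all add: scale_down_def)
qed

lemma scale_down_blow_up: "scale_down ex (blow_up ex N) = N"
proof -
  have "scale_down ex (blow_up ex N) \<le> N" "N < Suc (scale_down ex (blow_up ex N))"
    using scale_down(1)[of ex "blow_up ex N"] scale_down(2)[of "blow_up ex N" ex] strict_mono_less_eq[OF strict_mono_blow_up] strict_mono_less[OF strict_mono_blow_up]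
    by blast+
  then show ?thesis by simp
qed

lemma filterlim_scale_down: "filterlim (scale_down ex) at_top sequentially"
  unfolding filterlim_at_top
proof (intro allI eventually_sequentiallyI)
  fix Z n assume "blow_up ex Z \<le> n"
  then have "blow_up ex Z < blow_up ex (Suc (scale_down ex n))" using scale_down(2)[of n ex] by linarith
  then show "Z \<le> scale_down ex n" using strict_mono_less[OF strict_mono_blow_up] by (simp add: less_Suc_eq_le)
qed

text \<open>The exponent \<open>ex + 1\<close> instead of \<open>ex\<close> absorbs all constants
  and the step from \<open>N\<close> to \<open>Suc N\<close>.\<close>

lemma eventually_blow_up_bounds:
  "\<forall>\<^sub>F N in sequentially. \<forall>n. blow_up ex N \<le> n \<longrightarrow> n < blow_up ex (Suc N) \<longrightarrow>
     ln (real n) \<le> 2 * ln (real N) \<and> real n \<le> real N * ln (real n) ^ (ex + 1) \<and>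
     real N * ln (real n) ^ ex \<le> 2 ^ ex * real n"
proof -
  have "\<forall>\<^sub>F y :: real in at_top. 4 * (ln y + 3) ^ ex \<le> ln y ^ (ex + 1)" by real_asymp
  then have 1: "\<forall>\<^sub>F N in sequentially. 4 * (ln (real N) + 3) ^ ex \<le> ln (real N) ^ (ex + 1)"
    by (rule eventually_compose_filterlim[OF _ filterlim_real_sequentially])
  have "\<forall>\<^sub>F y :: real in at_top. y * ln y ^ (ex + 1) \<le> y\<^sup>2" by real_asymp
  then have 2: "\<forall>\<^sub>F N in sequentially. real N * ln (real N) ^ (ex + 1) \<le> (real N)\<^sup>2"
    by (rule eventually_compose_filterlim[OF _ filterlim_real_sequentially])
  have "\<forall>\<^sub>F y :: real in at_top. 1 \<le> ln y" by real_asymp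
  then have 3: "\<forall>\<^sub>F N in sequentially. 1 \<le> ln (real N)"
    by (rule eventually_compose_filterlim[OF _ filterlim_real_sequentially])
  show ?thesis using 1 2 3
  proof eventually_elim
    case (elim N)
    let ?y = "real N"
    have N0: "0 < N" using elim(3) by (cases "N = 0") auto
    then have y: "1 \<le> ?y" by simp
    show ?case
    proof (intro allI impI)
      fix n assume n: "blow_up ex N \<le> n" "n < blow_up ex (Suc N)"
      have Nn: "N \<le> n" using n(1) le_blow_up[of N ex] by linarith
      then have ln_mono: "ln ?y \<le> ln (real n)" using N0 by simp
      have "ln (real (Suc N)) \<le> ln (2 * ?y)" using y by simp
      also have "\<dots> = ln 2 + ln ?y" using y by (simp add: ln_mult)
      also have "ln (2 :: real) \<le> 1" using ln_le_minus_one[of 2] by simp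
      finally have "real (log_size (Suc N)) \<le> ln ?y + 3" using log_size_le[of "Suc N"] by linarith
      then have ls: "real (log_size (Suc N)) ^ ex \<le> (ln ?y + 3) ^ ex" by (intro power_mono) auto
      have "real n \<le> real (blow_up ex (Suc N))" using n(2) by simp
      also have "\<dots> = 2 * (?y + 1) * real (log_size (Suc N)) ^ ex" by (simp add: blow_up_def algebra_simps)
      also have "\<dots> \<le> (4 * ?y) * (ln ?y + 3) ^ ex" by (rule mult_mono) (use y ls in auto)
      also have "\<dots> = ?y * (4 * (ln ?y + 3) ^ ex)" by simp
      also have "\<dots> \<le> ?y * ln ?y ^ (ex + 1)" using elim(1) by (intro mult_left_mono) auto
      finally have up: "real n \<le> ?y * ln ?y ^ (ex + 1)" .
      have "real n \<le> ?y\<^sup>2" using up elim(2) by linarith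
      then have "ln (real n) \<le> ln (?y\<^sup>2)" using Nn N0 by simp
      then have ln2: "ln (real n) \<le> 2 * ln ?y" using y by (simp add: ln_realpow)
      have "ln ?y ^ (ex + 1) \<le> ln (real n) ^ (ex + 1)" using ln_mono elim(3) by (intro power_mono) auto
      then have "?y * ln ?y ^ (ex + 1) \<le> ?y * ln (real n) ^ (ex + 1)" by (intro mult_left_mono) auto
      then have up': "real n \<le> ?y * ln (real n) ^ (ex + 1)" using up by linarith
      have "ln (real n) ^ ex \<le> (2 * real (log_size N)) ^ ex"
        using ln2 log_size_ge[of N] ln_mono elim(3) by (intro power_mono) auto
      also have "\<dots> = 2 ^ ex * real (log_size N) ^ ex" by (rule power_mult_distrib)
      finally have "?y * ln (real n) ^ ex \<le> ?y * (2 ^ ex * real (log_size N) ^ ex)" by (intro mult_left_mono) auto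
      also have "\<dots> = 2 ^ ex * (?y * real (log_size N) ^ ex)" by simp
      also have "\<dots> \<le> 2 ^ ex * real n"
      proof (intro mult_left_mono)
        have "N * log_size N ^ ex \<le> n" using n(1) by (simp add: blow_up_def)
        then have "real (N * log_size N ^ ex) \<le> real n" by (subst of_nat_le_iff)
        then show "?y * real (log_size N) ^ ex \<le> real n" by simp
      qed simp
      finally show "ln (real n) \<le> 2 * ln ?y \<and> real n \<le> ?y * ln (real n) ^ (ex + 1) \<and> ?y * ln (real n) ^ ex \<le> 2 ^ ex * real n"
        using ln2 up' by blast
    qed
  qed
qed

text \<open>The power \<open>a\<close> of the smaller size saves up to \<open>a * e\<close>
  logarithmic factors; this pays for the overhead in machines and space.\<close>

lemma powr_shrink:
  fixes x y L a :: real and e r :: nat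
  assumes "0 < y" "0 < x" "1 \<le> L" "y * L ^ e \<le> 2 ^ e * x" "0 \<le> a" "a \<le> 1" "real r \<le> a * real e"
  shows "y powr a \<le> 2 ^ e * (x powr a / L ^ r)"
proof -
  have "y powr a * L ^ r = y powr a * L powr real r" using assms(3) by (simp add: powr_realpow)
  also have "\<dots> \<le> y powr a * L powr (a * real e)" using assms by (intro mult_left_mono powr_mono) auto
  also have "L powr (a * real e) = (L powr real e) powr a" by (simp add: powr_powr mult.commute)
  also have "L powr real e = L ^ e" using assms(3) by (simp add: powr_realpow)
  also have "y powr a * (L ^ e) powr a = (y * L ^ e) powr a" using assms by (simp add: powr_mult)
  also have "\<dots> \<le> (2 ^ e * x) powr a" using assms by (intro powr_mono2) auto
  also have "\<dots> = (2 ^ e) powr a * x powr a" using assms by (simp add: powr_mult)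
  also have "\<dots> \<le> (2 ^ e) powr 1 * x powr a" using assms by (intro mult_right_mono powr_mono) auto
  finally have "y powr a * L ^ r \<le> 2 ^ e * x powr a" by simp
  moreover have "0 < L ^ r" using assms(3) by simp
  ultimately show ?thesis by (simp add: field_simps)
qed

lemma eventually_scale:
  fixes \<gamma> :: real and A :: mpc and k l :: "nat \<Rightarrow> nat" and d :: nat
  assumes gam: "0 < \<gamma>" "\<gamma> < 1"
    and m: "(\<lambda>n. real (machines A n)) \<in> O(\<lambda>n. real n powr (1 - \<gamma>) * ln (real n) ^ d)"
    and w: "(\<lambda>n. real (mem_words A n)) \<in> O(\<lambda>n. real n powr \<gamma>)"
    and wb: "(\<lambda>n. real (word_bits A n)) \<in> O(\<lambda>n. ln (real n))"
    and k: "(\<lambda>n. real (k n)) \<in> \<Theta>(\<lambda>n. ln (real n))"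
    and l: "(\<lambda>n. real (l n)) \<in> \<Theta>(\<lambda>n. ln (real n) ^ 4)"
    and samp: "samples_walks A k l"
  shows "\<exists>C c p ex cap. \<forall>\<^sub>F n in sequentially. scale \<gamma> C c p ex n (scale_down ex n)
    (k (scale_down ex n)) (l (scale_down ex n)) (cap (scale_down ex n)) A"
proof -
  obtain c1 where c1: "0 < c1" "\<forall>\<^sub>F n in sequentially. norm (real (machines A n)) \<le> c1 * norm (real n powr (1 - \<gamma>) * ln (real n) ^ d)"
    by (rule landau_o.bigE[OF m])
  obtain c2 where c2: "0 < c2" "\<forall>\<^sub>F n in sequentially. norm (real (mem_words A n)) \<le> c2 * norm (real n powr \<gamma>)"
    by (rule landau_o.bigE[OF w])
  obtain c3 where c3: "0 < c3" "\<forall>\<^sub>F n in sequentially. norm (real (word_bits A n)) \<le> c3 * norm (ln (real n))"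
    by (rule landau_o.bigE[OF wb])
  obtain c4 where c4: "0 < c4" "\<forall>\<^sub>F n in sequentially. norm (real (k n)) \<le> c4 * norm (ln (real n))"
    by (rule landau_o.bigE[OF bigthetaD1[OF k]])
  obtain c5 where c5: "0 < c5" "\<forall>\<^sub>F n in sequentially. norm (ln (real n)) \<le> c5 * norm (real (k n))"
    by (rule landau_o.bigE[OF bigthetaD1[OF k[unfolded bigtheta_sym[of "\<lambda>n. real (k n)"]]]])
  obtain c6 where c6: "0 < c6" "\<forall>\<^sub>F n in sequentially. norm (real (l n)) \<le> c6 * norm (ln (real n) ^ 4)"
    by (rule landau_o.bigE[OF bigthetaD1[OF l]])
  obtain c7 where c7: "0 < c7" "\<forall>\<^sub>F n in sequentially. norm (ln (real n) ^ 4) \<le> c7 * norm (real (l n))"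
    by (rule landau_o.bigE[OF bigthetaD1[OF l[unfolded bigtheta_sym[of "\<lambda>n. real (l n)"]]]])
  obtain cap c0 where cap: "0 < c0" "\<forall>\<^sub>F n in sequentially. n \<le> machines A n * cap n \<and> sampler A n (k n) (l n) (cap n) (real n powr (- c0))"
    using samp unfolding samples_walks_def sampler_def by blast
  \<comment> \<open>The other error terms are only bounded by \<open>n powr (-1/2)\<close>, so
    exponents above 1 are cut off.\<close>
  define c where "c = min c0 1"
  have c: "0 < c" "c \<le> 1" "c \<le> c0" using cap(1) by (auto simp: c_def)
  define p where "p = nat \<lceil>2 * (1 - \<gamma>) / \<gamma>\<rceil>"
  \<comment> \<open>The first summand gives \<open>7 \<le> \<gamma> * ex\<close> for the space. The
    second gives \<open>d + 1 \<le> (1 - \<gamma>) * ex\<close> for the machines: \<open>d\<close>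
    factors cancel those granted to the sampler, and one more absorbs the constants.\<close>
  define ex where "ex = nat \<lceil>7 / \<gamma>\<rceil> + nat \<lceil>real (d + 1) / (1 - \<gamma>)\<rceil>"
  have p: "0 < p" "(1 - \<gamma>) / real p \<le> \<gamma> / 2"
  proof -
    have pos: "0 < 2 * (1 - \<gamma>) / \<gamma>" using gam by simp
    have ge: "2 * (1 - \<gamma>) / \<gamma> \<le> real p" unfolding p_def by (rule real_nat_ceiling_ge)
    then show "0 < p" using pos by linarith
    then show "(1 - \<gamma>) / real p \<le> \<gamma> / 2" using ge gam by (simp add: field_simps)
  qed
  have ex: "real 7 \<le> \<gamma> * real ex" "real (d + 1) \<le> (1 - \<gamma>) * real ex"
  proof -
    have "7 / \<gamma> \<le> real ex" unfolding ex_def using real_nat_ceiling_ge[of "7 / \<gamma>"] by simp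
    then show "real 7 \<le> \<gamma> * real ex" using gam by (simp add: field_simps)
    have "real (d + 1) / (1 - \<gamma>) \<le> real ex" unfolding ex_def using real_nat_ceiling_ge[of "real (d + 1) / (1 - \<gamma>)"] by simp
    then show "real (d + 1) \<le> (1 - \<gamma>) * real ex" using gam by (simp add: pos_divide_le_eq mult.commute)
  qed
  define s where "s = c1 + c2 + c3 + c4 + c5 + c6 + c7 + 1"
  define C where "C = 2 ^ ex * s"
  have s: "c1 \<le> s" "c2 \<le> s" "c3 \<le> s" "c4 \<le> s" "c5 \<le> s" "c6 \<le> s" "c7 \<le> s" "1 \<le> s"
    using c1(1) c2(1) c3(1) c4(1) c5(1) c6(1) c7(1) by (simp_all add: s_def)
  have "1 * s \<le> 2 ^ ex * s" using s(8) by (intro mult_right_mono) auto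
  then have sC: "s \<le> C" by (simp add: C_def)
  have le_C: "r * t \<le> C * t" if "r \<le> s" "0 \<le> t" for r t
    using that sC by (intro mult_right_mono) auto
  let ?N = "scale_down ex"
  have up: "\<forall>\<^sub>F n in sequentially. P (?N n)" if "\<forall>\<^sub>F N in sequentially. P N" for P
    using that by (rule eventually_compose_filterlim[OF _ filterlim_scale_down])
  have "\<forall>\<^sub>F y :: real in at_top. 20 * (c1 * (y powr (1 - \<gamma>) * ln y ^ d)) \<le> y \<and> 1 \<le> ln y"
    using c1(1) gam by (intro eventually_conj) real_asymp+
  then have ev: "\<forall>\<^sub>F N in sequentially. 20 * (c1 * (real N powr (1 - \<gamma>) * ln (real N) ^ d)) \<le> real N \<and> 1 \<le> ln (real N)"
    by (rule eventually_compose_filterlim[OF _ filterlim_real_sequentially])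
  have lg: "\<forall>\<^sub>F n in sequentially. large \<gamma> C c p ex (real n)"
    by (rule eventually_compose_filterlim[OF eventually_large filterlim_real_sequentially])
      (use gam sC s(8) c(1) p(1) in auto)
  have "\<forall>\<^sub>F n in sequentially. scale \<gamma> C c p ex n (?N n) (k (?N n)) (l (?N n)) (cap (?N n)) A"
    using up[OF c1(2)] up[OF c2(2)] up[OF c3(2)] up[OF c4(2)] up[OF c5(2)] up[OF c6(2)] up[OF c7(2)] up[OF cap(2)]
      up[OF ev] up[OF eventually_blow_up_bounds[of ex]] lg
  proof eventually_elim
    case (elim n)
    let ?y = "real (?N n)" and ?x = "real n" and ?L = "ln (real n)"
    have N0: "0 < ?N n" using elim(9) by (cases "?N n = 0") auto
    have Nn: "?N n \<le> n" using scale_down(1)[of ex n] le_blow_up[of "?N n" ex] by linarith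
    have bd: "?L \<le> 2 * ln ?y" "?x \<le> ?y * ?L ^ (ex + 1)" "?y * ?L ^ ex \<le> 2 ^ ex * ?x"
      using elim(10)[rule_format, OF scale_down] by blast+
    have y1: "1 \<le> ln ?y" and lny: "ln ?y \<le> ?L" using elim(9) Nn N0 by auto
    then have L1: "1 \<le> ?L" by linarith
    have x0: "0 < ?x" using Nn N0 by simp
    have y0: "0 < ?y" using N0 by simp
    have sh1: "?y powr (1 - \<gamma>) \<le> 2 ^ ex * (?x powr (1 - \<gamma>) / ?L ^ (d + 1))"
      by (rule powr_shrink[OF y0 x0 L1 bd(3) _ _ ex(2)]) (use gam in auto)
    have sh2: "?y powr \<gamma> \<le> 2 ^ ex * (?x powr \<gamma> / ?L ^ 7)"
      by (rule powr_shrink[OF y0 x0 L1 bd(3) _ _ ex(1)]) (use gam in auto)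
    have m1: "real (machines A (?N n)) \<le> c1 * (?y powr (1 - \<gamma>) * ln ?y ^ d)"
      using elim(1) y1 by (simp add: abs_mult)
    show ?case
    proof
      show "0 < \<gamma>" "\<gamma> < 1" "0 < p" "(1 - \<gamma>) / real p \<le> \<gamma> / 2" "0 < c" "c \<le> 1" "1 \<le> C" "?N n \<le> n"
        using gam p c sC s(8) Nn by auto
      show "?L \<le> 2 * ln ?y" "?x \<le> ?y * ?L ^ (ex + 1)" using bd by auto
      have "?y powr (1 - \<gamma>) * ln ?y ^ d \<le> 2 ^ ex * (?x powr (1 - \<gamma>) / ?L ^ (d + 1)) * ?L ^ d"
        using sh1 lny y1 L1 by (intro mult_mono power_mono) auto
      also have "\<dots> = 2 ^ ex * (?x powr (1 - \<gamma>) / ?L)" using L1 by simp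
      finally have "c1 * (?y powr (1 - \<gamma>) * ln ?y ^ d) \<le> c1 * (2 ^ ex * (?x powr (1 - \<gamma>) / ?L))"
        using c1(1) by (intro mult_left_mono) auto
      also have "\<dots> \<le> s * (2 ^ ex * (?x powr (1 - \<gamma>) / ?L))" using s(1) L1 by (intro mult_right_mono) auto
      also have "\<dots> = C * (?x powr (1 - \<gamma>) / ?L)" by (simp add: C_def)
      finally show "real (machines A (?N n)) \<le> C * (?x powr (1 - \<gamma>) / ?L)" using m1 by linarith
      have "real (20 * machines A (?N n)) \<le> ?y" using m1 elim(9) by simp
      then show "20 * machines A (?N n) \<le> ?N n" by (subst (asm) of_nat_le_iff)
      have "real (mem_words A (?N n)) \<le> c2 * ?y powr \<gamma>" using elim(2) by simp
      also have "\<dots> \<le> s * (2 ^ ex * (?x powr \<gamma> / ?L ^ 7))" using s(2,8) sh2 by (intro mult_mono) auto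
      also have "\<dots> = C * (?x powr \<gamma> / ?L ^ 7)" by (simp add: C_def)
      finally show "real (mem_words A (?N n)) \<le> C * (?x powr \<gamma> / ?L ^ 7)" .
      have "real (word_bits A (?N n)) \<le> c3 * ln ?y" using elim(3) y1 by simp
      also have "\<dots> \<le> C * ?L" using s(3,8) sC lny y1 by (intro mult_mono) auto
      finally show "real (word_bits A (?N n)) \<le> C * ?L" .
      have "ln ?y \<le> c5 * real (k (?N n))" using elim(5) y1 by simp
      then show "ln ?y \<le> C * real (k (?N n))" using le_C[OF s(5), of "real (k (?N n))"] by simp
      have "real (k (?N n)) \<le> c4 * ln ?y" using elim(4) y1 by simp
      also have "\<dots> \<le> C * ?L" using s(4,8) sC lny y1 by (intro mult_mono) auto
      finally show "real (k (?N n)) \<le> C * ?L" .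
      have "ln ?y ^ 4 \<le> c7 * real (l (?N n))" using elim(7) by simp
      then show "ln ?y ^ 4 \<le> C * real (l (?N n))" using le_C[OF s(7), of "real (l (?N n))"] by simp
      have "real (l (?N n)) \<le> c6 * ln ?y ^ 4" using elim(6) by simp
      also have "\<dots> \<le> C * ?L ^ 4" using s(6,8) sC lny y1 by (intro mult_mono power_mono) auto
      finally show "real (l (?N n)) \<le> C * ?L ^ 4" .
      show "?N n \<le> machines A (?N n) * cap (?N n)" using elim(8) by blast
      have "?y powr - c0 \<le> ?y powr - c" using N0 c by (intro powr_mono) auto
      then show "sampler A (?N n) (k (?N n)) (l (?N n)) (cap (?N n)) (?y powr - c)"
        using elim(8) unfolding sampler_def by (meson order_trans)
      show "large \<gamma> C c p ex ?x" by (rule elim(11))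
    qed
  qed
  then show ?thesis by blast
qed

theorem theorem1p3:
  fixes \<gamma> :: real and A :: mpc and k l :: "nat \<Rightarrow> nat" and d :: nat
  assumes "0 < \<gamma>" and "\<gamma> < 1"
    and "one_vs_two_cycle_conjecture \<gamma>"
    and "(\<lambda>n. real (machines A n)) \<in> O(\<lambda>n. real n powr (1 - \<gamma>) * ln (real n) ^ d)"
    and "(\<lambda>n. real (mem_words A n)) \<in> O(\<lambda>n. real n powr \<gamma>)"
    and "(\<lambda>n. real (word_bits A n)) \<in> O(\<lambda>n. ln (real n))"
    and "(\<lambda>n. real (k n)) \<in> \<Theta>(\<lambda>n. ln (real n))"
    and "(\<lambda>n. real (l n)) \<in> \<Theta>(\<lambda>n. ln (real n) ^ 4)"
    and "samples_walks A k l"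
  shows "(\<lambda>n. real (num_rounds A n)) \<in> \<Omega>(\<lambda>n. ln (ln (real n)))"
  proof -
  obtain C c p ex cap where ev: "\<forall>\<^sub>F n in sequentially. scale \<gamma> C c p ex n (scale_down ex n)
      (k (scale_down ex n)) (l (scale_down ex n)) (cap (scale_down ex n)) A"
    using eventually_scale[OF assms(1,2,4-9)] by blast
  obtain c0 where c0: "0 < c0" "\<forall>\<^sub>F n in even_sizes. c0 * ln (real n) \<le> real (7 + 5 * pre_stages ex n + p +
      main_stages n (scale_down ex n) * (num_rounds A (scale_down ex n) + 2 * p + 3))"
    using simulation_rounds[OF assms(3) ev] by blast
  \<comment> \<open>\<open>E\<close> absorbs the constants of all rounds outside the sampler. These
    are \<open>O((ln ln n)^3)\<close> plus \<open>O(ln n / ln ln n)\<close> rounds, at most half of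
    \<open>c0 * ln n\<close>.\<close>
  define E where "E = 800 * (9 + 5 * real (ex + 1)) + real p"
  have E: "800 * (9 + 5 * real (ex + 1)) \<le> E" "real p \<le> E" "0 < E" by (simp_all add: E_def add_pos_nonneg)
  have "\<forall>\<^sub>F x :: real in at_top.
      7 + E + 5 * (E * ln (ln x) ^ 3) + 9 * ln x / ln (ln x) * (2 * E + 3) \<le> c0 * ln x / 2"
    using E(3) c0(1) by real_asymp
  then have small: "\<forall>\<^sub>F n in sequentially. 7 + E + 5 * (E * ln (ln (real n)) ^ 3) +
      9 * ln (real n) / ln (ln (real n)) * (2 * E + 3) \<le> c0 * ln (real n) / 2"
    by (rule eventually_compose_filterlim[OF _ filterlim_real_sequentially])
  have "\<forall>\<^sub>F n in even_sizes. c0 / 18 * ln (ln (real n)) \<le> real (num_rounds A (scale_down ex n))"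
    using c0(2) eventually_even_sizesI[OF ev] eventually_even_sizesI[OF small]
  proof eventually_elim
    case (elim n)
    let ?L = "ln (real n)" and ?r = "real (num_rounds A (scale_down ex n))"
    let ?u = "ln ?L" and ?t = "real (main_stages n (scale_down ex n))"
    note sc = elim(2)
    have L: "0 < ?L" "0 < ?u" using scale.big(1,2)[OF sc] by linarith+
    have "real (pre_stages ex n) \<le> 800 * (9 + 5 * real (ex + 1)) * ?u ^ 3" by (rule scale.tau(1)[OF sc])
    also have "\<dots> \<le> E * ?u ^ 3" using E(1) L(2) by (intro mult_right_mono) auto
    finally have tau: "real (pre_stages ex n) \<le> E * ?u ^ 3" .
    have "?t * (?r + (2 * real p + 3)) \<le> 9 * ?L / ?u * (?r + (2 * E + 3))"
      using scale.Tm(1)[OF sc] E L by (intro mult_mono) auto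
    also have "\<dots> = 9 * ?L / ?u * ?r + 9 * ?L / ?u * (2 * E + 3)" by (rule distrib_left)
    finally have t: "?t * (?r + (2 * real p + 3)) \<le> 9 * ?L / ?u * ?r + 9 * ?L / ?u * (2 * E + 3)" .
    have "c0 * ?L \<le> 7 + 5 * real (pre_stages ex n) + real p + ?t * (?r + (2 * real p + 3))"
      using elim(1) by (simp add: algebra_simps)
    \<comment> \<open>The other half must come from the at most \<open>9 * ln n / ln ln n\<close>
      runs of the sampler, whence the constant \<open>c0 / 18\<close>.\<close>
    then have "c0 * ?L / 2 \<le> 9 * ?L / ?u * ?r" using tau t elim(3) E(2) by linarith
    then show ?case using L by (simp add: field_simps)
  qed
  then obtain n0 where n0: "\<And>n. n0 \<le> n \<Longrightarrow> even n \<Longrightarrow>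
      c0 / 18 * ln (ln (real n)) \<le> real (num_rounds A (scale_down ex n))"
    by (auto simp: eventually_inf_principal eventually_sequentially)
  have "\<forall>\<^sub>F y :: real in at_top. 1 \<le> ln y" by real_asymp
  then have one: "\<forall>\<^sub>F N in sequentially. 1 \<le> ln (real N)"
    by (rule eventually_compose_filterlim[OF _ filterlim_real_sequentially])
  show ?thesis
  proof (rule landau_omega.bigI[of "c0 / 18"])
    show "0 < c0 / 18" using c0(1) by simp
    show "\<forall>\<^sub>F N in sequentially. c0 / 18 * norm (ln (ln (real N))) \<le> norm (real (num_rounds A N))"
      using one eventually_ge_at_top[of n0]
    proof eventually_elim
      case (elim N)
      \<comment> \<open>Every large \<open>N\<close> is the sampler size belonging to the even size
        \<open>?n\<close>, so a bound at even sizes covers all \<open>N\<close>.\<close>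
      let ?n = "blow_up ex N"
      have N0: "0 < N" using elim(1) by (cases "N = 0") auto
      have "ln (real N) \<le> ln (real ?n)" using le_blow_up[of N ex] N0 by simp
      then have "ln (ln (real N)) \<le> ln (ln (real ?n))" using elim(1) by simp
      then have "c0 / 18 * ln (ln (real N)) \<le> c0 / 18 * ln (ln (real ?n))" using c0(1) by (intro mult_left_mono) auto
      also have "\<dots> \<le> real (num_rounds A N)"
        using n0[of ?n] elim(2) le_blow_up[of N ex] even_blow_up[of ex N] by (simp add: scale_down_blow_up)
      finally show ?case using elim(1) by simp
    qed
  qed
qed

end
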